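(* Let $Q\subset\mathcal{S}(\mathbb{R})$ be both $L^2$-bounded and $L^2$-equicontinuous. Then for each $T>0$ there is a constant $C=C(T,Q)$ such that every solution $q(t)$ of $i\partial_t q + \partial_x^2 q + i\partial_x(|q|^2 q)=0$ with initial data $q(0)\in Q$ satisfies \[ \sup_{\mu\in\mathbb{R}}\int_{-T}^{T}\bigl\|\psi_\mu^{12}\,q(t)\bigr\|_{H^{1/2}}^2\,dt\le C\,\|q(0)\|_{L^2}^2. \]
   Context: Schwartz initial data give unique global Schwartz solutions of the equation (known from prior work). $\psi(x)=\sqrt{\operatorname{sech}(x/99)}$ and $\psi_\mu(x)=\psi(x-\mu)$. $\|f\|_{H^{s}}^2=\int(4+\xi^2)^{s}|\hat f(\xi)|^2\,d\xi$. A set $Q\subset L^2(\mathbb{R})$ is $L^2$-equicontinuous if for every $\varepsilon>0$ there is $\delta>0$ such that $\sup_{q\in Q}\sup_{|y|<\delta}\|q(\cdot+y)-q\|_{L^2}<\varepsilon$. *)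

theory Defs
  imports "HOL-Analysis.Analysis"
begin

fun vderiv_n :: "nat \<Rightarrow> (real \<Rightarrow> complex) \<Rightarrow> real \<Rightarrow> complex" where
  "vderiv_n 0 f = f"
| "vderiv_n (Suc n) f = (\<lambda>x. vector_derivative (vderiv_n n f) (at x))"

definition schwartz :: "(real \<Rightarrow> complex) set" where
  "schwartz = {f. (\<forall>n x. (vderiv_n n f has_vector_derivative vderiv_n (Suc n) f x) (at x))
     \<and> (\<forall>k n. \<exists>C. \<forall>x. \<bar>x\<bar> ^ k * cmod (vderiv_n n f x) \<le> C)}"

definition L2norm :: "(real \<Rightarrow> complex) \<Rightarrow> real" where
  "L2norm f = sqrt (LINT x|lborel. (cmod (f x))\<^sup>2)"

definition fourier :: "(real \<Rightarrow> complex) \<Rightarrow> real \<Rightarrow> complex" where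
  "fourier f \<xi> = (LINT x|lborel. exp (- \<i> * complex_of_real (x * \<xi>)) * f x)"

definition Hs_norm_sq :: "real \<Rightarrow> (real \<Rightarrow> complex) \<Rightarrow> ennreal" where
  "Hs_norm_sq s f = (\<integral>\<^sup>+ \<xi>. ennreal ((4 + \<xi>\<^sup>2) powr s * (cmod (fourier f \<xi>))\<^sup>2) \<partial>lborel)"

definition psi :: "real \<Rightarrow> real" where
  "psi x = sqrt (1 / cosh (x / 99))"

definition L2_bounded :: "(real \<Rightarrow> complex) set \<Rightarrow> bool" where
  "L2_bounded Q \<longleftrightarrow> (\<exists>M. \<forall>q\<in>Q. L2norm q \<le> M)"

definition L2_equicontinuous :: "(real \<Rightarrow> complex) set \<Rightarrow> bool" where
  "L2_equicontinuous Q \<longleftrightarrow> (\<forall>\<epsilon>>0. \<exists>\<delta>>0. \<forall>q\<in>Q. \<forall>y. \<bar>y\<bar> < \<delta> \<longrightarrow>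
      L2norm (\<lambda>x. q (x + y) - q x) < \<epsilon>)"

definition dnls_solution :: "(real \<Rightarrow> real \<Rightarrow> complex) \<Rightarrow> bool" where
  "dnls_solution q \<longleftrightarrow>
     (\<forall>t. q t \<in> schwartz)
   \<and> (\<forall>T k n. \<exists>C. \<forall>t x. \<bar>t\<bar> \<le> T \<longrightarrow> \<bar>x\<bar> ^ k * cmod (vderiv_n n (q t) x) \<le> C)
   \<and> (\<forall>t x. \<exists>d. ((\<lambda>s. q s x) has_vector_derivative d) (at t)
        \<and> \<i> * d + vderiv_n 2 (q t) x
          + \<i> * vector_derivative (\<lambda>y. complex_of_real ((cmod (q t y))\<^sup>2) * q t y) (at x) = 0)"

end

theory Submission
  imports Defs "HOL-Probability.Probability" "HOL-Complex_Analysis.Complex_Analysis"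
begin

text \<open>For \<open>k > 0\<close> let \<open>R\<^sub>k = (\<partial> + 2 k)\<^sup>-\<^sup>1\<close>. At the spectral parameter \<open>\<lambda>\<close> with \<open>\<lambda>\<^sup>2 = i k\<close>
  the Kaup--Newell system of the equation reduces to a Riccati equation, whose decaying solution \<open>r\<close> is
  \<open>- \<lambda>\<close> times the complex conjugate of \<open>R\<^sub>k q\<close> up to cubic terms as soon as
  \<open>sqrt k sup |R\<^sub>k q|\<close> is small. The density \<open>\<lambda> q r\<close> obeys a microscopic conservation law.

  Its integral is conserved, and its imaginary part measures the part of the mass at frequencies below \<open>k\<close>.
  Together with the bound \<open>\<Sum> k\<^sub>j sup |R\<^bsub>k\<^sub>j\<^esub> q|\<^sup>2 \<le> C \<parallel>q\<parallel>\<^sup>2\<close> over the scales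
  \<open>k\<^sub>j = 4\<^sup>j k\<^sub>0\<close>, which always supplies one good scale, this propagates equicontinuity in time, so that the
  smallness above holds at all times for every \<open>k \<ge> k\<^sub>0\<close>.

  Testing the conservation law against an antiderivative of the weight \<open>\<psi>\<^sub>\<mu>\<^sup>2\<^sup>4\<close> and summing over the scales
  produces \<open>\<Sum> k\<^sub>j \<integral> \<psi>\<^sub>\<mu>\<^sup>2\<^sup>4 |\<partial> R\<^bsub>k\<^sub>j\<^esub> q|\<^sup>2\<close>, which is the square of the \<open>H\<^sup>1\<^sup>/\<^sup>2\<close> norm
  up to commutators. The quartic errors are absorbed because the weighted squares of the suprema are summable,
  and the boundary terms in time are bounded by the mass uniformly in the number of scales.\<close>

section \<open>Integrals of rapidly decaying functions\<close>

text \<open>The obstacle is that the mass may be large. At \<open>l = lam k\<close>, on the diagonal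
  of the quadrant, a Riccati solution bounded by 1 is known only at times when the scale
  \<open>k\<close> is good, and the good scale found at a time depends on that time. Hence the
  conservation law cannot be integrated from 0 to \<open>t\<close> at \<open>lam k\<close>. Close to
  the imaginary axis a solution exists at every time, and there the law can be integrated. A scale
  that is good at the two times 0 and \<open>t\<close> gives, at these two times, solutions for all
  \<open>l\<close> in a convex region that contains \<open>lam k\<close> and borders on the axis.
  The conserved integral is holomorphic in \<open>l\<close>, so equality near the axis continues to
  \<open>lam k\<close>. Uniformity in \<open>t\<close> survives because the scale is one of finitely
  many candidates. In the smoothing estimate the number of scales has to grow with the sup norm and
  the derivative of the solution, which the final constant must not see. Estimating the quadratic
  part of the density scale by scale would cost one multiple of the mass per scale, so these parts
  have to be added up before they are estimated.\<close>

lemma one_plus_sq_pos [simp]: "1 + (x::real)\<^sup>2 > 0" "1 + (x::real)\<^sup>2 \<noteq> 0" "1 + (x::real)\<^sup>2 \<ge> 1"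
  by (auto simp: add_pos_nonneg power2_eq_square add_nonneg_eq_0_iff)

lemma integrable_inverse_square: "integrable lborel (\<lambda>x::real. 1 / (1 + x\<^sup>2))"
proof -
  let ?f = "\<lambda>x::real. indicator {0<..} x *\<^sub>R (1 / (1 + x\<^sup>2))"
  have f: "integrable lborel ?f"
    using integrable_I0i_1_div_plus_square
    unfolding interval_lebesgue_integrable_def set_integrable_def by (simp add: zero_ereal_def)
  have f': "integrable lborel (\<lambda>x. ?f (0 + (-1) * x))"
    by (rule lborel_integrable_real_affine[OF f]) simp
  have "integrable lborel (\<lambda>x. ?f x + ?f (0 + (-1) * x))"
    by (intro Bochner_Integration.integrable_add f f')
  moreover have "AE x in lborel. ?f x + ?f (0 + (-1) * x) = 1 / (1 + x\<^sup>2)"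
    using AE_lborel_singleton[of 0] by eventually_elim (auto simp: indicator_def)
  ultimately show ?thesis
    by (subst integrable_cong_AE[where g = "\<lambda>x. ?f x + ?f (0 + (-1) * x)"]) auto
qed

text \<open>Continuity with quadratic decay is the one function class in space: it gives
  integrability of the function and of its square and vanishing at infinity, and it is stable under
  bounded factors, \<open>resolv\<close> and translation. \<open>L^2\<close> norms are plain
  integrals of such functions.\<close>

definition nice :: "(real \<Rightarrow> 'a::real_normed_vector) \<Rightarrow> bool" where
  "nice f \<longleftrightarrow> continuous_on UNIV f \<and> (\<exists>B. \<forall>x. norm (f x) \<le> B / (1 + x\<^sup>2))"

definition bcont :: "(real \<Rightarrow> 'a::real_normed_vector) \<Rightarrow> bool" where
  "bcont f \<longleftrightarrow> continuous_on UNIV f \<and> (\<exists>B. \<forall>x. norm (f x) \<le> B)"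

lemma niceI: "continuous_on UNIV f \<Longrightarrow> (\<And>x. norm (f x) \<le> B / (1 + x\<^sup>2)) \<Longrightarrow> nice f"
  unfolding nice_def by blast

lemma bcontI: "continuous_on UNIV f \<Longrightarrow> (\<And>x. norm (f x) \<le> B) \<Longrightarrow> bcont f"
  unfolding bcont_def by blast

lemma nice_cont: "nice f \<Longrightarrow> continuous_on UNIV f"
  and bcont_cont: "bcont f \<Longrightarrow> continuous_on UNIV f"
  unfolding nice_def bcont_def by auto

lemma niceE:
  assumes "nice f" obtains B where "B \<ge> 0" "\<And>x. norm (f x) \<le> B / (1 + x\<^sup>2)"
proof -
  from assms obtain B where B: "norm (f x) \<le> B / (1 + x\<^sup>2)" for x unfolding nice_def by blast
  have "0 \<le> B / (1 + 0\<^sup>2)" using B[of 0] norm_ge_zero order_trans by blast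
  thus ?thesis using B that by simp
qed

lemma bcontE:
  assumes "bcont f" obtains B where "B \<ge> 0" "\<And>x. norm (f x) \<le> B"
proof -
  from assms obtain B where B: "norm (f x) \<le> B" for x unfolding bcont_def by blast
  show ?thesis using B[of 0] B that norm_ge_zero order_trans by blast
qed

lemma bcont_nice: assumes "nice f" shows "bcont f"
proof -
  obtain B where B: "B \<ge> 0" "\<And>x. norm (f x) \<le> B / (1 + x\<^sup>2)" using niceE[OF assms] by blast
  have "norm (f x) \<le> B" for x
    using B(2)[of x] divide_left_mono[of 1 "1 + x\<^sup>2" B] B(1) by simp
  thus ?thesis using nice_cont[OF assms] bcontI by blast
qed

lemma nice_dominated:
  assumes "nice g" "continuous_on UNIV f" "\<And>x. norm (f x) \<le> C * norm (g x)" "C \<ge> 0"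
  shows "nice f"
proof -
  obtain B where B: "B \<ge> 0" "\<And>x. norm (g x) \<le> B / (1 + x\<^sup>2)" using niceE[OF assms(1)] by blast
  have "norm (f x) \<le> (C * B) / (1 + x\<^sup>2)" for x
    using order_trans[OF assms(3)[of x] mult_left_mono[OF B(2)[of x] assms(4)]] by simp
  thus ?thesis using niceI assms(2) by blast
qed

lemma nice_add: "nice f \<Longrightarrow> nice g \<Longrightarrow> nice (\<lambda>x. f x + g x)"
proof -
  assume f: "nice f" and g: "nice g"
  obtain B where B: "\<And>x. norm (f x) \<le> B / (1 + x\<^sup>2)" using niceE[OF f] by blast
  obtain C where C: "\<And>x. norm (g x) \<le> C / (1 + x\<^sup>2)" using niceE[OF g] by blast
  show ?thesis
  proof (rule niceI)
    show "norm (f x + g x) \<le> (B + C) / (1 + x\<^sup>2)" for x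
      using norm_triangle_ineq[of "f x" "g x"] B[of x] C[of x] by (simp add: add_divide_distrib)
  qed (intro continuous_intros nice_cont f g)
qed

lemma nice_mult_left:
  fixes f g :: "real \<Rightarrow> 'a::real_normed_algebra"
  assumes f: "nice f" and g: "bcont g" shows "nice (\<lambda>x. f x * g x)"
proof -
  obtain B where B: "B \<ge> 0" "\<And>x. norm (g x) \<le> B" using bcontE[OF g] by blast
  show ?thesis
  proof (rule nice_dominated[OF f _ _ B(1)])
    show "continuous_on UNIV (\<lambda>x. f x * g x)"
      by (intro continuous_intros nice_cont[OF f] bcont_cont[OF g])
    show "norm (f x * g x) \<le> B * norm (f x)" for x
      using order_trans[OF norm_mult_ineq mult_left_mono[OF B(2)[of x] norm_ge_zero[of "f x"]]]
      by (simp add: mult.commute)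
  qed
qed

lemma nice_mult_right:
  fixes f g :: "real \<Rightarrow> 'a::real_normed_algebra"
  assumes f: "bcont f" and g: "nice g" shows "nice (\<lambda>x. f x * g x)"
proof -
  obtain B where B: "B \<ge> 0" "\<And>x. norm (f x) \<le> B" using bcontE[OF f] by blast
  show ?thesis
  proof (rule nice_dominated[OF g _ _ B(1)])
    show "continuous_on UNIV (\<lambda>x. f x * g x)"
      by (intro continuous_intros nice_cont[OF g] bcont_cont[OF f])
    show "norm (f x * g x) \<le> B * norm (g x)" for x
      using order_trans[OF norm_mult_ineq mult_right_mono[OF B(2)[of x] norm_ge_zero[of "g x"]]] .
  qed
qed

lemma nice_scaleR_left:
  assumes f: "bcont f" and g: "nice g" shows "nice (\<lambda>x. f x *\<^sub>R g x)"
proof -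
  obtain B where B: "B \<ge> 0" "\<And>x. norm (f x) \<le> B" using bcontE[OF f] by blast
  show ?thesis
    by (rule nice_dominated[OF g _ _ B(1)])
      (use B(2) in \<open>auto intro!: continuous_intros nice_cont[OF g] bcont_cont[OF f] mult_right_mono\<close>)
qed

lemma nice_linear:
  assumes "bounded_linear L" "nice f" shows "nice (\<lambda>x. L (f x))"
proof -
  interpret bounded_linear L by fact
  obtain K where K: "K > 0" "\<And>x. norm (L x) \<le> norm x * K" using pos_bounded by blast
  show ?thesis
  proof (rule nice_dominated[OF assms(2), where C=K])
    show "continuous_on UNIV (\<lambda>x. L (f x))" by (rule continuous_on[OF nice_cont[OF assms(2)]])
    show "norm (L (f x)) \<le> K * norm (f x)" for x using K(2)[of "f x"] by (simp add: mult.commute)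
  qed (use K(1) in simp)
qed

lemma nice_minus: "nice f \<Longrightarrow> nice (\<lambda>x. - f x)"
  by (rule nice_linear[OF bounded_linear_minus[OF bounded_linear_ident]])

lemma nice_diff: "nice f \<Longrightarrow> nice g \<Longrightarrow> nice (\<lambda>x. f x - g x)"
  using nice_add[OF _ nice_minus, of f g] by simp

lemma nice_norm: "nice f \<Longrightarrow> nice (\<lambda>x. norm (f x))"
  by (rule nice_dominated[where g=f and C=1]) (auto intro: continuous_on_norm nice_cont)

lemma nice_zero: "nice (\<lambda>x. 0)"
  by (rule niceI[where B=0]) auto

lemma nice_Re: "nice f \<Longrightarrow> nice (\<lambda>x. Re (f x))" by (rule nice_linear[OF bounded_linear_Re])
lemma nice_Im: "nice f \<Longrightarrow> nice (\<lambda>x. Im (f x))" by (rule nice_linear[OF bounded_linear_Im])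
lemma nice_cnj: "nice f \<Longrightarrow> nice (\<lambda>x. cnj (f x))" by (rule nice_linear[OF bounded_linear_cnj])
lemma nice_of_real: "nice f \<Longrightarrow> nice (\<lambda>x. complex_of_real (f x))"
  by (rule nice_linear[OF bounded_linear_of_real])

lemma bcont_const: "bcont (\<lambda>x. c)" by (rule bcontI[where B="norm c"]) auto

lemma nice_power:
  fixes f :: "real \<Rightarrow> 'a::real_normed_div_algebra"
  assumes f: "nice f" shows "nice (\<lambda>x. f x ^ Suc n)"
proof (induction n)
  case 0 thus ?case using f by simp
next
  case (Suc n) thus ?case using nice_mult_left[OF f bcont_nice[OF Suc]] by simp
qed

lemma nice_power2: "nice f \<Longrightarrow> nice (\<lambda>x. (f x :: 'a::real_normed_div_algebra)\<^sup>2)"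
  and nice_power4: "nice f \<Longrightarrow> nice (\<lambda>x. (f x)^4)"
  using nice_power[of f 1] nice_power[of f 3] by (simp_all add: numeral_eq_Suc)

lemma bcont_add: "bcont f \<Longrightarrow> bcont g \<Longrightarrow> bcont (\<lambda>x. f x + g x)"
proof -
  assume f: "bcont f" and g: "bcont g"
  obtain B where B: "\<And>x. norm (f x) \<le> B" using bcontE[OF f] by blast
  obtain C where C: "\<And>x. norm (g x) \<le> C" using bcontE[OF g] by blast
  show ?thesis
  proof (rule bcontI)
    show "norm (f x + g x) \<le> B + C" for x
      using norm_triangle_ineq[of "f x" "g x"] B[of x] C[of x] by simp
  qed (intro continuous_intros bcont_cont f g)
qed

lemma bcont_mult:
  fixes f g :: "real \<Rightarrow> 'a::real_normed_algebra"
  assumes f: "bcont f" and g: "bcont g" shows "bcont (\<lambda>x. f x * g x)"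
proof -
  obtain B where B: "B \<ge> 0" "\<And>x. norm (f x) \<le> B" using bcontE[OF f] by blast
  obtain C where C: "\<And>x. norm (g x) \<le> C" using bcontE[OF g] by blast
  show ?thesis
  proof (rule bcontI)
    show "norm (f x * g x) \<le> B * C" for x
      using order_trans[OF norm_mult_ineq mult_mono[OF B(2)[of x] C[of x] B(1) norm_ge_zero]] .
  qed (intro continuous_intros bcont_cont f g)
qed

lemma bcont_linear:
  assumes "bounded_linear L" "bcont f" shows "bcont (\<lambda>x. L (f x))"
proof -
  interpret bounded_linear L by fact
  obtain K where K: "K > 0" "\<And>x. norm (L x) \<le> norm x * K" using pos_bounded by blast
  obtain B where B: "\<And>x. norm (f x) \<le> B" using bcontE[OF assms(2)] by blast
  show ?thesis
  proof (rule bcontI)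
    show "norm (L (f x)) \<le> B * K" for x
      using order_trans[OF K(2) mult_right_mono[OF B[of x]]] K(1) by simp
  qed (rule continuous_on[OF bcont_cont[OF assms(2)]])
qed

lemma bcont_minus: "bcont f \<Longrightarrow> bcont (\<lambda>x. - f x)"
  by (rule bcont_linear[OF bounded_linear_minus[OF bounded_linear_ident]])
lemma bcont_diff: "bcont f \<Longrightarrow> bcont g \<Longrightarrow> bcont (\<lambda>x. f x - g x)"
  using bcont_add[OF _ bcont_minus, of f g] by simp
lemma bcont_cnj: "bcont f \<Longrightarrow> bcont (\<lambda>x. cnj (f x))" by (rule bcont_linear[OF bounded_linear_cnj])
lemma bcont_Re: "bcont f \<Longrightarrow> bcont (\<lambda>x. Re (f x))" by (rule bcont_linear[OF bounded_linear_Re])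
lemma bcont_Im: "bcont f \<Longrightarrow> bcont (\<lambda>x. Im (f x))" by (rule bcont_linear[OF bounded_linear_Im])
lemma bcont_of_real: "bcont f \<Longrightarrow> bcont (\<lambda>x. complex_of_real (f x))"
  by (rule bcont_linear[OF bounded_linear_of_real])
lemma bcont_norm: "bcont f \<Longrightarrow> bcont (\<lambda>x. norm (f x))"
  unfolding bcont_def by (auto intro: continuous_intros)
lemma bcont_power: "bcont f \<Longrightarrow> bcont (\<lambda>x. (f x :: 'a::real_normed_div_algebra) ^ n)"
  by (induction n) (auto intro: bcont_mult bcont_const)

lemmas nice_rules = nice_add nice_diff nice_minus nice_norm nice_Re nice_Im nice_cnj nice_of_real
  nice_power2 nice_power4 nice_mult_left nice_mult_right nice_zero
lemmas bcont_rules = bcont_const bcont_add bcont_diff bcont_minus bcont_norm bcont_Re bcont_Im bcont_cnj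
  bcont_of_real bcont_power bcont_mult

lemma nice_measurable: "nice f \<Longrightarrow> f \<in> borel_measurable borel"
  by (auto intro!: borel_measurable_continuous_onI simp: nice_cont)

lemma nice_integrable:
  fixes f :: "real \<Rightarrow> 'a::{banach, second_countable_topology}"
  assumes "nice f" shows "integrable lborel f"
proof -
  obtain B where B: "B \<ge> 0" "\<And>x. norm (f x) \<le> B / (1 + x\<^sup>2)" using niceE[OF assms] by blast
  show ?thesis
  proof (rule Bochner_Integration.integrable_bound)
    show "integrable lborel (\<lambda>x::real. B * (1 / (1 + x\<^sup>2)))"
      by (intro integrable_mult_right integrable_inverse_square)
    show "f \<in> borel_measurable lborel" using nice_measurable[OF assms] by simp
    show "AE x in lborel. norm (f x) \<le> norm (B * (1 / (1 + x\<^sup>2)))"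
      using B by (auto intro!: AE_I2 simp: abs_mult)
  qed
qed

lemma tendsto_inverse_square_at_infinity:
  "((\<lambda>x::real. B / (1 + x\<^sup>2)) \<longlongrightarrow> 0) at_top" "((\<lambda>x::real. B / (1 + x\<^sup>2)) \<longlongrightarrow> 0) at_bot"
  by real_asymp+

lemma nice_tendsto:
  assumes "nice f" shows "(f \<longlongrightarrow> 0) at_top" "(f \<longlongrightarrow> 0) at_bot"
proof -
  obtain B where B: "B \<ge> 0" "\<And>x. norm (f x) \<le> B / (1 + x\<^sup>2)" using niceE[OF assms] by blast
  show "(f \<longlongrightarrow> 0) at_top"
    by (rule Lim_null_comparison[OF _ tendsto_inverse_square_at_infinity(1)[of B]]) (use B in auto)
  show "(f \<longlongrightarrow> 0) at_bot"
    by (rule Lim_null_comparison[OF _ tendsto_inverse_square_at_infinity(2)[of B]]) (use B in auto)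
qed

lemma integral_derivative_line:
  fixes F f :: "real \<Rightarrow> 'a::euclidean_space"
  assumes "\<And>x. (F has_vector_derivative f x) (at x)" "continuous_on UNIV f" "integrable lborel f"
    and "(F \<longlongrightarrow> a) at_bot" "(F \<longlongrightarrow> b) at_top"
  shows "(LINT x|lborel. f x) = b - a"
proof -
  have "(LBINT x=-\<infinity>..\<infinity>. f x) = b - a"
  proof (rule interval_integral_FTC_integrable)
    show "set_integrable lborel (einterval (-\<infinity>) \<infinity>) f"
      using assms(3) by (simp add: set_integrable_def)
    show "isCont f x" for x using assms(2) by (simp add: continuous_on_eq_continuous_at)
    show "((F \<circ> real_of_ereal) \<longlongrightarrow> a) (at_right (- \<infinity>))"
      using assms(4) by (simp add: ereal_tendsto_simps)
    show "((F \<circ> real_of_ereal) \<longlongrightarrow> b) (at_left \<infinity>)"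
      using assms(5) by (simp add: ereal_tendsto_simps)
  qed (use assms(1) in auto)
  thus ?thesis by (simp add: interval_lebesgue_integral_def set_lebesgue_integral_def)
qed

text \<open>Integrations by parts below have this form: an identity between integrals is proved by
  exhibiting a decaying primitive \<open>F\<close> of the difference of the integrands.\<close>

lemma integral_derivative_nice:
  fixes F f :: "real \<Rightarrow> 'a::euclidean_space"
  assumes "\<And>x. (F has_vector_derivative f x) (at x)" "nice f" "nice F"
  shows "(LINT x|lborel. f x) = 0"
  using integral_derivative_line[OF assms(1) nice_cont[OF assms(2)] nice_integrable[OF assms(2)]
      nice_tendsto(2)[OF assms(3)] nice_tendsto(1)[OF assms(3)]] by simp

lemma integral_Cauchy_Schwarz:
  fixes f g :: "'a \<Rightarrow> real"
  assumes [measurable]: "f \<in> borel_measurable M" "g \<in> borel_measurable M"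
    and f2: "integrable M (\<lambda>x. (f x)\<^sup>2)" and g2: "integrable M (\<lambda>x. (g x)\<^sup>2)"
  shows "integrable M (\<lambda>x. f x * g x)"
    "(LINT x|M. \<bar>f x * g x\<bar>) \<le> sqrt (LINT x|M. (f x)\<^sup>2) * sqrt (LINT x|M. (g x)\<^sup>2)"
proof -
  have le: "\<bar>a * b\<bar> \<le> a\<^sup>2 + b\<^sup>2" for a b :: real
  proof -
    have "0 \<le> (\<bar>a\<bar> - \<bar>b\<bar>)\<^sup>2" by simp
    hence "2 * (\<bar>a\<bar> * \<bar>b\<bar>) \<le> a\<^sup>2 + b\<^sup>2" by (simp add: power2_diff)
    moreover have "0 \<le> a\<^sup>2 + b\<^sup>2" by simp
    ultimately show ?thesis unfolding abs_mult by linarith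
  qed
  show I: "integrable M (\<lambda>x. f x * g x)"
    by (rule Bochner_Integration.integrable_bound[OF Bochner_Integration.integrable_add[OF f2 g2]])
      (auto intro!: AE_I2 le)
  define F G where "F = (LINT x|M. (f x)\<^sup>2)" and "G = (LINT x|M. (g x)\<^sup>2)"
  have FG: "F \<ge> 0" "G \<ge> 0" unfolding F_def G_def by (auto intro!: integral_nonneg_AE)
  \<comment> \<open>The pointwise inequality \<open>2 |f g| \<le> s f^2 + g^2 / s\<close>,
    integrated. The optimal \<open>s\<close> is \<open>sqrt G / sqrt F\<close>; when
    \<open>F\<close> or \<open>G\<close> vanishes, an arbitrary \<open>e\<close> sends
    \<open>s\<close> to an end of the half-line instead.\<close>
  have key: "2 * (LINT x|M. \<bar>f x * g x\<bar>) \<le> s * F + G / s" if "s > 0" for s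
  proof -
    have "(LINT x|M. 2 * \<bar>f x * g x\<bar>) \<le> (LINT x|M. s * (f x)\<^sup>2 + (g x)\<^sup>2 / s)"
    proof (rule integral_mono)
      show "integrable M (\<lambda>x. 2 * \<bar>f x * g x\<bar>)" using I by auto
      show "integrable M (\<lambda>x. s * (f x)\<^sup>2 + (g x)\<^sup>2 / s)" using f2 g2 by auto
      fix x
      have "0 \<le> (s * \<bar>f x\<bar> - \<bar>g x\<bar>)\<^sup>2 / s" using that by simp
      also have "\<dots> = s * (f x)\<^sup>2 + (g x)\<^sup>2 / s - 2 * \<bar>f x * g x\<bar>"
        using that by (simp add: power2_diff field_simps abs_mult power2_eq_square)
      finally show "2 * \<bar>f x * g x\<bar> \<le> s * (f x)\<^sup>2 + (g x)\<^sup>2 / s" by simp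
    qed
    thus ?thesis using f2 g2 by (simp add: F_def G_def)
  qed
  have "2 * (LINT x|M. \<bar>f x * g x\<bar>) \<le> 2 * (sqrt F * sqrt G)"
  proof (cases "F = 0 \<or> G = 0")
    case False
    hence pos: "F > 0" "G > 0" using FG by auto
    have "2 * (LINT x|M. \<bar>f x * g x\<bar>) \<le> (sqrt G / sqrt F) * F + G / (sqrt G / sqrt F)"
      by (rule key) (use pos in auto)
    also have "\<dots> = 2 * (sqrt F * sqrt G)"
    proof -
      obtain a b where ab: "a > 0" "b > 0" "F = a\<^sup>2" "G = b\<^sup>2"
        using pos by (metis real_sqrt_gt_0_iff real_sqrt_pow2 less_imp_le)
      thus ?thesis by (simp add: field_simps power2_eq_square)
    qed
    finally show ?thesis .
  next
    case True
    have "2 * (LINT x|M. \<bar>f x * g x\<bar>) \<le> 0 + e" if "e > 0" for e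
    proof (cases "F = 0")
      case True
      show ?thesis
      proof (cases "G = 0")
        case G0: True thus ?thesis using key[of 1] True that by simp
      next
        case False
        hence "G > 0" using FG by simp
        thus ?thesis using key[of "G / e"] True that by simp
      qed
    next
      case False
      hence "F > 0" "G = 0" using FG \<open>F = 0 \<or> G = 0\<close> by auto
      thus ?thesis using key[of "e / F"] that by simp
    qed
    hence "2 * (LINT x|M. \<bar>f x * g x\<bar>) \<le> 0" by (rule field_le_epsilon)
    thus ?thesis using True by auto
  qed
  thus "(LINT x|M. \<bar>f x * g x\<bar>) \<le> sqrt (LINT x|M. (f x)\<^sup>2) * sqrt (LINT x|M. (g x)\<^sup>2)"
    by (simp add: F_def G_def)
qed

section \<open>The one-sided exponential resolvent\<close>

definition expker :: "real \<Rightarrow> real \<Rightarrow> real" where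
  "expker c s = indicator {0..} s * exp (- (c * s))"

text \<open>The inverse of \<open>\<partial> + c\<close> on bounded functions, so that
  \<open>resolv (2 * k)\<close> is the operator \<open>R_k\<close>. Its value at \<open>x\<close>
  sees \<open>f\<close> only on \<open>y \<le> x\<close>; the bootstrap for the Riccati equation,
  which starts at minus infinity, relies on this.\<close>

definition resolv :: "real \<Rightarrow> (real \<Rightarrow> 'a::{banach, second_countable_topology}) \<Rightarrow> real \<Rightarrow> 'a" where
  "resolv c f x = (LINT s|lborel. expker c s *\<^sub>R f (x - s))"

lemma expker_nonneg: "expker c s \<ge> 0"
  by (simp add: expker_def)

lemma expker_measurable [measurable]: "expker c \<in> borel_measurable borel"
  unfolding expker_def by measurable

lemma has_integral_expker:
  assumes c: "c > 0"
  shows "has_bochner_integral lborel (expker c) (1 / c)"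
    "integrable lborel (\<lambda>s. expker c s * (1 + s\<^sup>2))"
proof -
  have eq: "expker c = (\<lambda>s. (c * s)^0 * exp (- (c * s)) * indicator {0..} (c * s))"
    using c by (intro ext) (auto simp: expker_def indicator_def zero_le_mult_iff)
  show e: "has_bochner_integral lborel (expker c) (1 / c)"
    using has_bochner_integral_I0i_power_exp_m'[of 0] lborel_has_bochner_integral_real_affine_iff[of c
       "\<lambda>x. x ^ 0 * exp (- x) * indicator {0..} x" 1 0] c
    unfolding eq by (simp add: divide_inverse)
  have "integrable lborel (\<lambda>s. (0 + c * s)^2 * exp (- (0 + c * s)) * indicator {0..} (0 + c * s))"
    using has_bochner_integral_I0i_power_exp_m'[of 2] c
    by (intro lborel_integrable_real_affine) (auto simp: has_bochner_integral_iff)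
  hence "integrable lborel (\<lambda>s. inverse (c\<^sup>2) * ((0 + c * s)^2 * exp (- (0 + c * s)) * indicator {0..} (0 + c * s)))"
    by (rule integrable_mult_right)
  also have "(\<lambda>s. inverse (c\<^sup>2) * ((0 + c * s)^2 * exp (- (0 + c * s)) * indicator {0..} (0 + c * s)))
      = (\<lambda>s. expker c s * s\<^sup>2)"
    using c by (intro ext) (auto simp: expker_def indicator_def zero_le_mult_iff field_simps power_mult_distrib)
  finally have "integrable lborel (\<lambda>s. expker c s + expker c s * s\<^sup>2)"
    using e by (intro Bochner_Integration.integrable_add) (auto simp: has_bochner_integral_iff)
  thus "integrable lborel (\<lambda>s. expker c s * (1 + s\<^sup>2))" by (simp add: distrib_left)
qed

lemma expker_integrable: "c > 0 \<Longrightarrow> integrable lborel (expker c)"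
  and expker_integral: "c > 0 \<Longrightarrow> (LINT s|lborel. expker c s) = 1 / c"
  using has_integral_expker(1)[of c] by (auto simp: has_bochner_integral_iff)

lemma bcont_shift_measurable:
  assumes "bcont f" shows "(\<lambda>s. f (x - s)) \<in> borel_measurable borel"
proof -
  have "continuous_on UNIV (\<lambda>s. f (x - s))"
    by (rule continuous_on_compose2[OF bcont_cont[OF assms]]) (auto intro: continuous_intros)
  thus ?thesis by (rule borel_measurable_continuous_onI)
qed

lemma resolv_integrable:
  fixes f :: "real \<Rightarrow> 'a::{banach, second_countable_topology}"
  assumes c: "c > 0" and f: "bcont f"
  shows "integrable lborel (\<lambda>s. expker c s *\<^sub>R f (x - s))"
proof -
  obtain B where B: "B \<ge> 0" "\<And>x. norm (f x) \<le> B" using bcontE[OF f] by blast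
  note [measurable] = bcont_shift_measurable[OF f]
  show ?thesis
  proof (rule Bochner_Integration.integrable_bound)
    show "integrable lborel (\<lambda>s. B * expker c s)"
      by (intro integrable_mult_right expker_integrable c)
    show "AE s in lborel. norm (expker c s *\<^sub>R f (x - s)) \<le> norm (B * expker c s)"
      using B by (auto intro!: AE_I2 mult_right_mono simp: expker_nonneg abs_mult mult.commute[of _ "norm _"])
  qed measurable
qed

lemma resolv_norm_le:
  fixes f :: "real \<Rightarrow> 'a::{banach, second_countable_topology}"
  assumes c: "c > 0" and f: "bcont f"
  shows "norm (resolv c f x) \<le> resolv c (\<lambda>y. norm (f y)) x"
  unfolding resolv_def
  using integral_norm_bound[of lborel "\<lambda>s. expker c s *\<^sub>R f (x - s)"]
  by (simp add: expker_nonneg)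

text \<open>The kernel is one-sided, so a comparison to the left of \<open>x\<close> is enough. This
  lets bounds known up to \<open>x\<close> be used at \<open>x\<close>.\<close>

lemma resolv_mono:
  fixes f g :: "real \<Rightarrow> real"
  assumes c: "c > 0" and f: "bcont f" and g: "bcont g" and le: "\<And>y. y \<le> x \<Longrightarrow> f y \<le> g y"
  shows "resolv c f x \<le> resolv c g x"
  unfolding resolv_def
proof (rule integral_mono[OF resolv_integrable[OF c f] resolv_integrable[OF c g]])
  fix s
  show "expker c s *\<^sub>R f (x - s) \<le> expker c s *\<^sub>R g (x - s)"
    using le[of "x - s"] by (cases "s \<ge> 0") (auto simp: expker_def)
qed

lemma resolv_nonneg: "(\<And>y. f y \<ge> (0::real)) \<Longrightarrow> resolv c f x \<ge> 0"
  unfolding resolv_def by (intro integral_nonneg_AE AE_I2) (simp add: expker_nonneg)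

lemma resolv_const:
  fixes a :: real assumes c: "c > 0"
  shows "resolv c (\<lambda>_. a) x = a / c"
  unfolding resolv_def using expker_integral[OF c] expker_integrable[OF c] by simp

lemma resolv_le_const:
  fixes f :: "real \<Rightarrow> 'a::{banach, second_countable_topology}"
  assumes c: "c > 0" and f: "bcont f" and B: "\<And>y. y \<le> x \<Longrightarrow> norm (f y) \<le> B"
  shows "norm (resolv c f x) \<le> B / c"
proof -
  have "resolv c (\<lambda>y. norm (f y)) x \<le> resolv c (\<lambda>_. B) x"
    by (rule resolv_mono[OF c bcont_norm[OF f] bcont_const]) (rule B)
  thus ?thesis using resolv_norm_le[OF c f, of x] by (simp add: resolv_const[OF c])
qed

lemma resolv_add:
  fixes f :: "real \<Rightarrow> 'a::{banach, second_countable_topology}"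
  assumes "c > 0" "bcont f" "bcont g"
  shows "resolv c (\<lambda>y. f y + g y) x = resolv c f x + resolv c g x"
  unfolding resolv_def
  using Bochner_Integration.integral_add[OF resolv_integrable[OF assms(1,2)] resolv_integrable[OF assms(1,3)]]
  by (simp add: scaleR_right_distrib)

lemma resolv_linear:
  fixes f :: "real \<Rightarrow> 'a::{banach, second_countable_topology}"
    and L :: "'a \<Rightarrow> 'b::{banach, second_countable_topology}"
  assumes "bounded_linear L" "c > 0" "bcont f"
  shows "resolv c (\<lambda>y. L (f y)) x = L (resolv c f x)"
  unfolding resolv_def
  using integral_bounded_linear[OF assms(1) resolv_integrable[OF assms(2,3)]]
  by (simp add: linear_cmul[OF bounded_linear.linear[OF assms(1)]])

lemma resolv_cmult:
  fixes f :: "real \<Rightarrow> 'a::{banach, second_countable_topology, real_normed_algebra}"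
  shows "c > 0 \<Longrightarrow> bcont f \<Longrightarrow> resolv c (\<lambda>y. a * f y) x = a * resolv c f x"
  by (rule resolv_linear[OF bounded_linear_mult_right])

text \<open>After the substitution \<open>y = x - s\<close> the variable \<open>x\<close> occurs
  only in a factor and in the limit of integration, so the resolvent of a merely continuous
  \<open>f\<close> can be differentiated.\<close>

lemma resolv_explicit:
  fixes f :: "real \<Rightarrow> 'a::{banach, second_countable_topology}"
  assumes c: "c > 0" and f: "bcont f"
  shows "set_integrable lborel {..x} (\<lambda>y. exp (c * y) *\<^sub>R f y)"
    "resolv c f x = exp (- (c * x)) *\<^sub>R (LINT y:{..x}|lborel. exp (c * y) *\<^sub>R f y)"
proof -
  let ?g = "\<lambda>s. expker c s *\<^sub>R f (x - s)"
  have eq: "?g (x + (-1) * y) = exp (- (c * x)) *\<^sub>R (indicator {..x} y *\<^sub>R (exp (c * y) *\<^sub>R f y))" for y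
    by (auto simp: expker_def indicator_def algebra_simps exp_add[symmetric])
  have "integrable lborel (\<lambda>y. ?g (x + (-1) * y))"
    by (rule lborel_integrable_real_affine[OF resolv_integrable[OF c f]]) simp
  hence "integrable lborel (\<lambda>y. exp (c * x) *\<^sub>R exp (- (c * x)) *\<^sub>R (indicator {..x} y *\<^sub>R (exp (c * y) *\<^sub>R f y)))"
    unfolding eq by (rule integrable_scaleR_right)
  also have "(\<lambda>y. exp (c * x) *\<^sub>R exp (- (c * x)) *\<^sub>R (indicator {..x} y *\<^sub>R (exp (c * y) *\<^sub>R f y)))
    = (\<lambda>y. indicator {..x} y *\<^sub>R (exp (c * y) *\<^sub>R f y))"
  proof -
    have "exp (c * x) *\<^sub>R exp (- (c * x)) *\<^sub>R v = v" for v :: 'a by (simp add: exp_minus)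
    thus ?thesis by metis
  qed
  finally show "set_integrable lborel {..x} (\<lambda>y. exp (c * y) *\<^sub>R f y)"
    unfolding set_integrable_def .
  have "(LINT s|lborel. ?g s) = \<bar>-1\<bar> *\<^sub>R (LINT y|lborel. ?g (x + (-1) * y))"
    by (rule lborel_integral_real_affine) simp
  thus "resolv c f x = exp (- (c * x)) *\<^sub>R (LINT y:{..x}|lborel. exp (c * y) *\<^sub>R f y)"
    unfolding eq resolv_def set_lebesgue_integral_def integral_scaleR_right by (simp del: scaleR_scaleR)
qed

lemma lower_integral_deriv:
  fixes G :: "real \<Rightarrow> 'a::euclidean_space"
  assumes cont: "continuous_on UNIV G" and int: "\<And>x. set_integrable lborel {..x} G"
  shows "((\<lambda>x. LINT y:{..x}|lborel. G y) has_vector_derivative G x) (at x)"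
proof -
  have contG: "continuous_on S G" for S
    by (rule continuous_on_subset[OF cont]) auto
  \<comment> \<open>Near \<open>x\<close> the integral is split at the fixed point \<open>a\<close>,
    and the fundamental theorem on a compact interval treats the part that moves.\<close>
  define a b where "a = x - 1" and "b = x + 1"
  have K: "(LINT y:{..z}|lborel. G y) = (LINT y:{..a}|lborel. G y) + integral {a..z} G" if "z \<in> {a<..<b}" for z
  proof -
    have S: "set_integrable lborel {a<..z} G"
      by (rule set_integrable_subset[OF int[of z]]) auto
    have "(LINT y:{..a} \<union> {a<..z}|lborel. G y) = (LINT y:{..a}|lborel. G y) + (LINT y:{a<..z}|lborel. G y)"
      by (rule set_integral_Un[OF _ int S]) auto
    also have "{..a} \<union> {a<..z} = {..z}" using that by auto
    also have "(LINT y:{a<..z}|lborel. G y) = (LINT y:{a..z}|lborel. G y)"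
      using AE_lborel_singleton[of a] unfolding set_lebesgue_integral_def
      by (intro integral_cong_AE borel_measurable_scaleR borel_measurable_indicator)
        (auto simp: indicator_def contG intro!: borel_measurable_continuous_onI elim!: eventually_mono)
    also have "(LINT y:{a..z}|lborel. G y) = integral {a..z} G"
      by (rule set_borel_integral_eq_integral(2)[OF borel_integrable_atLeastAtMost']) (rule contG)
    finally show ?thesis .
  qed
  have d: "((\<lambda>z. integral {a..z} G) has_vector_derivative G x) (at x)"
  proof -
    have "((\<lambda>z. integral {a..z} G) has_vector_derivative G x) (at x within {a..b})"
      by (rule integral_has_vector_derivative[OF contG]) (auto simp: a_def b_def)
    moreover have "at x within {a..b} = at x"
      by (rule at_within_interior) (auto simp: a_def b_def)
    ultimately show ?thesis by simp
  qed
  have D: "((\<lambda>z. (LINT y:{..a}|lborel. G y) + integral {a..z} G) has_vector_derivative G x) (at x)"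
    using has_vector_derivative_add[OF has_vector_derivative_const d] by simp
  show ?thesis
    by (rule has_vector_derivative_transform_within_open[OF D, of "{a<..<b}"])
      (use K in \<open>auto simp: a_def b_def\<close>)
qed

lemma resolv_deriv:
  fixes f :: "real \<Rightarrow> 'a::euclidean_space"
  assumes c: "c > 0" and f: "bcont f"
  shows "(resolv c f has_vector_derivative (f x - c *\<^sub>R resolv c f x)) (at x)"
proof -
  have d: "((\<lambda>x. LINT y:{..x}|lborel. exp (c * y) *\<^sub>R f y) has_vector_derivative exp (c * x) *\<^sub>R f x) (at x)"
    by (intro lower_integral_deriv resolv_explicit(1)[OF c f] continuous_intros bcont_cont[OF f])
  have eq: "resolv c f = (\<lambda>x. exp (- (c * x)) *\<^sub>R (LINT y:{..x}|lborel. exp (c * y) *\<^sub>R f y))"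
    by (intro ext resolv_explicit(2)[OF c f])
  show ?thesis unfolding eq
    by (rule has_vector_derivative_eq_rhs, rule has_vector_derivative_scaleR[OF _ d])
      (auto intro!: derivative_eq_intros simp: exp_minus)
qed

lemma has_vector_derivative_cont: "(\<And>x. (f has_vector_derivative f' x) (at x)) \<Longrightarrow> continuous_on UNIV f"
  by (meson continuous_at_imp_continuous_on has_vector_derivative_continuous)

lemma resolv_bcont:
  fixes f :: "real \<Rightarrow> 'a::euclidean_space"
  assumes c: "c > 0" and f: "bcont f" shows "bcont (resolv c f)"
proof -
  obtain B where B: "B \<ge> 0" "\<And>x. norm (f x) \<le> B" using bcontE[OF f] by blast
  show ?thesis
    by (rule bcontI[OF has_vector_derivative_cont[OF resolv_deriv[OF c f]], of "B / c"])
      (rule resolv_le_const[OF c f B(2)])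
qed

lemma resolv_nice:
  fixes f :: "real \<Rightarrow> 'a::euclidean_space"
  assumes c: "c > 0" and f: "nice f" shows "nice (resolv c f)"
proof -
  obtain B where B: "B \<ge> 0" "\<And>x. norm (f x) \<le> B / (1 + x\<^sup>2)" using niceE[OF f] by blast
  note bf = bcont_nice[OF f]
  define K where "K = (LINT s|lborel. expker c s * (1 + s\<^sup>2))"
  show ?thesis
  proof (rule niceI[OF has_vector_derivative_cont[OF resolv_deriv[OF c bf]], of "2 * B * K"])
    fix x
    have "norm (resolv c f x) \<le> (LINT s|lborel. (2 * B / (1 + x\<^sup>2)) * (expker c s * (1 + s\<^sup>2)))"
      unfolding resolv_def
    proof (rule order_trans[OF integral_norm_bound], rule integral_mono)
      show "integrable lborel (\<lambda>s. norm (expker c s *\<^sub>R f (x - s)))"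
        by (rule integrable_norm[OF resolv_integrable[OF c bf]])
      show "integrable lborel (\<lambda>s. (2 * B / (1 + x\<^sup>2)) * (expker c s * (1 + s\<^sup>2)))"
        by (intro integrable_mult_right has_integral_expker(2) c)
      fix s
      \<comment> \<open>Expanded, this is \<open>1 + x^2 \<le> 2 (1 + s^2) (1 + (x - s)^2)\<close>:
        decay at \<open>x - s\<close> becomes decay at \<open>x\<close> at the price of the factor
        \<open>1 + s^2\<close>, which the exponential kernel integrates.\<close>
      have "0 \<le> (x - 2 * s)\<^sup>2 + 1 + 2 * (s * (x - s))\<^sup>2" by (intro add_nonneg_nonneg) auto
      hence "1 + x\<^sup>2 \<le> 2 * ((1 + s\<^sup>2) * (1 + (x - s)\<^sup>2))"
        by (simp add: power2_eq_square algebra_simps)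
      hence "1 / (1 + (x - s)\<^sup>2) \<le> 2 / (1 + x\<^sup>2) * (1 + s\<^sup>2)"
        by (simp add: field_simps)
      from mult_left_mono[OF this B(1)]
      have "B / (1 + (x - s)\<^sup>2) \<le> (2 * B / (1 + x\<^sup>2)) * (1 + s\<^sup>2)" by (simp add: field_simps)
      hence "norm (f (x - s)) \<le> (2 * B / (1 + x\<^sup>2)) * (1 + s\<^sup>2)" using B(2)[of "x - s"] by linarith
      from mult_left_mono[OF this expker_nonneg[of c s]]
      show "norm (expker c s *\<^sub>R f (x - s)) \<le> (2 * B / (1 + x\<^sup>2)) * (expker c s * (1 + s\<^sup>2))"
        by (simp add: expker_nonneg mult_ac)
    qed
    thus "norm (resolv c f x) \<le> 2 * B * K / (1 + x\<^sup>2)" by (simp add: K_def)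
  qed
qed

lemma exp_decay_bounded_zero:
  fixes d :: "real \<Rightarrow> 'a::real_normed_vector"
  assumes "c > 0" "\<And>x y. y \<le> x \<Longrightarrow> norm (d x) \<le> C * exp (- (c * (x - y))) * B"
  shows "d x = 0"
proof -
  have lim: "((\<lambda>y. C * exp (- (c * (x - y))) * B) \<longlongrightarrow> 0) at_bot"
    using assms(1) by real_asymp
  have "norm (d x) \<le> 0"
  proof (rule tendsto_le[OF _ lim tendsto_const])
    show "\<forall>\<^sub>F y in at_bot. norm (d x) \<le> C * exp (- (c * (x - y))) * B"
      using eventually_le_at_bot[of x] by eventually_elim (rule assms(2))
  qed simp
  thus ?thesis by simp
qed

text \<open>The difference \<open>e\<close> solves \<open>e' = - c e\<close>, so
  \<open>exp (c x) e\<close> is constant, and boundedness at minus infinity forces it to vanish.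
  Identities for resolvents are proved below by checking the differential equation and applying
  this.\<close>

lemma resolv_unique:
  fixes w f :: "real \<Rightarrow> 'a::euclidean_space"
  assumes c: "c > 0" and f: "bcont f" and w: "bcont w"
    and d: "\<And>x. (w has_vector_derivative (f x - c *\<^sub>R w x)) (at x)"
  shows "w x = resolv c f x"
proof -
  define e where "e x = w x - resolv c f x" for x
  have e: "(e has_vector_derivative (- c *\<^sub>R e x)) (at x)" for x
    unfolding e_def[abs_def]
    by (rule has_vector_derivative_eq_rhs, rule has_vector_derivative_diff[OF d resolv_deriv[OF c f]])
      (simp add: algebra_simps)
  obtain B where B: "B \<ge> 0" "\<And>x. norm (e x) \<le> B"
    unfolding e_def using bcontE[OF bcont_diff[OF w resolv_bcont[OF c f]]] by blast
  have D: "((\<lambda>x. exp (c * x) *\<^sub>R e x) has_vector_derivative 0) (at x)" for x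
    by (rule has_vector_derivative_eq_rhs, rule has_vector_derivative_scaleR[OF _ e])
      (auto intro!: derivative_eq_intros)
  have const: "exp (c * x) *\<^sub>R e x = exp (c * y) *\<^sub>R e y" for x y
  proof (rule has_derivative_zero_unique[of UNIV "\<lambda>x. exp (c * x) *\<^sub>R e x", simplified])
    show "((\<lambda>x. exp (c * x) *\<^sub>R e x) has_derivative (\<lambda>h. 0)) (at x)" for x
      using D[of x] by (simp add: has_vector_derivative_def)
  qed
  have "norm (e x) \<le> 1 * exp (- (c * (x - y))) * B" if "y \<le> x" for x y
  proof -
    have "e x = exp (- (c * x)) *\<^sub>R (exp (c * x) *\<^sub>R e x)" by (simp add: exp_minus)
    also have "\<dots> = exp (- (c * (x - y))) *\<^sub>R e y"
      by (subst const[of x y]) (simp add: exp_add[symmetric] algebra_simps)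
    finally show ?thesis using B(2)[of y] by simp
  qed
  from exp_decay_bounded_zero[OF c this] have "e x = 0" by blast
  thus ?thesis by (simp add: e_def)
qed

section \<open>Square integrals and the resolvent\<close>

definition sqint :: "(real \<Rightarrow> 'a::real_normed_vector) \<Rightarrow> real" where
  "sqint f = (LINT x|lborel. (norm (f x))\<^sup>2)"

lemma sqint_nonneg: "sqint f \<ge> 0"
  unfolding sqint_def by (intro integral_nonneg_AE) auto

lemma nice_sq: "nice f \<Longrightarrow> nice (\<lambda>x. (norm (f x))\<^sup>2)"
  by (intro nice_power2 nice_norm)

lemma sqint_integrable: "nice f \<Longrightarrow> integrable lborel (\<lambda>x. (norm (f x))\<^sup>2)"
  by (intro nice_integrable nice_sq)

lemma expker_sq: "(expker c s)\<^sup>2 = expker (2 * c) s"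
  by (auto simp: expker_def indicator_def power2_eq_square exp_add[symmetric])

text \<open>Jensen for the probability density \<open>c * expker c s\<close>, written as
  Cauchy-Schwarz with a factor \<open>sqrt (expker c s)\<close> on each side.\<close>

lemma resolv_sq_le:
  fixes f :: "real \<Rightarrow> 'a::{banach, second_countable_topology}"
  assumes c: "c > 0" and f: "bcont f"
  shows "(norm (resolv c f x))\<^sup>2 \<le> resolv c (\<lambda>y. (norm (f y))\<^sup>2) x / c"
proof -
  note [measurable] = bcont_shift_measurable[OF f]
  let ?a = "\<lambda>s. sqrt (expker c s)" and ?b = "\<lambda>s. sqrt (expker c s) * norm (f (x - s))"
  have b2: "integrable lborel (\<lambda>s. (?b s)\<^sup>2)"
    using resolv_integrable[OF c bcont_power[OF bcont_norm[OF f], of 2], of x]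
    by (simp add: power_mult_distrib expker_nonneg)
  have a2: "integrable lborel (\<lambda>s. (?a s)\<^sup>2)"
    using expker_integrable[OF c] by (simp add: expker_nonneg)
  have "(LINT s|lborel. \<bar>?a s * ?b s\<bar>) \<le> sqrt (LINT s|lborel. (?a s)\<^sup>2) * sqrt (LINT s|lborel. (?b s)\<^sup>2)"
    by (rule integral_Cauchy_Schwarz(2)) (use a2 b2 in auto)
  also have "\<dots> = sqrt (1 / c) * sqrt (resolv c (\<lambda>y. (norm (f y))\<^sup>2) x)"
    by (simp add: resolv_def power_mult_distrib expker_nonneg expker_integral[OF c])
  also have "(LINT s|lborel. \<bar>?a s * ?b s\<bar>) = resolv c (\<lambda>y. norm (f y)) x"
    by (simp add: resolv_def abs_mult expker_nonneg flip: mult.assoc)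
  finally have "norm (resolv c f x) \<le> sqrt (1 / c) * sqrt (resolv c (\<lambda>y. (norm (f y))\<^sup>2) x)"
    using resolv_norm_le[OF c f, of x] by linarith
  hence "(norm (resolv c f x))\<^sup>2 \<le> (sqrt (1 / c) * sqrt (resolv c (\<lambda>y. (norm (f y))\<^sup>2) x))\<^sup>2"
    by (rule power_mono) simp
  also have "\<dots> = resolv c (\<lambda>y. (norm (f y))\<^sup>2) x / c"
    using c resolv_nonneg[of "\<lambda>y. (norm (f y))\<^sup>2" c x] by (simp add: power_mult_distrib field_simps)
  finally show ?thesis .
qed

lemma sqint_shift: "sqint (\<lambda>s. f (x - s)) = sqint f"
  unfolding sqint_def using lborel_integral_real_affine[of "-1" "\<lambda>s. (norm (f s))\<^sup>2" x] by simp

text \<open>Cauchy-Schwarz against the kernel, whose square has integral \<open>1 / (2 c)\<close>.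
  Hence \<open>sqrt k * |R_k q|\<close> is bounded by the \<open>L^2\<close> norm at every scale,
  and its smallness is the natural notion of a good scale.\<close>

lemma resolv_sup:
  fixes f :: "real \<Rightarrow> 'a::{banach, second_countable_topology}"
  assumes c: "c > 0" and f: "nice f"
  shows "norm (resolv c f x) \<le> sqrt (sqint f / (2 * c))"
proof -
  note bf = bcont_nice[OF f]
  note [measurable] = bcont_shift_measurable[OF bf]
  have f2: "integrable lborel (\<lambda>s. (norm (f (x - s)))\<^sup>2)"
    using lborel_integrable_real_affine[OF sqint_integrable[OF f], of "-1" x] by simp
  have "norm (resolv c f x) \<le> resolv c (\<lambda>y. norm (f y)) x" by (rule resolv_norm_le[OF c bf])
  also have "\<dots> = (LINT s|lborel. \<bar>expker c s * norm (f (x - s))\<bar>)"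
    by (simp add: resolv_def abs_mult expker_nonneg)
  also have "\<dots> \<le> sqrt (LINT s|lborel. (expker c s)\<^sup>2) * sqrt (LINT s|lborel. (norm (f (x - s)))\<^sup>2)"
    by (rule integral_Cauchy_Schwarz(2)) (use f2 c in \<open>auto simp: expker_sq expker_integrable\<close>)
  also have "\<dots> = sqrt (1 / (2 * c)) * sqrt (sqint f)"
    using sqint_shift[of f x] c by (simp add: expker_sq expker_integral sqint_def)
  finally show ?thesis by (simp add: real_sqrt_mult real_sqrt_divide)
qed

lemma resolv_integral:
  fixes f :: "real \<Rightarrow> 'a::euclidean_space"
  assumes c: "c > 0" and f: "nice f"
  shows "c *\<^sub>R (LINT x|lborel. resolv c f x) = (LINT x|lborel. f x)"
proof -
  note w = resolv_nice[OF c f]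
  have "(LINT x|lborel. f x - c *\<^sub>R resolv c f x) = 0"
    by (rule integral_derivative_nice[OF resolv_deriv[OF c bcont_nice[OF f]] _ w])
      (intro nice_diff f nice_scaleR_left bcont_const w)
  thus ?thesis
    using nice_integrable[OF f] nice_integrable[OF w] by simp
qed

lemma has_vector_derivative_norm_sq:
  fixes F :: "real \<Rightarrow> complex"
  assumes "(F has_vector_derivative f) (at x)"
  shows "((\<lambda>x. (cmod (F x))\<^sup>2) has_vector_derivative 2 * Re (cnj (F x) * f)) (at x)"
proof -
  have "((\<lambda>x. Re (cnj (F x) * F x)) has_vector_derivative Re (cnj (F x) * f + cnj f * F x)) (at x)"
    by (intro bounded_linear.has_vector_derivative[OF bounded_linear_Re] has_vector_derivative_mult
        bounded_linear.has_vector_derivative[OF bounded_linear_cnj] assms)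
  moreover have "(\<lambda>x. Re (cnj (F x) * F x)) = (\<lambda>x. (cmod (F x))\<^sup>2)"
    by (intro ext) (simp add: cmod_power2 flip: power2_eq_square)
  moreover have "Re (cnj (F x) * f + cnj f * F x) = 2 * Re (cnj (F x) * f)" by (simp add: mult.commute[of "Re f"] mult.commute[of "Im f"])
  ultimately show ?thesis by (simp only:)
qed

text \<open>With \<open>w = R q\<close> and \<open>p = w'\<close> one has
  \<open>q = p + c w\<close>, and the cross term \<open>2 Re (cnj w p)\<close> is the derivative of
  \<open>|w|^2\<close>. This is the splitting of the mass at frequency \<open>c\<close>, obtained by
  integration by parts.\<close>

lemma resolv_energy:
  fixes q :: "real \<Rightarrow> complex"
  assumes c: "c > 0" and q: "nice q"
  shows "sqint q = c\<^sup>2 * sqint (resolv c q) + sqint (\<lambda>x. q x - c * resolv c q x)"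
proof -
  define w where "w = resolv c q"
  define p where "p x = q x - c * w x" for x
  have w: "nice w" and p: "nice p"
    unfolding w_def p_def[abs_def] by (intro nice_diff nice_mult_right bcont_const q resolv_nice c)+
  have d: "(w has_vector_derivative p x) (at x)" for x
    using resolv_deriv[OF c bcont_nice[OF q], of x] by (simp add: w_def p_def scaleR_conv_of_real)
  have z: "(LINT x|lborel. 2 * Re (cnj (w x) * p x)) = 0"
    by (rule integral_derivative_nice[OF has_vector_derivative_norm_sq[OF d]])
      (intro nice_rules bcont_rules bcont_nice w p)+
  have eq: "(norm (q x))\<^sup>2 = c\<^sup>2 * (norm (w x))\<^sup>2 + (norm (p x))\<^sup>2 + c * (2 * Re (cnj (w x) * p x))" for x
  proof -
    have "q x = p x + c * w x" by (simp add: p_def)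
    thus ?thesis
      by (simp only: cmod_power2) (simp add: power2_eq_square algebra_simps)
  qed
  have "sqint q = (LINT x|lborel. c\<^sup>2 * (norm (w x))\<^sup>2 + (norm (p x))\<^sup>2 + c * (2 * Re (cnj (w x) * p x)))"
    unfolding sqint_def eq ..
  also have "\<dots> = c\<^sup>2 * sqint w + sqint p + c * (LINT x|lborel. 2 * Re (cnj (w x) * p x))"
  proof -
    have "integrable lborel (\<lambda>x. 2 * Re (cnj (w x) * p x))"
      by (rule nice_integrable) (intro nice_rules bcont_rules bcont_nice w p)
    thus ?thesis using sqint_integrable[OF w] sqint_integrable[OF p] unfolding sqint_def
      by (subst Bochner_Integration.integral_add; simp)+
  qed
  finally show ?thesis unfolding z by (simp add: w_def p_def[abs_def])
qed

definition cumul :: "(real \<Rightarrow> 'a::{banach, second_countable_topology}) \<Rightarrow> real \<Rightarrow> 'a" where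
  "cumul f x = (LINT y:{..x}|lborel. f y)"

lemma nice_set_integrable:
  fixes f :: "real \<Rightarrow> 'a::{banach, second_countable_topology}"
  shows "nice f \<Longrightarrow> A \<in> sets lborel \<Longrightarrow> set_integrable lborel A f"
  unfolding set_integrable_def by (intro integrable_mult_indicator nice_integrable)

lemma cumul_deriv:
  fixes f :: "real \<Rightarrow> 'a::euclidean_space"
  assumes "nice f" shows "(cumul f has_vector_derivative f x) (at x)"
  unfolding cumul_def[abs_def]
  by (intro lower_integral_deriv nice_cont assms nice_set_integrable) auto

lemma cumul_norm_le:
  fixes f :: "real \<Rightarrow> 'a::{banach, second_countable_topology}"
  assumes "nice f" shows "norm (cumul f x) \<le> (LINT y|lborel. norm (f y))"
proof -
  have "norm (cumul f x) \<le> (LINT y|lborel. norm (indicator {..x} y *\<^sub>R f y))"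
    unfolding cumul_def set_lebesgue_integral_def by (rule integral_norm_bound)
  also have "\<dots> \<le> (LINT y|lborel. norm (f y))"
    using integrable_norm[OF nice_set_integrable[OF assms, of "{..x}", unfolded set_integrable_def]] nice_integrable[OF assms]
    by (intro integral_mono) (auto simp: indicator_def)
  finally show ?thesis .
qed

lemma cumul_bcont:
  fixes f :: "real \<Rightarrow> 'a::euclidean_space"
  assumes "nice f" shows "bcont (cumul f)"
  by (rule bcontI[OF has_vector_derivative_cont[OF cumul_deriv[OF assms]] cumul_norm_le[OF assms]])

lemma bcont_exp:
  fixes f :: "real \<Rightarrow> 'a::{real_normed_field, banach}"
  assumes "bcont f" shows "bcont (\<lambda>x. exp (f x))"
proof -
  obtain B where "\<And>x. norm (f x) \<le> B" using bcontE[OF assms] by blast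
  hence "norm (exp (f x)) \<le> exp B" for x using norm_exp[of "f x"] by (meson exp_le_cancel_iff order_trans)
  thus ?thesis by (intro bcontI[where B="exp B"] continuous_intros bcont_cont[OF assms])
qed

section \<open>Linear equations with decaying perturbation\<close>

text \<open>The bounded solution of \<open>y' = a y + f\<close> for \<open>Re a < 0\<close>: the
  oscillating factor removes \<open>Im a\<close>, which leaves the resolvent at the real rate
  \<open>- Re a\<close>.\<close>

definition lsol :: "complex \<Rightarrow> (real \<Rightarrow> complex) \<Rightarrow> real \<Rightarrow> complex" where
  "lsol a f x = exp (\<i> * (Im a * x)) * resolv (- Re a) (\<lambda>y. exp (- (\<i> * (Im a * y))) * f y) x"

lemma has_vector_derivative_exp:
  fixes g :: "real \<Rightarrow> complex"
  assumes "(g has_vector_derivative g') (at x)"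
  shows "((\<lambda>x. exp (g x)) has_vector_derivative g' * exp (g x)) (at x)"
  using field_vector_diff_chain_at[OF assms, of exp "exp (g x)"] DERIV_exp[of "g x"]
  by (simp add: o_def)

lemma bcont_cis: "bcont (\<lambda>x. exp (\<i> * (complex_of_real (b * x))))" "bcont (\<lambda>x. exp (- (\<i> * (complex_of_real (b * x)))))"
  by (intro bcontI[where B=1] continuous_intros; simp)+

lemma
  assumes a: "Re a < 0" and f: "bcont f"
  shows lsol_deriv: "(lsol a f has_vector_derivative (a * lsol a f x + f x)) (at x)"
    and lsol_bound: "cmod (lsol a f x) \<le> resolv (- Re a) (\<lambda>y. cmod (f y)) x"
    and lsol_bcont: "bcont (lsol a f)"
proof -
  let ?h = "\<lambda>y. exp (- (\<i> * (Im a * y))) * f y"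
  have c: "- Re a > 0" using a by simp
  have h: "bcont ?h" by (intro bcont_mult bcont_cis f)
  have e: "((\<lambda>x. exp (\<i> * (Im a * x))) has_vector_derivative (\<i> * Im a) * exp (\<i> * (Im a * x))) (at x)"
    by (rule has_vector_derivative_exp) (auto intro!: derivative_eq_intros simp: has_vector_derivative_def scaleR_conv_of_real)
  have aeq: "a = Re a + \<i> * Im a" by (simp add: complex_eq_iff)
  show "(lsol a f has_vector_derivative (a * lsol a f x + f x)) (at x)"
    unfolding lsol_def[abs_def]
  proof (rule has_vector_derivative_eq_rhs, rule has_vector_derivative_mult[OF e resolv_deriv[OF c h]])
    define R where "R = resolv (- Re a) ?h x"
    have "exp (\<i> * (Im a * x)) * (?h x - (- Re a) *\<^sub>R R) + (\<i> * Im a) * exp (\<i> * (Im a * x)) * R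
      = (Re a + \<i> * Im a) * (exp (\<i> * (Im a * x)) * R) + (exp (\<i> * (Im a * x)) * exp (- (\<i> * (Im a * x)))) * f x"
      by (simp add: algebra_simps scaleR_conv_of_real)
    also have "\<dots> = a * (exp (\<i> * (Im a * x)) * R) + f x"
      using aeq by (simp add: exp_minus)
    finally show "exp (\<i> * (Im a * x)) * (?h x - (- Re a) *\<^sub>R resolv (- Re a) ?h x) + (\<i> * Im a) * exp (\<i> * (Im a * x)) * resolv (- Re a) ?h x
      = a * (exp (\<i> * (Im a * x)) * resolv (- Re a) ?h x) + f x" unfolding R_def .
  qed
  show "cmod (lsol a f x) \<le> resolv (- Re a) (\<lambda>y. cmod (f y)) x"
    using resolv_norm_le[OF c h, of x] by (simp add: lsol_def norm_mult)
  show "bcont (lsol a f)" unfolding lsol_def[abs_def]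
    by (intro bcont_mult bcont_cis resolv_bcont c h)
qed

lemma lsol_diff:
  assumes a: "Re a < 0" and f: "bcont f" and g: "bcont g"
  shows "lsol a f x - lsol a g x = lsol a (\<lambda>y. f y - g y) x"
proof -
  have c: "- Re a > 0" using a by simp
  let ?e = "\<lambda>y. exp (- (\<i> * complex_of_real (Im a * y)))"
  have "resolv (- Re a) (\<lambda>y. ?e y * (f y - g y)) x = resolv (- Re a) (\<lambda>y. ?e y * f y + - (?e y * g y)) x"
    by (simp add: algebra_simps)
  also have "\<dots> = resolv (- Re a) (\<lambda>y. ?e y * f y) x + resolv (- Re a) (\<lambda>y. - (?e y * g y)) x"
    by (intro resolv_add c bcont_mult bcont_cis f g bcont_minus)
  also have "resolv (- Re a) (\<lambda>y. - (?e y * g y)) x = - resolv (- Re a) (\<lambda>y. ?e y * g y) x"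
    by (rule resolv_linear[OF bounded_linear_minus[OF bounded_linear_ident] c]) (intro bcont_mult bcont_cis g)
  finally have "resolv (- Re a) (\<lambda>y. ?e y * (f y - g y)) x
    = resolv (- Re a) (\<lambda>y. ?e y * f y) x - resolv (- Re a) (\<lambda>y. ?e y * g y) x" by simp
  thus ?thesis by (simp only: lsol_def right_diff_distrib)
qed

lemma lsol_unique:
  assumes a: "Re a < 0" and f: "bcont f" and d: "bcont d"
    and ode: "\<And>x. (d has_vector_derivative (a * d x + f x)) (at x)"
  shows "d x = lsol a f x"
proof -
  have c: "- Re a > 0" using a by simp
  let ?e = "\<lambda>x. exp (- (\<i> * complex_of_real (Im a * x)))"
  have e: "(?e has_vector_derivative (- (\<i> * Im a)) * ?e x) (at x)" for x
    by (rule has_vector_derivative_exp) (auto intro!: derivative_eq_intros simp: has_vector_derivative_def scaleR_conv_of_real)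
  have "?e x * d x = resolv (- Re a) (\<lambda>y. ?e y * f y) x"
  proof (rule resolv_unique[OF c])
    fix x
    have "?e x * (a * d x + f x) + (- (\<i> * Im a)) * ?e x * d x = ?e x * f x + (a - \<i> * Im a) * (?e x * d x)"
      by (simp add: algebra_simps)
    also have "a - \<i> * Im a = Re a" by (simp add: complex_eq_iff)
    finally show "((\<lambda>x. ?e x * d x) has_vector_derivative (?e x * f x - (- Re a) *\<^sub>R (?e x * d x))) (at x)"
      by (intro has_vector_derivative_eq_rhs[OF has_vector_derivative_mult[OF e ode]])
        (simp add: scaleR_conv_of_real)
  qed (intro bcont_mult bcont_cis f d)+
  hence "exp (\<i> * (Im a * x)) * (?e x * d x) = lsol a f x" by (simp add: lsol_def)
  moreover have "exp (\<i> * (Im a * x)) * ?e x = 1" by (simp add: exp_minus)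
  ultimately show ?thesis by (simp flip: mult.assoc)
qed

lemma exp_cumul_deriv:
  fixes \<alpha> :: "real \<Rightarrow> complex"
  assumes "nice \<alpha>"
  shows "((\<lambda>x. exp (- cumul \<alpha> x)) has_vector_derivative (- \<alpha> x) * exp (- cumul \<alpha> x)) (at x)"
    "((\<lambda>x. exp (cumul \<alpha> x)) has_vector_derivative \<alpha> x * exp (cumul \<alpha> x)) (at x)"
  by (intro has_vector_derivative_exp has_vector_derivative_minus cumul_deriv assms)+

text \<open>The integrating factor \<open>exp (- cumul \<alpha>)\<close> removes the perturbation;
  it and its inverse are at most \<open>exp N\<close>, whence \<open>exp (2 N)\<close>. The bound
  sees \<open>\<alpha>\<close> only through its \<open>L^1\<close> norm, so it is uniform along
  sequences of parameters or times.\<close>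

lemma perturbed_bound:
  assumes a: "Re a < 0" and \<alpha>: "nice \<alpha>" and f: "bcont f" and d: "bcont d"
    and ode: "\<And>x. (d has_vector_derivative ((a + \<alpha> x) * d x + f x)) (at x)"
    and N: "(LINT y|lborel. cmod (\<alpha> y)) \<le> N"
  shows "cmod (d x) \<le> exp (2 * N) * resolv (- Re a) (\<lambda>y. cmod (f y)) x"
proof -
  let ?E = "\<lambda>x. exp (- cumul \<alpha> x)"
  have c: "- Re a > 0" using a by simp
  have E: "bcont ?E" by (intro bcont_exp bcont_minus cumul_bcont \<alpha>)
  have eq: "?E x * d x = lsol a (\<lambda>y. ?E y * f y) x" for x
  proof (rule lsol_unique[OF a])
    show "((\<lambda>x. ?E x * d x) has_vector_derivative (a * (?E x * d x) + ?E x * f x)) (at x)" for x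
      by (rule has_vector_derivative_eq_rhs[OF has_vector_derivative_mult[OF exp_cumul_deriv(1)[OF \<alpha>] ode]])
        (simp add: algebra_simps)
  qed (intro bcont_mult E f d)+
  have cm: "cmod (cumul \<alpha> x) \<le> N" for x using cumul_norm_le[OF \<alpha>, of x] N by linarith
  have En: "cmod (exp (- cumul \<alpha> x)) \<le> exp N" "cmod (exp (cumul \<alpha> x)) \<le> exp N" for x
    using norm_exp[of "cumul \<alpha> x"] norm_exp[of "- cumul \<alpha> x"] cm[of x]
    by (simp_all add: order_trans[OF _ exp_le_cancel_iff[THEN iffD2]])
  have "cmod (?E x * d x) \<le> resolv (- Re a) (\<lambda>y. cmod (?E y * f y)) x"
    unfolding eq by (intro lsol_bound a bcont_mult E f)
  also have "\<dots> \<le> resolv (- Re a) (\<lambda>y. exp N * cmod (f y)) x"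
    unfolding norm_mult by (intro resolv_mono c bcont_rules E f mult_right_mono En norm_ge_zero)
  also have "\<dots> = exp N * resolv (- Re a) (\<lambda>y. cmod (f y)) x"
    by (intro resolv_cmult c bcont_norm f)
  finally have *: "cmod (?E x * d x) \<le> exp N * resolv (- Re a) (\<lambda>y. cmod (f y)) x" .
  have "d x = exp (cumul \<alpha> x) * (?E x * d x)" by (simp add: exp_minus)
  hence "cmod (d x) = cmod (exp (cumul \<alpha> x)) * cmod (?E x * d x)" by (metis norm_mult)
  also have "\<dots> \<le> exp N * (exp N * resolv (- Re a) (\<lambda>y. cmod (f y)) x)"
    by (intro mult_mono En *) (auto intro!: mult_nonneg_nonneg resolv_nonneg)
  finally show ?thesis by (simp add: exp_add[symmetric] flip: mult.assoc)
qed

lemma perturbed_exists: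
  assumes a: "Re a < 0" and \<alpha>: "nice \<alpha>" and f: "bcont f"
  obtains d where "bcont d" "\<And>x. (d has_vector_derivative ((a + \<alpha> x) * d x + f x)) (at x)"
proof -
  let ?E = "\<lambda>x. exp (- cumul \<alpha> x)"
  have E: "bcont ?E" by (intro bcont_exp bcont_minus cumul_bcont \<alpha>)
  define d where "d x = exp (cumul \<alpha> x) * lsol a (\<lambda>y. ?E y * f y) x" for x
  have "bcont d" unfolding d_def[abs_def]
    by (intro bcont_mult bcont_exp cumul_bcont \<alpha> lsol_bcont a E f)
  moreover have "(d has_vector_derivative ((a + \<alpha> x) * d x + f x)) (at x)" for x
    unfolding d_def[abs_def]
    by (rule has_vector_derivative_eq_rhs[OF has_vector_derivative_mult[OF exp_cumul_deriv(2)[OF \<alpha>] lsol_deriv[OF a]]])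
      (intro bcont_mult E f, simp add: algebra_simps exp_minus)
  ultimately show ?thesis using that by blast
qed

section \<open>The Riccati equation of the Kaup--Newell system\<close>

text \<open>\<open>r\<close> is the quotient of the second by the first component of the solution of
  the Kaup-Newell system that decays at minus infinity. The bound 1 gives the uniform control used
  when \<open>l\<close> or the time varies.\<close>

definition riccati :: "complex \<Rightarrow> (real \<Rightarrow> complex) \<Rightarrow> (real \<Rightarrow> complex) \<Rightarrow> bool" where
  "riccati l q r \<longleftrightarrow> bcont r \<and> (\<forall>x. cmod (r x) \<le> 1) \<and>
     (\<forall>x. (r has_vector_derivative (2 * \<i> * l\<^sup>2 * r x - l * cnj (q x) - l * q x * (r x)\<^sup>2)) (at x))"

text \<open>The nearest-point projection to the closed unit disc is 1-Lipschitz and fixes the disc.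
  It makes the quadratic term globally Lipschitz, so that a global solution exists before any bound
  on it is known.\<close>

definition clip :: "complex \<Rightarrow> complex" where
  "clip z = closest_point (cball 0 1) z"

lemma clip_simps:
  "cmod z \<le> 1 \<Longrightarrow> clip z = z" "cmod (clip z) \<le> 1" "cmod (clip z - clip w) \<le> cmod (z - w)"
  "continuous_on S f \<Longrightarrow> continuous_on S (\<lambda>x. clip (f x))"
proof -
  show "cmod z \<le> 1 \<Longrightarrow> clip z = z" unfolding clip_def by (rule closest_point_self) simp
  show "cmod (clip z) \<le> 1" unfolding clip_def
    using closest_point_in_set[of "cball 0 1 :: complex set" z] by simp
  show "cmod (clip z - clip w) \<le> cmod (z - w)" unfolding clip_def
    using closest_point_lipschitz[of "cball 0 1 :: complex set" z w] by (simp add: dist_norm)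
  show "continuous_on S f \<Longrightarrow> continuous_on S (\<lambda>x. clip (f x))" unfolding clip_def
    by (rule continuous_on_compose2[OF continuous_on_closest_point[of "cball 0 1" UNIV]]) auto
qed

lemma clip_sq_lipschitz: "cmod ((clip z)\<^sup>2 - (clip w)\<^sup>2) \<le> 2 * cmod (z - w)"
proof -
  have "(clip z)\<^sup>2 - (clip w)\<^sup>2 = (clip z + clip w) * (clip z - clip w)"
    by (simp add: power2_eq_square algebra_simps)
  moreover have "cmod (clip z + clip w) \<le> 2"
    using norm_triangle_ineq[of "clip z" "clip w"] clip_simps(2)[of z] clip_simps(2)[of w] by linarith
  ultimately show ?thesis using clip_simps(3)[of z w] by (simp add: norm_mult mult_mono)
qed

lemma Re_rate: "Re (2 * \<i> * l\<^sup>2) = - (4 * Re l * Im l)"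
  by (simp add: power2_eq_square)

text \<open>Banach's theorem in a sup norm with weight \<open>exp (- b \<phi>)\<close>, where
  \<open>\<phi>\<close> is the cumulative integral of \<open>|q|\<close>. The weight changes at a
  rate proportional to the Lipschitz constant of the source, which gives a contraction for
  \<open>q\<close> of any size.\<close>

lemma clipped_riccati_exists:
  assumes l: "Re l > 0" "Im l > 0" and q: "nice q"
  obtains r where "bcont r"
    "\<And>x. (r has_vector_derivative (2 * \<i> * l\<^sup>2 * r x - l * cnj (q x) - l * q x * (clip (r x))\<^sup>2)) (at x)"
    "\<And>x. r x = lsol (2 * \<i> * l\<^sup>2) (\<lambda>y. - l * cnj (q y) - l * q y * (clip (r y))\<^sup>2) x"
proof -
  define a where "a = 2 * \<i> * l\<^sup>2"
  have a: "Re a < 0" unfolding a_def Re_rate using l by simp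
  hence c: "- Re a > 0" by simp
  define G where "G r y = - l * cnj (q y) - l * q y * (clip (r y))\<^sup>2" for r y
  have G: "bcont (G r)" if "bcont r" for r
  proof -
    have "bcont (\<lambda>y. clip (r y))"
      by (rule bcontI[OF clip_simps(4)[OF bcont_cont[OF that]] clip_simps(2)])
    thus ?thesis unfolding G_def[abs_def] by (intro bcont_rules bcont_nice[OF q])
  qed
  \<comment> \<open>The source has Lipschitz constant \<open>2 |l| |q|\<close>, and the estimate
    \<open>key\<close> divides by \<open>b\<close>; \<open>b = 4 |l|\<close> gives the contraction
    factor 1/2.\<close>
  define b where "b = 4 * cmod l"
  have b: "b > 0" using l by (auto simp: b_def)
  have nq: "nice (\<lambda>y. cmod (q y))" by (rule nice_norm[OF q])
  define \<phi> where "\<phi> = cumul (\<lambda>y. cmod (q y))"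
  have \<phi>b: "bcont \<phi>" unfolding \<phi>_def by (rule cumul_bcont[OF nq])
  define W where "W s x = complex_of_real (exp (s * b * \<phi> x))" for s x
  have W: "bcont (W s)" for s unfolding W_def[abs_def]
    by (intro bcont_of_real bcont_exp bcont_mult bcont_const \<phi>b)
  have bc: "bcont f \<longleftrightarrow> f \<in> bcontfun" for f :: "real \<Rightarrow> complex"
    unfolding bcont_def bcontfun_def bounded_iff by auto
  \<comment> \<open>The fixed point map conjugated by the weight, so that the space of bounded
    continuous functions can be used with its own metric.\<close>
  define T where "T n x = W (-1) x * lsol a (G (\<lambda>y. W 1 y * apply_bcontfun n y)) x" for n :: "real \<Rightarrow>\<^sub>C complex" and x
  have Wn: "bcont (\<lambda>y. W 1 y * apply_bcontfun n y)" for n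
    by (intro bcont_mult W) (simp add: bc apply_bcontfun)
  have T: "bcont (T n)" for n unfolding T_def[abs_def]
    by (intro bcont_mult W lsol_bcont a G Wn)
  have key: "resolv (- Re a) (\<lambda>y. cmod (q y) * exp (b * \<phi> y)) x \<le> exp (b * \<phi> x) / b" for x
  proof -
    \<comment> \<open>\<open>P' = |q| exp (b \<phi>)\<close>, so \<open>P\<close> is the resolvent
      of that function plus the nonnegative \<open>- Re a * P\<close>; dropping the latter gives the
      claim.\<close>
    define P where "P y = exp (b * \<phi> y) / b" for y
    have P: "bcont P" unfolding P_def[abs_def] divide_inverse by (intro bcont_mult bcont_exp bcont_const \<phi>b)
    have g: "bcont (\<lambda>y. cmod (q y) * exp (b * \<phi> y))"
      by (intro bcont_mult bcont_exp bcont_const \<phi>b bcont_nice[OF nq])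
    have "(\<phi> has_real_derivative cmod (q y)) (at y)" for y
      unfolding \<phi>_def has_real_derivative_iff_has_vector_derivative by (rule cumul_deriv[OF nq])
    hence "(P has_real_derivative (cmod (q y) * exp (b * \<phi> y))) (at y)" for y
      unfolding P_def[abs_def] using b by (auto intro!: derivative_eq_intros)
    hence "P x = resolv (- Re a) (\<lambda>y. cmod (q y) * exp (b * \<phi> y) + (- Re a) * P y) x"
      by (intro resolv_unique c P bcont_add g bcont_mult bcont_const)
        (simp add: has_real_derivative_iff_has_vector_derivative)
    also have "\<dots> \<ge> resolv (- Re a) (\<lambda>y. cmod (q y) * exp (b * \<phi> y)) x"
      using a b by (intro resolv_mono c g bcont_add bcont_mult bcont_const P) (simp add: P_def divide_nonpos_pos mult_nonpos_nonneg)
    finally show ?thesis by (simp add: P_def)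
  qed
  have "\<exists>!n. Bcontfun (T n) = n"
  proof (rule banach_fix_type[where c="1/2"], simp, simp, intro allI dist_bound)
    fix n m :: "real \<Rightarrow>\<^sub>C complex" and x
    let ?n = "\<lambda>y. W 1 y * apply_bcontfun n y" and ?m = "\<lambda>y. W 1 y * apply_bcontfun m y"
    have "dist (apply_bcontfun (Bcontfun (T n)) x) (apply_bcontfun (Bcontfun (T m)) x) = cmod (T n x - T m x)"
      using T by (simp add: Bcontfun_inverse bc dist_norm)
    also have "T n x - T m x = W (-1) x * lsol a (\<lambda>y. G ?n y - G ?m y) x"
      unfolding T_def by (simp only: lsol_diff[OF a G[OF Wn] G[OF Wn], symmetric] right_diff_distrib)
    also have "cmod \<dots> \<le> exp (- (b * \<phi> x)) * resolv (- Re a) (\<lambda>y. cmod (G ?n y - G ?m y)) x"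
      unfolding norm_mult by (intro mult_mono lsol_bound a bcont_diff G Wn) (auto simp: W_def)
    also have "resolv (- Re a) (\<lambda>y. cmod (G ?n y - G ?m y)) x
       \<le> resolv (- Re a) (\<lambda>y. (2 * cmod l * dist n m) * (cmod (q y) * exp (b * \<phi> y))) x"
    proof (intro resolv_mono c bcont_norm bcont_diff G Wn bcont_mult bcont_const bcont_exp \<phi>b bcont_nice[OF q])
      fix y
      have "G ?n y - G ?m y = - l * q y * ((clip (?n y))\<^sup>2 - (clip (?m y))\<^sup>2)"
        by (simp add: G_def algebra_simps)
      hence A: "cmod (G ?n y - G ?m y) \<le> cmod l * cmod (q y) * (2 * cmod (?n y - ?m y))"
        by (simp add: norm_mult mult_left_mono[OF clip_sq_lipschitz])
      have "cmod (?n y - ?m y) = exp (b * \<phi> y) * dist (apply_bcontfun n y) (apply_bcontfun m y)"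
        by (simp add: W_def dist_norm norm_mult flip: right_diff_distrib)
      also have "\<dots> \<le> exp (b * \<phi> y) * dist n m" by (intro mult_left_mono dist_bounded) auto
      finally have "cmod l * cmod (q y) * (2 * cmod (?n y - ?m y)) \<le> cmod l * cmod (q y) * (2 * (exp (b * \<phi> y) * dist n m))"
        by (intro mult_left_mono) auto
      with A show "cmod (G ?n y - G ?m y) \<le> (2 * cmod l * dist n m) * (cmod (q y) * exp (b * \<phi> y))"
        by (simp only: mult_ac)
    qed
    also have "\<dots> = (2 * cmod l * dist n m) * resolv (- Re a) (\<lambda>y. cmod (q y) * exp (b * \<phi> y)) x"
      by (intro resolv_cmult c bcont_mult bcont_exp bcont_const \<phi>b bcont_nice[OF nq])
    also have "\<dots> \<le> (2 * cmod l * dist n m) * (exp (b * \<phi> x) / b)"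
      by (intro mult_left_mono key) auto
    also have "exp (- (b * \<phi> x)) * \<dots> = 1 / 2 * dist n m"
      using b l unfolding b_def by (simp add: exp_minus field_simps)
    finally show "dist (apply_bcontfun (Bcontfun (T n)) x) (apply_bcontfun (Bcontfun (T m)) x) \<le> 1 / 2 * dist n m"
      by simp
  qed
  then obtain n where n: "Bcontfun (T n) = n" by blast
  define r where "r y = W 1 y * apply_bcontfun n y" for y
  have r: "bcont r" unfolding r_def[abs_def] by (rule Wn)
  have req: "r x = lsol a (G r) x" for x
  proof -
    have "apply_bcontfun n x = T n x" using n T by (metis Bcontfun_inverse bc)
    hence "r x = W 1 x * W (-1) x * lsol a (G r) x" by (simp add: r_def[abs_def] T_def)
    also have "W 1 x * W (-1) x = 1" by (simp add: W_def exp_minus field_simps flip: of_real_mult)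
    finally show ?thesis by simp
  qed
  have "(r has_vector_derivative (a * r x + G r x)) (at x)" for x
  proof -
    have "lsol a (G r) = r" by (intro ext req[symmetric])
    thus ?thesis using lsol_deriv[OF a G[OF r], of x] by (simp only:)
  qed
  hence d: "(r has_vector_derivative (2 * \<i> * l\<^sup>2 * r x - l * cnj (q x) - l * q x * (clip (r x))\<^sup>2)) (at x)" for x
    by (simp add: a_def G_def algebra_simps)
  have eq: "r x = lsol (2 * \<i> * l\<^sup>2) (\<lambda>y. - l * cnj (q y) - l * q y * (clip (r y))\<^sup>2) x" for x
    using req[of x] unfolding a_def G_def .
  show ?thesis by (rule that[OF r d eq])
qed

lemma resolv_cong_le:
  assumes "\<And>y. y \<le> x \<Longrightarrow> f y = g y"
  shows "resolv c f x = resolv c g x"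
  unfolding resolv_def
  by (intro Bochner_Integration.integral_cong refl) (use assms in \<open>auto simp: expker_def indicator_def\<close>)

lemma lsol_cong_le:
  assumes "\<And>y. y \<le> x \<Longrightarrow> f y = g y"
  shows "lsol a f x = lsol a g x"
proof -
  have "resolv (- Re a) (\<lambda>y. exp (- (\<i> * (Im a * y))) * f y) x = resolv (- Re a) (\<lambda>y. exp (- (\<i> * (Im a * y))) * g y) x"
    by (rule resolv_cong_le) (simp only: assms)
  thus ?thesis by (simp only: lsol_def)
qed

lemma riccatiD:
  assumes "riccati l q r"
  shows "bcont r" "cmod (r x) \<le> 1"
    "(r has_vector_derivative (2 * \<i> * l\<^sup>2 * r x - l * cnj (q x) - l * q x * (r x)\<^sup>2)) (at x)"
  using assms by (auto simp: riccati_def)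

lemma riccati_lsol:
  assumes l: "Re l > 0" "Im l > 0" and q: "nice q" and r: "riccati l q r"
  shows "r x = lsol (2 * \<i> * l\<^sup>2) (\<lambda>y. - l * cnj (q y) - l * q y * (r y)\<^sup>2) x"
proof (rule lsol_unique)
  show "Re (2 * \<i> * l\<^sup>2) < 0" unfolding Re_rate using l by simp
  show "bcont (\<lambda>y. - l * cnj (q y) - l * q y * (r y)\<^sup>2)"
    by (intro bcont_rules bcont_nice[OF q] riccatiD(1)[OF r])
  show "(r has_vector_derivative 2 * \<i> * l\<^sup>2 * r x + (- l * cnj (q x) - l * q x * (r x)\<^sup>2)) (at x)" for x
    using riccatiD(3)[OF r, of x] by (simp add: algebra_simps)
qed (rule riccatiD(1)[OF r])

lemma lsol_nice:
  assumes a: "Re a < 0" and f: "nice f" shows "nice (lsol a f)"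
proof -
  have c: "- Re a > 0" using a by simp
  show ?thesis
    by (rule nice_dominated[OF resolv_nice[OF c nice_norm[OF f]] bcont_cont[OF lsol_bcont[OF a bcont_nice[OF f]]], of 1])
      (use lsol_bound[OF a bcont_nice[OF f]] resolv_nonneg[of "\<lambda>y. cmod (f y)"] in auto)
qed

lemma riccati_source_nice:
  assumes q: "nice q" and r: "bcont r" shows "nice (\<lambda>y. - l * cnj (q y) - l * q y * (r y)\<^sup>2)"
proof -
  have "nice (\<lambda>y. - l * cnj (q y) + (- l) * (q y * (r y)\<^sup>2))"
    by (intro nice_add nice_mult_right bcont_const nice_cnj q nice_mult_left bcont_power r)
  thus ?thesis by (simp add: mult.assoc)
qed

lemma riccati_nice:
  assumes l: "Re l > 0" "Im l > 0" and q: "nice q" and r: "riccati l q r"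
  shows "nice r"
proof -
  have a: "Re (2 * \<i> * l\<^sup>2) < 0" unfolding Re_rate using l by simp
  have "nice (lsol (2 * \<i> * l\<^sup>2) (\<lambda>y. - l * cnj (q y) - l * q y * (r y)\<^sup>2))"
    by (intro lsol_nice a riccati_source_nice q riccatiD(1)[OF r])
  moreover have "lsol (2 * \<i> * l\<^sup>2) (\<lambda>y. - l * cnj (q y) - l * q y * (r y)\<^sup>2) = r"
    by (intro ext riccati_lsol[OF l q r, symmetric])
  ultimately show ?thesis by (simp only:)
qed

text \<open>The quadratic terms differ by \<open>l q (r + s) (r - s)\<close>, so the difference of
  two solutions is a bounded solution of a homogeneous linear equation with an integrable
  perturbation of the rate.\<close>

lemma riccati_unique:
  assumes l: "Re l > 0" "Im l > 0" and q: "nice q" and r: "riccati l q r" and s: "riccati l q s"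
  shows "r = s"
proof
  fix x
  have a: "Re (2 * \<i> * l\<^sup>2) < 0" unfolding Re_rate using l by simp
  have rs: "bcont r" "bcont s" using riccatiD(1) r s by auto
  have "cmod (r x - s x) \<le> exp (2 * (LINT y|lborel. cmod (- l * (q y * (r y + s y))))) * resolv (- Re (2 * \<i> * l\<^sup>2)) (\<lambda>y. cmod 0) x"
  proof (rule perturbed_bound[OF a])
    show "nice (\<lambda>y. - l * (q y * (r y + s y)))"
      by (intro nice_mult_right bcont_const nice_mult_left q bcont_add rs)
    show "((\<lambda>x. r x - s x) has_vector_derivative ((2 * \<i> * l\<^sup>2 + - l * (q x * (r x + s x))) * (r x - s x) + 0)) (at x)" for x
      by (rule has_vector_derivative_eq_rhs[OF has_vector_derivative_diff[OF riccatiD(3)[OF r] riccatiD(3)[OF s]]])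
        (simp add: algebra_simps power2_eq_square)
  qed (intro bcont_const bcont_diff rs order_refl)+
  thus "r x = s x" by (simp add: resolv_def)
qed

text \<open>At the infimum of the set where \<open>f \<ge> b\<close>, the bound
  \<open>f \<le> b\<close> holds on the whole half-line to the left, and \<open>step\<close> makes
  it strict there. The bound near minus infinity plays the part of an initial condition.\<close>

lemma continuity_principle:
  fixes f :: "real \<Rightarrow> real"
  assumes f: "continuous_on UNIV f" and x0: "\<And>x. x \<le> x0 \<Longrightarrow> f x < b"
    and step: "\<And>x. (\<And>y. y \<le> x \<Longrightarrow> f y \<le> b) \<Longrightarrow> f x < b"
  shows "f x < b"
proof (rule ccontr)
  assume "\<not> f x < b"
  define S where "S = {x. b \<le> f x}"
  have ne: "S \<noteq> {}" using \<open>\<not> f x < b\<close> by (auto simp: S_def not_less)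
  have cl: "closed S" unfolding S_def by (rule closed_Collect_le[OF continuous_on_const f])
  have bdd: "bdd_below S" using x0 by (intro bdd_belowI[where m=x0]) (force simp: S_def not_less[symmetric])
  have m: "Inf S \<in> S" by (rule closed_contains_Inf[OF ne bdd cl])
  have lt: "f y < b" if "y < Inf S" for y
    using cInf_lower[OF _ bdd, of y] that by (force simp: S_def not_less[symmetric])
  have "(f \<longlongrightarrow> f (Inf S)) (at_left (Inf S))"
    using f by (meson UNIV_I continuous_on_eq_continuous_at isCont_def open_UNIV tendsto_mono at_le subset_UNIV)
  hence "f (Inf S) \<le> b"
    by (rule tendsto_upperbound) (auto simp: eventually_at_left_field intro!: exI[of _ "Inf S - 1"] less_imp_le lt)
  hence "f (Inf S) < b" using lt by (intro step) (metis less_eq_real_def)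
  thus False using m by (simp add: S_def)
qed

text \<open>The clipped equation agrees with the true one as long as \<open>|r| \<le> b\<close>
  holds from minus infinity up to \<open>x\<close>. So \<open>step\<close> may use the true equation
  to the left of \<open>x\<close> and the integral formula at \<open>x\<close>, and has to make the
  bound strict. The derivative \<open>r'\<close> is passed on along the whole line so that
  \<open>resolv_unique\<close> remains applicable.\<close>

lemma riccati_exists:
  assumes l: "Re l > 0" "Im l > 0" and q: "nice q" and b: "0 < b" "b \<le> 1"
    and step: "\<And>r r' x. nice r \<Longrightarrow> (\<And>y. y \<le> x \<Longrightarrow> cmod (r y) \<le> b) \<Longrightarrow>
      bcont r' \<Longrightarrow> (\<And>y. (r has_vector_derivative r' y) (at y)) \<Longrightarrow>
      (\<And>y. y \<le> x \<Longrightarrow> r' y = 2 * \<i> * l\<^sup>2 * r y - l * cnj (q y) - l * q y * (r y)\<^sup>2) \<Longrightarrow>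
      r x = lsol (2 * \<i> * l\<^sup>2) (\<lambda>y. - l * cnj (q y) - l * q y * (r y)\<^sup>2) x \<Longrightarrow> cmod (r x) < b"
  obtains r where "riccati l q r" "\<And>x. cmod (r x) < b"
proof -
  have a: "Re (2 * \<i> * l\<^sup>2) < 0" unfolding Re_rate using l by simp
  from clipped_riccati_exists[OF l q] obtain r where r: "bcont r"
    "\<And>x. (r has_vector_derivative (2 * \<i> * l\<^sup>2 * r x - l * cnj (q x) - l * q x * (clip (r x))\<^sup>2)) (at x)"
    "\<And>x. r x = lsol (2 * \<i> * l\<^sup>2) (\<lambda>y. - l * cnj (q y) - l * q y * (clip (r y))\<^sup>2) x" by blast
  have cr: "bcont (\<lambda>y. clip (r y))"
    by (rule bcontI[OF clip_simps(4)[OF bcont_cont[OF r(1)]] clip_simps(2)])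
  have nr: "nice r"
  proof -
    have "nice (lsol (2 * \<i> * l\<^sup>2) (\<lambda>y. - l * cnj (q y) - l * q y * (clip (r y))\<^sup>2))"
      by (intro lsol_nice a riccati_source_nice q cr)
    moreover have "lsol (2 * \<i> * l\<^sup>2) (\<lambda>y. - l * cnj (q y) - l * q y * (clip (r y))\<^sup>2) = r"
      by (intro ext r(3)[symmetric])
    ultimately show ?thesis by (simp only:)
  qed
  have cd: "bcont (\<lambda>x. 2 * \<i> * l\<^sup>2 * r x - l * cnj (q x) - l * q x * (clip (r x))\<^sup>2)"
    by (intro bcont_rules r(1) bcont_nice[OF q] cr)
  have "eventually (\<lambda>x. cmod (r x) < b) at_bot"
    using nice_tendsto(2)[OF nr] b(1) by (auto simp: tendsto_iff dist_norm)
  then obtain x0 where x0: "\<And>x. x \<le> x0 \<Longrightarrow> cmod (r x) < b" by (auto simp: eventually_at_bot_linorder)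
  have lt: "cmod (r x) < b" for x
  proof (rule continuity_principle[where f="\<lambda>x. cmod (r x)", OF _ x0])
    show "continuous_on UNIV (\<lambda>x. cmod (r x))" by (intro continuous_intros bcont_cont r(1))
    fix x assume le: "\<And>y. y \<le> x \<Longrightarrow> cmod (r y) \<le> b"
    have c: "clip (r y) = r y" if "y \<le> x" for y using le[OF that] b clip_simps(1) by force
    show "cmod (r x) < b"
    proof (rule step[OF nr le cd r(2)])
      show "2 * \<i> * l\<^sup>2 * r y - l * cnj (q y) - l * q y * (clip (r y))\<^sup>2
        = 2 * \<i> * l\<^sup>2 * r y - l * cnj (q y) - l * q y * (r y)\<^sup>2" if "y \<le> x" for y
        by (simp only: c[OF that])
      have "r x = lsol (2 * \<i> * l\<^sup>2) (\<lambda>y. - l * cnj (q y) - l * q y * (clip (r y))\<^sup>2) x" by (rule r(3))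
      also have "\<dots> = lsol (2 * \<i> * l\<^sup>2) (\<lambda>y. - l * cnj (q y) - l * q y * (r y)\<^sup>2) x"
        by (rule lsol_cong_le) (simp add: c)
      finally show "r x = lsol (2 * \<i> * l\<^sup>2) (\<lambda>y. - l * cnj (q y) - l * q y * (r y)\<^sup>2) x" .
    qed
  qed
  have "clip (r x) = r x" for x using lt[of x] b clip_simps(1)[of "r x"] by linarith
  hence "riccati l q r" unfolding riccati_def using r(1,2) lt b(2) by (metis less_imp_le order_trans)
  with lt show ?thesis using that by blast
qed

text \<open>On the imaginary axis the Kaup--Newell system has \<open>su(1,1)\<close> symmetry, which keeps \<open>r\<close> in the
  open unit disc whatever the size of \<open>q\<close>; this survives close to the axis.\<close>

lemma riccati_near_axis:
  assumes l: "Re l > 0" "Im l > 0" and q: "nice q"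
    and N: "(LINT x|lborel. cmod (q x)) \<le> N" and small: "4 * Re l * exp (2 * Im l * N) * N < 1"
  obtains r where "riccati l q r"
proof -
  define m s where "m = Re l" and "s = Im l"
  have m: "m > 0" and s: "s > 0" using l by (auto simp: m_def s_def)
  have nq: "nice (\<lambda>y. cmod (q y))" by (rule nice_norm[OF q])
  define \<phi> where "\<phi> = cumul (\<lambda>y. cmod (q y))"
  have \<phi>d: "(\<phi> has_real_derivative cmod (q y)) (at y)" for y
    unfolding \<phi>_def has_real_derivative_iff_has_vector_derivative by (rule cumul_deriv[OF nq])
  have \<phi>0: "\<phi> y \<ge> 0" for y unfolding \<phi>_def cumul_def set_lebesgue_integral_def
    by (intro integral_nonneg_AE) auto
  have \<phi>N: "\<phi> y \<le> N" for y
    using cumul_norm_le[OF nq, of y] N \<phi>0[of y] unfolding \<phi>_def by simp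
  have N0: "N \<ge> 0" using \<phi>0[of 0] \<phi>N[of 0] by linarith
  define K where "K = 4 * m * exp (2 * s * N)"
  have K: "K \<ge> 0" "K * N < 1" using m small by (auto simp: K_def m_def s_def)
  show ?thesis
  proof (rule riccati_exists[OF l q, of 1])
    fix r r' :: "real \<Rightarrow> complex" and x
    assume nr: "nice r" and le: "\<And>y. y \<le> x \<Longrightarrow> cmod (r y) \<le> 1"
      and d': "\<And>y. (r has_vector_derivative r' y) (at y)"
      and r': "\<And>y. y \<le> x \<Longrightarrow> r' y = 2 * \<i> * l\<^sup>2 * r y - l * cnj (q y) - l * q y * (r y)\<^sup>2"
    have d: "(r has_vector_derivative (2 * \<i> * l\<^sup>2 * r y - l * cnj (q y) - l * q y * (r y)\<^sup>2)) (at y)" if "y \<le> x" for y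
      using d'[of y] r'[OF that] by simp
    define Y where "Y y = 1 - (cmod (r y))\<^sup>2" for y
    \<comment> \<open>\<open>Y' \<ge> - 4 m |q| - 2 s |q| Y\<close>. The exponential absorbs the
      second term and \<open>K * \<phi>\<close> the first, so \<open>Z\<close> does not decrease
      from its limit 1 at minus infinity. Since \<open>K * \<phi> \<le> K * N < 1\<close>, the value
      of \<open>Y\<close> cannot reach 0.\<close>
    define Z where "Z y = Y y * exp (2 * s * \<phi> y) + K * \<phi> y" for y
    \<comment> \<open>On the axis \<open>m = 0\<close> and only the last term is left, which
      vanishes where \<open>|r| = 1\<close>. For \<open>m > 0\<close> the first term has the
      favourable sign and the second is small with \<open>m\<close>.\<close>
    have Yd: "(Y has_real_derivative (8 * m * s * (cmod (r y))\<^sup>2 + 2 * m * Re (q y * r y) * (1 + (cmod (r y))\<^sup>2)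
        + 2 * s * Im (q y * r y) * Y y)) (at y)" if "y \<le> x" for y
    proof -
      have "(Y has_real_derivative (0 - 2 * Re (cnj (r y) * (2 * \<i> * l\<^sup>2 * r y - l * cnj (q y) - l * q y * (r y)\<^sup>2)))) (at y)"
        unfolding Y_def[abs_def] has_real_derivative_iff_has_vector_derivative
        by (intro has_vector_derivative_diff has_vector_derivative_const has_vector_derivative_norm_sq d that)
      moreover have "0 - 2 * Re (cnj (r y) * (2 * \<i> * l\<^sup>2 * r y - l * cnj (q y) - l * q y * (r y)\<^sup>2)) =
        8 * m * s * (cmod (r y))\<^sup>2 + 2 * m * Re (q y * r y) * (1 + (cmod (r y))\<^sup>2) + 2 * s * Im (q y * r y) * Y y"
        unfolding Y_def cmod_power2 m_def s_def by (simp add: power2_eq_square) algebra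
      ultimately show ?thesis by simp
    qed
    have mono: "Z y \<le> Z x" if "y \<le> x" for y
    proof (rule DERIV_nonneg_imp_nondecreasing[OF that])
      fix z assume z: "y \<le> z" "z \<le> x"
      define Y' where "Y' = 8 * m * s * (cmod (r z))\<^sup>2 + 2 * m * Re (q z * r z) * (1 + (cmod (r z))\<^sup>2)
        + 2 * s * Im (q z * r z) * Y z"
      have r1: "cmod (r z) \<le> 1" by (rule le[OF z(2)])
      hence r2: "(cmod (r z))\<^sup>2 \<le> 1" by (simp add: power_le_one)
      have Y0: "Y z \<ge> 0" using r2 by (simp add: Y_def)
      have qr: "cmod (q z * r z) \<le> cmod (q z)" using r1 by (simp add: norm_mult mult_left_le)
      have "2 * m * Re (q z * r z) * (1 + (cmod (r z))\<^sup>2) \<ge> - (2 * m * cmod (q z) * 2)"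
      proof -
        have "\<bar>Re (q z * r z)\<bar> * (1 + (cmod (r z))\<^sup>2) \<le> cmod (q z) * 2"
          using order_trans[OF abs_Re_le_cmod qr] r2 by (intro mult_mono) auto
        hence "\<bar>2 * m * Re (q z * r z) * (1 + (cmod (r z))\<^sup>2)\<bar> \<le> 2 * m * (cmod (q z) * 2)"
          using m mult_left_mono[of "\<bar>Re (q z * r z)\<bar> * (1 + (cmod (r z))\<^sup>2)" "cmod (q z) * 2" "2 * m"]
          by (simp add: abs_mult mult.assoc del: times_complex.sel)
        thus ?thesis by (simp add: mult.assoc del: times_complex.sel)
      qed
      moreover have "2 * s * Im (q z * r z) * Y z \<ge> - (2 * s * cmod (q z) * Y z)"
      proof -
        have "\<bar>Im (q z * r z)\<bar> \<le> cmod (q z)" using order_trans[OF abs_Im_le_cmod qr] .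
        hence "- cmod (q z) \<le> Im (q z * r z)" by linarith
        hence "- cmod (q z) * (2 * s * Y z) \<le> Im (q z * r z) * (2 * s * Y z)"
          by (rule mult_right_mono) (use s Y0 in simp)
        thus ?thesis by (simp add: mult_ac)
      qed
      moreover have "8 * m * s * (cmod (r z))\<^sup>2 \<ge> 0" using m s by simp
      ultimately have Y': "Y' \<ge> - (4 * m * cmod (q z)) - 2 * s * cmod (q z) * Y z"
        unfolding Y'_def by linarith
      have "(Z has_real_derivative (Y' * exp (2 * s * \<phi> z) + Y z * (2 * s * cmod (q z) * exp (2 * s * \<phi> z)) + K * cmod (q z))) (at z)"
        unfolding Z_def[abs_def] Y'_def
        by (auto intro!: derivative_eq_intros Yd[OF z(2)] \<phi>d)
      moreover have "Y' * exp (2 * s * \<phi> z) + Y z * (2 * s * cmod (q z) * exp (2 * s * \<phi> z)) + K * cmod (q z) \<ge> 0"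
      proof -
        have e: "exp (2 * s * \<phi> z) \<le> exp (2 * s * N)" using s \<phi>N[of z] by simp
        have "(Y' + 2 * s * cmod (q z) * Y z) * exp (2 * s * \<phi> z) \<ge> - (4 * m * cmod (q z)) * exp (2 * s * \<phi> z)"
          using Y' by (intro mult_right_mono) auto
        moreover have "4 * m * cmod (q z) * exp (2 * s * \<phi> z) \<le> 4 * m * cmod (q z) * exp (2 * s * N)"
          using m e by (intro mult_left_mono) auto
        ultimately show ?thesis by (simp add: K_def algebra_simps)
      qed
      ultimately show "\<exists>y. (Z has_real_derivative y) (at z) \<and> 0 \<le> y" by blast
    qed
    have "Y x > 0"
    proof (rule ccontr)
      assume "\<not> Y x > 0"
      hence "Z x \<le> K * N"
      proof -
        have "Y x * exp (2 * s * \<phi> x) \<le> 0" using \<open>\<not> Y x > 0\<close> by (intro mult_nonpos_nonneg) auto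
        moreover have "K * \<phi> x \<le> K * N" using K \<phi>N by (intro mult_left_mono)
        ultimately show ?thesis by (simp add: Z_def)
      qed
      have "((\<lambda>y. Y y) \<longlongrightarrow> 1 - (cmod 0)\<^sup>2) at_bot"
        unfolding Y_def by (intro tendsto_intros nice_tendsto(2)[OF nr])
      hence "eventually (\<lambda>y. Y y > K * N) at_bot" using K(2) by (simp add: order_tendsto_iff)
      hence "eventually (\<lambda>y. Y y > K * N \<and> y \<le> x) at_bot" using eventually_le_at_bot[of x] by eventually_elim simp
      then obtain y where y: "Y y > K * N" "y \<le> x" using eventually_happens trivial_limit_at_bot_linorder by blast
      have "Y y * 1 \<le> Y y * exp (2 * s * \<phi> y)"
        using y K N0 s \<phi>0[of y] by (intro mult_left_mono) (auto intro: order_trans[OF mult_nonneg_nonneg less_imp_le])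
      moreover have "K * \<phi> y \<ge> 0" using K \<phi>0 by simp
      ultimately have "Y y \<le> Z y" by (simp add: Z_def)
      thus False using mono[OF y(2)] y(1) \<open>Z x \<le> K * N\<close> by linarith
    qed
    thus "cmod (r x) < 1" by (simp add: Y_def power_less_one_iff abs_square_less_1)
  qed (use that in auto)
qed

text \<open>The square root of \<open>\<i> * k\<close> in the open first quadrant. Then
  \<open>2 * \<i> * l\<^sup>2 = - 2 * k\<close> is real, and \<open>resolv (2 * k)\<close> inverts
  the linear part of the Riccati equation.\<close>

definition lam :: "real \<Rightarrow> complex" where
  "lam k = Complex (sqrt (k / 2)) (sqrt (k / 2))"

lemma lam_simps:
  assumes "k > 0"
  shows "Re (lam k) > 0" "Im (lam k) > 0" "(lam k)\<^sup>2 = \<i> * k" "cmod (lam k) = sqrt k" "Im (lam k) > sqrt k / 2"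
proof -
  show "Re (lam k) > 0" "Im (lam k) > 0" using assms by (auto simp: lam_def)
  show "(lam k)\<^sup>2 = \<i> * k" using assms by (simp add: lam_def complex_eq_iff power2_eq_square)
  show "cmod (lam k) = sqrt k" using assms by (simp add: lam_def cmod_def)
  have "sqrt (k / 4) < sqrt (k / 2)" using assms by simp
  thus "Im (lam k) > sqrt k / 2" by (simp add: lam_def real_sqrt_divide)
qed

lemma lsol_real: "lsol (complex_of_real (- c)) f x = resolv c f x"
  by (simp add: lsol_def)

text \<open>Bootstrap with the bound \<open>2 e\<close>: in
  \<open>r = - lam k (cnj (R q) + R (q r^2))\<close> the first term is at most \<open>e\<close> by
  hypothesis, the second at most \<open>sqrt k * 4 e^2 * sqrt (sqint q) / (2 sqrt k) = e * (2 e sqrt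
  (sqint q)) < e\<close>.\<close>

lemma riccati_small:
  assumes k: "k > 0" and q: "nice q" and e: "e > 0" "2 * e \<le> 1" "2 * e * sqrt (sqint q) < 1"
    and w: "\<And>x. sqrt k * cmod (resolv (2 * k) q x) \<le> e"
  obtains r where "riccati (lam k) q r" "\<And>x. cmod (r x) < 2 * e"
proof (rule riccati_exists[OF lam_simps(1,2)[OF k] q, of "2 * e"])
  have c: "2 * k > 0" using k by simp
  fix r :: "real \<Rightarrow> complex" and x
  assume nr: "nice r" and le: "\<And>y. y \<le> x \<Longrightarrow> cmod (r y) \<le> 2 * e"
    and eq: "r x = lsol (2 * \<i> * (lam k)\<^sup>2) (\<lambda>y. - lam k * cnj (q y) - lam k * q y * (r y)\<^sup>2) x"
  note bq = bcont_nice[OF q]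
  have b2: "bcont (\<lambda>y. q y * (r y)\<^sup>2)" by (intro bcont_rules bq bcont_nice[OF nr])
  have "2 * \<i> * (lam k)\<^sup>2 = complex_of_real (- (2 * k))"
    by (simp add: lam_simps[OF k] complex_eq_iff)
  hence "r x = resolv (2 * k) (\<lambda>y. (- lam k) * (cnj (q y) + q y * (r y)\<^sup>2)) x"
    unfolding eq by (simp only: lsol_real) (simp add: algebra_simps)
  also have "\<dots> = (- lam k) * resolv (2 * k) (\<lambda>y. cnj (q y) + q y * (r y)\<^sup>2) x"
    by (intro resolv_cmult c bcont_add b2 bcont_cnj bq)
  also have "resolv (2 * k) (\<lambda>y. cnj (q y) + q y * (r y)\<^sup>2) x = cnj (resolv (2 * k) q x) + resolv (2 * k) (\<lambda>y. q y * (r y)\<^sup>2) x"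
    using resolv_add[OF c bcont_cnj[OF bq] b2, of x] resolv_linear[OF bounded_linear_cnj c bq, of x] by simp
  finally have "cmod (r x) = sqrt k * cmod (cnj (resolv (2 * k) q x) + resolv (2 * k) (\<lambda>y. q y * (r y)\<^sup>2) x)"
    by (simp add: norm_mult lam_simps[OF k])
  also have "\<dots> \<le> sqrt k * (cmod (resolv (2 * k) q x) + cmod (resolv (2 * k) (\<lambda>y. q y * (r y)\<^sup>2) x))"
    using k norm_triangle_ineq[of "cnj (resolv (2 * k) q x)" "resolv (2 * k) (\<lambda>y. q y * (r y)\<^sup>2) x"]
    by (intro mult_left_mono) auto
  also have "cmod (resolv (2 * k) (\<lambda>y. q y * (r y)\<^sup>2) x) \<le> (4 * e\<^sup>2) * (sqrt (sqint q) / (2 * sqrt k))"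
  proof -
    have "cmod (resolv (2 * k) (\<lambda>y. q y * (r y)\<^sup>2) x) \<le> resolv (2 * k) (\<lambda>y. cmod (q y * (r y)\<^sup>2)) x"
      by (rule resolv_norm_le[OF c b2])
    also have "\<dots> \<le> resolv (2 * k) (\<lambda>y. 4 * e\<^sup>2 * cmod (q y)) x"
    proof (intro resolv_mono c bcont_norm b2 bcont_mult bcont_const bq)
      fix y assume "y \<le> x"
      from power_mono[OF le[OF this], of 2] have "(cmod (r y))\<^sup>2 \<le> 4 * e\<^sup>2" by (simp add: power_mult_distrib)
      thus "cmod (q y * (r y)\<^sup>2) \<le> 4 * e\<^sup>2 * cmod (q y)"
        by (simp add: norm_mult norm_power mult.commute[of "4 * e\<^sup>2"] mult_left_mono)
    qed
    also have "\<dots> = 4 * e\<^sup>2 * resolv (2 * k) (\<lambda>y. cmod (q y)) x" by (intro resolv_cmult c bcont_norm bq)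
    also have "resolv (2 * k) (\<lambda>y. cmod (q y)) x \<le> sqrt (sqint q / (2 * (2 * k)))"
      using resolv_sup[OF c nice_norm[OF q], of x] by (simp add: sqint_def)
    also have "\<dots> = sqrt (sqint q) / (2 * sqrt k)" by (simp add: real_sqrt_divide real_sqrt_mult)
    finally show ?thesis by (simp add: mult_left_mono)
  qed
  finally have "cmod (r x) \<le> sqrt k * (cmod (resolv (2 * k) q x) + (4 * e\<^sup>2) * (sqrt (sqint q) / (2 * sqrt k)))"
    using k by (simp add: mult_left_mono)
  also have "\<dots> = sqrt k * cmod (resolv (2 * k) q x) + e * (2 * e * sqrt (sqint q))"
    using k by (simp add: field_simps power2_eq_square)
  also have "\<dots> < e + e * 1" using w[of x] e by (intro add_le_less_mono mult_strict_left_mono) auto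
  finally show "cmod (r x) < 2 * e" by simp
qed (use e in auto)

text \<open>For nonnegative \<open>f\<close> the function \<open>exp (c y) * resolv c f y\<close>
  has the derivative \<open>exp (c y) * f y \<ge> 0\<close>.\<close>

lemma resolv_decay:
  fixes f :: "real \<Rightarrow> real"
  assumes c: "c > 0" and f: "bcont f" and pos: "\<And>y. f y \<ge> 0" and s: "s \<ge> 0"
  shows "exp (- (c * s)) * resolv c f (x - s) \<le> resolv c f x"
proof -
  have "exp (c * (x - s)) * resolv c f (x - s) \<le> exp (c * x) * resolv c f x"
  proof (rule DERIV_nonneg_imp_nondecreasing[where f="\<lambda>y. exp (c * y) * resolv c f y"])
    fix y
    have "(resolv c f has_real_derivative (f y - c * resolv c f y)) (at y)"
      using resolv_deriv[OF c f, of y] by (simp add: has_real_derivative_iff_has_vector_derivative)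
    hence "((\<lambda>y. exp (c * y) * resolv c f y) has_real_derivative exp (c * y) * f y) (at y)"
      by (auto intro!: derivative_eq_intros simp: algebra_simps)
    thus "\<exists>d. ((\<lambda>y. exp (c * y) * resolv c f y) has_real_derivative d) (at y) \<and> 0 \<le> d"
      using pos[of y] by (meson exp_ge_zero mult_nonneg_nonneg)
  qed (use s in simp)
  hence "exp (- (c * x)) * (exp (c * (x - s)) * resolv c f (x - s)) \<le> exp (- (c * x)) * (exp (c * x) * resolv c f x)"
    by (intro mult_left_mono) auto
  moreover have "exp (- (c * x)) * (exp (c * (x - s)) * resolv c f (x - s)) = exp (- (c * s)) * resolv c f (x - s)"
    by (simp add: mult.assoc[symmetric] exp_add[symmetric] right_diff_distrib)
  moreover have "exp (- (c * x)) * (exp (c * x) * resolv c f x) = resolv c f x"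
    by (simp add: exp_minus)
  ultimately show ?thesis by linarith
qed

text \<open>Cauchy-Schwarz for the measure with density
  \<open>expker c s * \<theta> (x - s)\<close>; in the second factor the density is replaced by its
  bound \<open>S\<close>. It estimates a weighted average of \<open>|q|\<close> by the
  \<open>L^2\<close> norm of \<open>q\<close>, while \<open>\<theta>\<close> is controlled only
  through \<open>S\<close>.\<close>

lemma resolv_weighted_Cauchy_Schwarz:
  fixes \<theta> g :: "real \<Rightarrow> real"
  assumes c: "c > 0" and \<theta>: "bcont \<theta>" "\<And>y. \<theta> y \<ge> 0" and g: "nice g" "\<And>y. g y \<ge> 0"
    and S: "\<And>s. s \<ge> 0 \<Longrightarrow> exp (- (c * s)) * \<theta> (x - s) \<le> S" "S \<ge> 0"
  shows "(resolv c (\<lambda>y. \<theta> y * g y) x)\<^sup>2 \<le> resolv c \<theta> x * (S * sqint g)"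
proof -
  note [measurable] = bcont_shift_measurable[OF \<theta>(1)] bcont_shift_measurable[OF bcont_nice[OF g(1)]]
  let ?a = "\<lambda>s. sqrt (expker c s * \<theta> (x - s))"
  let ?b = "\<lambda>s. sqrt (expker c s * \<theta> (x - s)) * g (x - s)"
  have t0: "expker c s * \<theta> (x - s) \<ge> 0" for s by (intro mult_nonneg_nonneg expker_nonneg \<theta>)
  have a2: "integrable lborel (\<lambda>s. (?a s)\<^sup>2)" using resolv_integrable[OF c \<theta>(1), of x] by (simp add: t0)
  have b2: "integrable lborel (\<lambda>s. (?b s)\<^sup>2)"
    using resolv_integrable[OF c bcont_mult[OF \<theta>(1) bcont_power[OF bcont_nice[OF g(1)], of 2]], of x]
    by (simp add: power_mult_distrib t0 mult.assoc)
  have "(LINT s|lborel. \<bar>?a s * ?b s\<bar>) \<le> sqrt (LINT s|lborel. (?a s)\<^sup>2) * sqrt (LINT s|lborel. (?b s)\<^sup>2)"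
    by (rule integral_Cauchy_Schwarz(2)) (use a2 b2 in auto)
  also have "(LINT s|lborel. \<bar>?a s * ?b s\<bar>) = resolv c (\<lambda>y. \<theta> y * g y) x"
    unfolding resolv_def
  proof (intro Bochner_Integration.integral_cong refl)
    fix s
    have "?a s * ?b s = expker c s * \<theta> (x - s) * g (x - s)" by (simp add: t0 flip: mult.assoc)
    moreover have "expker c s * \<theta> (x - s) * g (x - s) \<ge> 0" by (intro mult_nonneg_nonneg t0 g)
    ultimately show "\<bar>?a s * ?b s\<bar> = expker c s *\<^sub>R (\<theta> (x - s) * g (x - s))"
      by (simp only: abs_of_nonneg real_scaleR_def mult.assoc)
  qed
  also have "(LINT s|lborel. (?a s)\<^sup>2) = resolv c \<theta> x"
    unfolding resolv_def by (intro Bochner_Integration.integral_cong refl) (simp add: t0)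
  finally have 1: "resolv c (\<lambda>y. \<theta> y * g y) x \<le> sqrt (resolv c \<theta> x) * sqrt (LINT s|lborel. (?b s)\<^sup>2)" .
  have 2: "(LINT s|lborel. (?b s)\<^sup>2) \<le> S * sqint g"
  proof -
    have gi: "integrable lborel (\<lambda>s. (norm (g (x - s)))\<^sup>2)"
      using lborel_integrable_real_affine[OF sqint_integrable[OF g(1)], of "-1" x] by simp
    have "(LINT s|lborel. (?b s)\<^sup>2) \<le> (LINT s|lborel. S * (norm (g (x - s)))\<^sup>2)"
    proof (rule integral_mono[OF b2])
      fix s
      have "expker c s * \<theta> (x - s) \<le> S"
        using S(1)[of s] S(2) by (cases "s \<ge> 0") (auto simp: expker_def)
      thus "(?b s)\<^sup>2 \<le> S * (norm (g (x - s)))\<^sup>2"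
        by (simp add: power_mult_distrib t0 mult_right_mono)
    qed (use gi in auto)
    also have "\<dots> = S * sqint g" using sqint_shift[of g x] by (simp add: sqint_def)
    finally show ?thesis .
  qed
  have nn: "resolv c \<theta> x \<ge> 0" "resolv c (\<lambda>y. \<theta> y * g y) x \<ge> 0"
    by (auto intro!: resolv_nonneg \<theta> g mult_nonneg_nonneg)
  have "sqrt (resolv c \<theta> x) * sqrt (LINT s|lborel. (?b s)\<^sup>2) \<le> sqrt (resolv c \<theta> x) * sqrt (S * sqint g)"
    using 2 by (intro mult_left_mono) (auto simp: nn)
  with 1 have "resolv c (\<lambda>y. \<theta> y * g y) x \<le> sqrt (resolv c \<theta> x) * sqrt (S * sqint g)" by linarith
  from power_mono[OF this nn(2), of 2] show ?thesis
    using nn S(2) sqint_nonneg[of g] by (simp add: power_mult_distrib)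
qed

text \<open>The function \<open>\<theta>\<close> below is \<open>exp (- c x)\<close> times the squared modulus of the first component of the
  Jost solution, so that \<open>\<theta> (1 - r r*)\<close> measures the excess of the first component over the
  second; its growth is controlled by integrating \<open>q = w' + 2 k w\<close> by parts.\<close>

lemma riccati_good_scale:
  assumes k: "k > 0" and q: "nice q" and l: "Re l > 0" "Im l > sqrt k / 2" "cmod l < 2 * sqrt k"
    and e: "e \<ge> 0" "148 * (1 + sqint q) * e \<le> 1"
    and w: "\<And>x. sqrt k * cmod (resolv (2 * k) q x) \<le> e"
  obtains r where "riccati l q r"
proof -
  define K where "K = sqrt k"
  have K: "K > 0" "k = K\<^sup>2" using k by (auto simp: K_def)
  have l2: "Im l > 0" using l(2) real_sqrt_gt_zero[OF k] by linarith
  define m s where "m = Re l" and "s = Im l"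
  have ms: "m > 0" "s > 0" "s > K / 2" using l l2 by (auto simp: m_def s_def K_def)
  define c where "c = 4 * m * s"
  have c: "c > 0" using ms by (simp add: c_def)
  have lK: "cmod l \<le> 2 * K" using l(3) by (simp add: K_def)
  have l4: "(cmod l)\<^sup>2 \<le> 4 * K\<^sup>2" using power_mono[OF lK, of 2] by (simp add: power_mult_distrib)
  have c2: "c \<le> 2 * (cmod l)\<^sup>2"
  proof -
    have "0 \<le> (m - s)\<^sup>2" by simp
    thus ?thesis unfolding cmod_power2 c_def m_def s_def by (simp add: power2_diff)
  qed
  have k2: "2 * k > 0" using k by simp
  define W where "W = resolv (2 * k) q"
  have Wn: "nice W" unfolding W_def by (rule resolv_nice[OF k2 q])
  have Wd: "(W has_vector_derivative (q y - 2 * k * W y)) (at y)" for y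
    using resolv_deriv[OF k2 bcont_nice[OF q], of y] by (simp add: W_def scaleR_conv_of_real)
  have We: "cmod (W y) \<le> e / K" for y
  proof -
    have "K * cmod (W y) \<le> e" using w[of y] by (simp only: W_def K_def)
    thus ?thesis using K(1) by (simp add: pos_le_divide_eq mult.commute)
  qed
  have nq: "nice (\<lambda>y. cmod (q y))" by (rule nice_norm[OF q])
  note bq = bcont_nice[OF q] bcont_nice[OF nq]
  define M where "M = sqint q"
  have M: "M \<ge> 0" by (simp add: M_def sqint_nonneg)
  show ?thesis
  proof (rule riccati_exists[OF l(1) l2 q, of 1])
    fix r r' :: "real \<Rightarrow> complex" and x
    assume nr: "nice r" and le: "\<And>y. y \<le> x \<Longrightarrow> cmod (r y) \<le> 1"
      and r'b: "bcont r'" and d: "\<And>y. (r has_vector_derivative r' y) (at y)"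
      and r': "\<And>y. y \<le> x \<Longrightarrow> r' y = 2 * \<i> * l\<^sup>2 * r y - l * cnj (q y) - l * q y * (r y)\<^sup>2"
    note br = bcont_nice[OF nr]
    define \<alpha> where "\<alpha> y = 2 * Re (l * (q y * r y))" for y
    have \<alpha>: "nice \<alpha>" unfolding \<alpha>_def[abs_def]
      by (intro nice_mult_right bcont_const nice_Re nice_mult_left q br)
    define \<theta> where "\<theta> y = exp (cumul \<alpha> y)" for y
    have \<theta>b: "bcont \<theta>" unfolding \<theta>_def[abs_def] by (intro bcont_exp cumul_bcont \<alpha>)
    have \<theta>pos: "\<theta> y > 0" for y by (simp add: \<theta>_def)
    have \<theta>d: "(\<theta> has_real_derivative \<alpha> y * \<theta> y) (at y)" for y
      using cumul_deriv[OF \<alpha>, of y] unfolding \<theta>_def[abs_def] has_real_derivative_iff_has_vector_derivative[symmetric]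
      by (auto intro!: derivative_eq_intros)
    have \<alpha>le: "\<bar>\<alpha> y\<bar> \<le> 4 * K * cmod (q y)" if "y \<le> x" for y
    proof -
      have "\<bar>\<alpha> y\<bar> \<le> 2 * cmod (l * (q y * r y))" unfolding \<alpha>_def
        using abs_Re_le_cmod[of "l * (q y * r y)"] by (simp add: abs_mult del: times_complex.sel)
      also have "\<dots> \<le> 2 * ((2 * K) * (cmod (q y) * 1))"
        unfolding norm_mult using K by (intro mult_left_mono mult_mono lK le that) auto
      finally show ?thesis by simp
    qed
    \<comment> \<open>The weighted averages of 1 and of \<open>|q|\<close> over the half-line, up to
      the factor \<open>c\<close>. The goal will be \<open>|T| < s * a\<close> for the corresponding
      average \<open>T\<close> of \<open>q r\<close>.\<close>
    define a b where "a = resolv c \<theta> x" and "b = resolv c (\<lambda>y. \<theta> y * cmod (q y)) x"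
    have b0: "b \<ge> 0" unfolding b_def using \<theta>pos by (intro resolv_nonneg mult_nonneg_nonneg) (auto intro: less_imp_le)
    \<comment> \<open>\<open>\<theta>\<close> is bounded below because \<open>cumul \<alpha>\<close>
      is bounded. Positivity of \<open>a\<close> is what makes the last comparison strict.\<close>
    have a0: "a > 0"
    proof -
      define N where "N = (LINT y|lborel. norm (\<alpha> y))"
      have "exp (- N) \<le> \<theta> y" for y
        using cumul_norm_le[OF \<alpha>, of y] by (simp add: \<theta>_def N_def)
      hence "resolv c (\<lambda>_. exp (- N)) x \<le> a" unfolding a_def by (intro resolv_mono c bcont_const \<theta>b)
      moreover have "resolv c (\<lambda>_. exp (- N)) x > 0" using c by (simp add: resolv_const)
      ultimately show ?thesis by linarith
    qed
    have \<theta>R: "\<theta> y = resolv c (\<lambda>z. \<alpha> z * \<theta> z + c * \<theta> z) y" for y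
      by (rule resolv_unique[OF c _ \<theta>b])
        (use \<theta>d in \<open>auto simp: has_real_derivative_iff_has_vector_derivative intro!: bcont_rules bcont_nice[OF \<alpha>] \<theta>b\<close>)
    have \<theta>le: "\<theta> y \<le> 8 * K\<^sup>2 * resolv c \<theta> y + 4 * K * resolv c (\<lambda>z. \<theta> z * cmod (q z)) y" if "y \<le> x" for y
    proof -
      have "\<theta> y \<le> resolv c (\<lambda>z. 8 * K\<^sup>2 * \<theta> z + 4 * K * (\<theta> z * cmod (q z))) y"
        unfolding \<theta>R[of y]
      proof (rule resolv_mono[OF c])
        fix z assume "z \<le> y"
        hence "\<alpha> z \<le> 4 * K * cmod (q z)" using \<alpha>le[of z] that by linarith
        hence "\<alpha> z * \<theta> z \<le> 4 * K * cmod (q z) * \<theta> z" using \<theta>pos[of z] by (intro mult_right_mono) auto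
        moreover have "c * \<theta> z \<le> 8 * K\<^sup>2 * \<theta> z" using c2 l4 \<theta>pos[of z] by (intro mult_right_mono) auto
        ultimately show "\<alpha> z * \<theta> z + c * \<theta> z \<le> 8 * K\<^sup>2 * \<theta> z + 4 * K * (\<theta> z * cmod (q z))"
          by (simp add: mult_ac)
      qed (intro bcont_rules bcont_nice[OF \<alpha>] \<theta>b bq)+
      also have "\<dots> = resolv c (\<lambda>z. 8 * K\<^sup>2 * \<theta> z) y + resolv c (\<lambda>z. 4 * K * (\<theta> z * cmod (q z))) y"
        by (intro resolv_add c bcont_rules \<theta>b bq)
      also have "\<dots> = 8 * K\<^sup>2 * resolv c \<theta> y + 4 * K * resolv c (\<lambda>z. \<theta> z * cmod (q z)) y"
        by (intro arg_cong2[of _ _ _ _ "(+)"] resolv_cmult c bcont_rules \<theta>b bq)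
      finally show ?thesis .
    qed
    \<comment> \<open>The bound \<open>S\<close> of the density is itself expressed through
      \<open>a\<close> and \<open>b\<close>, so Cauchy-Schwarz gives a quadratic inequality for
      \<open>b\<close>; it is solved with \<open>0 \<le> (b - 4 M K a)^2\<close>.\<close>
    have b_le: "b \<le> 4 * K * (1 + M) * a"
    proof -
      define S where "S = 8 * K\<^sup>2 * a + 4 * K * b"
      have S0: "S \<ge> 0" unfolding S_def using K a0 b0 by simp
      have S: "exp (- (c * t)) * \<theta> (x - t) \<le> S" if "t \<ge> 0" for t
      proof -
        have "exp (- (c * t)) * \<theta> (x - t) \<le> exp (- (c * t)) * (8 * K\<^sup>2 * resolv c \<theta> (x - t) + 4 * K * resolv c (\<lambda>z. \<theta> z * cmod (q z)) (x - t))"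
          using that by (intro mult_left_mono \<theta>le) auto
        also have "\<dots> = 8 * K\<^sup>2 * (exp (- (c * t)) * resolv c \<theta> (x - t)) + 4 * K * (exp (- (c * t)) * resolv c (\<lambda>z. \<theta> z * cmod (q z)) (x - t))"
          by (simp add: algebra_simps)
        also have "\<dots> \<le> S" unfolding S_def a_def b_def using K
          by (intro add_mono mult_left_mono resolv_decay c \<theta>b that bcont_mult bq)
            (auto intro: less_imp_le[OF \<theta>pos] mult_nonneg_nonneg)
        finally show ?thesis .
      qed
      have "b\<^sup>2 \<le> a * (S * sqint (\<lambda>y. cmod (q y)))" unfolding a_def b_def
        by (rule resolv_weighted_Cauchy_Schwarz[OF c \<theta>b _ nq _ S S0]) (auto intro: less_imp_le[OF \<theta>pos])
      also have "sqint (\<lambda>y. cmod (q y)) = M" by (simp add: M_def sqint_def)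
      finally have "b\<^sup>2 \<le> 8 * M * (K * a)\<^sup>2 + 4 * M * (K * a) * b"
        by (simp add: S_def power2_eq_square algebra_simps)
      moreover have "0 \<le> (b - 4 * M * (K * a))\<^sup>2" by simp
      ultimately have "b\<^sup>2 \<le> 16 * (M + M\<^sup>2) * (K * a)\<^sup>2"
        by (simp add: power2_eq_square algebra_simps)
      also have "\<dots> \<le> 16 * (1 + M)\<^sup>2 * (K * a)\<^sup>2"
      proof -
        have "M + M\<^sup>2 \<le> (1 + M)\<^sup>2" using M by (simp add: power2_eq_square algebra_simps)
        thus ?thesis by (intro mult_right_mono mult_left_mono) auto
      qed
      also have "\<dots> = (4 * K * (1 + M) * a)\<^sup>2" by (simp add: power2_eq_square algebra_simps)
      finally show ?thesis using K a0 M by (simp add: power2_le_iff_abs_le)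
    qed
    define T where "T = resolv c (\<lambda>y. \<theta> y * (q y * r y)) x"
    \<comment> \<open>Writing \<open>q = W' + 2 k W\<close> and integrating by parts leaves
      \<open>W\<close>, of size \<open>e / K\<close>, times quantities controlled by
      \<open>a\<close> and \<open>b\<close>. The direct bound of \<open>T\<close> by
      \<open>b\<close> would have no small factor.\<close>
    have T_le: "cmod T \<le> e / K * (26 * K\<^sup>2 * a + 12 * K * b)"
    proof -
      define P where "P y = complex_of_real (\<theta> y) * (r y * W y)" for y
      define Q where "Q y = complex_of_real (\<theta> y) * ((\<alpha> y * r y + r' y - 2 * k * r y + c * r y) * W y)" for y
      have Pb: "bcont P" and Qb: "bcont Q" unfolding P_def[abs_def] Q_def[abs_def]
        by (intro bcont_rules \<theta>b br bcont_nice[OF Wn] bcont_nice[OF \<alpha>] r'b)+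
      have tb: "bcont (\<lambda>y. complex_of_real (\<theta> y) * (q y * r y))" by (intro bcont_rules \<theta>b br bq)
      have \<theta>dc: "((\<lambda>y. complex_of_real (\<theta> y)) has_vector_derivative complex_of_real (\<alpha> y * \<theta> y)) (at y)" for y
        using \<theta>d[of y] by (intro bounded_linear.has_vector_derivative[OF bounded_linear_of_real])
          (simp add: has_real_derivative_iff_has_vector_derivative)
      have "P x = resolv c (\<lambda>y. complex_of_real (\<theta> y) * (q y * r y) + Q y) x"
      proof (rule resolv_unique[OF c bcont_add[OF tb Qb] Pb])
        fix y
        show "(P has_vector_derivative (complex_of_real (\<theta> y) * (q y * r y) + Q y - c *\<^sub>R P y)) (at y)"
          unfolding P_def[abs_def]
          by (rule has_vector_derivative_eq_rhs[OF has_vector_derivative_mult[OF \<theta>dc has_vector_derivative_mult[OF d Wd]]])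
            (simp add: Q_def scaleR_conv_of_real algebra_simps)
      qed
      also have "\<dots> = resolv c (\<lambda>y. complex_of_real (\<theta> y) * (q y * r y)) x + resolv c Q x"
        by (rule resolv_add[OF c tb Qb])
      finally have "T = P x - resolv c Q x" by (simp add: T_def scaleR_conv_of_real)
      hence "cmod T \<le> cmod (P x) + cmod (resolv c Q x)" by (simp add: norm_triangle_ineq4)
      moreover have "cmod (P x) \<le> e / K * \<theta> x"
      proof -
        have "cmod (P x) = \<theta> x * (cmod (r x) * cmod (W x))" by (simp add: P_def norm_mult less_imp_le[OF \<theta>pos])
        also have "\<dots> \<le> \<theta> x * (1 * (e / K))"
          using \<theta>pos[of x] by (intro mult_left_mono mult_mono le We) auto
        finally show ?thesis by (simp add: mult.commute)
      qed
      moreover have "cmod (resolv c Q x) \<le> e / K * (18 * K\<^sup>2 * a + 8 * K * b)"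
      proof -
        have "cmod (resolv c Q x) \<le> resolv c (\<lambda>y. cmod (Q y)) x" by (rule resolv_norm_le[OF c Qb])
        also have "\<dots> \<le> resolv c (\<lambda>y. e / K * (18 * K\<^sup>2 * \<theta> y + 8 * K * (\<theta> y * cmod (q y)))) x"
        proof (rule resolv_mono[OF c])
          fix y assume y: "y \<le> x"
          have r1: "cmod (r y) \<le> 1" by (rule le[OF y])
          have r2: "cmod (r y) ^ 2 \<le> 1" using r1 by (simp add: power_le_one)
          have n1: "cmod (\<alpha> y * r y) \<le> 4 * K * cmod (q y) * 1"
            unfolding norm_mult norm_of_real using K by (intro mult_mono \<alpha>le y r1) auto
          have "cmod (r' y) \<le> cmod (2 * \<i> * l\<^sup>2 * r y) + cmod (l * cnj (q y)) + cmod (l * q y * (r y)\<^sup>2)"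
            unfolding r'[OF y] by (meson norm_triangle_ineq4 order_trans add_right_mono)
          also have "\<dots> \<le> 2 * (4 * K\<^sup>2) * 1 + 2 * K * cmod (q y) + 2 * K * cmod (q y) * 1"
            unfolding norm_mult norm_power complex_mod_cnj using K l4 lK r1 r2
            by (intro add_mono mult_mono) auto
          finally have n2: "cmod (r' y) \<le> 8 * K\<^sup>2 + 4 * K * cmod (q y)" by simp
          have n3: "cmod (2 * k * r y) \<le> 2 * K\<^sup>2"
            using r1 K mult_left_le[of "cmod (r y)" "2 * K\<^sup>2"] by (simp add: norm_mult norm_power)
          have n4: "cmod (c * r y) \<le> 8 * K\<^sup>2"
          proof -
            have "c * cmod (r y) \<le> c" using r1 c by (intro mult_left_le) auto
            moreover have "c \<le> 8 * K\<^sup>2" using c2 l4 by linarith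
            ultimately have "c * cmod (r y) \<le> 8 * K\<^sup>2" by linarith
            thus ?thesis using c by (simp add: norm_mult)
          qed
          have "cmod (\<alpha> y * r y + r' y - 2 * k * r y + c * r y) \<le> cmod (\<alpha> y * r y) + cmod (r' y) + cmod (2 * k * r y) + cmod (c * r y)"
            by (meson norm_triangle_ineq norm_triangle_ineq4 order_trans add_right_mono)
          hence n5: "cmod (\<alpha> y * r y + r' y - 2 * k * r y + c * r y) \<le> 18 * K\<^sup>2 + 8 * K * cmod (q y)"
            using n1 n2 n3 n4 by linarith
          have "cmod (Q y) = \<theta> y * (cmod (\<alpha> y * r y + r' y - 2 * k * r y + c * r y) * cmod (W y))"
            by (simp add: Q_def norm_mult less_imp_le[OF \<theta>pos])
          also have "\<dots> \<le> \<theta> y * ((18 * K\<^sup>2 + 8 * K * cmod (q y)) * (e / K))"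
            using \<theta>pos[of y] K by (intro mult_left_mono mult_mono n5 We) auto
          finally show "cmod (Q y) \<le> e / K * (18 * K\<^sup>2 * \<theta> y + 8 * K * (\<theta> y * cmod (q y)))"
            by (simp only: distrib_left distrib_right mult_ac)
        qed (intro bcont_rules Qb \<theta>b bq)+
        also have "\<dots> = e / K * resolv c (\<lambda>y. 18 * K\<^sup>2 * \<theta> y + 8 * K * (\<theta> y * cmod (q y))) x"
          by (intro resolv_cmult c bcont_rules \<theta>b bq)
        also have "resolv c (\<lambda>y. 18 * K\<^sup>2 * \<theta> y + 8 * K * (\<theta> y * cmod (q y))) x
          = resolv c (\<lambda>y. 18 * K\<^sup>2 * \<theta> y) x + resolv c (\<lambda>y. 8 * K * (\<theta> y * cmod (q y))) x"
          by (intro resolv_add c bcont_rules \<theta>b bq)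
        also have "\<dots> = 18 * K\<^sup>2 * a + 8 * K * b" unfolding a_def b_def
          by (intro arg_cong2[of _ _ _ _ "(+)"] resolv_cmult c bcont_rules \<theta>b bq)
        finally show ?thesis .
      qed
      moreover have "e / K * \<theta> x \<le> e / K * (8 * K\<^sup>2 * a + 4 * K * b)"
        using \<theta>le[of x] e K unfolding a_def b_def by (intro mult_left_mono) auto
      ultimately have "cmod T \<le> e / K * (8 * K\<^sup>2 * a + 4 * K * b) + e / K * (18 * K\<^sup>2 * a + 8 * K * b)"
        by linarith
      also have "\<dots> = e / K * (26 * K\<^sup>2 * a + 12 * K * b)"
        by (simp only: distrib_left[symmetric]) (simp add: algebra_simps)
      finally show ?thesis .
    qed
    \<comment> \<open>Inserting the bound for \<open>b\<close> gives
      \<open>26 + 48 (1 + M) \<le> 74 (1 + M)\<close>, and \<open>Im l > sqrt k / 2\<close> costs a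
      factor 2: hence 148.\<close>
    have T_lt: "cmod T < s * a"
    proof -
      have "e / K * (26 * K\<^sup>2 * a + 12 * K * b) \<le> e / K * (26 * K\<^sup>2 * a + 12 * K * (4 * K * (1 + M) * a))"
        using e K b_le by (intro mult_left_mono add_mono) auto
      also have "\<dots> = e * K * a * (74 + 48 * M)" using K by (simp add: power2_eq_square field_simps)
      also have "\<dots> \<le> e * K * a * (74 * (1 + M))"
        using e K a0 M by (intro mult_left_mono mult_nonneg_nonneg) auto
      also have "\<dots> = K / 2 * a * (148 * (1 + M) * e)" by simp
      also have "\<dots> \<le> K / 2 * a * 1" using e K a0 unfolding M_def by (intro mult_left_mono) auto
      also have "\<dots> < s * a" using ms a0 by simp
      finally show ?thesis using T_le by linarith
    qed
    define Y where "Y y = 1 - (cmod (r y))\<^sup>2" for y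
    define Y' where "Y' y = - (2 * Re (cnj (r y) * r' y))" for y
    have Yd: "(Y has_real_derivative Y' y) (at y)" for y
    proof -
      have "(Y has_vector_derivative (0 - 2 * Re (cnj (r y) * r' y))) (at y)"
        unfolding Y_def[abs_def]
        by (intro has_vector_derivative_diff has_vector_derivative_const has_vector_derivative_norm_sq d)
      thus ?thesis by (simp add: Y'_def has_real_derivative_iff_has_vector_derivative)
    qed
    have Yb: "bcont Y" and Y'b: "bcont Y'" unfolding Y_def[abs_def] Y'_def[abs_def]
      by (intro bcont_rules br r'b)+
    \<comment> \<open>To the left of \<open>x\<close>, where the true equation holds, the derivative
      of \<open>\<theta> * Y\<close> plus \<open>c * \<theta> * Y\<close> collapses to
      \<open>4 m \<theta> (s (1 + |r|^2) + Re (q r))\<close>. Thus \<open>Y x > 0\<close> once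
      \<open>s * a\<close> beats \<open>|T|\<close>; because \<open>m\<close> is a common factor,
      \<open>Re l\<close> may be arbitrarily small.\<close>
    define H where "H y = \<theta> y * (\<alpha> y * Y y + Y' y + c * Y y)" for y
    have Hb: "bcont H" unfolding H_def[abs_def] by (intro bcont_rules \<theta>b Yb Y'b bcont_nice[OF \<alpha>])
    have "\<theta> x * Y x = resolv c H x"
    proof (rule resolv_unique[OF c Hb bcont_mult[OF \<theta>b Yb]])
      fix y
      have "((\<lambda>x. \<theta> x * Y x) has_real_derivative (H y - c * (\<theta> y * Y y))) (at y)"
        by (auto intro!: derivative_eq_intros \<theta>d Yd simp: H_def algebra_simps)
      thus "((\<lambda>x. \<theta> x * Y x) has_vector_derivative (H y - c *\<^sub>R (\<theta> y * Y y))) (at y)"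
        by (simp add: has_real_derivative_iff_has_vector_derivative)
    qed
    also have "\<dots> = resolv c (\<lambda>y. 4 * m * (s * (\<theta> y * (1 + (cmod (r y))\<^sup>2)) + Re (complex_of_real (\<theta> y) * (q y * r y)))) x"
    proof (rule resolv_cong_le)
      fix y assume y: "y \<le> x"
      have "\<alpha> y * Y y + Y' y + c * Y y = 4 * m * (s * (1 + (cmod (r y))\<^sup>2) + Re (q y * r y))"
        unfolding \<alpha>_def Y_def Y'_def c_def r'[OF y] cmod_power2 m_def s_def
        by (simp add: power2_eq_square) algebra
      thus "H y = 4 * m * (s * (\<theta> y * (1 + (cmod (r y))\<^sup>2)) + Re (complex_of_real (\<theta> y) * (q y * r y)))"
        unfolding H_def by (simp only:) (simp add: algebra_simps)
    qed
    also have "\<dots> = 4 * m * (resolv c (\<lambda>y. s * (\<theta> y * (1 + (cmod (r y))\<^sup>2))) x + resolv c (\<lambda>y. Re (complex_of_real (\<theta> y) * (q y * r y))) x)"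
      by (subst resolv_cmult[OF c], intro bcont_rules \<theta>b br bq)
        (subst resolv_add[OF c], (intro bcont_rules \<theta>b br bq)+, simp)
    also have "resolv c (\<lambda>y. Re (complex_of_real (\<theta> y) * (q y * r y))) x = Re T"
      unfolding T_def by (subst resolv_linear[OF bounded_linear_Re c])
        (auto intro!: bcont_rules \<theta>b br bq simp: scaleR_conv_of_real)
    also have "resolv c (\<lambda>y. s * (\<theta> y * (1 + (cmod (r y))\<^sup>2))) x = s * resolv c (\<lambda>y. \<theta> y * (1 + (cmod (r y))\<^sup>2)) x"
      by (intro resolv_cmult c bcont_rules \<theta>b br)
    finally have eq: "\<theta> x * Y x = 4 * m * (s * resolv c (\<lambda>y. \<theta> y * (1 + (cmod (r y))\<^sup>2)) x + Re T)" .
    have "a \<le> resolv c (\<lambda>y. \<theta> y * (1 + (cmod (r y))\<^sup>2)) x" unfolding a_def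
      by (intro resolv_mono c bcont_rules \<theta>b br) (use \<theta>pos in \<open>auto simp: less_imp_le\<close>)
    hence "s * a \<le> s * resolv c (\<lambda>y. \<theta> y * (1 + (cmod (r y))\<^sup>2)) x" using ms by simp
    moreover have "Re T \<ge> - cmod T" using abs_Re_le_cmod[of T] by linarith
    ultimately have "s * resolv c (\<lambda>y. \<theta> y * (1 + (cmod (r y))\<^sup>2)) x + Re T > 0" using T_lt by linarith
    hence "\<theta> x * Y x > 0" unfolding eq using ms by simp
    hence "Y x > 0" using \<theta>pos[of x] by (simp add: zero_less_mult_iff)
    thus "cmod (r x) < 1" by (simp add: Y_def power_less_one_iff abs_square_less_1)
  qed (use that in auto)
qed

section \<open>Dependence of the Riccati solution on parameters\<close>

lemma has_vector_derivative_iff_tendsto: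
  fixes f :: "real \<Rightarrow> 'a::real_normed_vector"
  shows "(f has_vector_derivative D) (at x within S) \<longleftrightarrow>
    ((\<lambda>y. (f y - f x) /\<^sub>R (y - x)) \<longlongrightarrow> D) (at x within S)"
proof -
  have eq: "norm ((1 / norm (y - x)) *\<^sub>R (f y - (f x + (y - x) *\<^sub>R D))) = norm ((f y - f x) /\<^sub>R (y - x) - D)"
    if "y \<noteq> x" for y
  proof -
    have "(f y - f x) /\<^sub>R (y - x) - D = (1 / (y - x)) *\<^sub>R (f y - (f x + (y - x) *\<^sub>R D))"
    proof -
      have "(1 / (y - x)) *\<^sub>R (f y - (f x + (y - x) *\<^sub>R D)) = (1 / (y - x)) *\<^sub>R (f y - f x) - ((1 / (y - x)) * (y - x)) *\<^sub>R D"
        by (simp only: diff_diff_eq[symmetric] scaleR_diff_right scaleR_scaleR)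
      thus ?thesis using that by (simp add: divide_inverse)
    qed
    thus ?thesis by (simp add: divide_inverse abs_inverse)
  qed
  have "(f has_vector_derivative D) (at x within S) \<longleftrightarrow>
    ((\<lambda>y. (1 / norm (y - x)) *\<^sub>R (f y - (f x + (y - x) *\<^sub>R D))) \<longlongrightarrow> 0) (at x within S)"
    unfolding has_vector_derivative_def has_derivative_within by (simp add: bounded_linear_scaleR_left)
  also have "\<dots> \<longleftrightarrow> ((\<lambda>y. norm ((1 / norm (y - x)) *\<^sub>R (f y - (f x + (y - x) *\<^sub>R D)))) \<longlongrightarrow> 0) (at x within S)"
    by (rule tendsto_norm_zero_iff[symmetric])
  also have "\<dots> \<longleftrightarrow> ((\<lambda>y. norm ((f y - f x) /\<^sub>R (y - x) - D)) \<longlongrightarrow> 0) (at x within S)"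
    by (rule Lim_cong_within) (use eq in auto)
  also have "\<dots> \<longleftrightarrow> ((\<lambda>y. (f y - f x) /\<^sub>R (y - x)) \<longlongrightarrow> D) (at x within S)"
    by (simp only: tendsto_norm_zero_iff LIM_zero_iff)
  finally show ?thesis .
qed

lemma vector_derivative_lipschitz:
  fixes f :: "real \<Rightarrow> 'a::real_normed_vector"
  assumes S: "convex S" "x \<in> S" "y \<in> S" and d: "\<And>z. z \<in> S \<Longrightarrow> (f has_vector_derivative f' z) (at z)"
    and B: "\<And>z. z \<in> S \<Longrightarrow> norm (f' z) \<le> B"
  shows "norm (f x - f y) \<le> B * \<bar>x - y\<bar>"
proof -
  have "norm (f x - f y) \<le> B * norm (x - y)"
  proof (rule differentiable_bound[OF S(1) _ _ S(2,3)])
    show "(f has_derivative (\<lambda>h. h *\<^sub>R f' z)) (at z within S)" if "z \<in> S" for z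
      using has_vector_derivative_at_within[OF d[OF that]] by (simp add: has_vector_derivative_def)
    show "onorm (\<lambda>h. h *\<^sub>R f' z) \<le> B" if "z \<in> S" for z
      by (rule onorm_le) (use mult_left_mono[OF B[OF that] abs_ge_zero] in \<open>simp add: mult.commute\<close>)
  qed
  thus ?thesis by simp
qed

text \<open>Dominated convergence along sequences of difference quotients, with a majorant from the
  mean value inequality. \<open>\<delta> t\<close> is measurable as a pointwise limit of the
  quotients.\<close>

lemma leibniz_line:
  fixes \<rho> \<delta> :: "real \<Rightarrow> real \<Rightarrow> 'a::euclidean_space"
  assumes d: "\<And>t x. \<bar>t\<bar> < T \<Longrightarrow> ((\<lambda>s. \<rho> s x) has_vector_derivative \<delta> t x) (at t)"
    and n: "\<And>t. \<bar>t\<bar> < T \<Longrightarrow> nice (\<rho> t)"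
    and b: "\<And>t x. \<bar>t\<bar> < T \<Longrightarrow> norm (\<delta> t x) \<le> C / (1 + x\<^sup>2)"
    and t: "\<bar>t\<bar> < T"
  shows "((\<lambda>s. LINT x|lborel. \<rho> s x) has_vector_derivative (LINT x|lborel. \<delta> t x)) (at t)"
proof -
  let ?S = "{-T<..<T}"
  have at: "at t within ?S = at t" using t by (intro at_within_open) auto
  show ?thesis
    unfolding has_vector_derivative_iff_tendsto at[symmetric] tendsto_at_iff_sequentially
  proof (intro allI impI)
    fix X :: "nat \<Rightarrow> real" assume X: "\<forall>i. X i \<in> ?S - {t}" "X \<longlonglongrightarrow> t"
    have XT: "\<bar>X i\<bar> < T" "X i \<noteq> t" for i using X(1) by (auto simp: abs_less_iff dest: spec[of _ i])
    let ?D = "\<lambda>i x. (\<rho> (X i) x - \<rho> t x) /\<^sub>R (X i - t)"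
    have nD: "nice (?D i)" for i
      by (intro nice_scaleR_left bcont_const nice_diff n XT t)
    have "(\<lambda>i. LINT x|lborel. ?D i x) \<longlonglongrightarrow> (LINT x|lborel. \<delta> t x)"
    proof (rule integral_dominated_convergence[where w="\<lambda>x. C * (1 / (1 + x\<^sup>2))"])
      show "integrable lborel (\<lambda>x. C * (1 / (1 + x\<^sup>2)))"
        by (intro integrable_mult_right integrable_inverse_square)
      show "?D i \<in> borel_measurable lborel" for i using nice_measurable[OF nD] by simp
      have lim: "(\<lambda>i. ?D i x) \<longlonglongrightarrow> \<delta> t x" for x
        using d[OF t, of x] X unfolding has_vector_derivative_iff_tendsto at[symmetric] tendsto_at_iff_sequentially
        by (auto simp: o_def)
      show "AE x in lborel. (\<lambda>i. ?D i x) \<longlonglongrightarrow> \<delta> t x" using lim by simp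
      show "\<delta> t \<in> borel_measurable lborel"
        by (rule borel_measurable_LIMSEQ_metric[OF _ lim]) (use nice_measurable[OF nD] in simp)
      show "AE x in lborel. norm (?D i x) \<le> C * (1 / (1 + x\<^sup>2))" for i
      proof (intro AE_I2)
        fix x
        have "norm (\<rho> (X i) x - \<rho> t x) \<le> C / (1 + x\<^sup>2) * \<bar>X i - t\<bar>"
          by (rule vector_derivative_lipschitz[of ?S _ _ "\<lambda>s. \<rho> s x" "\<lambda>s. \<delta> s x"])
            (use XT[of i] t d b in auto)
        from divide_right_mono[OF this, of "\<bar>X i - t\<bar>"]
        have "norm (\<rho> (X i) x - \<rho> t x) / \<bar>X i - t\<bar> \<le> C * (1 / (1 + x\<^sup>2))"
          using XT(2)[of i] by simp
        thus "norm (?D i x) \<le> C * (1 / (1 + x\<^sup>2))" by (simp add: divide_inverse mult.commute)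
      qed
    qed
    moreover have "(LINT x|lborel. ?D i x) = ((LINT x|lborel. \<rho> (X i) x) - (LINT x|lborel. \<rho> t x)) /\<^sub>R (X i - t)" for i
      using nice_integrable[OF n[OF XT(1)[of i]]] nice_integrable[OF n[OF t]] by simp
    ultimately show "((\<lambda>y. ((LINT x|lborel. \<rho> y x) - (LINT x|lborel. \<rho> t x)) /\<^sub>R (y - t)) \<circ> X) \<longlonglongrightarrow> (LINT x|lborel. \<delta> t x)"
      by (simp only: o_def)
  qed
qed

text \<open>Pointwise convergence of bounded sources suffices: \<open>perturbed_bound\<close> is
  uniform in \<open>n\<close>, and the resolvent integral admits dominated convergence. It is
  applied to difference quotients minus the candidate derivative, in \<open>l\<close> and in
  time.\<close>

lemma perturbed_tendsto_zero:
  fixes d f \<alpha> :: "nat \<Rightarrow> real \<Rightarrow> complex"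
  assumes a: "Re a < 0" and \<alpha>: "\<And>n. nice (\<alpha> n)" "\<And>n. (LINT y|lborel. cmod (\<alpha> n y)) \<le> N"
    and f: "\<And>n. bcont (f n)" "\<And>n y. cmod (f n y) \<le> C" "\<And>y. (\<lambda>n. f n y) \<longlonglongrightarrow> 0"
    and d: "\<And>n. bcont (d n)" "\<And>n x. (d n has_vector_derivative ((a + \<alpha> n x) * d n x + f n x)) (at x)"
  shows "(\<lambda>n. d n x) \<longlonglongrightarrow> 0"
proof -
  have c: "- Re a > 0" using a by simp
  have "(\<lambda>n. resolv (- Re a) (\<lambda>y. cmod (f n y)) x) \<longlonglongrightarrow> (LINT s::real|lborel. (0::real))"
    unfolding resolv_def
  proof (rule integral_dominated_convergence[where w="\<lambda>s. C * expker (- Re a) s"])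
    show "integrable lborel (\<lambda>s. C * expker (- Re a) s)" by (intro integrable_mult_right expker_integrable c)
    show "(\<lambda>s. expker (- Re a) s *\<^sub>R cmod (f n (x - s))) \<in> borel_measurable lborel" for n
      using bcont_shift_measurable[OF bcont_norm[OF f(1)[of n]], of x] by measurable
    have "(\<lambda>n. expker (- Re a) s *\<^sub>R cmod (f n (x - s))) \<longlonglongrightarrow> expker (- Re a) s *\<^sub>R 0" for s
      by (intro tendsto_intros tendsto_norm_zero f)
    thus "AE s in lborel. (\<lambda>n. expker (- Re a) s *\<^sub>R cmod (f n (x - s))) \<longlonglongrightarrow> 0" by simp
    show "AE s in lborel. norm (expker (- Re a) s *\<^sub>R cmod (f n (x - s))) \<le> C * expker (- Re a) s" for n
      using f(2)[of n] by (auto intro!: AE_I2 simp: expker_nonneg mult.commute[of C] mult_left_mono)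
  qed simp
  hence "(\<lambda>n. exp (2 * N) * resolv (- Re a) (\<lambda>y. cmod (f n y)) x) \<longlonglongrightarrow> exp (2 * N) * 0"
    by (intro tendsto_intros) simp
  hence L: "(\<lambda>n. exp (2 * N) * resolv (- Re a) (\<lambda>y. cmod (f n y)) x) \<longlonglongrightarrow> 0" by simp
  show ?thesis
    by (rule Lim_null_comparison[OF always_eventually L])
      (intro allI perturbed_bound[OF a \<alpha>(1) f(1) d(1) d(2) \<alpha>(2)])
qed

lemma perturbed_sup:
  assumes a: "Re a < 0" and \<alpha>: "nice \<alpha>" "(LINT y|lborel. cmod (\<alpha> y)) \<le> N"
    and f: "bcont f" "\<And>y. cmod (f y) \<le> C" and d: "bcont d"
    and ode: "\<And>x. (d has_vector_derivative ((a + \<alpha> x) * d x + f x)) (at x)"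
  shows "cmod (d x) \<le> exp (2 * N) * (C / (- Re a))"
proof -
  have c: "- Re a > 0" using a by simp
  have "cmod (d x) \<le> exp (2 * N) * resolv (- Re a) (\<lambda>y. cmod (f y)) x"
    by (rule perturbed_bound[OF a \<alpha>(1) f(1) d ode \<alpha>(2)])
  also have "\<dots> \<le> exp (2 * N) * (C / (- Re a))"
    using resolv_le_const[OF c bcont_norm[OF f(1)], of x C] f(2) by (intro mult_left_mono) auto
  finally show ?thesis .
qed

text \<open>The solutions are given for each \<open>l\<close> separately. Their difference quotients
  solve linear equations whose perturbations have a common \<open>L^1\<close> bound, thanks to
  \<open>|r| \<le> 1\<close>. So the quotients are bounded, which makes \<open>r\<close> continuous
  in \<open>l\<close>, and then they converge to the solution of the differentiated
  equation.\<close>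

lemma riccati_holomorphic:
  assumes S: "open S" and q: "nice q" and quad: "\<And>l. l \<in> S \<Longrightarrow> Re l > 0 \<and> Im l > 0"
    and r: "\<And>l. l \<in> S \<Longrightarrow> riccati l q (r l)"
  shows "(\<lambda>l. LINT x|lborel. l * (q x * r l x)) holomorphic_on S"
proof -
  note bq = bcont_nice[OF q]
  have "\<exists>D'. ((\<lambda>l. LINT x|lborel. l * (q x * r l x)) has_field_derivative D') (at l within S)" if l: "l \<in> S" for l
  proof -
    define a where "a = 2 * \<i> * l\<^sup>2"
    have a: "Re a < 0" unfolding a_def Re_rate using quad[OF l] by simp
    note rl = riccatiD[OF r[OF l]]
    have \<alpha>l: "nice (\<lambda>x. - 2 * l * (q x * r l x))" by (intro nice_mult_right bcont_const nice_mult_left q rl)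
    have fl: "bcont (\<lambda>x. 4 * \<i> * l * r l x - (cnj (q x) + q x * (r l x)\<^sup>2))" by (intro bcont_rules bq rl)
    \<comment> \<open>\<open>D\<close> solves the Riccati equation differentiated formally in
      \<open>l\<close>; it is the candidate for the derivative of \<open>r\<close>.\<close>
    from perturbed_exists[OF a \<alpha>l fl] obtain D where D: "bcont D"
      "\<And>x. (D has_vector_derivative ((a + - 2 * l * (q x * r l x)) * D x + (4 * \<i> * l * r l x - (cnj (q x) + q x * (r l x)\<^sup>2)))) (at x)"
      by blast
    obtain BD where BD: "BD \<ge> 0" "\<And>x. cmod (D x) \<le> BD" using bcontE[OF D(1)] by blast
    obtain Bq where Bq: "Bq \<ge> 0" "\<And>x. cmod (q x) \<le> Bq" using bcontE[OF bq] by blast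
    have "((\<lambda>y. ((LINT x|lborel. y * (q x * r y x)) - (LINT x|lborel. l * (q x * r l x))) / (y - l)) \<longlongrightarrow>
        (LINT x|lborel. q x * r l x + l * (q x * D x))) (at l within S)"
      unfolding tendsto_at_iff_sequentially
    proof (intro allI impI)
      fix X :: "nat \<Rightarrow> complex" assume X0: "\<forall>i. X i \<in> S - {l}" and Xl: "X \<longlonglongrightarrow> l"
      have X: "X i \<in> S" "X i \<noteq> l" for i using X0 by auto
      note rX = riccatiD[OF r[OF X(1)]]
      obtain L where L: "\<And>i. cmod (X i) \<le> L" using convergent_imp_Bseq[OF convergentI[OF Xl]] by (auto simp: Bseq_def)
      have L0: "L \<ge> 0" using L[of 0] norm_ge_zero order_trans by blast
      define I where "I = (LINT x|lborel. cmod (q x))"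
      define N where "N = L * (I * 2)"
      define \<alpha> where "\<alpha> i x = - X i * (q x * (r (X i) x + r l x))" for i x
      have \<alpha>n: "nice (\<alpha> i)" for i unfolding \<alpha>_def[abs_def]
        by (intro nice_mult_right bcont_const nice_mult_left q bcont_add rl rX)
      have sum2: "cmod (r (X i) x + r l x) \<le> 2" for i x
        using norm_triangle_ineq[of "r (X i) x" "r l x"] rl(2)[of x] rX(2)[of i x] by linarith
      have \<alpha>N: "(LINT y|lborel. cmod (\<alpha> i y)) \<le> N" for i
      proof -
        have "(LINT y|lborel. cmod (\<alpha> i y)) \<le> (LINT y|lborel. L * (cmod (q y) * 2))"
          using nice_integrable[OF nice_norm[OF \<alpha>n]] nice_integrable[OF nice_norm[OF q]]
          by (intro integral_mono) (auto simp: \<alpha>_def norm_mult intro!: mult_mono L sum2 L0)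
        thus ?thesis by (simp add: N_def I_def)
      qed
      define E where "E i x = (r (X i) x - r l x) / (X i - l)" for i x
      have Eb: "bcont (E i)" for i
        unfolding E_def[abs_def] divide_inverse by (intro bcont_rules rl rX)
      define F where "F i x = 2 * \<i> * (X i + l) * r (X i) x - (cnj (q x) + q x * (r l x)\<^sup>2)" for i x
      have Fb: "bcont (F i)" for i unfolding F_def[abs_def] by (intro bcont_rules bq rl rX)
      have Eode: "(E i has_vector_derivative ((a + \<alpha> i x) * E i x + F i x)) (at x)" for i x
      proof -
        have "(E i has_vector_derivative ((2 * \<i> * (X i)\<^sup>2 * r (X i) x - X i * cnj (q x) - X i * q x * (r (X i) x)\<^sup>2)
            - (2 * \<i> * l\<^sup>2 * r l x - l * cnj (q x) - l * q x * (r l x)\<^sup>2)) / (X i - l)) (at x)"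
          unfolding E_def[abs_def]
          by (intro bounded_linear.has_vector_derivative[OF bounded_linear_divide] has_vector_derivative_diff rl rX)
        moreover have "((2 * \<i> * (X i)\<^sup>2 * r (X i) x - X i * cnj (q x) - X i * q x * (r (X i) x)\<^sup>2)
            - (2 * \<i> * l\<^sup>2 * r l x - l * cnj (q x) - l * q x * (r l x)\<^sup>2)) / (X i - l) = (a + \<alpha> i x) * E i x + F i x"
          using X(2)[of i] unfolding E_def F_def \<alpha>_def a_def by (simp add: field_simps power2_eq_square)
        ultimately show ?thesis by simp
      qed
      have FC: "cmod (F i x) \<le> 2 * (L + cmod l) * 1 + (Bq + Bq * 1)" for i x
      proof -
        have "cmod (F i x) \<le> cmod (2 * \<i> * (X i + l) * r (X i) x) + (cmod (cnj (q x)) + cmod (q x * (r l x)\<^sup>2))"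
          unfolding F_def by (meson norm_triangle_ineq4 norm_triangle_ineq order_trans add_left_mono)
        also have "\<dots> \<le> 2 * (L + cmod l) * 1 + (Bq + Bq * 1)"
          unfolding norm_mult norm_power complex_mod_cnj
          using L0 Bq rX(2)[of i x] rl(2)[of x] norm_triangle_mono[OF L[of i] order_refl[of "cmod l"]]
          by (intro add_mono mult_mono) (auto simp: power_le_one)
        finally show ?thesis .
      qed
      define C where "C = exp (2 * N) * ((2 * (L + cmod l) * 1 + (Bq + Bq * 1)) / (- Re a))"
      have EC: "cmod (E i x) \<le> C" for i x unfolding C_def
        by (rule perturbed_sup[OF a \<alpha>n \<alpha>N Fb FC Eb Eode])
      have C0: "C \<ge> 0" using EC[of 0 0] norm_ge_zero order_trans by blast
      have rlim: "(\<lambda>i. r (X i) x) \<longlonglongrightarrow> r l x" for x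
      proof (rule LIM_zero_cancel, rule Lim_null_comparison[OF always_eventually])
        have "cmod (r (X i) x - r l x) \<le> C * cmod (X i - l)" for i
        proof -
          have "r (X i) x - r l x = E i x * (X i - l)" using X(2)[of i] by (simp add: E_def)
          thus ?thesis by (simp add: norm_mult EC mult_right_mono)
        qed
        thus "\<forall>i. cmod (r (X i) x - r l x) \<le> C * cmod (X i - l)" by blast
        have "(\<lambda>i. C * cmod (X i - l)) \<longlonglongrightarrow> C * cmod (l - l)" by (intro tendsto_intros Xl)
        thus "(\<lambda>i. C * cmod (X i - l)) \<longlonglongrightarrow> 0" by simp
      qed
      let ?f = "\<lambda>i x. (\<alpha> i x - (- 2 * l * (q x * r l x))) * D x + (F i x - (4 * \<i> * l * r l x - (cnj (q x) + q x * (r l x)\<^sup>2)))"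
      have Elim: "(\<lambda>i. E i x) \<longlonglongrightarrow> D x" for x
      proof (rule LIM_zero_cancel, rule perturbed_tendsto_zero[where d="\<lambda>i x. E i x - D x" and f="?f", OF a \<alpha>n \<alpha>N])
        show "bcont (\<lambda>x. E i x - D x)" for i by (intro bcont_diff Eb D)
        show "((\<lambda>x. E i x - D x) has_vector_derivative ((a + \<alpha> i x) * (E i x - D x) + ?f i x)) (at x)" for i x
          by (rule has_vector_derivative_eq_rhs[OF has_vector_derivative_diff[OF Eode D(2)]]) (simp add: algebra_simps)
        show "bcont (?f i)" for i by (intro bcont_rules bcont_nice[OF \<alpha>n] bq rl Fb D(1))
        show "cmod (?f i x) \<le> (L * (Bq * 2) + 2 * cmod l * (Bq * 1)) * BD
            + ((2 * (L + cmod l) * 1 + (Bq + Bq * 1)) + (4 * cmod l * 1 + (Bq + Bq * 1)))" for i x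
        proof -
          have 1: "cmod (\<alpha> i x - (- 2 * l * (q x * r l x))) \<le> L * (Bq * 2) + 2 * cmod l * (Bq * 1)"
          proof (rule order_trans[OF norm_triangle_ineq4], rule add_mono)
            show "cmod (\<alpha> i x) \<le> L * (Bq * 2)" unfolding \<alpha>_def norm_mult norm_minus_cancel
              using L0 Bq by (intro mult_mono L sum2) auto
            show "cmod (- 2 * l * (q x * r l x)) \<le> 2 * cmod l * (Bq * 1)" unfolding norm_mult norm_minus_cancel
              using Bq rl(2)[of x] by (intro mult_mono) auto
          qed
          have 2: "cmod (4 * \<i> * l * r l x - (cnj (q x) + q x * (r l x)\<^sup>2)) \<le> 4 * cmod l * 1 + (Bq + Bq * 1)"
          proof (rule order_trans[OF norm_triangle_ineq4], rule add_mono)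
            show "cmod (4 * \<i> * l * r l x) \<le> 4 * cmod l * 1" unfolding norm_mult
              using rl(2)[of x] by (intro mult_mono) auto
            show "cmod (cnj (q x) + q x * (r l x)\<^sup>2) \<le> Bq + Bq * 1"
              by (rule order_trans[OF norm_triangle_ineq], unfold norm_mult norm_power complex_mod_cnj)
                (use Bq rl(2)[of x] in \<open>intro add_mono mult_mono; auto simp: power_le_one\<close>)
          qed
          have 3: "cmod ((\<alpha> i x - (- 2 * l * (q x * r l x))) * D x) \<le> (L * (Bq * 2) + 2 * cmod l * (Bq * 1)) * BD"
            unfolding norm_mult using L0 Bq by (intro mult_mono 1[unfolded norm_mult] BD) auto
          have 4: "cmod (F i x - (4 * \<i> * l * r l x - (cnj (q x) + q x * (r l x)\<^sup>2)))
            \<le> (2 * (L + cmod l) * 1 + (Bq + Bq * 1)) + (4 * cmod l * 1 + (Bq + Bq * 1))"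
            by (rule order_trans[OF norm_triangle_ineq4]) (intro add_mono FC 2)
          show ?thesis by (rule order_trans[OF norm_triangle_ineq]) (intro add_mono 3 4)
        qed
        have "(\<lambda>i. ?f i x) \<longlonglongrightarrow> (- l * (q x * (r l x + r l x)) - (- 2 * l * (q x * r l x))) * D x
            + (2 * \<i> * (l + l) * r l x - (cnj (q x) + q x * (r l x)\<^sup>2) - (4 * \<i> * l * r l x - (cnj (q x) + q x * (r l x)\<^sup>2)))" for x
          unfolding \<alpha>_def F_def by (intro tendsto_intros Xl rlim)
        moreover have "(- l * (q x * (r l x + r l x)) - (- 2 * l * (q x * r l x))) * D x
            + (2 * \<i> * (l + l) * r l x - (cnj (q x) + q x * (r l x)\<^sup>2) - (4 * \<i> * l * r l x - (cnj (q x) + q x * (r l x)\<^sup>2))) = 0" for x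
          by (simp add: algebra_simps)
        ultimately show "(\<lambda>i. ?f i x) \<longlonglongrightarrow> 0" for x by simp
      qed
      have nX: "nice (\<lambda>x. X i * (q x * r (X i) x))" for i by (intro nice_mult_right bcont_const nice_mult_left q rX)
      have nl: "nice (\<lambda>x. l * (q x * r l x))" by (intro nice_mult_right bcont_const nice_mult_left q rl)
      have quot: "(X i * (q x * r (X i) x) - l * (q x * r l x)) / (X i - l) = q x * r (X i) x + l * (q x * E i x)" for i x
        using X(2)[of i] by (simp add: E_def field_simps)
      have nn: "nice (\<lambda>x. q x * r (X i) x + l * (q x * E i x))" for i
        by (intro nice_add nice_mult_right bcont_const nice_mult_left q rX Eb)
      have nD: "nice (\<lambda>x. q x * r l x + l * (q x * D x))"
        by (intro nice_add nice_mult_right bcont_const nice_mult_left q rl D(1))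
      have "(\<lambda>i. LINT x|lborel. q x * r (X i) x + l * (q x * E i x)) \<longlonglongrightarrow> (LINT x|lborel. q x * r l x + l * (q x * D x))"
      proof (rule integral_dominated_convergence[where w="\<lambda>x. (1 + cmod l * C) * cmod (q x)"])
        show "integrable lborel (\<lambda>x. (1 + cmod l * C) * cmod (q x))"
          by (intro integrable_mult_right nice_integrable nice_norm q)
        show "AE x in lborel. (\<lambda>i. q x * r (X i) x + l * (q x * E i x)) \<longlonglongrightarrow> q x * r l x + l * (q x * D x)"
          by (intro AE_I2 tendsto_intros rlim Elim)
        show "AE x in lborel. cmod (q x * r (X i) x + l * (q x * E i x)) \<le> (1 + cmod l * C) * cmod (q x)" for i
        proof (intro AE_I2)
          fix x
          have "cmod (q x * r (X i) x + l * (q x * E i x)) \<le> cmod (q x) * cmod (r (X i) x) + cmod l * (cmod (q x) * cmod (E i x))"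
            by (rule order_trans[OF norm_triangle_ineq]) (simp add: norm_mult)
          also have "\<dots> \<le> cmod (q x) * 1 + cmod l * (cmod (q x) * C)"
            by (intro add_mono mult_left_mono rX EC) auto
          finally show "cmod (q x * r (X i) x + l * (q x * E i x)) \<le> (1 + cmod l * C) * cmod (q x)"
            by (simp add: algebra_simps)
        qed
      qed (use nice_measurable[OF nn] nice_measurable[OF nD] in auto)
      moreover have "(LINT x|lborel. q x * r (X i) x + l * (q x * E i x))
        = ((LINT x|lborel. X i * (q x * r (X i) x)) - (LINT x|lborel. l * (q x * r l x))) / (X i - l)" for i
        using nice_integrable[OF nX[of i]] nice_integrable[OF nl] unfolding quot[symmetric]
        by (simp add: integral_diff[symmetric] del: integral_mult_right_zero integral_mult_right)
      ultimately show "((\<lambda>y. ((LINT x|lborel. y * (q x * r y x)) - (LINT x|lborel. l * (q x * r l x))) / (y - l)) \<circ> X)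
        \<longlonglongrightarrow> (LINT x|lborel. q x * r l x + l * (q x * D x))" by (simp add: o_def)
    qed
    thus ?thesis unfolding has_field_derivative_iff by blast
  qed
  thus ?thesis unfolding holomorphic_on_def field_differentiable_def by blast
qed

section \<open>The flow and its microscopic conservation law\<close>

text \<open>The time derivative of \<open>q\<close> in terms of \<open>a = q\<close> and its first
  two space derivatives \<open>b\<close> and \<open>c\<close>. Writing \<open>|q|^2\<close> as
  \<open>a * cnj a\<close> keeps the identities below polynomial in the values and their
  conjugates.\<close>

definition qdot :: "complex \<Rightarrow> complex \<Rightarrow> complex \<Rightarrow> complex" where
  "qdot a b c = \<i> * c - (2 * (a * cnj a) * b + a\<^sup>2 * cnj b)"

text \<open>\<open>p\<close> and \<open>z\<close> are the first two space derivatives, which the Lax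
  pair and the equation involve. \<open>B\<close> is a qualitative bound: it justifies limits under
  integrals, a strip next to the imaginary axis and the choice of the number of scales, and the
  final constant does not contain it.\<close>

locale dnls_flow =
  fixes q p z :: "real \<Rightarrow> real \<Rightarrow> complex" and T B :: real
  assumes q_deriv: "\<bar>t\<bar> < T \<Longrightarrow> (q t has_vector_derivative p t x) (at x)"
    and p_deriv: "\<bar>t\<bar> < T \<Longrightarrow> (p t has_vector_derivative z t x) (at x)"
    and z_cont: "\<bar>t\<bar> < T \<Longrightarrow> continuous_on UNIV (z t)"
    and q_bound: "\<bar>t\<bar> < T \<Longrightarrow> cmod (q t x) \<le> B / (1 + x\<^sup>2)"
    and p_bound: "\<bar>t\<bar> < T \<Longrightarrow> cmod (p t x) \<le> B / (1 + x\<^sup>2)"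
    and z_bound: "\<bar>t\<bar> < T \<Longrightarrow> cmod (z t x) \<le> B / (1 + x\<^sup>2)"
    and q_time: "\<bar>t\<bar> < T \<Longrightarrow> ((\<lambda>s. q s x) has_vector_derivative qdot (q t x) (p t x) (z t x)) (at t)"
begin

lemma q_nice: "\<bar>t\<bar> < T \<Longrightarrow> nice (q t)"
  by (rule niceI[OF has_vector_derivative_cont[OF q_deriv] q_bound])

lemma p_nice: "\<bar>t\<bar> < T \<Longrightarrow> nice (p t)"
  by (rule niceI[OF has_vector_derivative_cont[OF p_deriv] p_bound])

lemma z_nice: "\<bar>t\<bar> < T \<Longrightarrow> nice (z t)"
  by (rule niceI[OF z_cont z_bound])

abbreviation "qt t x \<equiv> qdot (q t x) (p t x) (z t x)"

lemma qt_nice: "\<bar>t\<bar> < T \<Longrightarrow> nice (qt t)"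
  unfolding qdot_def
  by (intro nice_rules bcont_rules bcont_nice[OF q_nice] q_nice p_nice z_nice)

lemma B_nonneg: "\<bar>t\<bar> < T \<Longrightarrow> B \<ge> 0"
  using order_trans[OF norm_ge_zero q_bound[of t 0]] by simp

lemma sup_bounds: "\<bar>t\<bar> < T \<Longrightarrow> cmod (q t x) \<le> B" "\<bar>t\<bar> < T \<Longrightarrow> cmod (p t x) \<le> B"
  "\<bar>t\<bar> < T \<Longrightarrow> cmod (z t x) \<le> B"
proof -
  assume t: "\<bar>t\<bar> < T"
  have "B / (1 + x\<^sup>2) \<le> B" using divide_left_mono[of 1 "1 + x\<^sup>2" B] B_nonneg[OF t] by simp
  thus "cmod (q t x) \<le> B" "cmod (p t x) \<le> B" "cmod (z t x) \<le> B"
    using q_bound[OF t, of x] p_bound[OF t, of x] z_bound[OF t, of x] by linarith+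
qed

lemma qt_bound: assumes t: "\<bar>t\<bar> < T" shows "cmod (qt t x) \<le> (B + 3 * B * B * B) / (1 + x\<^sup>2)"
proof -
  note b = sup_bounds[OF t, of x] and B = B_nonneg[OF t]
  have "cmod (qt t x) \<le> cmod (\<i> * z t x) + (cmod (2 * (q t x * cnj (q t x)) * p t x) + cmod ((q t x)\<^sup>2 * cnj (p t x)))"
    unfolding qdot_def by (meson norm_triangle_ineq4 norm_triangle_ineq order_trans add_left_mono)
  also have "\<dots> \<le> B / (1 + x\<^sup>2) + (2 * (B * B) * (B / (1 + x\<^sup>2)) + (B * B) * (B / (1 + x\<^sup>2)))"
    unfolding norm_mult power2_eq_square[of "q t x"] complex_mod_cnj using B b p_bound[OF t, of x] z_bound[OF t, of x]
    by (intro add_mono mult_mono) auto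
  also have "\<dots> = (B + 3 * B * B * B) / (1 + x\<^sup>2)" by (simp add: add_divide_distrib)
  finally show ?thesis .
qed

lemma conserved:
  fixes \<rho> \<delta> :: "real \<Rightarrow> real \<Rightarrow> 'a::euclidean_space"
  assumes "\<And>t x. \<bar>t\<bar> < T \<Longrightarrow> ((\<lambda>s. \<rho> s x) has_vector_derivative \<delta> t x) (at t)"
    and "\<And>t. \<bar>t\<bar> < T \<Longrightarrow> nice (\<rho> t)"
    and "\<And>t x. \<bar>t\<bar> < T \<Longrightarrow> norm (\<delta> t x) \<le> C / (1 + x\<^sup>2)"
    and z: "\<And>t. \<bar>t\<bar> < T \<Longrightarrow> (LINT x|lborel. \<delta> t x) = 0"
    and "\<bar>t\<bar> < T" "\<bar>s\<bar> < T"
  shows "(LINT x|lborel. \<rho> t x) = (LINT x|lborel. \<rho> s x)"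
proof -
  let ?S = "{-T<..<T}"
  have d0: "((\<lambda>s. LINT x|lborel. \<rho> s x) has_derivative (\<lambda>h. 0)) (at t within ?S)" if "t \<in> ?S" for t
  proof -
    have t: "\<bar>t\<bar> < T" using that by auto
    have "((\<lambda>s. LINT x|lborel. \<rho> s x) has_vector_derivative (LINT x|lborel. \<delta> t x)) (at t)"
      by (rule leibniz_line[where \<rho>=\<rho> and \<delta>=\<delta> and T=T and C=C])
        (rule assms(1), assumption, rule assms(2), assumption, rule assms(3), assumption, rule t)
    hence "((\<lambda>s. LINT x|lborel. \<rho> s x) has_vector_derivative 0) (at t)" unfolding z[OF t] .
    thus ?thesis unfolding has_vector_derivative_def scaleR_zero_right
      by (rule has_derivative_at_withinI)
  qed
  have "\<exists>c. \<forall>t\<in>?S. (LINT x|lborel. \<rho> t x) = c"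
    by (rule has_derivative_zero_constant[OF convex_real_interval(8) d0])
  then obtain c where c: "\<forall>t\<in>?S. (LINT x|lborel. \<rho> t x) = c" ..
  have ts: "t \<in> ?S" "s \<in> ?S" using assms(5,6) by auto
  show ?thesis using bspec[OF c ts(1)] bspec[OF c ts(2)] by (rule trans[OF _ sym])
qed

lemma mass_conserved:
  assumes "\<bar>t\<bar> < T" "\<bar>s\<bar> < T" shows "sqint (q t) = sqint (q s)"
  unfolding sqint_def
proof (rule conserved[where \<rho>="\<lambda>t x. (cmod (q t x))\<^sup>2" and \<delta>="\<lambda>t x. 2 * Re (cnj (q t x) * qt t x)", OF _ _ _ _ assms])
  fix t x assume t: "\<bar>t\<bar> < T"
  show "((\<lambda>s. (cmod (q s x))\<^sup>2) has_vector_derivative 2 * Re (cnj (q t x) * qt t x)) (at t)"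
    by (rule has_vector_derivative_norm_sq[OF q_time[OF t]])
  show "nice (\<lambda>x. (cmod (q t x))\<^sup>2)" by (rule nice_sq[OF q_nice[OF t]])
  have "norm (2 * Re (cnj (q t x) * qt t x)) \<le> 2 * (cmod (q t x) * cmod (qt t x))"
    using abs_Re_le_cmod[of "cnj (q t x) * qt t x"] by (simp add: norm_mult del: times_complex.sel)
  also have "\<dots> \<le> 2 * (B * ((B + 3 * B * B * B) / (1 + x\<^sup>2)))"
    using B_nonneg[OF t] by (intro mult_mono sup_bounds qt_bound t) auto
  finally show "norm (2 * Re (cnj (q t x) * qt t x)) \<le> 2 * B * (B + 3 * B * B * B) / (1 + x\<^sup>2)" by simp
  \<comment> \<open>The flux of the mass: \<open>|q|^2\<close> changes at the rate of the space
    derivative of \<open>- 2 Im (cnj q p) - 3/2 |q|^4\<close>.\<close>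
  let ?J = "\<lambda>x. - (2 * Im (cnj (q t x) * p t x)) - 3 / 2 * (Re (cnj (q t x) * q t x))\<^sup>2"
  show "(LINT x|lborel. 2 * Re (cnj (q t x) * qt t x)) = 0"
  proof (rule integral_derivative_nice[where F="?J"])
    fix x
    have c: "((\<lambda>x. cnj (q t x)) has_vector_derivative cnj (p t x)) (at x)"
      by (rule bounded_linear.has_vector_derivative[OF bounded_linear_cnj q_deriv[OF t]])
    have 1: "((\<lambda>x. Im (cnj (q t x) * p t x)) has_real_derivative Im (cnj (q t x) * z t x + cnj (p t x) * p t x)) (at x)"
      unfolding has_real_derivative_iff_has_vector_derivative
      by (intro bounded_linear.has_vector_derivative[OF bounded_linear_Im] has_vector_derivative_mult c p_deriv t)
    have 2: "((\<lambda>x. Re (cnj (q t x) * q t x)) has_real_derivative Re (cnj (q t x) * p t x + cnj (p t x) * q t x)) (at x)"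
      unfolding has_real_derivative_iff_has_vector_derivative
      by (intro bounded_linear.has_vector_derivative[OF bounded_linear_Re] has_vector_derivative_mult c q_deriv t)
    have 3: "(?J has_real_derivative (- (2 * Im (cnj (q t x) * z t x + cnj (p t x) * p t x))
      - 3 / 2 * (2 * Re (cnj (q t x) * q t x) * Re (cnj (q t x) * p t x + cnj (p t x) * q t x)))) (at x)"
      by (rule DERIV_cong[OF DERIV_diff[OF DERIV_minus[OF DERIV_cmult[OF 1]] DERIV_cmult[OF DERIV_power[OF 2, of 2]]]])
        (simp del: times_complex.sel)
    have 4: "- (2 * Im (cnj (q t x) * z t x + cnj (p t x) * p t x))
      - 3 / 2 * (2 * Re (cnj (q t x) * q t x) * Re (cnj (q t x) * p t x + cnj (p t x) * q t x)) = 2 * Re (cnj (q t x) * qt t x)"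
      unfolding qdot_def by (simp add: power2_eq_square) algebra
    show "(?J has_vector_derivative 2 * Re (cnj (q t x) * qt t x)) (at x)"
      using 3 unfolding 4 has_real_derivative_iff_has_vector_derivative .
  next
    show "nice (\<lambda>x. 2 * Re (cnj (q t x) * qt t x))"
      by (intro nice_mult_right nice_mult_left bcont_rules nice_Re nice_cnj q_nice bcont_nice[OF qt_nice] t)
    show "nice ?J"
      by (intro nice_diff nice_minus nice_mult_right nice_mult_left bcont_rules nice_Re nice_Im nice_cnj nice_power2
          q_nice bcont_nice[OF p_nice] bcont_nice[OF q_nice] t)
  qed
qed

section \<open>Evolution of the Riccati solution through the time half of the Lax pair\<close>

context
  fixes l :: complex and r :: "real \<Rightarrow> real \<Rightarrow> complex"
  assumes l: "Re l > 0" "Im l > 0" and r: "\<And>t. \<bar>t\<bar> < T \<Longrightarrow> riccati l (q t) (r t)"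
begin

text \<open>The time half of the Lax pair acts on the quotient of the two components by a Riccati
  equation as well, and this is its right-hand side. It is at this point only a candidate for the
  time derivative of \<open>r\<close>.\<close>

definition "rdot t x = - 2 * l^3 * cnj (q t x) + l * (\<i> * cnj (p t x) + q t x * cnj (q t x) * cnj (q t x))
  + 2 * (2 * \<i> * l^4 - \<i> * l\<^sup>2 * (q t x * cnj (q t x))) * r t x
  - (2 * l^3 * q t x + l * (\<i> * p t x - q t x * cnj (q t x) * q t x)) * (r t x)\<^sup>2"

text \<open>The first row of the time half of the Lax pair applied to the vector with components 1
  and \<open>r\<close>, up to an additive constant.\<close>

definition "flux t x = \<i> * l\<^sup>2 * (q t x * cnj (q t x)) + 2 * l^3 * q t x * r t x
  + l * (\<i> * p t x - q t x * cnj (q t x) * q t x) * r t x"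

lemma cnj_derivs:
  assumes "\<bar>t\<bar> < T"
  shows "((\<lambda>x. cnj (q t x)) has_vector_derivative cnj (p t x)) (at x)"
    "((\<lambda>x. cnj (p t x)) has_vector_derivative cnj (z t x)) (at x)"
  by (intro bounded_linear.has_vector_derivative[OF bounded_linear_cnj] q_deriv p_deriv assms)+

text \<open>Compatibility of the two halves of the Lax pair: the candidate satisfies the space
  Riccati equation differentiated in time. The check is polynomial in \<open>q\<close>,
  \<open>p\<close>, \<open>z\<close>, \<open>r\<close> and conjugates.\<close>

lemma rdot_deriv:
  assumes t: "\<bar>t\<bar> < T"
  shows "(rdot t has_vector_derivative ((2 * \<i> * l\<^sup>2 + - 2 * l * (q t x * r t x)) * rdot t x
    + (- l * cnj (qt t x) - l * qt t x * (r t x)\<^sup>2))) (at x)"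
  unfolding rdot_def[abs_def]
  apply (rule has_vector_derivative_eq_rhs)
   apply (rule has_vector_derivative_diff has_vector_derivative_add has_vector_derivative_mult
      has_vector_derivative_const q_deriv[OF t] p_deriv[OF t] cnj_derivs[OF t] riccatiD(3)[OF r[OF t]]
      | simp only: power2_eq_square)+
  unfolding qdot_def
  by (simp add: algebra_simps power2_eq_square power3_eq_cube power4_eq_xxxx)

lemma flux_deriv:
  assumes t: "\<bar>t\<bar> < T"
  shows "(flux t has_vector_derivative l * (qt t x * r t x + q t x * rdot t x)) (at x)"
  unfolding flux_def[abs_def]
  apply (rule has_vector_derivative_eq_rhs)
   apply (rule has_vector_derivative_diff has_vector_derivative_add has_vector_derivative_mult
      has_vector_derivative_const q_deriv[OF t] p_deriv[OF t] cnj_derivs[OF t] riccatiD(3)[OF r[OF t]])+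
  unfolding qdot_def rdot_def
  by (simp add: algebra_simps power2_eq_square power3_eq_cube power4_eq_xxxx)

lemma rate: "Re (2 * \<i> * l\<^sup>2) < 0"
  unfolding Re_rate using l by simp

lemma r_facts:
  assumes "\<bar>t\<bar> < T" shows "bcont (r t)" "cmod (r t x) \<le> 1" "nice (r t)"
  using riccatiD[OF r[OF assms]] riccati_nice[OF l q_nice[OF assms] r[OF assms]] by auto

definition "rdot_const = 2 * cmod l ^ 3 * B + cmod l * (B + B * B * B) + 2 * (2 * cmod l ^ 4 + cmod l ^ 2 * (B * B))
  + (2 * cmod l ^ 3 * B + cmod l * (B + B * B * B))"

lemma rdot_facts:
  assumes t: "\<bar>t\<bar> < T" shows "bcont (rdot t)" "cmod (rdot t x) \<le> rdot_const"
proof -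
  show "bcont (rdot t)" unfolding rdot_def[abs_def]
    by (intro bcont_rules bcont_nice[OF q_nice] bcont_nice[OF p_nice] r_facts t)
  note B = B_nonneg[OF t] and b = sup_bounds[OF t, of x] and r1 = r_facts(2)[OF t, of x]
  have r2: "cmod (r t x) ^ 2 \<le> 1" using r1 by (simp add: power_le_one)
  have "cmod (rdot t x) \<le> cmod (- 2 * l^3 * cnj (q t x)) + cmod (l * (\<i> * cnj (p t x) + q t x * cnj (q t x) * cnj (q t x)))
    + cmod (2 * (2 * \<i> * l^4 - \<i> * l\<^sup>2 * (q t x * cnj (q t x))) * r t x)
    + cmod ((2 * l^3 * q t x + l * (\<i> * p t x - q t x * cnj (q t x) * q t x)) * (r t x)\<^sup>2)"
    unfolding rdot_def by (meson norm_triangle_ineq norm_triangle_ineq4 order_trans add_right_mono)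
  also have "\<dots> \<le> 2 * cmod l ^ 3 * B + cmod l * (B + B * B * B) + 2 * (2 * cmod l ^ 4 + cmod l ^ 2 * (B * B)) * 1
    + (2 * cmod l ^ 3 * B + cmod l * (B + B * B * B)) * 1"
  proof (intro add_mono)
    show "cmod (- 2 * l^3 * cnj (q t x)) \<le> 2 * cmod l ^ 3 * B"
      using b by (simp add: norm_mult norm_power mult_left_mono)
    have c1: "cmod (\<i> * cnj (p t x) + q t x * cnj (q t x) * cnj (q t x)) \<le> B + B * B * B"
      by (rule order_trans[OF norm_triangle_ineq], unfold norm_mult complex_mod_cnj)
        (use b B in \<open>intro add_mono mult_mono; auto\<close>)
    show "cmod (l * (\<i> * cnj (p t x) + q t x * cnj (q t x) * cnj (q t x))) \<le> cmod l * (B + B * B * B)"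
      unfolding norm_mult[of l] by (intro mult_left_mono c1) auto
    have c2: "cmod (2 * \<i> * l^4 - \<i> * l\<^sup>2 * (q t x * cnj (q t x))) \<le> 2 * cmod l ^ 4 + cmod l ^ 2 * (B * B)"
      by (rule order_trans[OF norm_triangle_ineq4], unfold norm_mult complex_mod_cnj norm_power)
        (use b B in \<open>intro add_mono mult_mono; auto\<close>)
    show "cmod (2 * (2 * \<i> * l^4 - \<i> * l\<^sup>2 * (q t x * cnj (q t x))) * r t x) \<le> 2 * (2 * cmod l ^ 4 + cmod l ^ 2 * (B * B)) * 1"
      unfolding norm_mult[of _ "r t x"] norm_mult[of 2] using c2 r1 B by (intro mult_mono) auto
    have c3: "cmod (\<i> * p t x - q t x * cnj (q t x) * q t x) \<le> B + B * B * B"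
      by (rule order_trans[OF norm_triangle_ineq4], unfold norm_mult complex_mod_cnj)
        (use b B in \<open>intro add_mono mult_mono; auto\<close>)
    have c4: "cmod (2 * l^3 * q t x + l * (\<i> * p t x - q t x * cnj (q t x) * q t x)) \<le> 2 * cmod l ^ 3 * B + cmod l * (B + B * B * B)"
    proof (rule order_trans[OF norm_triangle_ineq], rule add_mono)
      show "cmod (2 * l^3 * q t x) \<le> 2 * cmod l ^ 3 * B"
        using b by (simp add: norm_mult norm_power mult_left_mono)
      show "cmod (l * (\<i> * p t x - q t x * cnj (q t x) * q t x)) \<le> cmod l * (B + B * B * B)"
        unfolding norm_mult[of l] by (intro mult_left_mono c3) auto
    qed
    show "cmod ((2 * l^3 * q t x + l * (\<i> * p t x - q t x * cnj (q t x) * q t x)) * (r t x)\<^sup>2)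
      \<le> (2 * cmod l ^ 3 * B + cmod l * (B + B * B * B)) * 1"
      unfolding norm_mult[of _ "(r t x)\<^sup>2"] norm_power using c4 r2 B by (intro mult_mono) auto
  qed
  finally show "cmod (rdot t x) \<le> rdot_const" by (simp add: rdot_const_def)
qed

text \<open>\<open>r t\<close> is prescribed at each time separately. Its difference quotients in
  time solve linear equations with a common \<open>L^1\<close> bound on the perturbation,
  \<open>rdot\<close> solves the limit equation, and the sources of the equations for the
  differences tend to 0.\<close>

lemma r_time:
  assumes t: "\<bar>t\<bar> < T"
  shows "((\<lambda>s. r s x) has_vector_derivative rdot t x) (at t)"
proof -
  let ?S = "{-T<..<T}"
  have at: "at t within ?S = at t" using t by (intro at_within_open) auto
  show ?thesis
    unfolding has_vector_derivative_iff_tendsto at[symmetric] tendsto_at_iff_sequentially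
  proof (intro allI impI)
    fix X :: "nat \<Rightarrow> real" assume X: "\<forall>i. X i \<in> ?S - {t}" and Xt: "X \<longlonglongrightarrow> t"
    have XT: "\<bar>X i\<bar> < T" "X i \<noteq> t" for i using X by (auto simp: abs_less_iff dest: spec[of _ i])
    define a where "a = 2 * \<i> * l\<^sup>2"
    have a: "Re a < 0" unfolding a_def by (rule rate)
    note B = B_nonneg[OF t]
    define C1 where "C1 = B + 3 * B * B * B"
    have C1: "C1 \<ge> 0" using B by (simp add: C1_def)
    define \<Delta> where "\<Delta> i = complex_of_real (X i - t)" for i
    have \<Delta>0: "\<Delta> i \<noteq> 0" for i using XT(2)[of i] by (simp add: \<Delta>_def)
    define dq where "dq i y = (q (X i) y - q t y) / \<Delta> i" for i y
    have dqR: "dq i y = (q (X i) y - q t y) /\<^sub>R (X i - t)" for i y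
      by (simp add: dq_def \<Delta>_def scaleR_conv_of_real divide_inverse mult.commute)
    have dq_lim: "(\<lambda>i. dq i y) \<longlonglongrightarrow> qt t y" for y
      using q_time[OF t, of y] X Xt unfolding has_vector_derivative_iff_tendsto at[symmetric] tendsto_at_iff_sequentially dqR
      by (auto simp: o_def)
    have dq_le: "cmod (dq i y) \<le> C1" for i y
    proof -
      have "cmod (q (X i) y - q t y) \<le> C1 * \<bar>X i - t\<bar>"
      proof (rule vector_derivative_lipschitz[of ?S _ _ "\<lambda>s. q s y" "\<lambda>s. qt s y"])
        fix s assume s: "s \<in> ?S"
        hence sT: "\<bar>s\<bar> < T" by auto
        show "((\<lambda>s. q s y) has_vector_derivative qt s y) (at s)" by (rule q_time[OF sT])
        have "C1 / (1 + y\<^sup>2) \<le> C1" using divide_left_mono[of 1 "1 + y\<^sup>2" C1] C1 by simp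
        thus "cmod (qt s y) \<le> C1" using qt_bound[OF sT, of y] unfolding C1_def by linarith
      qed (use XT[of i] t in auto)
      thus ?thesis using XT(2)[of i] unfolding dq_def \<Delta>_def norm_divide norm_of_real
        by (simp add: pos_divide_le_eq)
    qed
    have dq_b: "bcont (dq i)" for i unfolding dq_def[abs_def] divide_inverse
      by (intro bcont_rules bcont_nice[OF q_nice] t XT)
    define \<alpha> where "\<alpha> i y = - l * (q (X i) y * (r (X i) y + r t y))" for i y
    have \<alpha>n: "nice (\<alpha> i)" for i unfolding \<alpha>_def[abs_def]
      by (intro nice_mult_right bcont_const nice_mult_left q_nice bcont_add r_facts t XT)
    have sum2: "cmod (r (X i) y + r t y) \<le> 2" for i y
      using norm_triangle_ineq[of "r (X i) y" "r t y"] r_facts(2)[OF t, of y] r_facts(2)[OF XT(1)[of i], of y] by linarith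
    define N where "N = (LINT y|lborel. cmod l * (B * (1 / (1 + y\<^sup>2)) * 2))"
    have \<alpha>N: "(LINT y|lborel. cmod (\<alpha> i y)) \<le> N" for i unfolding N_def
    proof (rule integral_mono)
      show "integrable lborel (\<lambda>y. cmod (\<alpha> i y))" by (rule nice_integrable[OF nice_norm[OF \<alpha>n]])
      show "integrable lborel (\<lambda>y. cmod l * (B * (1 / (1 + y\<^sup>2)) * 2))"
        by (intro integrable_mult_right integrable_mult_left integrable_inverse_square)
      show "cmod (\<alpha> i y) \<le> cmod l * (B * (1 / (1 + y\<^sup>2)) * 2)" for y
        unfolding \<alpha>_def norm_mult norm_minus_cancel using q_bound[OF XT(1)[of i], of y]
        by (intro mult_left_mono mult_mono sum2) (auto simp: B)
    qed
    define E where "E i y = (r (X i) y - r t y) / \<Delta> i" for i y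
    have Eb: "bcont (E i)" for i unfolding E_def[abs_def] divide_inverse by (intro bcont_rules r_facts t XT)
    define F where "F i y = - l * cnj (dq i y) - l * dq i y * (r t y)\<^sup>2" for i y
    have Fb: "bcont (F i)" for i unfolding F_def[abs_def] by (intro bcont_rules dq_b r_facts t)
    have r2: "cmod (r t y) ^ 2 \<le> 1" for y using r_facts(2)[OF t, of y] by (simp add: power_le_one)
    have Fle: "cmod (- l * cnj w - l * w * (r t y)\<^sup>2) \<le> cmod l * C1 + cmod l * C1 * 1" if "cmod w \<le> C1" for w y
      by (rule order_trans[OF norm_triangle_ineq4], unfold norm_mult complex_mod_cnj norm_power norm_minus_cancel)
        (intro add_mono mult_mono that r2; simp add: C1)
    have FC: "cmod (F i y) \<le> cmod l * C1 + cmod l * C1 * 1" for i y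
      unfolding F_def by (rule Fle[OF dq_le])
    have Eode: "(E i has_vector_derivative ((a + \<alpha> i y) * E i y + F i y)) (at y)" for i y
    proof -
      have "(E i has_vector_derivative ((2 * \<i> * l\<^sup>2 * r (X i) y - l * cnj (q (X i) y) - l * q (X i) y * (r (X i) y)\<^sup>2)
          - (2 * \<i> * l\<^sup>2 * r t y - l * cnj (q t y) - l * q t y * (r t y)\<^sup>2)) / \<Delta> i) (at y)"
        unfolding E_def[abs_def]
        by (intro bounded_linear.has_vector_derivative[OF bounded_linear_divide] has_vector_derivative_diff riccatiD(3) r t XT)
      moreover have "((2 * \<i> * l\<^sup>2 * r (X i) y - l * cnj (q (X i) y) - l * q (X i) y * (r (X i) y)\<^sup>2)
          - (2 * \<i> * l\<^sup>2 * r t y - l * cnj (q t y) - l * q t y * (r t y)\<^sup>2)) / \<Delta> i = (a + \<alpha> i y) * E i y + F i y"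
      proof -
        have c: "cnj (dq i y) = (cnj (q (X i) y) - cnj (q t y)) / \<Delta> i" by (simp add: dq_def \<Delta>_def)
        show ?thesis unfolding E_def F_def \<alpha>_def a_def c unfolding dq_def
          using \<Delta>0[of i] by (simp add: field_simps power2_eq_square)
      qed
      ultimately show ?thesis by simp
    qed
    \<comment> \<open>A uniform bound for the difference quotients comes before their limit: it
      yields continuity of \<open>r\<close> in time, which makes the sources of the final comparison
      tend to 0.\<close>
    define C where "C = exp (2 * N) * ((cmod l * C1 + cmod l * C1 * 1) / (- Re a))"
    have EC: "cmod (E i y) \<le> C" for i y unfolding C_def
      by (rule perturbed_sup[OF a \<alpha>n \<alpha>N Fb FC Eb Eode])
    have \<Delta>lim: "(\<lambda>i. K * cmod (\<Delta> i)) \<longlonglongrightarrow> 0" for K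
    proof -
      have "(\<lambda>i. K * cmod (complex_of_real (X i - t))) \<longlonglongrightarrow> K * cmod (complex_of_real (t - t))" by (intro tendsto_intros Xt)
      thus ?thesis by (simp add: \<Delta>_def)
    qed
    have rlim: "(\<lambda>i. r (X i) y) \<longlonglongrightarrow> r t y" for y
    proof (rule LIM_zero_cancel, rule Lim_null_comparison[OF always_eventually \<Delta>lim[of C]], rule allI)
      fix i
      have "r (X i) y - r t y = E i y * \<Delta> i" using \<Delta>0[of i] by (simp add: E_def)
      thus "cmod (r (X i) y - r t y) \<le> C * cmod (\<Delta> i)" by (simp add: norm_mult EC mult_right_mono)
    qed
    have qlim: "(\<lambda>i. q (X i) y) \<longlonglongrightarrow> q t y" for y
    proof (rule LIM_zero_cancel, rule Lim_null_comparison[OF always_eventually \<Delta>lim[of C1]], rule allI)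
      fix i
      have "q (X i) y - q t y = dq i y * \<Delta> i" using \<Delta>0[of i] by (simp add: dq_def)
      thus "cmod (q (X i) y - q t y) \<le> C1 * cmod (\<Delta> i)" by (simp add: norm_mult dq_le mult_right_mono)
    qed
    define G where "G = rdot_const"
    have G: "cmod (rdot t y) \<le> G" for y unfolding G_def by (rule rdot_facts(2)[OF t])
    have G0: "G \<ge> 0" using G[of 0] norm_ge_zero order_trans by blast
    let ?f = "\<lambda>i y. (\<alpha> i y - (- 2 * l * (q t y * r t y))) * rdot t y
      + (F i y - (- l * cnj (qt t y) - l * qt t y * (r t y)\<^sup>2))"
    have "(\<lambda>i. E i x - rdot t x) \<longlonglongrightarrow> 0"
    proof (rule perturbed_tendsto_zero[where d="\<lambda>i x. E i x - rdot t x" and f="?f", OF a \<alpha>n \<alpha>N])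
      show "bcont (\<lambda>x. E i x - rdot t x)" for i by (intro bcont_diff Eb rdot_facts t)
      show "((\<lambda>x. E i x - rdot t x) has_vector_derivative ((a + \<alpha> i x) * (E i x - rdot t x) + ?f i x)) (at x)" for i x
        by (rule has_vector_derivative_eq_rhs[OF has_vector_derivative_diff[OF Eode rdot_deriv[OF t]]])
          (simp add: a_def algebra_simps)
      show "bcont (?f i)" for i
        by (intro bcont_rules bcont_nice[OF \<alpha>n] bcont_nice[OF q_nice] bcont_nice[OF qt_nice] r_facts rdot_facts Fb t)
      show "cmod (?f i y) \<le> (cmod l * (B * 2) + 2 * cmod l * (B * 1)) * G
          + ((cmod l * C1 + cmod l * C1 * 1) + (cmod l * C1 + cmod l * C1 * 1))" for i y
      proof (rule order_trans[OF norm_triangle_ineq], rule add_mono)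
        have 1: "cmod (\<alpha> i y - (- 2 * l * (q t y * r t y))) \<le> cmod l * (B * 2) + 2 * cmod l * (B * 1)"
        proof (rule order_trans[OF norm_triangle_ineq4], rule add_mono)
          show "cmod (\<alpha> i y) \<le> cmod l * (B * 2)" unfolding \<alpha>_def norm_mult norm_minus_cancel
            using B by (intro mult_mono sum2 sup_bounds XT) auto
          show "cmod (- 2 * l * (q t y * r t y)) \<le> 2 * cmod l * (B * 1)" unfolding norm_mult norm_minus_cancel
            using B by (intro mult_mono r_facts sup_bounds t) auto
        qed
        show "cmod ((\<alpha> i y - (- 2 * l * (q t y * r t y))) * rdot t y) \<le> (cmod l * (B * 2) + 2 * cmod l * (B * 1)) * G"
          unfolding norm_mult[of _ "rdot t y"] using B by (intro mult_mono 1 G) auto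
        have "C1 / (1 + y\<^sup>2) \<le> C1" using divide_left_mono[of 1 "1 + y\<^sup>2" C1] C1 by simp
        hence "cmod (qt t y) \<le> C1" using qt_bound[OF t, of y] unfolding C1_def by linarith
        thus "cmod (F i y - (- l * cnj (qt t y) - l * qt t y * (r t y)\<^sup>2))
          \<le> (cmod l * C1 + cmod l * C1 * 1) + (cmod l * C1 + cmod l * C1 * 1)"
          by (intro order_trans[OF norm_triangle_ineq4] add_mono FC Fle)
      qed
      have "(\<lambda>i. ?f i y) \<longlonglongrightarrow> (- l * (q t y * (r t y + r t y)) - (- 2 * l * (q t y * r t y))) * rdot t y
          + ((- l * cnj (qt t y) - l * qt t y * (r t y)\<^sup>2) - (- l * cnj (qt t y) - l * qt t y * (r t y)\<^sup>2))" for y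
        unfolding \<alpha>_def F_def by (intro tendsto_intros rlim qlim dq_lim)
      moreover have "(- l * (q t y * (r t y + r t y)) - (- 2 * l * (q t y * r t y))) * rdot t y
          + ((- l * cnj (qt t y) - l * qt t y * (r t y)\<^sup>2) - (- l * cnj (qt t y) - l * qt t y * (r t y)\<^sup>2)) = 0" for y
        by (simp add: algebra_simps)
      ultimately show "(\<lambda>i. ?f i y) \<longlonglongrightarrow> 0" for y by simp
    qed
    hence "(\<lambda>i. E i x) \<longlonglongrightarrow> rdot t x" by (rule LIM_zero_cancel)
    moreover have "E i x = (r (X i) x - r t x) /\<^sub>R (X i - t)" for i
      by (simp add: E_def \<Delta>_def scaleR_conv_of_real divide_inverse mult.commute)
    ultimately show "((\<lambda>y. (r y x - r t x) /\<^sub>R (y - t)) \<circ> X) \<longlonglongrightarrow> rdot t x" by (simp add: o_def)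
  qed
qed

lemma flux_nice:
  assumes t: "\<bar>t\<bar> < T" shows "nice (flux t)"
proof -
  have "nice (\<lambda>x. \<i> * l\<^sup>2 * (q t x * cnj (q t x)) + 2 * l^3 * (q t x * r t x)
    + l * ((\<i> * p t x - (q t x * cnj (q t x)) * q t x) * r t x))"
    by (intro nice_add nice_diff nice_mult_right[OF bcont_const] nice_mult_left[OF _ bcont_nice[OF q_nice]] nice_mult_left[OF _ r_facts(1)]
        nice_mult_left[OF q_nice bcont_cnj[OF bcont_nice[OF q_nice]]] q_nice p_nice t)
  thus ?thesis unfolding flux_def[abs_def] by (simp add: mult.assoc)
qed

text \<open>Integration by parts moves the space derivative of the flux onto \<open>\<phi>\<close>,
  so the current appears with the weight \<open>\<eta>\<close>. The choice \<open>\<phi> = 1\<close>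
  gives the conserved integral.\<close>

lemma flux_law:
  assumes \<phi>: "bcont \<phi>" "\<And>x. (\<phi> has_real_derivative \<eta> x) (at x)" and \<eta>: "bcont \<eta>" and t: "\<bar>t\<bar> < T"
  shows "((\<lambda>t. LINT x|lborel. \<phi> x *\<^sub>R (l * (q t x * r t x))) has_vector_derivative
    - (LINT x|lborel. \<eta> x *\<^sub>R flux t x)) (at t)"
proof -
  obtain P where P: "P \<ge> 0" "\<And>x. \<bar>\<phi> x\<bar> \<le> P" using bcontE[OF \<phi>(1)] by auto
  let ?d = "\<lambda>t x. \<phi> x *\<^sub>R (l * (qt t x * r t x + q t x * rdot t x))"
  have "((\<lambda>t. LINT x|lborel. \<phi> x *\<^sub>R (l * (q t x * r t x))) has_vector_derivative (LINT x|lborel. ?d t x)) (at t)"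
  proof (rule leibniz_line[OF _ _ _ t])
    fix t x assume t: "\<bar>t\<bar> < T"
    show "((\<lambda>s. \<phi> x *\<^sub>R (l * (q s x * r s x))) has_vector_derivative ?d t x) (at t)"
      by (rule has_vector_derivative_eq_rhs[OF bounded_linear.has_vector_derivative[OF bounded_linear_scaleR_right
            bounded_linear.has_vector_derivative[OF bounded_linear_mult_right
              has_vector_derivative_mult[OF q_time[OF t] r_time[OF t]]]]])
        (simp add: add.commute)
    show "nice (\<lambda>x. \<phi> x *\<^sub>R (l * (q t x * r t x)))"
      by (intro nice_scaleR_left \<phi> nice_mult_right bcont_const nice_mult_left q_nice r_facts t)
    have "norm (?d t x) \<le> P * (cmod l * ((B + 3 * B * B * B) / (1 + x\<^sup>2) * 1 + B / (1 + x\<^sup>2) * rdot_const))"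
    proof -
      have "cmod (qt t x * r t x + q t x * rdot t x) \<le> (B + 3 * B * B * B) / (1 + x\<^sup>2) * 1 + B / (1 + x\<^sup>2) * rdot_const"
        by (rule order_trans[OF norm_triangle_ineq], unfold norm_mult)
          (intro add_mono mult_mono qt_bound r_facts q_bound rdot_facts t norm_ge_zero;
            use B_nonneg[OF t] in simp)
      thus ?thesis unfolding norm_scaleR norm_mult[of l] using P by (intro mult_mono P) auto
    qed
    also have "\<dots> = P * cmod l * (B + 3 * B * B * B + B * rdot_const) / (1 + x\<^sup>2)"
      by (simp add: add_divide_distrib algebra_simps)
    finally show "norm (?d t x) \<le> P * cmod l * (B + 3 * B * B * B + B * rdot_const) / (1 + x\<^sup>2)" .
  qed
  also have "(LINT x|lborel. ?d t x) = - (LINT x|lborel. \<eta> x *\<^sub>R flux t x)"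
  proof -
    have n1: "nice (?d t)"
      by (intro nice_scaleR_left \<phi> nice_mult_right nice_add bcont_const nice_mult_left q_nice qt_nice r_facts rdot_facts t)
    have n2: "nice (\<lambda>x. \<eta> x *\<^sub>R flux t x)" by (intro nice_scaleR_left \<eta> flux_nice t)
    have "(LINT x|lborel. ?d t x + \<eta> x *\<^sub>R flux t x) = 0"
      by (rule integral_derivative_nice[OF has_vector_derivative_scaleR[OF \<phi>(2) flux_deriv[OF t]]])
        (intro nice_add n1 n2 nice_scaleR_left \<phi> flux_nice t)+
    thus ?thesis using nice_integrable[OF n1] nice_integrable[OF n2] by (simp add: eq_neg_iff_add_eq_0)
  qed
  finally show ?thesis .
qed

lemma flux_conserved:
  assumes s: "\<bar>s\<bar> < T" and t: "\<bar>t\<bar> < T"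
  shows "(LINT x|lborel. l * (q s x * r s x)) = (LINT x|lborel. l * (q t x * r t x))"
proof -
  let ?F = "\<lambda>t. LINT x|lborel. 1 *\<^sub>R (l * (q t x * r t x))"
  let ?S = "{-T<..<T}"
  have d0: "(?F has_derivative (\<lambda>h. 0)) (at t within ?S)" if "t \<in> ?S" for t
  proof -
    have "(?F has_vector_derivative - (LINT x|lborel. 0 *\<^sub>R flux t x)) (at t)"
      by (rule flux_law[where \<phi>="\<lambda>x. 1" and \<eta>="\<lambda>x. 0"]) (use that in \<open>auto intro: bcont_const\<close>)
    hence "(?F has_vector_derivative 0) (at t)" by simp
    thus ?thesis unfolding has_vector_derivative_def scaleR_zero_right
      by (rule has_derivative_at_withinI)
  qed
  have "\<exists>c. \<forall>t\<in>?S. ?F t = c"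
    by (rule has_derivative_zero_constant[OF convex_real_interval(8) d0])
  then obtain c where c: "\<forall>t\<in>?S. ?F t = c" ..
  have st: "s \<in> ?S" "t \<in> ?S" using s t by auto
  have "?F s = ?F t" using bspec[OF c st(1)] bspec[OF c st(2)] by (rule trans[OF _ sym])
  thus ?thesis by simp
qed

end

end

section \<open>Square function bound over dyadic scales\<close>

text \<open>With truncated subtraction one of the exponents is 0, so the summand is \<open>2\<close>
  to the power \<open>- |i - j|\<close> and the full row has sum 3. The induction keeps the explicit
  tail, on either side of the diagonal.\<close>

lemma geometric_row_sum: "(\<Sum>j<J. (1/2::real) ^ (i - j) * (1/2) ^ (j - i)) \<le> 3"
proof -
  have "(\<Sum>j<J. (1/2::real) ^ (i - j) * (1/2) ^ (j - i)) \<le>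
    (if J \<le> i then 2 * (1/2) ^ (i + 1 - J) else 3 - (1/2) ^ (J - 1 - i))"
  proof (induction J)
    case (Suc J)
    consider "Suc J \<le> i" | "J = i" | "J > i" by linarith
    thus ?case
    proof cases
      case 1
      then obtain d where d: "i = Suc J + d" using le_Suc_ex by blast
      have "(1/2::real) ^ (i + 1 - J) = (1/2) ^ (Suc (Suc d))" "(1/2::real) ^ (i - J) = (1/2) ^ Suc d"
        "(1/2::real) ^ (i + 1 - Suc J) = (1/2) ^ Suc d" by (simp_all add: d)
      thus ?thesis using Suc.IH 1 by (simp add: field_simps)
    next
      case 2 thus ?thesis using Suc.IH by simp
    next
      case 3
      then obtain d where d: "J = Suc i + d" using less_imp_Suc_add by force
      let ?S = "\<Sum>j<J. (1/2::real) ^ (i - j) * (1/2) ^ (j - i)"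
      have nJ: "\<not> J \<le> i" "\<not> Suc J \<le> i" using 3 by auto
      have e: "i - J = 0" "J - i = Suc d" "J - 1 - i = d" "Suc J - 1 - i = Suc d" by (simp_all add: d)
      have S: "?S \<le> 3 - (1/2) ^ d" using Suc.IH unfolding if_not_P[OF nJ(1)] e .
      show ?thesis unfolding if_not_P[OF nJ(2)] sum.lessThan_Suc e power_0 power_Suc using S by linarith
    qed
  qed simp
  also have "\<dots> \<le> 3"
    using power_le_one[of "1/2::real" "i + 1 - J"] by auto
  finally show ?thesis .
qed

text \<open>Schur's test: \<open>b i * b j\<close> is at most half the sum of the squares, and the
  rows of the symmetric kernel sum to at most 3.\<close>

lemma schur_geometric:
  fixes b :: "nat \<Rightarrow> real"
  shows "(\<Sum>i<J. \<Sum>j<J. b i * b j * ((1/2) ^ (i - j) * (1/2) ^ (j - i))) \<le> 3 * (\<Sum>i<J. (b i)\<^sup>2)"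
proof -
  let ?g = "\<lambda>i j. (1/2::real) ^ (i - j) * (1/2) ^ (j - i)"
  have "(\<Sum>i<J. \<Sum>j<J. b i * b j * ?g i j) \<le> (\<Sum>i<J. \<Sum>j<J. ((b i)\<^sup>2 / 2 * ?g i j + (b j)\<^sup>2 / 2 * ?g j i))"
  proof (intro sum_mono)
    fix i j
    have "b i * b j \<le> (b i)\<^sup>2 / 2 + (b j)\<^sup>2 / 2"
      using sum_squares_bound[of "b i" "b j"] by (simp add: field_simps)
    hence "b i * b j * ?g i j \<le> ((b i)\<^sup>2 / 2 + (b j)\<^sup>2 / 2) * ?g i j" by (intro mult_right_mono) auto
    thus "b i * b j * ?g i j \<le> (b i)\<^sup>2 / 2 * ?g i j + (b j)\<^sup>2 / 2 * ?g j i"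
      by (simp only: distrib_right mult.commute[of "(1/2) ^ (j - i)"])
  qed
  also have "\<dots> = (\<Sum>i<J. \<Sum>j<J. (b i)\<^sup>2 / 2 * ?g i j) + (\<Sum>i<J. \<Sum>j<J. (b j)\<^sup>2 / 2 * ?g j i)"
    by (simp only: sum.distrib)
  also have "(\<Sum>i<J. \<Sum>j<J. (b j)\<^sup>2 / 2 * ?g j i) = (\<Sum>i<J. \<Sum>j<J. (b i)\<^sup>2 / 2 * ?g i j)"
    by (rule sum.swap)
  also have "(\<Sum>i<J. \<Sum>j<J. (b i)\<^sup>2 / 2 * ?g i j) + (\<Sum>i<J. \<Sum>j<J. (b i)\<^sup>2 / 2 * ?g i j)
     = (\<Sum>i<J. (b i)\<^sup>2 * (\<Sum>j<J. ?g i j))"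
    by (simp add: sum_distrib_left sum.distrib[symmetric])
  also have "\<dots> \<le> (\<Sum>i<J. (b i)\<^sup>2 * 3)"
    by (intro sum_mono mult_left_mono geometric_row_sum) auto
  finally show ?thesis by (simp add: sum_distrib_left mult.commute)
qed

text \<open>By symmetry \<open>a \<le> b\<close>: the product lives on \<open>y \<le> a\<close>,
  where the second kernel is largest if \<open>b\<close> is moved to \<open>a\<close>. The resulting
  bound is the same for all pairs of points.\<close>

lemma expker_correlation:
  assumes c: "c > 0" and d: "d > 0"
  shows "integrable lborel (\<lambda>y. expker c (a - y) * expker d (b - y))"
    "(LINT y|lborel. expker c (a - y) * expker d (b - y)) \<le> 1 / (c + d)"
proof -
  have main: "integrable lborel (\<lambda>y. expker c (a - y) * expker d (b - y)) \<and>
    (LINT y|lborel. expker c (a - y) * expker d (b - y)) \<le> 1 / (c + d)"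
    if c: "c > 0" and d: "d > 0" and ab: "a \<le> b" for c d a b
  proof -
    have cd: "c + d > 0" using c d by simp
    have i: "integrable lborel (\<lambda>y. expker (c + d) (a + (-1) * y))"
      by (rule lborel_integrable_real_affine[OF expker_integrable[OF cd]]) simp
    have le: "expker c (a - y) * expker d (b - y) \<le> expker (c + d) (a + (-1) * y)" for y
    proof (cases "y \<le> a")
      case True
      have "exp (- (c * (a - y))) * exp (- (d * (b - y))) \<le> exp (- (c * (a - y))) * exp (- (d * (a - y)))"
        using d ab by (intro mult_left_mono) auto
      also have "\<dots> = exp (- ((c + d) * (a - y)))" by (simp add: exp_add[symmetric] algebra_simps)
      finally show ?thesis using True ab by (simp add: expker_def)
    qed (simp add: expker_def)
    have I: "integrable lborel (\<lambda>y. expker c (a - y) * expker d (b - y))"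
      by (rule Bochner_Integration.integrable_bound[OF i])
        (use le in \<open>auto intro!: AE_I2 simp: expker_nonneg abs_mult\<close>)
    have "(LINT y|lborel. expker c (a - y) * expker d (b - y)) \<le> (LINT y|lborel. expker (c + d) (a + (-1) * y))"
      by (rule integral_mono[OF I i le])
    also have "\<dots> = 1 / (c + d)"
      using lborel_integral_real_affine[of "-1" "expker (c + d)" a] expker_integral[OF cd] by simp
    finally show ?thesis using I by simp
  qed
  show "integrable lborel (\<lambda>y. expker c (a - y) * expker d (b - y))"
    "(LINT y|lborel. expker c (a - y) * expker d (b - y)) \<le> 1 / (c + d)"
    using main[OF c d, of a b] main[OF d c, of b a] linear[of a b] by (auto simp: mult.commute add.commute)
qed

lemma nice_Cauchy_Schwarz:
  fixes f g :: "real \<Rightarrow> real"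
  assumes f: "nice f" and g: "nice g"
  shows "(LINT x|lborel. \<bar>f x * g x\<bar>) \<le> sqrt (sqint f) * sqrt (sqint g)"
proof -
  have "(LINT x|lborel. \<bar>f x * g x\<bar>) \<le> sqrt (LINT x|lborel. (f x)\<^sup>2) * sqrt (LINT x|lborel. (g x)\<^sup>2)"
    by (rule integral_Cauchy_Schwarz)
      (use nice_measurable[OF f] nice_measurable[OF g] sqint_integrable[OF f] sqint_integrable[OF g] in auto)
  thus ?thesis by (simp add: sqint_def)
qed

text \<open>A \<open>TT*\<close> argument: the functionals \<open>q \<mapsto> w\<^sub>j (x\<^sub>j)\<close> have correlations at most
  \<open>1 / (2 (k\<^sub>i + k\<^sub>j))\<close> wherever the points \<open>x\<^sub>j\<close> are.\<close>

lemma square_function_points: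
  fixes q :: "real \<Rightarrow> complex"
  assumes k: "k > 0" and q: "nice q"
  shows "(\<Sum>j<J. k * 4^j * (cmod (resolv (2 * (k * 4^j)) q (x j)))\<^sup>2) \<le> 3 / 2 * sqint q"
proof -
  define c where "c j = 2 * (k * 4^j)" for j :: nat
  have c: "c j > 0" for j using k by (simp add: c_def)
  define W where "W j = cmod (resolv (c j) q (x j))" for j
  have W0: "W j \<ge> 0" for j by (simp add: W_def)
  define E where "E j y = expker (c j) (x j - y)" for j y
  have E0: "E j y \<ge> 0" for j y by (simp add: E_def expker_nonneg)
  have Em[measurable]: "E j \<in> borel_measurable borel" for j unfolding E_def[abs_def] by measurable
  \<comment> \<open>The dual function: \<open>A\<close> is at most the integral of
    \<open>h |q|\<close>, while the integral of \<open>h^2\<close> is at most \<open>3/2 A\<close>.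
    Cauchy-Schwarz then bounds \<open>A\<close> in terms of its own square root.\<close>
  define h where "h y = (\<Sum>j<J. k * 4^j * W j * E j y)" for y
  have hm[measurable]: "h \<in> borel_measurable borel" unfolding h_def[abs_def] by measurable
  have h0: "h y \<ge> 0" for y unfolding h_def using k W0 E0 by (intro sum_nonneg mult_nonneg_nonneg) auto
  define A where "A = (\<Sum>j<J. k * 4^j * (W j)\<^sup>2)"
  have A0: "A \<ge> 0" unfolding A_def using k by (intro sum_nonneg) auto
  have nq: "nice (\<lambda>y. cmod (q y))" by (rule nice_norm[OF q])
  have qm[measurable]: "q \<in> borel_measurable borel" by (rule nice_measurable[OF q])
  have EE: "integrable lborel (\<lambda>y. E i y * E j y)" "(LINT y|lborel. E i y * E j y) \<le> 1 / (c i + c j)" for i j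
    unfolding E_def by (intro expker_correlation c)+
  have hsq: "(h y)\<^sup>2 = (\<Sum>i<J. \<Sum>j<J. (k * 4^i * W i) * (k * 4^j * W j) * (E i y * E j y))" for y
    unfolding h_def power2_eq_square sum_product by (intro sum.cong refl) (simp add: mult_ac)
  have h2: "integrable lborel (\<lambda>y. (h y)\<^sup>2)" unfolding hsq
    by (intro Bochner_Integration.integrable_sum integrable_mult_right EE)
  have h2le: "(LINT y|lborel. (h y)\<^sup>2) \<le> 3 / 2 * A"
  proof -
    have "(LINT y|lborel. (h y)\<^sup>2) = (\<Sum>i<J. \<Sum>j<J. (k * 4^i * W i) * (k * 4^j * W j) * (LINT y|lborel. E i y * E j y))"
      unfolding hsq by (subst Bochner_Integration.integral_sum, intro Bochner_Integration.integrable_sum integrable_mult_right EE)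
        (intro sum.cong refl, subst Bochner_Integration.integral_sum, auto intro!: integrable_mult_right EE)
    also have "\<dots> \<le> (\<Sum>i<J. \<Sum>j<J. (sqrt k * 2^i * W i) * (sqrt k * 2^j * W j) * ((1/2) ^ (i - j) * (1/2) ^ (j - i)) / 2)"
    proof (intro sum_mono)
      fix i j :: nat
      \<comment> \<open>Once \<open>2^i\<close> and \<open>2^j\<close> are distributed to the two
        coefficients, the correlation bound decays like \<open>2\<close> to the power
        \<open>- |i - j|\<close> off the diagonal.\<close>
      have g: "2^i * 2^j / (4^i + 4^j) \<le> (1/2::real) ^ (i - j) * (1/2) ^ (j - i)" for i j :: nat
      proof (cases "i \<le> j")
        case True
        then obtain d where d: "j = i + d" using le_Suc_ex by blast
        have "2^i * 2^j / (4^i + 4^j) \<le> 2^i * 2^j / (4^j::real)" by (intro divide_left_mono) (auto intro!: mult_pos_pos add_pos_pos)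
        also have "\<dots> = (1/2) ^ d"
        proof -
          have "(4::real)^i = 2^i * 2^i" "(4::real)^d = 2^d * 2^d" by (simp_all flip: power_mult_distrib)
          thus ?thesis by (simp add: d power_add field_simps)
        qed
        finally show ?thesis by (simp add: d)
      next
        case False
        then obtain d where d: "i = j + d" using le_Suc_ex nat_le_linear by blast
        have "2^i * 2^j / (4^i + 4^j) \<le> 2^i * 2^j / (4^i::real)" by (intro divide_left_mono) (auto intro!: mult_pos_pos add_pos_pos)
        also have "\<dots> = (1/2) ^ d"
        proof -
          have "(4::real)^j = 2^j * 2^j" "(4::real)^d = 2^d * 2^d" by (simp_all flip: power_mult_distrib)
          thus ?thesis by (simp add: d power_add field_simps)
        qed
        finally show ?thesis by (simp add: d)
      qed
      have p4: "(4::real)^i = 2^i * 2^i" for i :: nat by (simp flip: power_mult_distrib)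
      have "(k * 4^i * W i) * (k * 4^j * W j) * (LINT y|lborel. E i y * E j y)
        \<le> (k * 4^i * W i) * (k * 4^j * W j) * (1 / (c i + c j))"
        using k W0 by (intro mult_left_mono EE) auto
      also have "\<dots> = k * (2^i * W i) * (2^j * W j) * (2^i * 2^j / (4^i + 4^j)) / 2"
      proof -
        define D where "D = (4::real)^i + 4^j"
        have D: "D > 0" by (simp add: D_def add_pos_pos)
        have "c i + c j = 2 * k * D" by (simp add: c_def D_def algebra_simps)
        thus ?thesis unfolding D_def[symmetric] unfolding p4[of i] p4[of j] using k D by (simp add: field_simps)
      qed
      also have "\<dots> \<le> k * (2^i * W i) * (2^j * W j) * ((1/2) ^ (i - j) * (1/2) ^ (j - i)) / 2"
        using k W0 by (intro divide_right_mono mult_left_mono g) auto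
      also have "\<dots> = (sqrt k * 2^i * W i) * (sqrt k * 2^j * W j) * ((1/2) ^ (i - j) * (1/2) ^ (j - i)) / 2"
      proof -
        have "k * (2^i * W i) * (2^j * W j) * ((1/2) ^ (i - j) * (1/2) ^ (j - i)) / 2 =
          (sqrt k * sqrt k) * (2^i * W i) * (2^j * W j) * ((1/2) ^ (i - j) * (1/2) ^ (j - i)) / 2"
          using k by simp
        thus ?thesis by (simp only: mult_ac)
      qed
      finally show "(k * 4^i * W i) * (k * 4^j * W j) * (LINT y|lborel. E i y * E j y)
        \<le> (sqrt k * 2^i * W i) * (sqrt k * 2^j * W j) * ((1/2) ^ (i - j) * (1/2) ^ (j - i)) / 2" .
    qed
    also have "\<dots> = (\<Sum>i<J. \<Sum>j<J. (sqrt k * 2^i * W i) * (sqrt k * 2^j * W j) * ((1/2) ^ (i - j) * (1/2) ^ (j - i))) / 2"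
      by (simp only: sum_divide_distrib)
    also have "\<dots> \<le> 3 * (\<Sum>i<J. (sqrt k * 2^i * W i)\<^sup>2) / 2"
      by (intro divide_right_mono schur_geometric) auto
    also have "(\<Sum>i<J. (sqrt k * 2^i * W i)\<^sup>2) = A" unfolding A_def
    proof (intro sum.cong refl)
      fix j
      have "((2::real)^j)\<^sup>2 = 4^j" by (simp add: power2_eq_square flip: power_mult_distrib)
      thus "(sqrt k * 2^j * W j)\<^sup>2 = k * 4^j * (W j)\<^sup>2" using k by (simp add: power_mult_distrib)
    qed
    finally show ?thesis by simp
  qed
  have "A \<le> (LINT y|lborel. h y * cmod (q y))"
  proof -
    have Eq: "integrable lborel (\<lambda>y. E j y * cmod (q y))" "W j \<le> (LINT y|lborel. E j y * cmod (q y))" for j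
    proof -
      have i: "integrable lborel (\<lambda>s. expker (c j) s *\<^sub>R cmod (q (x j - s)))"
        by (rule resolv_integrable[OF c bcont_nice[OF nq]])
      from lborel_integrable_real_affine[OF i, of "-1" "x j"]
      show "integrable lborel (\<lambda>y. E j y * cmod (q y))" by (simp add: E_def)
      have "W j \<le> resolv (c j) (\<lambda>y. cmod (q y)) (x j)" unfolding W_def
        by (rule resolv_norm_le[OF c bcont_nice[OF q]])
      also have "\<dots> = (LINT y|lborel. E j y * cmod (q y))"
        using lborel_integral_real_affine[of "-1" "\<lambda>s. expker (c j) s *\<^sub>R cmod (q (x j - s))" "x j"]
        by (simp add: resolv_def E_def)
      finally show "W j \<le> (LINT y|lborel. E j y * cmod (q y))" .
    qed
    have "A \<le> (\<Sum>j<J. k * 4^j * W j * (LINT y|lborel. E j y * cmod (q y)))" unfolding A_def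
    proof (intro sum_mono)
      fix j
      have "k * 4^j * (W j)\<^sup>2 = k * 4^j * W j * W j" by (simp add: power2_eq_square)
      also have "\<dots> \<le> k * 4^j * W j * (LINT y|lborel. E j y * cmod (q y))"
        using k W0 by (intro mult_left_mono Eq) auto
      finally show "k * 4^j * (W j)\<^sup>2 \<le> k * 4^j * W j * (LINT y|lborel. E j y * cmod (q y))" .
    qed
    also have "\<dots> = (LINT y|lborel. (\<Sum>j<J. k * 4^j * W j * (E j y * cmod (q y))))"
      by (subst Bochner_Integration.integral_sum) (auto intro!: integrable_mult_right Eq)
    also have "\<dots> = (LINT y|lborel. h y * cmod (q y))"
      unfolding h_def by (simp add: sum_distrib_right mult.assoc)
    finally show ?thesis .
  qed
  also have "\<dots> = (LINT y|lborel. \<bar>h y * cmod (q y)\<bar>)" using h0 by (simp add: abs_mult)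
  also have "\<dots> \<le> sqrt (LINT y|lborel. (h y)\<^sup>2) * sqrt (LINT y|lborel. (cmod (q y))\<^sup>2)"
    by (rule integral_Cauchy_Schwarz) (use h2 sqint_integrable[OF q] in auto)
  also have "\<dots> \<le> sqrt (3 / 2 * A) * sqrt (sqint q)"
    unfolding sqint_def using h2le by (intro mult_right_mono) (auto intro!: integral_nonneg_AE)
  finally have "A \<le> sqrt (3 / 2 * A) * sqrt (sqint q)" .
  from power_mono[OF this A0, of 2] have "A\<^sup>2 \<le> 3 / 2 * A * sqint q"
    using A0 sqint_nonneg[of q] by (simp add: power_mult_distrib)
  hence "A * A \<le> A * (3 / 2 * sqint q)" by (simp add: power2_eq_square)
  hence "A \<le> 3 / 2 * sqint q"
    using A0 sqint_nonneg[of q] by (cases "A = 0") (auto simp: mult_le_cancel_left)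
  thus ?thesis by (simp add: A_def W_def c_def)
qed

section \<open>Uniform norms of the resolvent over the scales\<close>

definition wsup :: "real \<Rightarrow> (real \<Rightarrow> complex) \<Rightarrow> real" where
  "wsup k q = (SUP x. cmod (resolv (2 * k) q x))"

lemma wsup_upper:
  assumes k: "k > 0" and q: "nice q" shows "cmod (resolv (2 * k) q x) \<le> wsup k q"
proof -
  have c: "2 * k > 0" using k by simp
  show ?thesis unfolding wsup_def
    using resolv_sup[OF c q] by (intro cSUP_upper) (auto intro!: bdd_aboveI2)
qed

lemma wsup_nonneg: "k > 0 \<Longrightarrow> nice q \<Longrightarrow> wsup k q \<ge> 0"
  using order_trans[OF norm_ge_zero wsup_upper[of k q 0]] .

lemma wsup_le: "(\<And>x. cmod (resolv (2 * k) q x) \<le> C) \<Longrightarrow> wsup k q \<le> C"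
  unfolding wsup_def by (intro cSUP_least) auto

text \<open>At each scale choose a point where half of the supremum is reached; squaring costs the
  factor 4 that turns 3/2 into 6.\<close>

lemma square_function:
  assumes k: "k > 0" and q: "nice q"
  shows "(\<Sum>j<J. k * 4^j * (wsup (k * 4^j) q)\<^sup>2) \<le> 6 * sqint q"
proof -
  have kj: "k * 4^j > 0" for j :: nat using k by simp
  have "\<exists>x. wsup (k * 4^j) q \<le> 2 * cmod (resolv (2 * (k * 4^j)) q x)" for j
  proof (rule ccontr)
    assume "\<not> ?thesis"
    hence lt: "2 * cmod (resolv (2 * (k * 4^j)) q x) < wsup (k * 4^j) q" for x by (auto simp: not_le)
    have "wsup (k * 4^j) q \<le> wsup (k * 4^j) q / 2"
      by (rule wsup_le) (use lt in \<open>simp add: less_imp_le mult.commute\<close>)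
    moreover have "wsup (k * 4^j) q > 0" using lt[of 0] norm_ge_zero[of "resolv (2 * (k * 4^j)) q 0"] by linarith
    ultimately show False by simp
  qed
  then obtain x where x: "\<And>j. wsup (k * 4^j) q \<le> 2 * cmod (resolv (2 * (k * 4^j)) q (x j))" by metis
  have "(\<Sum>j<J. k * 4^j * (wsup (k * 4^j) q)\<^sup>2) \<le> (\<Sum>j<J. 4 * (k * 4^j * (cmod (resolv (2 * (k * 4^j)) q (x j)))\<^sup>2))"
  proof (intro sum_mono)
    fix j
    have "(wsup (k * 4^j) q)\<^sup>2 \<le> (2 * cmod (resolv (2 * (k * 4^j)) q (x j)))\<^sup>2"
      by (rule power_mono[OF x wsup_nonneg[OF kj q]])
    from mult_left_mono[OF this less_imp_le[OF kj[of j]]]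
    show "k * 4^j * (wsup (k * 4^j) q)\<^sup>2 \<le> 4 * (k * 4^j * (cmod (resolv (2 * (k * 4^j)) q (x j)))\<^sup>2)"
      by (simp add: power_mult_distrib mult_ac)
  qed
  also have "\<dots> \<le> 4 * (3 / 2 * sqint q)"
    unfolding sum_distrib_left[symmetric] by (intro mult_left_mono square_function_points k q) auto
  finally show ?thesis by simp
qed

text \<open>Pigeonhole: if all \<open>J\<close> scales were bad, the square function would exceed
  \<open>J e^2\<close>. The scale depends on \<open>q\<close>, but the number of candidates only on
  its mass.\<close>

lemma good_scale_exists:
  assumes k: "k > 0" and q: "nice q" and J: "6 * sqint q \<le> real J * e\<^sup>2" "J > 0" and e: "e \<ge> 0"
  obtains j where "j < J" "\<And>x. sqrt (k * 4^j) * cmod (resolv (2 * (k * 4^j)) q x) \<le> e"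
proof -
  have kj: "k * 4^j > 0" for j :: nat using k by simp
  have "\<exists>j<J. k * 4^j * (wsup (k * 4^j) q)\<^sup>2 \<le> e\<^sup>2"
  proof (rule ccontr)
    assume "\<not> ?thesis"
    hence "(\<Sum>j<J. e\<^sup>2) < (\<Sum>j<J. k * 4^j * (wsup (k * 4^j) q)\<^sup>2)"
      using J(2) by (intro sum_strict_mono) (auto simp: not_le)
    thus False using square_function[OF k q, of J] J(1) by simp
  qed
  then obtain j where j: "j < J" "k * 4^j * (wsup (k * 4^j) q)\<^sup>2 \<le> e\<^sup>2" by blast
  have "sqrt (k * 4^j) * cmod (resolv (2 * (k * 4^j)) q x) \<le> e" for x
  proof -
    have "sqrt (k * 4^j) * cmod (resolv (2 * (k * 4^j)) q x) \<le> sqrt (k * 4^j) * wsup (k * 4^j) q"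
      using kj[of j] by (intro mult_left_mono wsup_upper[OF kj q]) auto
    also have "\<dots> = sqrt (k * 4^j * (wsup (k * 4^j) q)\<^sup>2)"
      using wsup_nonneg[OF kj[of j] q] by (simp add: real_sqrt_mult)
    also have "\<dots> \<le> sqrt (e\<^sup>2)" by (rule real_sqrt_le_mono[OF j(2)])
    also have "\<dots> = e" using e by simp
    finally show ?thesis .
  qed
  with j(1) that show ?thesis by blast
qed

section \<open>Propagation of equicontinuity\<close>

text \<open>The squared norm of the derivative of \<open>R_k q\<close>, with Fourier multiplier
  \<open>\<xi>^2 / (4 k^2 + \<xi>^2)\<close>: the mass at frequencies above
  \<open>k\<close>.\<close>

definition high :: "real \<Rightarrow> (real \<Rightarrow> complex) \<Rightarrow> real" where
  "high k q = sqint (\<lambda>x. q x - 2 * k * resolv (2 * k) q x)"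

lemma sqint_resolv_le:
  fixes f :: "real \<Rightarrow> 'a::euclidean_space"
  assumes c: "c > 0" and f: "nice f"
  shows "sqint (resolv c f) \<le> sqint f / c\<^sup>2"
proof -
  note n = nice_sq[OF f]
  have "sqint (resolv c f) \<le> (LINT x|lborel. resolv c (\<lambda>y. (norm (f y))\<^sup>2) x / c)"
    unfolding sqint_def
    by (rule integral_mono[OF sqint_integrable[OF resolv_nice[OF c f]] _ resolv_sq_le[OF c bcont_nice[OF f]]])
      (intro integrable_divide nice_integrable resolv_nice c n)
  also have "\<dots> = sqint f / c\<^sup>2"
    using resolv_integral[OF c n] c by (simp add: sqint_def power2_eq_square field_simps)
  finally show ?thesis .
qed

lemma high_eq:
  assumes k: "k > 0" and q: "nice q"
  shows "high k q = sqint q - (2 * k)\<^sup>2 * sqint (resolv (2 * k) q)"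
  using resolv_energy[of "2 * k" q] k q by (simp add: high_def)

text \<open>Split \<open>q\<close> into \<open>g = 2 k R_k q\<close> and the rest. As
  \<open>|g| \<le> sqrt (k M)\<close>, the first part contributes at most
  \<open>sqrt (k M) / (2 sqrt k') \<le> e / 2\<close>; the rest has \<open>L^2\<close> norm at most
  \<open>e\<close> and contributes at most \<open>e / 2\<close> by
  \<open>resolv_sup\<close>.\<close>

lemma good_of_high:
  assumes k: "k > 0" and k': "k' > 0" and q: "nice q" and e: "e > 0" and M: "sqint q \<le> M"
    and h: "high k q \<le> e\<^sup>2" and kk': "k * M \<le> e\<^sup>2 * k'"
  shows "sqrt k' * cmod (resolv (2 * k') q x) \<le> e"
proof -
  have c: "2 * k > 0" "2 * k' > 0" using k k' by auto
  define g where "g y = 2 * k * resolv (2 * k) q y" for y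
  have gn: "nice g" unfolding g_def[abs_def] by (intro nice_mult_right bcont_rules resolv_nice c q)
  have hn: "nice (\<lambda>y. q y - g y)" by (intro nice_diff q gn)
  have M0: "M \<ge> 0" using sqint_nonneg[of q] M by linarith
  have "resolv (2 * k') q x = resolv (2 * k') (\<lambda>y. g y + (q y - g y)) x" by simp
  also have "\<dots> = resolv (2 * k') g x + resolv (2 * k') (\<lambda>y. q y - g y) x"
    by (intro resolv_add c bcont_nice gn hn)
  finally have "cmod (resolv (2 * k') q x) \<le> cmod (resolv (2 * k') g x) + cmod (resolv (2 * k') (\<lambda>y. q y - g y) x)"
    by (simp add: norm_triangle_ineq)
  moreover have "cmod (resolv (2 * k') g x) \<le> sqrt (k * M) / (2 * k')"
  proof (rule resolv_le_const[OF c(2) bcont_nice[OF gn]])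
    fix y
    have "cmod (resolv (2 * k) q y) \<le> sqrt (sqint q / (2 * (2 * k)))" by (rule resolv_sup[OF c(1) q])
    also have "\<dots> \<le> sqrt (M / (4 * k))" using M k by (intro real_sqrt_le_mono) (simp add: divide_right_mono)
    finally have "cmod (g y) \<le> 2 * k * sqrt (M / (4 * k))" using k by (simp add: g_def norm_mult)
    also have "\<dots> = sqrt ((2 * k)\<^sup>2 * (M / (4 * k)))" using k by (simp only: real_sqrt_mult real_sqrt_abs)
    also have "(2 * k)\<^sup>2 * (M / (4 * k)) = k * M" using k by (simp add: power2_eq_square)
    finally show "cmod (g y) \<le> sqrt (k * M)" .
  qed
  moreover have "cmod (resolv (2 * k') (\<lambda>y. q y - g y) x) \<le> e / (2 * sqrt k')"
  proof -
    have "cmod (resolv (2 * k') (\<lambda>y. q y - g y) x) \<le> sqrt (sqint (\<lambda>y. q y - g y) / (2 * (2 * k')))"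
      by (rule resolv_sup[OF c(2) hn])
    also have "\<dots> \<le> sqrt (e\<^sup>2 / (4 * k'))"
      using h k' by (intro real_sqrt_le_mono) (simp add: high_def g_def divide_right_mono)
    also have "\<dots> = e / (2 * sqrt k')" using e by (simp add: real_sqrt_divide real_sqrt_mult)
    finally show ?thesis .
  qed
  ultimately have "sqrt k' * cmod (resolv (2 * k') q x) \<le> sqrt k' * (sqrt (k * M) / (2 * k') + e / (2 * sqrt k'))"
    using k' by (intro mult_left_mono) auto
  also have "\<dots> = sqrt (k * M) / (2 * sqrt k') + e / 2"
  proof -
    have s: "sqrt k' * sqrt k' = k'" "sqrt k' > 0" using k' by auto
    have "s * (X / (2 * (s * s)) + e / (2 * s)) = X / (2 * s) + e / 2" if "s > 0" for s X :: real
      using that by (simp add: field_simps)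
    from this[OF s(2), of "sqrt (k * M)"] show ?thesis unfolding s(1) .
  qed
  also have "\<dots> \<le> e"
  proof -
    have "sqrt (k * M) \<le> sqrt (e\<^sup>2 * k')" by (rule real_sqrt_le_mono[OF kk'])
    also have "\<dots> = e * sqrt k'" using e by (simp add: real_sqrt_mult)
    finally show ?thesis using k' by (simp add: field_simps)
  qed
  finally show ?thesis .
qed

text \<open>To leading order \<open>lam k q r\<close> is \<open>- \<i> k q cnj w\<close> with
  \<open>w = R_k q\<close>, and the real part of the integral of \<open>q cnj w\<close> is
  \<open>2 k sqint w\<close> because \<open>q - 2 k w\<close> is the derivative of \<open>w\<close>.
  So twice the imaginary part is minus the low-frequency mass, up to the cubic part \<open>v\<close>
  of the solution.\<close>

lemma action_estimate:
  assumes k: "k > 0" and q: "nice q" and r: "riccati (lam k) q r" and e: "e \<ge> 0" "\<And>x. cmod (r x) \<le> 2 * e"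
  shows "\<bar>2 * Im (LINT x|lborel. lam k * (q x * r x)) + sqint q - high k q\<bar> \<le> 4 * e\<^sup>2 * sqint q"
proof -
  have c: "2 * k > 0" using k by simp
  note bq = bcont_nice[OF q] and nr = riccati_nice[OF lam_simps(1,2)[OF k] q r]
  define w where "w = resolv (2 * k) q"
  define v where "v = resolv (2 * k) (\<lambda>y. q y * (r y)\<^sup>2)"
  have wn: "nice w" unfolding w_def by (intro resolv_nice c q)
  have n2: "nice (\<lambda>y. q y * (r y)\<^sup>2)" by (intro nice_mult_left q bcont_rules bcont_nice[OF nr])
  have vn: "nice v" unfolding v_def by (intro resolv_nice c n2)
  have "2 * \<i> * (lam k)\<^sup>2 = complex_of_real (- (2 * k))"
    by (simp add: lam_simps[OF k] complex_eq_iff)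
  hence "r x = resolv (2 * k) (\<lambda>y. (- lam k) * (cnj (q y) + q y * (r y)\<^sup>2)) x" for x
    using riccati_lsol[OF lam_simps(1,2)[OF k] q r, of x] by (simp only: lsol_real) (simp only: ring_distribs mult.assoc minus_mult_left add_uminus_conv_diff[symmetric])
  also have "resolv (2 * k) (\<lambda>y. (- lam k) * (cnj (q y) + q y * (r y)\<^sup>2)) x = (- lam k) * (cnj (w x) + v x)" for x
    using resolv_cmult[OF c bcont_add[OF bcont_cnj[OF bq] bcont_nice[OF n2]], of "- lam k" x]
      resolv_add[OF c bcont_cnj[OF bq] bcont_nice[OF n2], of x] resolv_linear[OF bounded_linear_cnj c bq, of x]
    by (simp add: w_def v_def)
  finally have rx: "r x = (- lam k) * (cnj (w x) + v x)" for x .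
  have eq: "lam k * (q x * r x) = - (\<i> * k) * (q x * cnj (w x)) + - (\<i> * k) * (q x * v x)" for x
  proof -
    have "lam k * (q x * r x) = - (lam k)\<^sup>2 * (q x * (cnj (w x) + v x))"
      by (simp only: rx power2_eq_square) (simp add: algebra_simps)
    thus ?thesis unfolding lam_simps(3)[OF k] by (simp add: algebra_simps)
  qed
  have i1: "integrable lborel (\<lambda>x. q x * cnj (w x))" by (intro nice_integrable nice_mult_left q bcont_cnj bcont_nice wn)
  have i2: "integrable lborel (\<lambda>x. q x * v x)" by (intro nice_integrable nice_mult_left q bcont_nice vn)
  have "(LINT x|lborel. lam k * (q x * r x)) = - (\<i> * k) * (LINT x|lborel. q x * cnj (w x)) + - (\<i> * k) * (LINT x|lborel. q x * v x)"
    unfolding eq using i1 i2 by (simp del: mult_minus_left)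
  hence Im: "Im (LINT x|lborel. lam k * (q x * r x)) = - k * Re (LINT x|lborel. q x * cnj (w x)) - k * Re (LINT x|lborel. q x * v x)"
    by simp
  have "Re (LINT x|lborel. q x * cnj (w x)) = 2 * k * sqint w"
  proof -
    have d: "(w has_vector_derivative (q x - 2 * k * w x)) (at x)" for x
      using resolv_deriv[OF c bq, of x] by (simp add: w_def scaleR_conv_of_real)
    have n: "nice (\<lambda>x. 2 * Re (cnj (w x) * (q x - 2 * k * w x)))"
      by (intro nice_mult_right bcont_rules nice_Re bcont_cnj bcont_nice[OF wn] nice_diff q wn)
    have z: "(LINT x|lborel. 2 * Re (cnj (w x) * (q x - 2 * k * w x))) = 0"
      by (rule integral_derivative_nice[OF has_vector_derivative_norm_sq[OF d] n nice_sq[OF wn]])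
    have "Re (q x * cnj (w x)) = 2 * k * (cmod (w x))\<^sup>2 + (1/2) * (2 * Re (cnj (w x) * (q x - 2 * k * w x)))" for x
      unfolding cmod_power2 by (simp add: power2_eq_square algebra_simps)
    hence "(LINT x|lborel. Re (q x * cnj (w x))) = (LINT x|lborel. 2 * k * (cmod (w x))\<^sup>2 + (1/2) * (2 * Re (cnj (w x) * (q x - 2 * k * w x))))"
      by (rule Bochner_Integration.integral_cong[OF refl])
    also have "\<dots> = (LINT x|lborel. 2 * k * (cmod (w x))\<^sup>2) + (LINT x|lborel. (1/2) * (2 * Re (cnj (w x) * (q x - 2 * k * w x))))"
      by (intro Bochner_Integration.integral_add integrable_mult_right sqint_integrable wn nice_integrable[OF n])
    also have "\<dots> = 2 * k * sqint w + (1/2) * (LINT x|lborel. 2 * Re (cnj (w x) * (q x - 2 * k * w x)))"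
      by (simp only: integral_mult_right_zero sqint_def)
    finally show ?thesis unfolding z using integral_Re[OF i1] by simp
  qed
  moreover have "\<bar>k * Re (LINT x|lborel. q x * v x)\<bar> \<le> 2 * e\<^sup>2 * sqint q"
  proof -
    have vle: "cmod (v x) \<le> 4 * e\<^sup>2 * resolv (2 * k) (\<lambda>y. cmod (q y)) x" for x
    proof -
      have "cmod (v x) \<le> resolv (2 * k) (\<lambda>y. cmod (q y * (r y)\<^sup>2)) x" unfolding v_def
        by (rule resolv_norm_le[OF c bcont_nice[OF n2]])
      also have "\<dots> \<le> resolv (2 * k) (\<lambda>y. 4 * e\<^sup>2 * cmod (q y)) x"
      proof (intro resolv_mono c bcont_norm bcont_nice[OF n2] bcont_mult bcont_const bq)
        fix y
        from power_mono[OF e(2)[of y], of 2] have "(cmod (r y))\<^sup>2 \<le> 4 * e\<^sup>2" by (simp add: power_mult_distrib)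
        thus "cmod (q y * (r y)\<^sup>2) \<le> 4 * e\<^sup>2 * cmod (q y)"
          by (simp add: norm_mult norm_power mult.commute[of "4 * e\<^sup>2"] mult_left_mono)
      qed
      also have "\<dots> = 4 * e\<^sup>2 * resolv (2 * k) (\<lambda>y. cmod (q y)) x" by (intro resolv_cmult c bcont_norm bq)
      finally show ?thesis .
    qed
    have nq: "nice (\<lambda>y. cmod (q y))" by (rule nice_norm[OF q])
    note nR = resolv_nice[OF c nq]
    have "\<bar>Re (LINT x|lborel. q x * v x)\<bar> \<le> cmod (LINT x|lborel. q x * v x)" by (rule abs_Re_le_cmod)
    also have "\<dots> \<le> (LINT x|lborel. cmod (q x * v x))" by (rule integral_norm_bound)
    also have "\<dots> \<le> (LINT x|lborel. 4 * e\<^sup>2 * \<bar>cmod (q x) * resolv (2 * k) (\<lambda>y. cmod (q y)) x\<bar>)"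
    proof (rule integral_mono)
      show "integrable lborel (\<lambda>x. cmod (q x * v x))" by (rule integrable_norm[OF i2])
      show "integrable lborel (\<lambda>x. 4 * e\<^sup>2 * \<bar>cmod (q x) * resolv (2 * k) (\<lambda>y. cmod (q y)) x\<bar>)"
        by (intro integrable_mult_right integrable_abs nice_integrable nice_mult_left nq bcont_nice[OF nR])
      fix x
      have "resolv (2 * k) (\<lambda>y. cmod (q y)) x \<ge> 0" by (intro resolv_nonneg) simp
      thus "cmod (q x * v x) \<le> 4 * e\<^sup>2 * \<bar>cmod (q x) * resolv (2 * k) (\<lambda>y. cmod (q y)) x\<bar>"
        using mult_left_mono[OF vle[of x], of "cmod (q x)"] by (simp add: norm_mult abs_mult mult_ac)
    qed
    also have "\<dots> = 4 * e\<^sup>2 * (LINT x|lborel. \<bar>cmod (q x) * resolv (2 * k) (\<lambda>y. cmod (q y)) x\<bar>)" by simp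
    also have "\<dots> \<le> 4 * e\<^sup>2 * (sqrt (sqint q) * sqrt (sqint q / (2 * k)\<^sup>2))"
    proof (intro mult_left_mono)
      have "(LINT x|lborel. \<bar>cmod (q x) * resolv (2 * k) (\<lambda>y. cmod (q y)) x\<bar>) \<le> sqrt (sqint (\<lambda>x. cmod (q x))) * sqrt (sqint (resolv (2 * k) (\<lambda>y. cmod (q y))))"
        by (rule nice_Cauchy_Schwarz[OF nq nR])
      also have "\<dots> \<le> sqrt (sqint q) * sqrt (sqint q / (2 * k)\<^sup>2)"
        using sqint_resolv_le[OF c nq] by (intro mult_mono real_sqrt_le_mono) (auto simp: sqint_def intro!: integral_nonneg_AE)
      finally show "(LINT x|lborel. \<bar>cmod (q x) * resolv (2 * k) (\<lambda>y. cmod (q y)) x\<bar>) \<le> sqrt (sqint q) * sqrt (sqint q / (2 * k)\<^sup>2)" .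
    qed simp
    also have "\<dots> = 2 * e\<^sup>2 * sqint q / k"
    proof -
      have "sqrt (sqint q / (2 * k)\<^sup>2) = sqrt (sqint q) / (2 * k)"
        using k by (simp only: real_sqrt_divide real_sqrt_abs)
      thus ?thesis using k sqint_nonneg[of q] by simp
    qed
    finally have "k * \<bar>Re (LINT x|lborel. q x * v x)\<bar> \<le> k * (2 * e\<^sup>2 * sqint q / k)" using k by (intro mult_left_mono) auto
    thus ?thesis using k by (simp add: abs_mult)
  qed
  moreover have "high k q = sqint q - 4 * k\<^sup>2 * sqint w"
    using high_eq[OF k q] by (simp add: w_def power_mult_distrib)
  ultimately show ?thesis unfolding Im by (simp add: power2_eq_square algebra_simps)
qed

context dnls_flow
begin

lemma action_transfer:
  assumes T: "T > 0" and t: "\<bar>t\<bar> < T" and k: "k > 0" and e: "e \<ge> 0" "148 * (1 + sqint (q t)) * e \<le> 1"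
    and g0: "\<And>x. sqrt k * cmod (resolv (2 * k) (q 0) x) \<le> e"
    and gt: "\<And>x. sqrt k * cmod (resolv (2 * k) (q t) x) \<le> e"
    and r0: "riccati (lam k) (q 0) r0" and rt: "riccati (lam k) (q t) rt"
  shows "(LINT x|lborel. lam k * (q 0 x * r0 x)) = (LINT x|lborel. lam k * (q t x * rt x))"
proof -
  \<comment> \<open>An intersection of half-planes and a disc, hence connected, on which
    \<open>riccati_good_scale\<close> applies at both times. It contains \<open>lam k\<close>, and
    its closure meets the imaginary axis, near which \<open>riccati_near_axis\<close> takes
    over.\<close>
  define S where "S = {l. Re l > 0 \<and> Im l > sqrt k / 2 \<and> cmod l < 2 * sqrt k}"
  have zero: "\<bar>0\<bar> < T" using T by simp
  have M: "sqint (q 0) = sqint (q t)" by (rule mass_conserved[OF zero t])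
  have sk: "sqrt k > 0" using k by simp
  have quad: "Re l > 0 \<and> Im l > 0" if "l \<in> S" for l
  proof -
    have "Re l > 0" "Im l > sqrt k / 2" using that by (auto simp: S_def)
    thus ?thesis using sk by linarith
  qed
  \<comment> \<open>One choice function for all times and parameters, so that near the axis it
    coincides with the family to which \<open>flux_conserved\<close> is applied.\<close>
  define sol where "sol s l = (SOME r. riccati l (q s) r)" for s l
  have sol: "riccati l (q s) (sol s l)" if "l \<in> S" "s = 0 \<or> s = t" for s l
  proof -
    have s: "\<bar>s\<bar> < T" "148 * (1 + sqint (q s)) * e \<le> 1" "sqrt k * cmod (resolv (2 * k) (q s) x) \<le> e" for x
      using that(2) t zero e(2) M g0[of x] gt[of x] by auto
    have "\<exists>r. riccati l (q s) r"
      by (rule riccati_good_scale[OF k q_nice[OF s(1)] _ _ _ e(1) s(2) s(3)])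
        (use that(1) in \<open>auto simp: S_def\<close>)
    thus ?thesis unfolding sol_def by (rule someI_ex)
  qed
  define N where "N = (LINT x|lborel. B * (1 / (1 + x\<^sup>2)))"
  have N: "(LINT x|lborel. cmod (q s x)) \<le> N" if "\<bar>s\<bar> < T" for s unfolding N_def
    by (rule integral_mono[OF nice_integrable[OF nice_norm[OF q_nice[OF that]]]])
      (intro integrable_mult_right integrable_inverse_square, use q_bound[OF that] in simp)
  have "0 \<le> (LINT x|lborel. cmod (q 0 x))" by (intro integral_nonneg_AE) auto
  hence N0: "N \<ge> 0" using N[OF zero] by linarith
  define K where "K = 4 * exp (2 * (2 * sqrt k) * N) * N"
  have K0: "K \<ge> 0" using N0 by (simp add: K_def)
  \<comment> \<open>\<open>N\<close> bounds the \<open>L^1\<close> norm of \<open>q\<close> at all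
    times, so this is a strip next to the axis in which solutions exist at all times. Its width may
    depend on \<open>B\<close>, since analytic continuation accepts an open set of any size.\<close>
  define S' where "S' = S \<inter> {l. Re l * K < 1}"
  define L where "L s l = (LINT x|lborel. l * (q s x * sol s l x))" for s l
  have "L 0 (lam k) = L t (lam k)"
  proof (rule analytic_continuation_open[of S' S "L 0" "L t"])
    have S_eq: "S = {l. Re l > 0} \<inter> {l. Im l > sqrt k / 2} \<inter> ball 0 (2 * sqrt k)" by (auto simp: S_def)
    have opS: "open S" unfolding S_eq by (intro open_Int open_halfspace_Re_gt open_halfspace_Im_gt open_ball)
    thus "open S" .
    have "open {l. Re l * K < 1}" by (intro open_Collect_less continuous_intros)
    thus "open S'" unfolding S'_def by (intro open_Int opS)
    show "connected S" unfolding S_eq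
      by (intro convex_connected convex_Int convex_halfspace_Re_gt convex_halfspace_Im_gt convex_ball)
    show "S' \<subseteq> S" by (auto simp: S'_def)
    show "L 0 holomorphic_on S" "L t holomorphic_on S" unfolding L_def[abs_def]
      by (rule riccati_holomorphic[OF opS q_nice]; use zero t quad sol in auto)+
    show "lam k \<in> S" using lam_simps[OF k] sk by (simp add: S_def)
    show "S' \<noteq> {}"
    proof -
      define m where "m = min (sqrt k / 2) (1 / (2 * (K + 1)))"
      have m: "m > 0" "m \<le> sqrt k / 2" using sk K0 by (auto simp: m_def)
      have mK: "m * K < 1"
      proof -
        have "m * K \<le> 1 / (2 * (K + 1)) * K" using K0 by (intro mult_right_mono) (auto simp: m_def)
        also have "\<dots> < 1" using K0 by (simp add: field_simps)
        finally show ?thesis .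
      qed
      have "cmod (Complex m (sqrt k)) \<le> m + sqrt k" using cmod_le[of "Complex m (sqrt k)"] m sk by simp
      hence "cmod (Complex m (sqrt k)) < 2 * sqrt k" using m sk by linarith
      hence "Complex m (sqrt k) \<in> S'" using m sk mK by (simp add: S'_def S_def)
      thus ?thesis by blast
    qed
    fix l assume l': "l \<in> S'"
    hence l: "l \<in> S" "Re l * K < 1" by (auto simp: S'_def)
    have ex: "\<exists>r. riccati l (q s) r" if s: "\<bar>s\<bar> < T" for s
    proof (rule riccati_near_axis[OF _ _ q_nice[OF s] N[OF s]])
      have "Im l \<le> 2 * sqrt k" using l(1) abs_Im_le_cmod[of l] by (auto simp: S_def)
      hence "exp (2 * Im l * N) \<le> exp (2 * (2 * sqrt k) * N)" using N0 by (simp add: mult_right_mono)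
      hence "4 * Re l * exp (2 * Im l * N) * N \<le> 4 * Re l * exp (2 * (2 * sqrt k) * N) * N"
        using quad[OF l(1)] N0 by (intro mult_right_mono mult_left_mono) auto
      also have "\<dots> = Re l * K" by (simp add: K_def)
      finally show "4 * Re l * exp (2 * Im l * N) * N < 1" using l(2) by linarith
    qed (use quad[OF l(1)] in auto)
    define r where "r s = (SOME r. riccati l (q s) r)" for s
    have r: "riccati l (q s) (r s)" if "\<bar>s\<bar> < T" for s unfolding r_def by (rule someI_ex[OF ex[OF that]])
    have "(LINT x|lborel. l * (q 0 x * r 0 x)) = (LINT x|lborel. l * (q t x * r t x))"
      by (rule flux_conserved[where r=r]) (use quad[OF l(1)] r zero t in auto)
    thus "L 0 l = L t l" by (simp add: L_def sol_def r_def)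
  qed
  moreover have "lam k \<in> S" using lam_simps[OF k] sk by (simp add: S_def)
  ultimately show ?thesis unfolding L_def
    using riccati_unique[OF lam_simps(1,2)[OF k] q_nice[OF zero] r0 sol[of "lam k" 0]]
      riccati_unique[OF lam_simps(1,2)[OF k] q_nice[OF t] rt sol[of "lam k" t]] by simp
qed

end

text \<open>The good scale at time \<open>t\<close> is one of the \<open>J\<close> candidates
  \<open>K1 * 4^j\<close>, and \<open>K1\<close> and \<open>J\<close> depend only on
  \<open>e\<close>, \<open>M\<close> and \<open>Q\<close>. \<open>K1\<close> is so large that all
  candidates are good at time 0. Equality of the actions at the two times then bounds the
  high-frequency mass at time \<open>t\<close>, and \<open>good_of_high\<close> passes from that
  scale to every \<open>k \<ge> K\<close>.\<close>

lemma equicontinuity_propagates: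
  assumes M: "M \<ge> 1" "\<And>f. f \<in> Q \<Longrightarrow> sqint f \<le> M"
    and eq: "\<And>\<eta>. \<eta> > 0 \<Longrightarrow> \<exists>K>0. \<forall>k\<ge>K. \<forall>f\<in>Q. high k f \<le> \<eta>" and e: "0 < e" "e \<le> 1"
  shows "\<exists>K>0. \<forall>q p z T B. dnls_flow q p z T B \<longrightarrow> T > 0 \<longrightarrow> q 0 \<in> Q \<longrightarrow>
    (\<forall>t k x. \<bar>t\<bar> < T \<longrightarrow> k \<ge> K \<longrightarrow> sqrt k * cmod (resolv (2 * k) (q t) x) \<le> e)"
proof -
  \<comment> \<open>Two demands: the errors of the two action estimates, \<open>8 d^2 M\<close>
    together, must stay below \<open>e^2 / 2\<close>, and \<open>riccati_good_scale\<close> needs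
    \<open>148 (1 + M) d \<le> 1\<close>.\<close>
  define d where "d = min (e / (4 * M)) (1 / (148 * (1 + M)))"
  have d: "d > 0" "d \<le> e / (4 * M)" "d \<le> 1 / (148 * (1 + M))" using e M by (auto simp: d_def)
  have d148: "148 * (1 + M) * d \<le> 1" using d(3) M by (simp add: field_simps)
  have d1: "2 * d \<le> 1"
  proof -
    have "2 * d \<le> 148 * (1 + M) * d" using M d by (intro mult_right_mono) auto
    thus ?thesis using d148 by linarith
  qed
  have d2: "8 * d\<^sup>2 * M \<le> e\<^sup>2 / 2"
  proof -
    have "d\<^sup>2 \<le> (e / (4 * M))\<^sup>2" using d by (intro power_mono) auto
    hence "8 * d\<^sup>2 * M \<le> 8 * (e / (4 * M))\<^sup>2 * M" using M by (intro mult_right_mono mult_left_mono) auto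
    also have "\<dots> = e\<^sup>2 / 2 / M" using M by (simp add: power2_eq_square field_simps)
    also have "\<dots> \<le> e\<^sup>2 / 2" using M divide_left_mono[of 1 M "e\<^sup>2 / 2"] by simp
    finally show ?thesis .
  qed
  obtain Ka where Ka: "Ka > 0" "\<And>k f. k \<ge> Ka \<Longrightarrow> f \<in> Q \<Longrightarrow> high k f \<le> e\<^sup>2 / 2"
    using eq[of "e\<^sup>2 / 2"] e by auto
  obtain Kb where Kb: "Kb > 0" "\<And>k f. k \<ge> Kb \<Longrightarrow> f \<in> Q \<Longrightarrow> high k f \<le> d\<^sup>2"
    using eq[of "d\<^sup>2"] d by auto
  define K1 where "K1 = max Ka (Kb * M / d\<^sup>2)"
  have K1: "K1 > 0" "K1 \<ge> Ka" "Kb * M \<le> d\<^sup>2 * K1"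
  proof -
    show "K1 > 0" "K1 \<ge> Ka" using Ka by (auto simp: K1_def)
    have "Kb * M / d\<^sup>2 \<le> K1" by (simp add: K1_def)
    thus "Kb * M \<le> d\<^sup>2 * K1" using d by (simp add: field_simps)
  qed
  obtain J where J: "6 * M / d\<^sup>2 < real J" using reals_Archimedean2 by blast
  have J0: "J > 0" using J M d by (metis divide_nonneg_nonneg gr0I mult_nonneg_nonneg not_less of_nat_0 zero_le_power2 zero_le_numeral order_trans zero_le_one)
  have J1: "6 * M \<le> real J * d\<^sup>2" using J d by (simp add: field_simps)
  \<comment> \<open>All candidate scales lie below \<open>K1 * 4^J\<close>, and
    \<open>good_of_high\<close> loses a further factor \<open>M / e^2\<close>.\<close>
  define K where "K = K1 * 4^J * M / e\<^sup>2"
  have K: "K > 0" unfolding K_def using K1 M e by auto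
  show ?thesis
  proof (intro exI[of _ K] conjI K allI impI)
    fix q p z T B t k x
    assume fl: "dnls_flow q p z T B" and T: "T > 0" and q0: "q 0 \<in> Q" and t: "\<bar>t\<bar> < T" and k: "k \<ge> K"
    interpret dnls_flow q p z T B by (rule fl)
    have zero: "\<bar>0\<bar> < T" using T by simp
    have Mt: "sqint (q t) = sqint (q 0)" by (rule mass_conserved[OF t zero])
    have M0: "sqint (q 0) \<le> M" by (rule M(2)[OF q0])
    have "6 * sqint (q t) \<le> real J * d\<^sup>2" using M0 Mt J1 by linarith
    from good_scale_exists[OF K1(1) q_nice[OF t] this J0 less_imp_le[OF d(1)]]
    obtain j where j: "j < J" "\<And>x. sqrt (K1 * 4^j) * cmod (resolv (2 * (K1 * 4^j)) (q t) x) \<le> d" by blast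
    define h where "h = K1 * 4^j"
    have h1: "K1 \<le> h" unfolding h_def using K1 by simp
    have h: "h > 0" "h \<ge> Ka" using h1 K1 by auto
    have gt: "sqrt h * cmod (resolv (2 * h) (q t) x) \<le> d" for x using j(2)[of x] by (simp add: h_def)
    have g0: "sqrt h * cmod (resolv (2 * h) (q 0) x) \<le> d" for x
    proof (rule good_of_high[OF Kb(1) h(1) q_nice[OF zero] d(1) M0 Kb(2)[OF order_refl q0]])
      have "d\<^sup>2 * K1 \<le> d\<^sup>2 * h" using h1 by (intro mult_left_mono) auto
      thus "Kb * M \<le> d\<^sup>2 * h" using K1(3) by linarith
    qed
    have small: "2 * d * sqrt (sqint (q s)) < 1" if "s = 0 \<or> s = t" for s
    proof -
      have "sqrt (sqint (q s)) \<le> sqrt M" using that M0 Mt by (intro real_sqrt_le_mono) auto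
      also have "sqrt M \<le> M" using M real_sqrt_le_mono[of M "M * M"] by simp
      finally have "2 * d * sqrt (sqint (q s)) \<le> 2 * d * M" using d by (intro mult_left_mono) auto
      also have "\<dots> < 148 * (1 + M) * d"
      proof -
        have "d * M > 0" using M(1) d(1) by simp
        hence "2 * (d * M) < 148 * d + 148 * (d * M)" using d(1) by linarith
        thus ?thesis by (simp add: algebra_simps)
      qed
      finally show ?thesis using d148 by linarith
    qed
    from riccati_small[OF h(1) q_nice[OF zero] d(1) d1 small g0]
    obtain r0 where r0: "riccati (lam h) (q 0) r0" "\<And>x. cmod (r0 x) < 2 * d" by blast
    from riccati_small[OF h(1) q_nice[OF t] d(1) d1 small gt]
    obtain rt where rt: "riccati (lam h) (q t) rt" "\<And>x. cmod (rt x) < 2 * d" by blast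
    have "148 * (1 + sqint (q t)) * d \<le> 148 * (1 + M) * d" using M0 Mt d by (intro mult_right_mono) auto
    hence dt: "148 * (1 + sqint (q t)) * d \<le> 1" using d148 by linarith
    have L: "(LINT x|lborel. lam h * (q 0 x * r0 x)) = (LINT x|lborel. lam h * (q t x * rt x))"
      by (rule action_transfer[OF T t h(1) less_imp_le[OF d(1)] dt g0 gt r0(1) rt(1)])
    have a0: "\<bar>2 * Im (LINT x|lborel. lam h * (q 0 x * r0 x)) + sqint (q 0) - high h (q 0)\<bar> \<le> 4 * d\<^sup>2 * sqint (q 0)"
      by (rule action_estimate[OF h(1) q_nice[OF zero] r0(1) less_imp_le[OF d(1)] less_imp_le[OF r0(2)]])
    have at: "\<bar>2 * Im (LINT x|lborel. lam h * (q t x * rt x)) + sqint (q t) - high h (q t)\<bar> \<le> 4 * d\<^sup>2 * sqint (q t)"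
      by (rule action_estimate[OF h(1) q_nice[OF t] rt(1) less_imp_le[OF d(1)] less_imp_le[OF rt(2)]])
    have "4 * d\<^sup>2 * sqint (q 0) \<le> 4 * d\<^sup>2 * M" using M0 by (intro mult_left_mono) auto
    hence "high h (q t) \<le> high h (q 0) + 8 * d\<^sup>2 * M" using a0 at unfolding L Mt by linarith
    hence hi: "high h (q t) \<le> e\<^sup>2" using Ka(2)[OF h(2) q0] d2 by linarith
    have k0: "k > 0" using K k by linarith
    show "sqrt k * cmod (resolv (2 * k) (q t) x) \<le> e"
    proof (rule good_of_high[OF h(1) k0 q_nice[OF t] e(1) _ hi])
      show "sqint (q t) \<le> M" using Mt M0 by simp
      have "h * M \<le> K1 * 4^J * M" unfolding h_def using j(1) K1 M by (intro mult_right_mono mult_left_mono power_increasing) auto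
      also have "\<dots> = e\<^sup>2 * K" using e by (simp add: K_def)
      also have "\<dots> \<le> e\<^sup>2 * k" using k by (intro mult_left_mono) auto
      finally show "h * M \<le> e\<^sup>2 * k" .
    qed
  qed
qed

section \<open>From small translations to small high-frequency mass\<close>

lemma nn_integral_sqint:
  assumes "nice f" shows "(\<integral>\<^sup>+x. ennreal ((norm (f x))\<^sup>2) \<partial>lborel) = ennreal (sqint f)"
  unfolding sqint_def by (rule nn_integral_eq_integral[OF sqint_integrable[OF assms]]) simp

lemma nice_shift:
  fixes q :: "real \<Rightarrow> 'a::real_normed_vector"
  assumes q: "nice q"
  shows "nice (\<lambda>x. q (x - s))"
proof -
  obtain C where C: "C \<ge> 0" "\<And>x. norm (q x) \<le> C / (1 + x\<^sup>2)" using niceE[OF q] by blast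
  show ?thesis
  proof (rule niceI)
    show "continuous_on UNIV (\<lambda>x. q (x - s))"
      by (rule continuous_on_compose2[OF nice_cont[OF q]]) (auto intro: continuous_intros)
    fix x
    have "0 \<le> (x - 2 * s)\<^sup>2 + 1 + 2 * (s * (x - s))\<^sup>2" by (intro add_nonneg_nonneg) auto
    hence "1 + x\<^sup>2 \<le> 2 * ((1 + s\<^sup>2) * (1 + (x - s)\<^sup>2))"
      by (simp add: power2_eq_square algebra_simps)
    hence "1 / (1 + (x - s)\<^sup>2) \<le> 2 * (1 + s\<^sup>2) / (1 + x\<^sup>2)"
      by (simp add: field_simps)
    from mult_left_mono[OF this C(1)]
    have "C / (1 + (x - s)\<^sup>2) \<le> C * (2 * (1 + s\<^sup>2)) / (1 + x\<^sup>2)" by simp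
    thus "norm (q (x - s)) \<le> C * (2 * (1 + s\<^sup>2)) / (1 + x\<^sup>2)" using C(2)[of "x - s"] by linarith
  qed
qed

text \<open>\<open>q - 2 k R_k q\<close> is the average of \<open>q x - q (x - s)\<close> in
  \<open>s\<close> against the probability density \<open>2 k exp (- 2 k s)\<close>. By Jensen and
  Fubini its squared norm is at most the average of the squared norms: shifts below
  \<open>\<delta>\<close> give \<open>e\<close>, the others at most \<open>4 sqint q\<close> with
  total weight \<open>exp (- 2 k \<delta>)\<close>.\<close>

lemma high_le_translates:
  assumes k: "k > 0" and q: "nice q" and \<delta>: "\<delta> > 0"
    and e: "\<And>s. \<bar>s\<bar> < \<delta> \<Longrightarrow> sqint (\<lambda>x. q x - q (x - s)) \<le> e"
  shows "high k q \<le> e + 4 * sqint q * exp (- (2 * k * \<delta>))"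
proof -
  have c: "2 * k > 0" using k by simp
  note bq = bcont_nice[OF q]
  have e0: "e \<ge> 0" using e[of 0] \<delta> sqint_nonneg[of "\<lambda>x. q x - q (x - 0)"] by linarith
  note ns = nice_shift[OF q]
  have nd: "nice (\<lambda>x. q x - q (x - s))" for s by (intro nice_diff q ns)
  define D where "D s = sqint (\<lambda>x. q x - q (x - s))" for s
  have D4: "D s \<le> 4 * sqint q" for s
  proof -
    have "D s \<le> (LINT x|lborel. 2 * (cmod (q x))\<^sup>2 + 2 * (cmod (q (x - s)))\<^sup>2)" unfolding D_def sqint_def
    proof (rule integral_mono)
      show "integrable lborel (\<lambda>x. (cmod (q x - q (x - s)))\<^sup>2)" by (rule sqint_integrable[OF nd])
      show "integrable lborel (\<lambda>x. 2 * (cmod (q x))\<^sup>2 + 2 * (cmod (q (x - s)))\<^sup>2)"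
        using sqint_integrable[OF q] sqint_integrable[OF ns] by simp
      fix x
      have "(cmod (q x - q (x - s)))\<^sup>2 \<le> (cmod (q x) + cmod (q (x - s)))\<^sup>2"
        by (intro power_mono norm_triangle_ineq4) auto
      also have "\<dots> \<le> 2 * (cmod (q x))\<^sup>2 + 2 * (cmod (q (x - s)))\<^sup>2"
        using sum_squares_bound[of "cmod (q x)" "cmod (q (x - s))"] by (simp add: power2_sum)
      finally show "(cmod (q x - q (x - s)))\<^sup>2 \<le> 2 * (cmod (q x))\<^sup>2 + 2 * (cmod (q (x - s)))\<^sup>2" .
    qed
    also have "\<dots> = 2 * sqint q + 2 * sqint (\<lambda>x. q (x - s))"
      unfolding sqint_def using sqint_integrable[OF q] sqint_integrable[OF ns] by simp
    also have "sqint (\<lambda>x. q (x - s)) = sqint q" unfolding sqint_def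
      using lborel_integral_real_affine[of 1 "\<lambda>x. (cmod (q x))\<^sup>2" "-s"] by simp
    finally show ?thesis by simp
  qed
  have pt: "(cmod (q x - 2 * k * resolv (2 * k) q x))\<^sup>2 \<le> 2 * k * (LINT s|lborel. expker (2 * k) s * (cmod (q x - q (x - s)))\<^sup>2)" for x
  proof -
    let ?f = "\<lambda>y. q x - q y"
    have bf: "bcont ?f" by (intro bcont_rules bq)
    have "resolv (2 * k) ?f x = resolv (2 * k) (\<lambda>y. q x + - q y) x" by simp
    also have "\<dots> = resolv (2 * k) (\<lambda>y. q x) x + resolv (2 * k) (\<lambda>y. - q y) x"
      by (intro resolv_add c bcont_rules bq)
    also have "resolv (2 * k) (\<lambda>y. - q y) x = - resolv (2 * k) q x"
      by (rule resolv_linear[OF bounded_linear_minus[OF bounded_linear_ident] c bq])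
    also have "resolv (2 * k) (\<lambda>y. q x) x = q x / (2 * k)"
      unfolding resolv_def using expker_integral[OF c] expker_integrable[OF c]
      by (simp add: scaleR_conv_of_real)
    finally have "q x - 2 * k * resolv (2 * k) q x = 2 * k * resolv (2 * k) ?f x"
      using k by (simp add: field_simps)
    hence "(cmod (q x - 2 * k * resolv (2 * k) q x))\<^sup>2 = (2 * k)\<^sup>2 * (cmod (resolv (2 * k) ?f x))\<^sup>2"
      using k by (simp add: norm_mult power_mult_distrib)
    also have "\<dots> \<le> (2 * k)\<^sup>2 * (resolv (2 * k) (\<lambda>y. (cmod (?f y))\<^sup>2) x / (2 * k))"
      by (intro mult_left_mono resolv_sq_le c bf) auto
    also have "\<dots> = 2 * k * resolv (2 * k) (\<lambda>y. (cmod (?f y))\<^sup>2) x" using k by (simp add: power2_eq_square)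
    finally show ?thesis by (simp add: resolv_def)
  qed
  have meas: "(\<lambda>(x, s). q x - q (x - s)) \<in> borel_measurable (borel \<Otimes>\<^sub>M borel)"
  proof -
    have "continuous_on UNIV (\<lambda>z::real \<times> real. q (fst z) - q (fst z - snd z))"
      by (intro continuous_intros continuous_on_compose2[OF nice_cont[OF q]]) auto
    hence "(\<lambda>z::real \<times> real. q (fst z) - q (fst z - snd z)) \<in> borel_measurable borel"
      by (rule borel_measurable_continuous_onI)
    thus ?thesis by (simp add: borel_prod case_prod_unfold)
  qed
  note [measurable] = meas
  have "ennreal (high k q) = (\<integral>\<^sup>+x. ennreal ((cmod (q x - 2 * k * resolv (2 * k) q x))\<^sup>2) \<partial>lborel)"
    unfolding high_def by (rule nn_integral_sqint[symmetric]) (intro nice_diff nice_mult_right bcont_rules resolv_nice c q)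
  also have "\<dots> \<le> (\<integral>\<^sup>+x. (\<integral>\<^sup>+s. ennreal (2 * k * expker (2 * k) s * (cmod (q x - q (x - s)))\<^sup>2) \<partial>lborel) \<partial>lborel)"
  proof (rule nn_integral_mono)
    fix x
    have i: "integrable lborel (\<lambda>s. 2 * k * expker (2 * k) s * (cmod (q x - q (x - s)))\<^sup>2)"
      using integrable_mult_right[OF resolv_integrable[OF c bcont_power[OF bcont_norm[OF bcont_diff[OF bcont_const bq]], of "q x" 2], of x], of "2 * k"]
      by (simp add: mult.assoc)
    have "ennreal ((cmod (q x - 2 * k * resolv (2 * k) q x))\<^sup>2) \<le> ennreal (LINT s|lborel. 2 * k * expker (2 * k) s * (cmod (q x - q (x - s)))\<^sup>2)"
      using pt[of x] by (intro ennreal_leI) (simp add: mult.assoc)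
    also have "\<dots> = (\<integral>\<^sup>+s. ennreal (2 * k * expker (2 * k) s * (cmod (q x - q (x - s)))\<^sup>2) \<partial>lborel)"
      by (rule nn_integral_eq_integral[OF i, symmetric]) (use k in \<open>simp add: expker_nonneg\<close>)
    finally show "ennreal ((cmod (q x - 2 * k * resolv (2 * k) q x))\<^sup>2) \<le> (\<integral>\<^sup>+s. ennreal (2 * k * expker (2 * k) s * (cmod (q x - q (x - s)))\<^sup>2) \<partial>lborel)" .
  qed
  also have "\<dots> = (\<integral>\<^sup>+s. (\<integral>\<^sup>+x. ennreal (2 * k * expker (2 * k) s * (cmod (q x - q (x - s)))\<^sup>2) \<partial>lborel) \<partial>lborel)"
    by (rule lborel_pair.Fubini') measurable
  also have "\<dots> = (\<integral>\<^sup>+s. ennreal (2 * k * expker (2 * k) s * D s) \<partial>lborel)"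
  proof (intro nn_integral_cong)
    fix s
    have "(\<integral>\<^sup>+x. ennreal (2 * k * expker (2 * k) s * (cmod (q x - q (x - s)))\<^sup>2) \<partial>lborel) =
      ennreal (2 * k * expker (2 * k) s) * (\<integral>\<^sup>+x. ennreal ((cmod (q x - q (x - s)))\<^sup>2) \<partial>lborel)"
      using k nice_measurable[OF nd[of s]] by (subst nn_integral_cmult[symmetric]) (auto simp: ennreal_mult expker_nonneg)
    thus "(\<integral>\<^sup>+x. ennreal (2 * k * expker (2 * k) s * (cmod (q x - q (x - s)))\<^sup>2) \<partial>lborel) = ennreal (2 * k * expker (2 * k) s * D s)"
      using k by (simp add: nn_integral_sqint[OF nd] D_def ennreal_mult[symmetric] expker_nonneg sqint_nonneg)
  qed
  also have "\<dots> \<le> (\<integral>\<^sup>+s. ennreal (2 * k * (e * expker (2 * k) s + 4 * sqint q * exp (- (2 * k * \<delta>)) * expker (2 * k) (s - \<delta>))) \<partial>lborel)"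
  proof (intro nn_integral_mono ennreal_leI)
    fix s
    have "expker (2 * k) s * D s \<le> e * expker (2 * k) s + 4 * sqint q * exp (- (2 * k * \<delta>)) * expker (2 * k) (s - \<delta>)"
    proof (cases "s < \<delta>")
      case True
      have "expker (2 * k) s * D s \<le> e * expker (2 * k) s"
        using True e[of s] by (cases "s \<ge> 0") (auto simp: D_def expker_def mult.commute[of e])
      moreover have "4 * sqint q * exp (- (2 * k * \<delta>)) * expker (2 * k) (s - \<delta>) \<ge> 0"
        by (intro mult_nonneg_nonneg expker_nonneg sqint_nonneg) auto
      ultimately show ?thesis by linarith
    next
      case False
      have "expker (2 * k) s = exp (- (2 * k * \<delta>)) * expker (2 * k) (s - \<delta>)"
        using False \<delta> by (simp add: expker_def exp_add[symmetric] algebra_simps)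
      hence "expker (2 * k) s * D s \<le> exp (- (2 * k * \<delta>)) * expker (2 * k) (s - \<delta>) * (4 * sqint q)"
        using D4[of s] by (simp only:) (intro mult_left_mono mult_nonneg_nonneg expker_nonneg; simp)
      also have "\<dots> = 4 * sqint q * exp (- (2 * k * \<delta>)) * expker (2 * k) (s - \<delta>)" by (simp only: mult_ac)
      finally have "expker (2 * k) s * D s \<le> 4 * sqint q * exp (- (2 * k * \<delta>)) * expker (2 * k) (s - \<delta>)" .
      moreover have "e * expker (2 * k) s \<ge> 0" using e0 by (simp add: expker_nonneg)
      ultimately show ?thesis by linarith
    qed
    from mult_left_mono[OF this, of "2 * k"]
    show "2 * k * expker (2 * k) s * D s \<le> 2 * k * (e * expker (2 * k) s + 4 * sqint q * exp (- (2 * k * \<delta>)) * expker (2 * k) (s - \<delta>))"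
      using k by (simp add: mult.assoc)
  qed
  also have "\<dots> = ennreal (LINT s|lborel. 2 * k * (e * expker (2 * k) s + 4 * sqint q * exp (- (2 * k * \<delta>)) * expker (2 * k) (s - \<delta>)))"
  proof (rule nn_integral_eq_integral)
    have "integrable lborel (\<lambda>s. expker (2 * k) (- \<delta> + 1 * s))"
      by (rule lborel_integrable_real_affine[OF expker_integrable[OF c]]) simp
    thus "integrable lborel (\<lambda>s. 2 * k * (e * expker (2 * k) s + 4 * sqint q * exp (- (2 * k * \<delta>)) * expker (2 * k) (s - \<delta>)))"
      using expker_integrable[OF c] by (intro integrable_mult_right Bochner_Integration.integrable_add) auto
    show "AE s in lborel. 0 \<le> 2 * k * (e * expker (2 * k) s + 4 * sqint q * exp (- (2 * k * \<delta>)) * expker (2 * k) (s - \<delta>))"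
      using k e0 by (intro AE_I2 mult_nonneg_nonneg add_nonneg_nonneg expker_nonneg sqint_nonneg) auto
  qed
  also have "(LINT s|lborel. 2 * k * (e * expker (2 * k) s + 4 * sqint q * exp (- (2 * k * \<delta>)) * expker (2 * k) (s - \<delta>)))
    = e + 4 * sqint q * exp (- (2 * k * \<delta>))"
  proof -
    have i: "integrable lborel (\<lambda>s. expker (2 * k) (- \<delta> + 1 * s))"
      by (rule lborel_integrable_real_affine[OF expker_integrable[OF c]]) simp
    have "(LINT s|lborel. expker (2 * k) (s - \<delta>)) = 1 / (2 * k)"
      using lborel_integral_real_affine[of 1 "expker (2 * k)" "-\<delta>"] expker_integral[OF c] by simp
    thus ?thesis using i expker_integrable[OF c] expker_integral[OF c] k by (simp add: field_simps)
  qed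
  finally show ?thesis
    by (subst (asm) ennreal_le_iff) (use e0 sqint_nonneg[of q] in auto)
qed

section \<open>The localized current at a single scale\<close>

text \<open>The weight varies slowly on unit length: with \<open>|\<eta>'| \<le> \<eta> / 8\<close>
  and \<open>k \<ge> 1\<close>, moving it past a resolvent costs a fraction of the term itself. The
  twelfth power of \<open>sech (x / 99)\<close> meets the constant 1/8.\<close>

locale weight =
  fixes \<eta> \<eta>' :: "real \<Rightarrow> real"
  assumes \<eta>_nonneg: "\<eta> x \<ge> 0" and \<eta>_le_1: "\<eta> x \<le> 1"
    and \<eta>_deriv: "(\<eta> has_real_derivative \<eta>' x) (at x)"
    and \<eta>'_bound: "\<bar>\<eta>' x\<bar> \<le> \<eta> x / 8"
    and \<eta>_nice: "nice \<eta>" and \<eta>'_cont: "continuous_on UNIV \<eta>'"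
begin

lemma \<eta>'_nice: "nice \<eta>'"
  by (rule nice_dominated[OF \<eta>_nice \<eta>'_cont, of "1/8"]) (use \<eta>'_bound \<eta>_nonneg in auto)

definition wint :: "(real \<Rightarrow> real) \<Rightarrow> real" where
  "wint f = (LINT x|lborel. \<eta> x * f x)"

lemma wint_integrable: "bcont f \<Longrightarrow> integrable lborel (\<lambda>x. \<eta> x * f x)"
  by (intro nice_integrable nice_mult_left \<eta>_nice)

lemma wint_mono: "bcont f \<Longrightarrow> bcont g \<Longrightarrow> (\<And>x. f x \<le> g x) \<Longrightarrow> wint f \<le> wint g"
  unfolding wint_def by (intro integral_mono wint_integrable mult_left_mono \<eta>_nonneg)

lemma wint_add: "bcont f \<Longrightarrow> bcont g \<Longrightarrow> wint (\<lambda>x. f x + g x) = wint f + wint g"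
  unfolding wint_def distrib_left by (intro Bochner_Integration.integral_add wint_integrable)

lemma wint_cmult: "wint (\<lambda>x. a * f x) = a * wint f"
  unfolding wint_def by (simp add: mult.left_commute)

lemma wint_nonneg: "(\<And>x. f x \<ge> 0) \<Longrightarrow> wint f \<ge> 0"
  unfolding wint_def by (intro integral_nonneg_AE AE_I2 mult_nonneg_nonneg \<eta>_nonneg)

lemma wint_le_integral: "nice f \<Longrightarrow> (\<And>x. f x \<ge> 0) \<Longrightarrow> wint f \<le> (LINT x|lborel. f x)"
  unfolding wint_def
  by (intro integral_mono wint_integrable bcont_nice nice_integrable)
    (auto simp: mult_left_le_one_le \<eta>_nonneg \<eta>_le_1)

text \<open>Integrating the derivative of \<open>\<eta> W\<close> gives
  \<open>2 k wint W = wint g\<close> plus the integral of \<open>\<eta>' W\<close>. The latter is at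
  most \<open>wint W / 8\<close> and is absorbed because \<open>k \<ge> 1\<close>.\<close>

lemma wint_resolv:
  assumes k: "k \<ge> 1" and g: "nice g" "\<And>x. g x \<ge> 0"
  shows "wint (resolv (2 * k) g) \<le> wint g / k"
proof -
  have c: "2 * k > 0" using k by simp
  define W where "W = resolv (2 * k) g"
  have W: "nice W" "bcont W" unfolding W_def by (intro resolv_nice c g bcont_nice)+
  have W0: "W x \<ge> 0" for x unfolding W_def by (intro resolv_nonneg g)
  have Wd: "(W has_real_derivative (g x - 2 * k * W x)) (at x)" for x
    using resolv_deriv[OF c bcont_nice[OF g(1)], of x] by (simp add: W_def has_real_derivative_iff_has_vector_derivative)
  have "(LINT x|lborel. \<eta> x * (g x - 2 * k * W x) + \<eta>' x * W x) = 0"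
  proof (rule integral_derivative_nice)
    show "((\<lambda>x. \<eta> x * W x) has_vector_derivative \<eta> x * (g x - 2 * k * W x) + \<eta>' x * W x) (at x)" for x
      unfolding has_real_derivative_iff_has_vector_derivative[symmetric]
      by (rule DERIV_cong[OF DERIV_mult[OF \<eta>_deriv Wd]]) (simp add: algebra_simps)
    show "nice (\<lambda>x. \<eta> x * (g x - 2 * k * W x) + \<eta>' x * W x)"
      by (rule nice_add[OF nice_mult_left[OF \<eta>_nice] nice_mult_left[OF \<eta>'_nice W(2)]])
        (intro bcont_rules bcont_nice[OF g(1)] W)
    show "nice (\<lambda>x. \<eta> x * W x)" by (rule nice_mult_left[OF \<eta>_nice W(2)])
  qed
  also have "(LINT x|lborel. \<eta> x * (g x - 2 * k * W x) + \<eta>' x * W x)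
    = (LINT x|lborel. \<eta> x * (g x + (- (2 * k)) * W x)) + (LINT x|lborel. \<eta>' x * W x)"
    by (subst Bochner_Integration.integral_add[symmetric])
      (auto intro!: wint_integrable nice_integrable nice_mult_left \<eta>_nice \<eta>'_nice W bcont_rules bcont_nice[OF g(1)])
  also have "(LINT x|lborel. \<eta> x * (g x + (- (2 * k)) * W x)) = wint g + (- (2 * k)) * wint W"
    unfolding wint_def[symmetric] wint_cmult[symmetric] by (intro wint_add bcont_rules bcont_nice[OF g(1)] W)
  finally have "0 = (wint g + (- (2 * k)) * wint W) + (LINT x|lborel. \<eta>' x * W x)" by simp
  moreover have "(LINT x|lborel. \<eta>' x * W x) \<le> (LINT x|lborel. \<eta> x * (1 / 8 * W x))"
  proof (rule integral_mono)
    show "integrable lborel (\<lambda>x. \<eta>' x * W x)" by (intro nice_integrable nice_mult_left \<eta>'_nice W)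
    show "integrable lborel (\<lambda>x. \<eta> x * (1 / 8 * W x))" by (intro wint_integrable bcont_rules W)
    fix x
    have "\<eta>' x \<le> \<eta> x / 8" using \<eta>'_bound[of x] by linarith
    from mult_right_mono[OF this W0[of x]] show "\<eta>' x * W x \<le> \<eta> x * (1 / 8 * W x)" by simp
  qed
  moreover have "(LINT x|lborel. \<eta> x * (1 / 8 * W x)) = 1 / 8 * wint W"
    unfolding wint_def[symmetric] by (rule wint_cmult)
  moreover have "1 * wint W \<le> k * wint W" using k by (intro mult_right_mono wint_nonneg W0) auto
  moreover have "wint W \<ge> 0" by (intro wint_nonneg W0)
  ultimately have "k * wint W \<le> wint g" by (simp only: mult_minus_left)
  thus ?thesis using k by (simp add: W_def field_simps)
qed

end

text \<open>One time and one scale are frozen; \<open>s\<close> stands for the supremum of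
  \<open>|R_k q|\<close>. The errors keep the factor \<open>k * s\<^sup>2\<close> because its sum
  over the scales is bounded by the mass, whereas a fixed small constant per scale would add up with
  the number of scales.\<close>

locale scale = weight +
  fixes q p r :: "real \<Rightarrow> complex" and k s :: real
  assumes q: "nice q" and p: "nice p" and qp: "(q has_vector_derivative p x) (at x)"
    and k: "k \<ge> 1" and ric: "riccati (lam k) q r" and s: "s \<ge> 0" "k * s\<^sup>2 \<le> 1 / 4"
    and r_le: "cmod (r x) \<le> 2 * sqrt k * s" and w_le: "cmod (resolv (2 * k) q x) \<le> s"
begin

definition "w = resolv (2 * k) q"
definition "dw x = q x - 2 * k * w x"
text \<open>Division by \<open>- lam k\<close> normalises the equation to
  \<open>u' = - 2 k u + cnj q + f\<close> with the cubic term \<open>f\<close>. Hence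
  \<open>u = cnj w + v\<close>: the linear part and the correction \<open>v\<close>.\<close>

definition "u x = - r x / lam k"
definition "f x = \<i> * k * q x * (u x)\<^sup>2"
definition "v = resolv (2 * k) f"
definition "Rq = resolv (2 * k) (\<lambda>x. cmod (q x))"
definition "g x = cmod (q x) * Rq x"
definition "Rg = resolv (2 * k) g"
definition "m = wint (\<lambda>x. (cmod (q x))\<^sup>2)"
definition "A = wint (\<lambda>x. (cmod (q x))^4)"
definition "current x = \<i> * (lam k)\<^sup>2 * (q x * cnj (q x)) + 2 * (lam k)^3 * q x * r x
  + lam k * (\<i> * p x - q x * cnj (q x) * q x) * r x"
text \<open>What remains of the current after its leading part and an exact derivative. Every term
  without \<open>\<eta>'\<close> contains \<open>dw\<close> or the imaginary part of
  \<open>q u\<close>, in which \<open>q\<close> may be replaced by \<open>dw\<close> up to a term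
  with \<open>v\<close>.\<close>

definition "err x = \<eta>' x * Re (dw x * cnj (w x)) + \<eta>' x * Re (q x * v x)
  + \<eta> x * (Im (q x * u x) * (2 * k * Re (q x * u x) + (cmod (q x))\<^sup>2))
  + 2 * \<eta> x * Re (dw x * (f x - 4 * k * v x)) - 4 * k * \<eta>' x * Re (w x * v x)"

lemma k0: "k > 0" and c0: "2 * k > 0" using k by auto
lemma lam0: "lam k \<noteq> 0" using lam_simps(1)[OF k0] by auto

lemma nices: "nice w" "nice dw" "nice u" "nice f" "nice v" "nice Rq" "nice g" "nice Rg" "nice r"
proof -
  show w: "nice w" unfolding w_def by (intro resolv_nice c0 q)
  show "nice dw" unfolding dw_def[abs_def] by (intro nice_diff nice_mult_right bcont_rules q w)
  show r: "nice r" by (rule riccati_nice[OF lam_simps(1,2)[OF k0] q ric])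
  have "nice (\<lambda>x. - (r x * inverse (lam k)))" by (intro nice_minus nice_mult_left bcont_const r)
  thus u: "nice u" by (simp add: u_def[abs_def] divide_inverse)
  show f: "nice f" unfolding f_def[abs_def]
    by (intro nice_mult_right[OF bcont_mult[OF bcont_const bcont_nice[OF q]]] nice_power2 u)
  show "nice v" unfolding v_def by (intro resolv_nice c0 f)
  show Rq: "nice Rq" unfolding Rq_def by (intro resolv_nice c0 nice_norm q)
  show g: "nice g" unfolding g_def[abs_def] by (intro nice_mult_left nice_norm q bcont_nice Rq)
  show "nice Rg" unfolding Rg_def by (intro resolv_nice c0 g)
qed

lemmas bconts = nices[THEN bcont_nice] bcont_nice[OF q] bcont_nice[OF p]

lemma w_deriv: "(w has_vector_derivative dw x) (at x)"
  using resolv_deriv[OF c0 bcont_nice[OF q], of x] by (simp add: w_def dw_def scaleR_conv_of_real)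

lemma v_deriv: "(v has_vector_derivative (f x - 2 * k * v x)) (at x)"
  using resolv_deriv[OF c0 bconts(4), of x] by (simp add: v_def scaleR_conv_of_real)

lemma r_eq: "r x = - lam k * u x"
  using lam0 by (simp add: u_def)

lemma u_deriv: "(u has_vector_derivative (- 2 * k * u x + cnj (q x) + f x)) (at x)"
proof -
  have "(u has_vector_derivative - (2 * \<i> * (lam k)\<^sup>2 * r x - lam k * cnj (q x) - lam k * q x * (r x)\<^sup>2) / lam k) (at x)"
    unfolding u_def[abs_def]
    by (intro bounded_linear.has_vector_derivative[OF bounded_linear_divide] has_vector_derivative_minus riccatiD(3)[OF ric])
  moreover have "- (2 * \<i> * (lam k)\<^sup>2 * r x - lam k * cnj (q x) - lam k * q x * (r x)\<^sup>2) / lam k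
     = 2 * \<i> * (lam k)\<^sup>2 * u x + cnj (q x) + (lam k)\<^sup>2 * q x * (u x)\<^sup>2"
    unfolding r_eq[of x] using lam0 by (simp add: field_simps power2_eq_square)
  ultimately have "(u has_vector_derivative 2 * \<i> * (lam k)\<^sup>2 * u x + cnj (q x) + (lam k)\<^sup>2 * q x * (u x)\<^sup>2) (at x)"
    by (simp only:)
  thus ?thesis unfolding lam_simps(3)[OF k0] by (simp add: f_def algebra_simps)
qed

lemma u_eq: "u x = cnj (w x) + v x"
proof -
  have "u x = resolv (2 * k) (\<lambda>y. cnj (q y) + f y) x"
    by (rule resolv_unique[OF c0 bcont_add[OF bcont_cnj[OF bcont_nice[OF q]] bconts(4)] bconts(3)])
      (use u_deriv in \<open>simp add: scaleR_conv_of_real algebra_simps\<close>)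
  also have "\<dots> = resolv (2 * k) (\<lambda>y. cnj (q y)) x + resolv (2 * k) f x"
    by (intro resolv_add c0 bcont_cnj bconts)
  also have "resolv (2 * k) (\<lambda>y. cnj (q y)) x = cnj (w x)" unfolding w_def
    by (intro resolv_linear[OF bounded_linear_cnj c0] bconts)
  finally show ?thesis by (simp add: v_def)
qed

lemma Rq0: "Rq x \<ge> 0" unfolding Rq_def by (intro resolv_nonneg) auto
lemma g0: "g x \<ge> 0" unfolding g_def by (intro mult_nonneg_nonneg Rq0) auto
lemma Rg0: "Rg x \<ge> 0" unfolding Rg_def by (intro resolv_nonneg g0)

lemma u_le_s: "cmod (u x) \<le> 2 * s"
proof -
  have "cmod (u x) = cmod (r x) / sqrt k" by (simp add: u_def norm_divide lam_simps(4)[OF k0])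
  also have "\<dots> \<le> 2 * sqrt k * s / sqrt k" using r_le[of x] k0 by (intro divide_right_mono) auto
  finally show ?thesis using k0 by simp
qed

lemma ww_le: "cmod (w x) \<le> s" "cmod (w x) \<le> Rq x"
  using w_le[of x] resolv_norm_le[OF c0 bcont_nice[OF q], of x] by (auto simp: w_def Rq_def)

lemma f_norm: "cmod (f x) = k * cmod (q x) * (cmod (u x))\<^sup>2"
  using k0 by (simp add: f_def norm_mult norm_power)

lemma v_le: "cmod (v x) \<le> 4 * (k * s\<^sup>2) * Rq x"
proof -
  have "cmod (v x) \<le> resolv (2 * k) (\<lambda>y. cmod (f y)) x" unfolding v_def by (intro resolv_norm_le c0 bconts)
  also have "\<dots> \<le> resolv (2 * k) (\<lambda>y. 4 * (k * s\<^sup>2) * cmod (q y)) x"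
  proof (intro resolv_mono c0 bcont_rules bconts)
    fix y
    from power_mono[OF u_le_s[of y], of 2] have "(cmod (u y))\<^sup>2 \<le> 4 * s\<^sup>2" by (simp add: power_mult_distrib)
    from mult_left_mono[OF this, of "k * cmod (q y)"] show "cmod (f y) \<le> 4 * (k * s\<^sup>2) * cmod (q y)"
      unfolding f_norm using k0 by (simp add: mult_ac)
  qed
  also have "\<dots> = 4 * (k * s\<^sup>2) * Rq x" unfolding Rq_def by (intro resolv_cmult c0 bcont_norm bconts)
  finally show ?thesis .
qed

text \<open>By \<open>k s^2 \<le> 1/4\<close> the correction \<open>v\<close> is no larger than the
  bound \<open>Rq\<close> of the linear part.\<close>

lemma u_le: "cmod (u x) \<le> 2 * Rq x"
proof -
  have "cmod (u x) \<le> cmod (w x) + cmod (v x)" unfolding u_eq by (rule order_trans[OF norm_triangle_ineq]) simp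
  also have "\<dots> \<le> Rq x + 4 * (k * s\<^sup>2) * Rq x" by (intro add_mono ww_le v_le)
  also have "4 * (k * s\<^sup>2) * Rq x \<le> 1 * Rq x" using s Rq0[of x] by (intro mult_right_mono) auto
  finally show ?thesis by simp
qed

lemma f_le: "cmod (f x) \<le> 4 * k * s * g x"
proof -
  have "(cmod (u x))\<^sup>2 \<le> 2 * s * (2 * Rq x)" unfolding power2_eq_square
    using u_le_s[of x] u_le[of x] s Rq0[of x] by (intro mult_mono) auto
  from mult_left_mono[OF this, of "k * cmod (q x)"] show ?thesis
    unfolding f_norm g_def using k0 by (simp add: mult_ac)
qed

text \<open>Compared with \<open>v_le\<close>, one factor \<open>s\<close> is traded for the
  bilinear quantity \<open>g\<close>, whose weighted square integral is controlled by the quartic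
  integral \<open>A\<close>.\<close>

lemma v_le': "cmod (v x) \<le> 4 * k * s * Rg x"
proof -
  have "cmod (v x) \<le> resolv (2 * k) (\<lambda>y. cmod (f y)) x" unfolding v_def by (intro resolv_norm_le c0 bconts)
  also have "\<dots> \<le> resolv (2 * k) (\<lambda>y. 4 * k * s * g y) x"
    by (intro resolv_mono c0 bcont_rules bconts f_le)
  also have "\<dots> = 4 * k * s * Rg x" unfolding Rg_def by (intro resolv_cmult c0 bconts)
  finally show ?thesis .
qed

lemma current_identity:
  "- (LINT x|lborel. \<eta> x * Re (current x)) = 2 * (k * wint (\<lambda>x. (cmod (dw x))\<^sup>2)) + k * (LINT x|lborel. err x)"
proof -
  \<comment> \<open>The first term removes \<open>p\<close> from the current, the second completes
    \<open>- 2 |q|^2 + 4 k Re (q cnj w)\<close> to \<open>- 2 |dw|^2\<close>, and the third replaces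
    \<open>w\<close> by \<open>dw\<close> in the terms linear in \<open>v\<close>.\<close>
  define \<Phi> where "\<Phi> x = - (\<eta> x * Re (q x * u x)) + 2 * k * (\<eta> x * (cmod (w x))\<^sup>2) + 4 * k * (\<eta> x * Re (w x * v x))" for x
  define \<Phi>' where "\<Phi>' x = - \<eta> x * Re (current x) / k - 2 * (\<eta> x * (cmod (dw x))\<^sup>2) - err x" for x
  have cur: "Re (current x) = k * (- (cmod (q x))\<^sup>2 + Re (2 * k * q x * u x + p x * u x) - (cmod (q x))\<^sup>2 * Im (q x * u x))" for x
  proof -
    define a where "a = lam k * lam k"
    have a: "a = \<i> * k" using lam_simps(3)[OF k0] by (simp add: a_def power2_eq_square)
    have "current x = \<i> * a * (q x * cnj (q x)) - 2 * (a * a) * q x * u x - a * ((\<i> * p x - q x * cnj (q x) * q x) * u x)"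
      unfolding current_def r_eq[of x] a_def by (simp add: algebra_simps power2_eq_square power3_eq_cube)
    also have "\<dots> = k * (- (q x * cnj (q x)) + (2 * k * q x * u x + p x * u x) + \<i> * (q x * cnj (q x)) * (q x * u x))"
      unfolding a by (simp add: algebra_simps)
    also have "q x * cnj (q x) = of_real ((cmod (q x))\<^sup>2)" by (rule complex_norm_square[symmetric])
    finally have "current x = k * (- of_real ((cmod (q x))\<^sup>2) + (2 * k * q x * u x + p x * u x)
      + \<i> * of_real ((cmod (q x))\<^sup>2) * (q x * u x))" .
    thus ?thesis by (simp only:) (simp add: algebra_simps)
  qed
  have d1: "((\<lambda>x. Re (q x * u x)) has_real_derivative Re (q x * (- 2 * k * u x + cnj (q x) + f x) + p x * u x)) (at x)" for x
    unfolding has_real_derivative_iff_has_vector_derivative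
    by (intro bounded_linear.has_vector_derivative[OF bounded_linear_Re] has_vector_derivative_mult qp u_deriv)
  have d2: "((\<lambda>x. (cmod (w x))\<^sup>2) has_real_derivative 2 * Re (cnj (w x) * dw x)) (at x)" for x
    unfolding has_real_derivative_iff_has_vector_derivative by (rule has_vector_derivative_norm_sq[OF w_deriv])
  have d3: "((\<lambda>x. Re (w x * v x)) has_real_derivative Re (w x * (f x - 2 * k * v x) + dw x * v x)) (at x)" for x
    unfolding has_real_derivative_iff_has_vector_derivative
    by (intro bounded_linear.has_vector_derivative[OF bounded_linear_Re] has_vector_derivative_mult w_deriv v_deriv)
  have \<Phi>d: "(\<Phi> has_vector_derivative \<Phi>' x) (at x)" for x
  proof -
    have "(\<Phi> has_real_derivative - (\<eta>' x * Re (q x * u x) + Re (q x * (- 2 * k * u x + cnj (q x) + f x) + p x * u x) * \<eta> x)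
        + 2 * k * (\<eta>' x * (cmod (w x))\<^sup>2 + 2 * Re (cnj (w x) * dw x) * \<eta> x)
        + 4 * k * (\<eta>' x * Re (w x * v x) + Re (w x * (f x - 2 * k * v x) + dw x * v x) * \<eta> x)) (at x)"
      unfolding \<Phi>_def[abs_def]
      by (intro DERIV_add DERIV_minus DERIV_cmult DERIV_mult \<eta>_deriv d1 d2 d3)
    moreover have "- (\<eta>' x * Re (q x * u x) + Re (q x * (- 2 * k * u x + cnj (q x) + f x) + p x * u x) * \<eta> x)
        + 2 * k * (\<eta>' x * (cmod (w x))\<^sup>2 + 2 * Re (cnj (w x) * dw x) * \<eta> x)
        + 4 * k * (\<eta>' x * Re (w x * v x) + Re (w x * (f x - 2 * k * v x) + dw x * v x) * \<eta> x) = \<Phi>' x"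
    proof -
      have c: "- \<eta> x * Re (current x) / k = - \<eta> x * (- (cmod (q x))\<^sup>2 + Re (2 * k * q x * u x + p x * u x) - (cmod (q x))\<^sup>2 * Im (q x * u x))"
        unfolding cur using k0 by simp
      show ?thesis unfolding \<Phi>'_def c err_def f_def u_eq dw_def cmod_power2
        by (simp add: power2_eq_square algebra_simps)
    qed
    ultimately show ?thesis by (simp add: has_real_derivative_iff_has_vector_derivative)
  qed
  have ncur: "bcont current" unfolding current_def[abs_def] by (intro bcont_rules bconts)
  have nerr: "nice err" unfolding err_def[abs_def]
    by (intro nice_add nice_diff nice_mult_left[OF \<eta>'_nice] nice_mult_left[OF \<eta>_nice]
        nice_mult_left[OF nice_mult_right[OF bcont_const \<eta>_nice]] nice_mult_left[OF nice_mult_right[OF bcont_const \<eta>'_nice]]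
        bcont_rules bconts)
  have n1: "nice (\<lambda>x. \<eta> x * Re (current x))" by (intro nice_mult_left \<eta>_nice bcont_rules ncur)
  have n2: "nice (\<lambda>x. \<eta> x * (cmod (dw x))\<^sup>2)" by (intro nice_mult_left \<eta>_nice bcont_rules bconts)
  have n3: "nice (\<lambda>x. (- 1 / k) * (\<eta> x * Re (current x)) + (- 2) * (\<eta> x * (cmod (dw x))\<^sup>2) - err x)"
    by (intro nice_add nice_diff nice_mult_right[OF bcont_const] n1 n2 nerr)
  have eq: "\<Phi>' = (\<lambda>x. (- 1 / k) * (\<eta> x * Re (current x)) + (- 2) * (\<eta> x * (cmod (dw x))\<^sup>2) - err x)"
    by (auto simp: \<Phi>'_def)
  have "(LINT x|lborel. \<Phi>' x) = 0"
  proof (rule integral_derivative_nice[OF \<Phi>d])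
    show "nice \<Phi>'" unfolding eq by (rule n3)
    show "nice \<Phi>" unfolding \<Phi>_def[abs_def]
      by (intro nice_add nice_minus nice_mult_right[OF bcont_const] nice_mult_left \<eta>_nice bcont_rules bconts)
  qed
  also have "(LINT x|lborel. \<Phi>' x) = (- 1 / k) * (LINT x|lborel. \<eta> x * Re (current x)) + (- 2) * (LINT x|lborel. \<eta> x * (cmod (dw x))\<^sup>2)
     - (LINT x|lborel. err x)"
    unfolding eq using nice_integrable[OF n1] nice_integrable[OF n2] nice_integrable[OF nerr] by simp
  finally show ?thesis using k0 by (simp add: wint_def field_simps)
qed

section \<open>Weighted bounds for the error quantities\<close>

lemma Rq_sq: "(Rq x)\<^sup>2 \<le> resolv (2 * k) (\<lambda>y. (cmod (q y))\<^sup>2) x / (2 * k)"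
  using resolv_sq_le[OF c0 bcont_norm[OF bcont_nice[OF q]], of x] Rq0[of x] by (simp add: Rq_def)

lemma wint_Rq_sq: "wint (\<lambda>x. (Rq x)\<^sup>2) \<le> m / (2 * k\<^sup>2)"
proof -
  have le: "(Rq x)\<^sup>2 \<le> inverse (2 * k) * resolv (2 * k) (\<lambda>y. (cmod (q y))\<^sup>2) x" for x
    using Rq_sq[of x] unfolding divide_inverse_commute .
  have "wint (\<lambda>x. (Rq x)\<^sup>2) \<le> wint (\<lambda>x. inverse (2 * k) * resolv (2 * k) (\<lambda>y. (cmod (q y))\<^sup>2) x)"
    by (rule wint_mono[OF _ _ le]) (intro bcont_rules bconts resolv_bcont c0)+
  also have "\<dots> \<le> inverse (2 * k) * (m / k)"
    unfolding wint_cmult m_def using k0 by (intro mult_left_mono wint_resolv k nice_power2 nice_norm q) auto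
  also have "\<dots> = m / (2 * k\<^sup>2)" using k0 by (simp add: power2_eq_square field_simps)
  finally show ?thesis .
qed

text \<open>Jensen twice, from \<open>|q|\<close> to \<open>|q|^2\<close> and from
  \<open>|q|^2\<close> to \<open>|q|^4\<close>, and the weight is moved past the resolvent
  once.\<close>

lemma wint_Rq_4: "wint (\<lambda>x. (Rq x)^4) \<le> A / (8 * k^4)"
proof -
  have le: "(Rq x)^4 \<le> inverse (8 * k^3) * resolv (2 * k) (\<lambda>y. (cmod (q y))^4) x" for x
  proof -
    have "(Rq x)^4 = ((Rq x)\<^sup>2)\<^sup>2" by (simp flip: power_mult)
    also have "\<dots> \<le> (resolv (2 * k) (\<lambda>y. (cmod (q y))\<^sup>2) x / (2 * k))\<^sup>2" by (intro power_mono Rq_sq) auto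
    also have "\<dots> = (resolv (2 * k) (\<lambda>y. (cmod (q y))\<^sup>2) x)\<^sup>2 / (4 * k\<^sup>2)" by (simp add: power_divide power_mult_distrib)
    also have "\<dots> \<le> (resolv (2 * k) (\<lambda>y. ((cmod (q y))\<^sup>2)\<^sup>2) x / (2 * k)) / (4 * k\<^sup>2)"
      using resolv_sq_le[OF c0 bcont_power[OF bcont_norm[OF bcont_nice[OF q]], of 2], of x]
      by (intro divide_right_mono) auto
    also have "\<dots> = inverse (8 * k^3) * resolv (2 * k) (\<lambda>y. (cmod (q y))^4) x"
    proof -
      have 1: "((cmod (q y))\<^sup>2)\<^sup>2 = (cmod (q y))^4" for y by (simp flip: power_mult)
      have 2: "(X / (2 * k)) / (4 * k\<^sup>2) = inverse (8 * k^3) * X" for X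
        using k0 by (simp add: field_simps power3_eq_cube power2_eq_square)
      show ?thesis unfolding 1 2 ..
    qed
    finally show ?thesis .
  qed
  have "wint (\<lambda>x. (Rq x)^4) \<le> wint (\<lambda>x. inverse (8 * k^3) * resolv (2 * k) (\<lambda>y. (cmod (q y))^4) x)"
    by (rule wint_mono[OF _ _ le]) (intro bcont_rules bconts resolv_bcont c0)+
  also have "\<dots> \<le> inverse (8 * k^3) * (A / k)"
    unfolding wint_cmult A_def using k0 by (intro mult_left_mono wint_resolv k nice_power4 nice_norm q) auto
  also have "\<dots> = A / (8 * k^4)" using k0 by (simp add: power4_eq_xxxx power3_eq_cube field_simps)
  finally show ?thesis .
qed

lemma A0: "A \<ge> 0" unfolding A_def by (intro wint_nonneg) auto
lemma m0: "m \<ge> 0" unfolding m_def by (intro wint_nonneg) auto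

text \<open>\<open>Rq\<close> has the size of \<open>|q| / k\<close>, so the product is split into
  fourth powers with \<open>k\<close> as the balancing weight.\<close>

lemma wint_g_sq: "wint (\<lambda>x. (g x)\<^sup>2) \<le> A / (2 * k\<^sup>2)"
proof -
  have le: "(g x)\<^sup>2 \<le> inverse (4 * k\<^sup>2) * (cmod (q x))^4 + k\<^sup>2 * (Rq x)^4" for x
  proof -
    have "0 \<le> ((cmod (q x))\<^sup>2 / (2 * k) - k * (Rq x)\<^sup>2)\<^sup>2" by simp
    also have "\<dots> = inverse (4 * k\<^sup>2) * (cmod (q x))^4 + k\<^sup>2 * (Rq x)^4 - (g x)\<^sup>2"
    proof -
      have "(Q\<^sup>2 / (2 * k) - k * R\<^sup>2)\<^sup>2 = inverse (4 * k\<^sup>2) * Q^4 + k\<^sup>2 * R^4 - (Q * R)\<^sup>2" for Q R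
        using k0 by (simp add: power2_eq_square power4_eq_xxxx field_simps)
      thus ?thesis unfolding g_def .
    qed
    finally show ?thesis by simp
  qed
  have "wint (\<lambda>x. (g x)\<^sup>2) \<le> wint (\<lambda>x. inverse (4 * k\<^sup>2) * (cmod (q x))^4 + k\<^sup>2 * (Rq x)^4)"
    by (rule wint_mono[OF _ _ le]) (intro bcont_rules bconts)+
  also have "\<dots> = inverse (4 * k\<^sup>2) * A + k\<^sup>2 * wint (\<lambda>x. (Rq x)^4)"
    unfolding A_def wint_cmult[symmetric] by (intro wint_add bcont_rules bconts)
  also have "\<dots> \<le> inverse (4 * k\<^sup>2) * A + k\<^sup>2 * (A / (8 * k^4))"
    by (intro add_left_mono mult_left_mono wint_Rq_4) auto
  also have "\<dots> = A / (8/3 * k\<^sup>2)" using k0 by (simp add: field_simps power2_eq_square power4_eq_xxxx)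
  also have "\<dots> \<le> A / (2 * k\<^sup>2)" using A0 k0 by (intro divide_left_mono) auto
  finally show ?thesis .
qed

lemma wint_Rg_sq: "wint (\<lambda>x. (Rg x)\<^sup>2) \<le> A / (4 * k^4)"
proof -
  have le: "(Rg x)\<^sup>2 \<le> inverse (2 * k) * resolv (2 * k) (\<lambda>y. (g y)\<^sup>2) x" for x
    using resolv_sq_le[OF c0 bconts(7), of x] unfolding Rg_def divide_inverse_commute by simp
  have "wint (\<lambda>x. (Rg x)\<^sup>2) \<le> wint (\<lambda>x. inverse (2 * k) * resolv (2 * k) (\<lambda>y. (g y)\<^sup>2) x)"
    by (rule wint_mono[OF _ _ le]) (intro bcont_rules bconts resolv_bcont c0)+
  also have "\<dots> \<le> inverse (2 * k) * (wint (\<lambda>x. (g x)\<^sup>2) / k)"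
    unfolding wint_cmult using k0 by (intro mult_left_mono wint_resolv k nice_power2 nices) auto
  also have "\<dots> \<le> inverse (2 * k) * (A / (2 * k\<^sup>2) / k)"
    using k0 by (intro mult_left_mono divide_right_mono wint_g_sq) auto
  also have "\<dots> = A / (4 * k^4)" using k0 by (simp add: power2_eq_square power4_eq_xxxx field_simps)
  finally show ?thesis .
qed

lemma amgm: "x * y \<le> t * x\<^sup>2 + y\<^sup>2 / (4 * t)" if "t > 0" for x y t :: real
proof -
  have "0 \<le> (2 * t * x - y)\<^sup>2 / (4 * t)" using that by simp
  also have "\<dots> = t * x\<^sup>2 + y\<^sup>2 / (4 * t) - x * y" using that by (simp add: power2_diff field_simps power2_eq_square)
  finally show ?thesis by simp
qed

text \<open>The terms with \<open>|dw|^2\<close> add up to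
  \<open>1/16 + 1/64 + 1/64 \<le> 1/8\<close> of \<open>k |dw|^2\<close>, which the main term
  absorbs. The quartic rest carries the factor \<open>k s^2\<close>; its coefficients are
  \<open>34 = 17 * 2\<close>, \<open>2592 = 17 * 32 + 1024 * 2\<close> and
  \<open>32768 = 1024 * 32\<close>, from the bounds for \<open>Y\<close> and
  \<open>Z\<close>.\<close>

lemma err_pointwise:
  "k * \<bar>err x\<bar> \<le> \<eta> x * (1 / 8 * (k * (cmod (dw x))\<^sup>2) + (k / 16 + 9 / 4 * (k * s\<^sup>2) * k\<^sup>2) * (Rq x)\<^sup>2
    + (k * s\<^sup>2) / 4 * (cmod (q x))\<^sup>2 + k * s\<^sup>2 * (34 * (cmod (q x))^4 + 2592 * k\<^sup>2 * (g x)\<^sup>2 + 32768 * k^4 * (Rg x)\<^sup>2))"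
proof -
  define e where "e = k * s\<^sup>2"
  define D Q R G H where "D = cmod (dw x)" and "Q = cmod (q x)" and "R = Rq x" and "G = g x" and "H = Rg x"
  have pos: "e \<ge> 0" "D \<ge> 0" "Q \<ge> 0" "R \<ge> 0" "G \<ge> 0" "H \<ge> 0" "k > 0" "s \<ge> 0"
    using k0 s Rq0 g0 Rg0 by (auto simp: e_def D_def Q_def R_def G_def H_def)
  have QR: "G = Q * R" by (simp add: G_def g_def Q_def R_def)
  have vl: "cmod (v x) \<le> 4 * e * R" using v_le[of x] by (simp add: e_def R_def)
  have t1: "k * \<bar>\<eta>' x * Re (dw x * cnj (w x))\<bar> \<le> \<eta> x * (k / 16 * D\<^sup>2 + k / 16 * R\<^sup>2)"
  proof -
    have "\<bar>Re (dw x * cnj (w x))\<bar> \<le> D * R"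
      using order_trans[OF abs_Re_le_cmod[of "dw x * cnj (w x)"]] mult_left_mono[OF ww_le(2)[of x] pos(2)]
      by (simp add: norm_mult D_def R_def)
    hence "\<bar>\<eta>' x\<bar> * \<bar>Re (dw x * cnj (w x))\<bar> \<le> \<eta> x / 8 * (D * R)"
      using \<eta>'_bound[of x] \<eta>_nonneg[of x] by (intro mult_mono) auto
    also have "\<dots> \<le> \<eta> x / 8 * (1/2 * D\<^sup>2 + R\<^sup>2 / (4 * (1/2)))" using \<eta>_nonneg[of x] by (intro mult_left_mono amgm) auto
    finally have "k * (\<bar>\<eta>' x\<bar> * \<bar>Re (dw x * cnj (w x))\<bar>) \<le> k * (\<eta> x / 8 * (1/2 * D\<^sup>2 + R\<^sup>2 / (4 * (1/2))))"
      using pos by (intro mult_left_mono) auto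
    also have "\<dots> = \<eta> x * (k / 16 * D\<^sup>2 + k / 16 * R\<^sup>2)" by (simp add: algebra_simps)
    finally show ?thesis unfolding abs_mult[of "\<eta>' x"] .
  qed
  have t2: "k * \<bar>\<eta>' x * Re (q x * v x)\<bar> \<le> \<eta> x * (e / 4 * Q\<^sup>2 + e / 4 * k\<^sup>2 * R\<^sup>2)"
  proof -
    have "\<bar>Re (q x * v x)\<bar> \<le> Q * (4 * e * R)"
      using order_trans[OF abs_Re_le_cmod[of "q x * v x"]] mult_left_mono[OF vl pos(3)]
      by (simp add: norm_mult Q_def)
    hence "\<bar>\<eta>' x\<bar> * \<bar>Re (q x * v x)\<bar> \<le> \<eta> x / 8 * (Q * (4 * e * R))"
      using \<eta>'_bound[of x] \<eta>_nonneg[of x] by (intro mult_mono) auto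
    hence "k * (\<bar>\<eta>' x\<bar> * \<bar>Re (q x * v x)\<bar>) \<le> k * (\<eta> x / 8 * (Q * (4 * e * R)))"
      using pos by (intro mult_left_mono) auto
    also have "\<dots> = \<eta> x * (e / 2) * (Q * (k * R))" by simp
    also have "\<dots> \<le> \<eta> x * (e / 2) * (1/2 * Q\<^sup>2 + (k * R)\<^sup>2 / (4 * (1/2)))"
      using \<eta>_nonneg[of x] pos by (intro mult_left_mono amgm) auto
    also have "\<dots> = \<eta> x * (e / 4 * Q\<^sup>2 + e / 4 * k\<^sup>2 * R\<^sup>2)" by (simp add: power_mult_distrib algebra_simps)
    finally show ?thesis unfolding abs_mult[of "\<eta>' x"] .
  qed
  define Y where "Y = 4 * k * G + Q\<^sup>2"
  have Y0: "Y \<ge> 0" using pos by (simp add: Y_def)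
  have Y2: "Y\<^sup>2 \<le> 32 * k\<^sup>2 * G\<^sup>2 + 2 * Q^4"
  proof -
    have "0 \<le> (4 * k * G - Q\<^sup>2)\<^sup>2" by simp
    thus ?thesis by (simp add: Y_def power2_eq_square power4_eq_xxxx algebra_simps)
  qed
  have t3: "k * \<bar>\<eta> x * (Im (q x * u x) * (2 * k * Re (q x * u x) + (cmod (q x))\<^sup>2))\<bar>
      \<le> \<eta> x * (k / 64 * D\<^sup>2 + 17 * e * Y\<^sup>2)"
  proof -
    \<comment> \<open>\<open>q - dw\<close> is a real multiple of \<open>w\<close>, so it drops out
      of the imaginary part; this is where the cubic current gains a derivative.\<close>
    have "Im (q x * cnj (w x)) = Im (dw x * cnj (w x))" by (simp add: dw_def algebra_simps)
    hence "Im (q x * u x) = Im (dw x * cnj (w x)) + Im (q x * v x)" by (simp add: u_eq algebra_simps)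
    moreover have "\<bar>Im (dw x * cnj (w x))\<bar> \<le> D * s"
      using order_trans[OF abs_Im_le_cmod[of "dw x * cnj (w x)"]] mult_left_mono[OF ww_le(1)[of x] pos(2)]
      by (simp add: norm_mult D_def)
    moreover have "\<bar>Im (q x * v x)\<bar> \<le> 4 * e * G"
      using order_trans[OF abs_Im_le_cmod[of "q x * v x"]] mult_left_mono[OF vl pos(3)]
      by (simp add: norm_mult Q_def QR mult_ac)
    ultimately have 1: "\<bar>Im (q x * u x)\<bar> \<le> D * s + 4 * e * G" by linarith
    have "\<bar>Re (q x * u x)\<bar> \<le> 2 * G"
      using order_trans[OF abs_Re_le_cmod[of "q x * u x"]] mult_left_mono[OF u_le[of x] pos(3)]
      by (simp add: norm_mult Q_def QR R_def mult_ac)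
    hence "\<bar>2 * k * Re (q x * u x)\<bar> \<le> 4 * k * G" using pos by (simp add: abs_mult)
    hence 2: "\<bar>2 * k * Re (q x * u x) + (cmod (q x))\<^sup>2\<bar> \<le> Y"
      by (intro order_trans[OF abs_triangle_ineq]) (simp add: Y_def Q_def del: times_complex.sel)
    have "k * (\<bar>Im (q x * u x)\<bar> * \<bar>2 * k * Re (q x * u x) + (cmod (q x))\<^sup>2\<bar>) \<le> k * ((D * s + 4 * e * G) * Y)"
      using 1 2 pos by (intro mult_left_mono mult_mono) auto
    also have "\<dots> = D * (k * s * Y) + e * (4 * k * G) * Y" by (simp add: algebra_simps)
    also have "\<dots> \<le> (k / 64 * D\<^sup>2 + (k * s * Y)\<^sup>2 / (4 * (k / 64))) + e * Y * Y"
      using pos Y0 by (intro add_mono amgm mult_right_mono mult_left_mono) (auto simp: Y_def)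
    also have "(k * s * Y)\<^sup>2 / (4 * (k / 64)) = 16 * e * Y\<^sup>2"
      using pos by (simp add: e_def power2_eq_square)
    also have "k / 64 * D\<^sup>2 + 16 * e * Y\<^sup>2 + e * Y * Y = k / 64 * D\<^sup>2 + 17 * e * Y\<^sup>2"
      by (simp add: power2_eq_square)
    finally have "k * (\<bar>Im (q x * u x)\<bar> * \<bar>2 * k * Re (q x * u x) + (cmod (q x))\<^sup>2\<bar>) \<le> k / 64 * D\<^sup>2 + 17 * e * Y\<^sup>2" .
    from mult_left_mono[OF this \<eta>_nonneg[of x]] show ?thesis using \<eta>_nonneg[of x] by (simp add: abs_mult mult_ac)
  qed
  define Z where "Z = G + 4 * k * H"
  have Z2: "Z\<^sup>2 \<le> 2 * G\<^sup>2 + 32 * k\<^sup>2 * H\<^sup>2"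
  proof -
    have "0 \<le> (G - 4 * k * H)\<^sup>2" by simp
    thus ?thesis by (simp add: Z_def power2_eq_square algebra_simps)
  qed
  have t4: "k * \<bar>2 * \<eta> x * Re (dw x * (f x - 4 * k * v x))\<bar> \<le> \<eta> x * (k / 64 * D\<^sup>2 + 1024 * e * k\<^sup>2 * Z\<^sup>2)"
  proof -
    have "cmod (f x - 4 * k * v x) \<le> cmod (f x) + cmod (4 * k * v x)" by (rule norm_triangle_ineq4)
    also have "cmod (4 * k * v x) = 4 * k * cmod (v x)" using pos by (simp add: norm_mult)
    also have "cmod (f x) + 4 * k * cmod (v x) \<le> 4 * k * s * G + 4 * k * (4 * k * s * H)"
      using f_le[of x] v_le'[of x] pos unfolding G_def H_def by (intro add_mono mult_left_mono) auto
    finally have fz: "cmod (f x - 4 * k * v x) \<le> 4 * k * s * Z" by (simp add: Z_def algebra_simps)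
    have "\<bar>Re (dw x * (f x - 4 * k * v x))\<bar> \<le> D * (4 * k * s * Z)"
      using order_trans[OF abs_Re_le_cmod[of "dw x * (f x - 4 * k * v x)"]] mult_left_mono[OF fz pos(2)]
      by (simp add: norm_mult D_def)
    hence "2 * k * \<bar>Re (dw x * (f x - 4 * k * v x))\<bar> \<le> 2 * k * (D * (4 * k * s * Z))"
      using pos by (intro mult_left_mono) auto
    also have "\<dots> = D * (8 * k\<^sup>2 * s * Z)" by (simp add: power2_eq_square)
    also have "\<dots> \<le> k / 64 * D\<^sup>2 + (8 * k\<^sup>2 * s * Z)\<^sup>2 / (4 * (k / 64))" using pos by (intro amgm) auto
    also have "(8 * k\<^sup>2 * s * Z)\<^sup>2 / (4 * (k / 64)) = 1024 * e * k\<^sup>2 * Z\<^sup>2"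
      using pos by (simp add: e_def power2_eq_square)
    finally have "2 * k * \<bar>Re (dw x * (f x - 4 * k * v x))\<bar> \<le> k / 64 * D\<^sup>2 + 1024 * e * k\<^sup>2 * Z\<^sup>2" .
    moreover have "k * \<bar>2 * \<eta> x * X\<bar> = \<eta> x * (2 * k * \<bar>X\<bar>)" for X
      using \<eta>_nonneg[of x] by (simp add: abs_mult)
    ultimately show ?thesis using mult_left_mono[OF _ \<eta>_nonneg[of x]] by (simp only:)
  qed
  have t5: "k * \<bar>4 * k * \<eta>' x * Re (w x * v x)\<bar> \<le> \<eta> x * (2 * e * k\<^sup>2 * R\<^sup>2)"
  proof -
    have "\<bar>Re (w x * v x)\<bar> \<le> cmod (w x) * cmod (v x)"
      using abs_Re_le_cmod[of "w x * v x"] by (simp add: norm_mult)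
    also have "\<dots> \<le> R * (4 * e * R)" using ww_le(2)[of x] vl pos by (intro mult_mono) (auto simp: R_def)
    finally have "\<bar>\<eta>' x\<bar> * \<bar>Re (w x * v x)\<bar> \<le> \<eta> x / 8 * (R * (4 * e * R))"
      using \<eta>'_bound[of x] \<eta>_nonneg[of x] by (intro mult_mono) auto
    hence "4 * k\<^sup>2 * (\<bar>\<eta>' x\<bar> * \<bar>Re (w x * v x)\<bar>) \<le> 4 * k\<^sup>2 * (\<eta> x / 8 * (R * (4 * e * R)))"
      by (intro mult_left_mono) auto
    also have "\<dots> = \<eta> x * (2 * e * k\<^sup>2 * R\<^sup>2)" by (simp add: power2_eq_square)
    finally have "4 * k\<^sup>2 * (\<bar>\<eta>' x\<bar> * \<bar>Re (w x * v x)\<bar>) \<le> \<eta> x * (2 * e * k\<^sup>2 * R\<^sup>2)" .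
    moreover have "k * \<bar>4 * k * \<eta>' x * X\<bar> = 4 * k\<^sup>2 * (\<bar>\<eta>' x\<bar> * \<bar>X\<bar>)" for X
      using pos by (simp add: abs_mult power2_eq_square)
    ultimately show ?thesis by (simp only:)
  qed
  have "\<bar>err x\<bar> \<le> \<bar>\<eta>' x * Re (dw x * cnj (w x))\<bar> + \<bar>\<eta>' x * Re (q x * v x)\<bar>
    + \<bar>\<eta> x * (Im (q x * u x) * (2 * k * Re (q x * u x) + (cmod (q x))\<^sup>2))\<bar>
    + \<bar>2 * \<eta> x * Re (dw x * (f x - 4 * k * v x))\<bar> + \<bar>4 * k * \<eta>' x * Re (w x * v x)\<bar>"
    unfolding err_def by linarith
  hence "k * \<bar>err x\<bar> \<le> k * (\<bar>\<eta>' x * Re (dw x * cnj (w x))\<bar> + \<bar>\<eta>' x * Re (q x * v x)\<bar>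
    + \<bar>\<eta> x * (Im (q x * u x) * (2 * k * Re (q x * u x) + (cmod (q x))\<^sup>2))\<bar>
    + \<bar>2 * \<eta> x * Re (dw x * (f x - 4 * k * v x))\<bar> + \<bar>4 * k * \<eta>' x * Re (w x * v x)\<bar>)"
    using pos by (intro mult_left_mono) auto
  also have "\<dots> \<le> \<eta> x * (k / 16 * D\<^sup>2 + k / 16 * R\<^sup>2) + \<eta> x * (e / 4 * Q\<^sup>2 + e / 4 * k\<^sup>2 * R\<^sup>2)
    + \<eta> x * (k / 64 * D\<^sup>2 + 17 * e * Y\<^sup>2) + \<eta> x * (k / 64 * D\<^sup>2 + 1024 * e * k\<^sup>2 * Z\<^sup>2) + \<eta> x * (2 * e * k\<^sup>2 * R\<^sup>2)"
    using t1 t2 t3 t4 t5 by (simp only: distrib_left)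
  also have "\<dots> = \<eta> x * (3 / 32 * (k * D\<^sup>2) + (k / 16 + 9 / 4 * e * k\<^sup>2) * R\<^sup>2 + e / 4 * Q\<^sup>2 + 17 * e * Y\<^sup>2 + 1024 * e * k\<^sup>2 * Z\<^sup>2)"
    by (simp add: algebra_simps)
  also have "\<dots> \<le> \<eta> x * (1 / 8 * (k * D\<^sup>2) + (k / 16 + 9 / 4 * e * k\<^sup>2) * R\<^sup>2 + e / 4 * Q\<^sup>2
      + 17 * e * (32 * k\<^sup>2 * G\<^sup>2 + 2 * Q^4) + 1024 * e * k\<^sup>2 * (2 * G\<^sup>2 + 32 * k\<^sup>2 * H\<^sup>2))"
    using pos by (intro mult_left_mono[OF _ \<eta>_nonneg] add_mono mult_left_mono Y2 Z2 mult_right_mono) auto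
  also have "\<dots> = \<eta> x * (1 / 8 * (k * D\<^sup>2) + (k / 16 + 9 / 4 * e * k\<^sup>2) * R\<^sup>2 + e / 4 * Q\<^sup>2
      + e * (34 * Q^4 + 2592 * k\<^sup>2 * G\<^sup>2 + 32768 * k^4 * H\<^sup>2))"
    by (simp add: algebra_simps power2_eq_square power4_eq_xxxx)
  finally show ?thesis unfolding D_def Q_def R_def G_def H_def e_def .
qed

text \<open>The weighted bounds turn every quartic quantity into a multiple of \<open>A\<close>:
  \<open>34 + 1296 + 8192 = 9522\<close>, rounded up to 10000. The coefficients of \<open>m\<close>
  are acceptable because \<open>1 / k\<close> and \<open>k s^2\<close> are both summable over the
  scales.\<close>

lemma current_estimate:
  "\<bar>- (LINT x|lborel. \<eta> x * Re (current x)) - 2 * (k * wint (\<lambda>x. (cmod (dw x))\<^sup>2))\<bar>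
    \<le> 1 / 8 * (k * wint (\<lambda>x. (cmod (dw x))\<^sup>2)) + (1 / k + 2 * (k * s\<^sup>2)) * m + 10000 * (k * s\<^sup>2) * A"
proof -
  define e where "e = k * s\<^sup>2"
  have e0: "e \<ge> 0" using k0 by (simp add: e_def)
  have nerr: "nice err" unfolding err_def[abs_def]
    by (intro nice_add nice_diff nice_mult_left[OF \<eta>'_nice] nice_mult_left[OF \<eta>_nice]
        nice_mult_left[OF nice_mult_right[OF bcont_const \<eta>_nice]] nice_mult_left[OF nice_mult_right[OF bcont_const \<eta>'_nice]]
        bcont_rules bconts)
  have "k * \<bar>LINT x|lborel. err x\<bar> \<le> k * (LINT x|lborel. \<bar>err x\<bar>)"
    using k0 integral_norm_bound[of lborel err] by (intro mult_left_mono) auto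
  also have "\<dots> = (LINT x|lborel. k * \<bar>err x\<bar>)" by simp
  also have "\<dots> \<le> wint (\<lambda>x. 1 / 8 * (k * (cmod (dw x))\<^sup>2) + (k / 16 + 9 / 4 * e * k\<^sup>2) * (Rq x)\<^sup>2
    + e / 4 * (cmod (q x))\<^sup>2 + e * (34 * (cmod (q x))^4 + 2592 * k\<^sup>2 * (g x)\<^sup>2 + 32768 * k^4 * (Rg x)\<^sup>2))"
    unfolding wint_def e_def
    by (rule integral_mono[OF _ wint_integrable err_pointwise])
      (intro integrable_mult_right integrable_abs nice_integrable nerr bcont_rules bconts)+
  also have "\<dots> = 1 / 8 * (k * wint (\<lambda>x. (cmod (dw x))\<^sup>2)) + (k / 16 + 9 / 4 * e * k\<^sup>2) * wint (\<lambda>x. (Rq x)\<^sup>2) + e / 4 * m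
     + e * (34 * A + 2592 * k\<^sup>2 * wint (\<lambda>x. (g x)\<^sup>2) + 32768 * k^4 * wint (\<lambda>x. (Rg x)\<^sup>2))"
  proof -
    have 1: "wint (\<lambda>x. 34 * (cmod (q x))^4 + 2592 * k\<^sup>2 * (g x)\<^sup>2 + 32768 * k^4 * (Rg x)\<^sup>2)
      = 34 * A + 2592 * k\<^sup>2 * wint (\<lambda>x. (g x)\<^sup>2) + 32768 * k^4 * wint (\<lambda>x. (Rg x)\<^sup>2)"
      unfolding A_def wint_cmult[symmetric]
      by (subst wint_add, (intro bcont_rules bconts)+)+ (rule refl)
    show ?thesis
      unfolding 1[symmetric] unfolding m_def wint_cmult[symmetric]
      by (subst wint_add, (intro bcont_rules bconts)+)+ (rule refl)
  qed
  also have "\<dots> \<le> 1 / 8 * (k * wint (\<lambda>x. (cmod (dw x))\<^sup>2)) + (k / 16 + 9 / 4 * e * k\<^sup>2) * (m / (2 * k\<^sup>2)) + e / 4 * m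
     + e * (34 * A + 2592 * k\<^sup>2 * (A / (2 * k\<^sup>2)) + 32768 * k^4 * (A / (4 * k^4)))"
    using e0 k0 by (intro add_mono mult_left_mono wint_Rq_sq wint_g_sq wint_Rg_sq order_refl) auto
  also have "\<dots> = 1 / 8 * (k * wint (\<lambda>x. (cmod (dw x))\<^sup>2)) + (1 / (32 * k) + 11 / 8 * e) * m + 9522 * e * A"
    using k0 by (simp add: field_simps power2_eq_square power4_eq_xxxx)
  also have "\<dots> \<le> 1 / 8 * (k * wint (\<lambda>x. (cmod (dw x))\<^sup>2)) + (1 / k + 2 * e) * m + 10000 * e * A"
    using e0 k0 A0 m0 by (intro add_mono order_refl mult_right_mono) (auto simp: field_simps)
  finally have "k * \<bar>LINT x|lborel. err x\<bar> \<le> \<dots>" .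
  thus ?thesis unfolding current_identity e_def using k0 by (simp add: abs_mult)
qed

end

section \<open>The density summed over scales\<close>

definition ip :: "(real \<Rightarrow> complex) \<Rightarrow> (real \<Rightarrow> complex) \<Rightarrow> real" where
  "ip f g = (LINT x|lborel. Re (f x * cnj (g x)))"

lemma ip_integrable: "nice f \<Longrightarrow> nice g \<Longrightarrow> integrable lborel (\<lambda>x. Re (f x * cnj (g x)))"
  by (intro nice_integrable nice_Re nice_mult_left bcont_cnj bcont_nice)

lemma ip_commute: "ip f g = ip g f"
  unfolding ip_def by (intro Bochner_Integration.integral_cong refl) (simp add: mult.commute)

lemma ip_self: "ip f f = sqint f"
  unfolding ip_def sqint_def by (intro Bochner_Integration.integral_cong refl) (simp add: cmod_power2 flip: power2_eq_square)

lemma ip_lin: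
  assumes "nice f" "nice g" "nice h"
  shows "ip (\<lambda>x. complex_of_real a * f x + complex_of_real b * g x) h = a * ip f h + b * ip g h"
proof -
  have eq: "Re ((complex_of_real a * f x + complex_of_real b * g x) * cnj (h x)) = a * Re (f x * cnj (h x)) + b * Re (g x * cnj (h x))" for x
    by (simp add: algebra_simps)
  show ?thesis unfolding ip_def eq
    using ip_integrable[OF assms(1,3)] ip_integrable[OF assms(2,3)] by simp
qed

lemma ip_parts:
  assumes "\<And>x. (F has_vector_derivative f x) (at x)" "\<And>x. (G has_vector_derivative g x) (at x)"
    and n: "nice F" "nice f" "nice G" "nice g"
  shows "ip f G = - ip F g"
proof -
  have "(LINT x|lborel. Re (F x * cnj (g x) + f x * cnj (G x))) = 0"
  proof (rule integral_derivative_nice)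
    show "((\<lambda>x. Re (F x * cnj (G x))) has_vector_derivative Re (F x * cnj (g x) + f x * cnj (G x))) (at x)" for x
      by (intro bounded_linear.has_vector_derivative[OF bounded_linear_Re] has_vector_derivative_mult assms
          bounded_linear.has_vector_derivative[OF bounded_linear_cnj])
    show "nice (\<lambda>x. Re (F x * cnj (g x) + f x * cnj (G x)))" "nice (\<lambda>x. Re (F x * cnj (G x)))"
      by (intro nice_Re nice_add nice_mult_left n bcont_cnj bcont_nice)+
  qed
  thus ?thesis unfolding ip_def plus_complex.sel
    using ip_integrable[OF n(1,4)] ip_integrable[OF n(2,3)] by simp
qed

text \<open>Reflection turns the resolvent into its adjoint, the inverse of
  \<open>2 k - \<partial>\<close>; the composition is the inverse of
  \<open>4 k^2 - \<partial>^2\<close>.\<close>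

definition resolv_sym :: "real \<Rightarrow> (real \<Rightarrow> complex) \<Rightarrow> real \<Rightarrow> complex" where
  "resolv_sym k q x = resolv (2 * k) (\<lambda>y. resolv (2 * k) q (- y)) (- x)"

definition dresolv_sym :: "real \<Rightarrow> (real \<Rightarrow> complex) \<Rightarrow> real \<Rightarrow> complex" where
  "dresolv_sym k q x = 2 * k * resolv_sym k q x - resolv (2 * k) q x"

lemma nice_reflect: assumes "nice f" shows "nice (\<lambda>x. f (- x))"
proof -
  obtain B where "\<And>x. norm (f x) \<le> B / (1 + x\<^sup>2)" using niceE[OF assms] by blast
  hence "norm (f (- x)) \<le> B / (1 + x\<^sup>2)" for x by (metis power2_minus)
  thus ?thesis by (intro niceI continuous_on_compose2[OF nice_cont[OF assms]] continuous_intros) auto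
qed

context
  fixes k :: real and q :: "real \<Rightarrow> complex"
  assumes k: "k > 0" and q: "nice q"
begin

lemma resolv_sym_nice: "nice (resolv_sym k q)" and dresolv_sym_nice: "nice (dresolv_sym k q)"
proof -
  have c: "2 * k > 0" using k by simp
  show n: "nice (resolv_sym k q)" unfolding resolv_sym_def[abs_def]
    by (rule nice_reflect[where f="resolv (2 * k) (\<lambda>y. resolv (2 * k) q (- y))"])
      (intro resolv_nice c nice_reflect q)
  show "nice (dresolv_sym k q)" unfolding dresolv_sym_def[abs_def]
    by (intro nice_diff nice_mult_right bcont_rules n resolv_nice c q)
qed

lemma resolv_sym_deriv: "(resolv_sym k q has_vector_derivative dresolv_sym k q x) (at x)"
proof -
  have c: "2 * k > 0" using k by simp
  let ?R = "resolv (2 * k) (\<lambda>y. resolv (2 * k) q (- y))"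
  have d: "(?R has_vector_derivative (resolv (2 * k) q (- (- x)) - (2 * k) *\<^sub>R ?R (- x))) (at (- x))"
    by (rule resolv_deriv[OF c bcont_nice[OF nice_reflect[OF resolv_nice[OF c q]]]])
  have "((?R \<circ> uminus) has_vector_derivative (- 1) *\<^sub>R (resolv (2 * k) q (- (- x)) - (2 * k) *\<^sub>R ?R (- x))) (at x)"
    by (rule vector_diff_chain_at[where f=uminus and f'="-1" and g="?R" and x=x, OF _ d]) (auto intro!: derivative_eq_intros)
  moreover have "?R \<circ> uminus = resolv_sym k q" by (auto simp: resolv_sym_def o_def)
  ultimately show ?thesis by (simp add: dresolv_sym_def resolv_sym_def scaleR_conv_of_real)
qed

lemma dresolv_sym_deriv: "(dresolv_sym k q has_vector_derivative (4 * k\<^sup>2 * resolv_sym k q x - q x)) (at x)"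
proof -
  have c: "2 * k > 0" using k by simp
  have "(dresolv_sym k q has_vector_derivative (2 * k * dresolv_sym k q x - (q x - (2 * k) *\<^sub>R resolv (2 * k) q x))) (at x)"
  proof -
    have e: "dresolv_sym k q = (\<lambda>x. complex_of_real (2 * k) * resolv_sym k q x - resolv (2 * k) q x)"
      by (auto simp: dresolv_sym_def)
    show ?thesis
      by (subst e) (intro has_vector_derivative_diff resolv_deriv[OF c bcont_nice[OF q]]
        bounded_linear.has_vector_derivative[OF bounded_linear_mult_right] resolv_sym_deriv)
  qed
  thus ?thesis by (simp add: dresolv_sym_def scaleR_conv_of_real power2_eq_square algebra_simps)
qed

lemma sym_second_nice: "nice (\<lambda>x. 4 * k\<^sup>2 * resolv_sym k q x - q x)"
  by (intro nice_diff nice_mult_right[OF bcont_const] resolv_sym_nice q)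

text \<open>Multiplier \<open>4 k^2 / (4 k^2 + \<xi>^2)\<close>: the part of the mass at frequencies
  below \<open>k\<close>.\<close>

definition low :: real where "low = (2 * k)\<^sup>2 * sqint (resolv (2 * k) q)"

lemma low_nonneg: "low \<ge> 0" and low_le: "low \<le> sqint q"
proof -
  show "low \<ge> 0" by (simp add: low_def sqint_nonneg)
  have "high k q \<ge> 0" unfolding high_def by (rule sqint_nonneg)
  thus "low \<le> sqint q" using high_eq[OF k q] by (simp add: low_def)
qed

lemma low_eq: "low = (2 * k)\<^sup>2 * ip q (resolv_sym k q)"
proof -
  have c: "2 * k > 0" using k by simp
  define w where "w = resolv (2 * k) q"
  have w: "nice w" unfolding w_def by (intro resolv_nice c q)
  have dw: "nice (\<lambda>x. q x - 2 * k * w x)" by (intro nice_diff nice_mult_right bcont_rules q w)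
  have d: "(w has_vector_derivative (q x - 2 * k * w x)) (at x)" for x
    using resolv_deriv[OF c bcont_nice[OF q], of x] by (simp add: w_def scaleR_conv_of_real)
  have "ip (\<lambda>x. q x - 2 * k * w x) (resolv_sym k q) = - ip w (dresolv_sym k q)"
    by (rule ip_parts[OF d resolv_sym_deriv w dw resolv_sym_nice dresolv_sym_nice])
  moreover have "(\<lambda>x. q x - 2 * k * w x) = (\<lambda>x. complex_of_real 1 * q x + complex_of_real (- (2 * k)) * w x)" by auto
  ultimately have "ip q (resolv_sym k q) = 2 * k * ip w (resolv_sym k q) - ip w (dresolv_sym k q)"
    using ip_lin[OF q w resolv_sym_nice, of 1 "- (2 * k)"] by simp
  also have "\<dots> = ip (\<lambda>x. complex_of_real (2 * k) * resolv_sym k q x + complex_of_real (- 1) * dresolv_sym k q x) w"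
    using ip_lin[OF resolv_sym_nice dresolv_sym_nice w, of "2 * k" "-1"] by (simp add: ip_commute[of w])
  also have "(\<lambda>x. complex_of_real (2 * k) * resolv_sym k q x + complex_of_real (- 1) * dresolv_sym k q x) = w"
    by (auto simp: dresolv_sym_def w_def)
  finally show ?thesis by (simp add: ip_self low_def w_def)
qed

end

text \<open>Write \<open>Y_a\<close> for the symmetric resolvent, so
  \<open>4 a^2 Y_a - Y_a'' = q\<close>. Integrating by parts with this equation, and with the one
  for \<open>b\<close>, expresses \<open>low\<close> at both scales through the inner products of
  \<open>Y_a\<close>, \<open>Y_b\<close> and of their derivatives; the former cancel in the
  difference, as in the resolvent identity.\<close>

lemma sym_cross:
  assumes a: "a > 0" and b: "b > 0" and q: "nice q"
  shows "4 * (b\<^sup>2 - a\<^sup>2) * ip (dresolv_sym a q) (dresolv_sym b q) = low b q - low a q"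
proof -
  note n = resolv_sym_nice[OF a q] dresolv_sym_nice[OF a q] sym_second_nice[OF a q]
    resolv_sym_nice[OF b q] dresolv_sym_nice[OF b q] sym_second_nice[OF b q]
  have half: "4 * c\<^sup>2 * ip (resolv_sym c q) (resolv_sym d q) - ip q (resolv_sym d q) = - ip (dresolv_sym c q) (dresolv_sym d q)"
    if c: "c > 0" and d: "d > 0" for c d
  proof -
    have "ip (\<lambda>x. 4 * c\<^sup>2 * resolv_sym c q x - q x) (resolv_sym d q) = - ip (dresolv_sym c q) (dresolv_sym d q)"
      by (rule ip_parts[OF dresolv_sym_deriv[OF c q] resolv_sym_deriv[OF d q]])
        (intro dresolv_sym_nice sym_second_nice resolv_sym_nice c d q)+
    moreover have "(\<lambda>x. 4 * c\<^sup>2 * resolv_sym c q x - q x) = (\<lambda>x. complex_of_real (4 * c\<^sup>2) * resolv_sym c q x + complex_of_real (- 1) * q x)"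
      by auto
    ultimately show ?thesis using ip_lin[OF resolv_sym_nice[OF c q] q resolv_sym_nice[OF d q], of "4 * c\<^sup>2" "-1"] by simp
  qed
  have 1: "ip q (resolv_sym b q) = 4 * a\<^sup>2 * ip (resolv_sym a q) (resolv_sym b q) + ip (dresolv_sym a q) (dresolv_sym b q)"
    using half[OF a b] by simp
  have 2: "ip q (resolv_sym a q) = 4 * b\<^sup>2 * ip (resolv_sym a q) (resolv_sym b q) + ip (dresolv_sym a q) (dresolv_sym b q)"
    using half[OF b a] by (simp add: ip_commute[of "resolv_sym b q"] ip_commute[of "dresolv_sym b q"])
  show ?thesis unfolding low_eq[OF a q] low_eq[OF b q] 1 2 by (simp add: power2_eq_square algebra_simps)
qed

text \<open>In Fourier variables the ratio of the multipliers,
  \<open>(64 a^2 + \<xi>^2) / (4 a^2 + \<xi>^2)\<close>, is at most 16. The energy argument for the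
  difference \<open>h\<close> of the two symmetric resolvents yields 17.\<close>

lemma sym_diag:
  assumes a: "a > 0" and q: "nice q"
  shows "sqint (dresolv_sym a q) \<le> 17 * ip (dresolv_sym a q) (dresolv_sym (4 * a) q)"
proof -
  have b: "4 * a > 0" using a by simp
  define Y Z where "Y = resolv_sym a q" and "Z = resolv_sym (4 * a) q"
  define dY dZ where "dY = dresolv_sym a q" and "dZ = dresolv_sym (4 * a) q"
  have n: "nice Y" "nice Z" "nice dY" "nice dZ" unfolding Y_def Z_def dY_def dZ_def
    by (intro resolv_sym_nice dresolv_sym_nice a b q)+
  define h where "h x = Y x - Z x" for x
  define h' where "h' x = dY x - dZ x" for x
  define h'' where "h'' x = complex_of_real (64 * a\<^sup>2) * h x + complex_of_real (- (60 * a\<^sup>2)) * Y x" for x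
  have nh: "nice h" "nice h'" unfolding h_def[abs_def] h'_def[abs_def] by (intro nice_diff n)+
  have nh'': "nice h''" unfolding h''_def[abs_def] by (intro nice_add nice_mult_right bcont_const nh n)
  have d1: "(h has_vector_derivative h' x) (at x)" for x unfolding h_def[abs_def] h'_def Y_def Z_def dY_def dZ_def
    by (intro has_vector_derivative_diff resolv_sym_deriv a b q)
  have d2: "(h' has_vector_derivative h'' x) (at x)" for x
  proof -
    have "(h' has_vector_derivative ((4 * a\<^sup>2 * Y x - q x) - (complex_of_real (4 * (4 * a)\<^sup>2) * Z x - q x))) (at x)"
      unfolding h'_def[abs_def] Y_def Z_def dY_def dZ_def
      by (intro has_vector_derivative_diff dresolv_sym_deriv a b q)
    thus ?thesis by (simp add: h''_def h_def algebra_simps power_mult_distrib)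
  qed
  have Yd: "(Y has_vector_derivative dY x) (at x)" for x unfolding Y_def dY_def by (rule resolv_sym_deriv[OF a q])
  define P where "P = ip dY h'"
  have "sqint h'' = ip h'' h''" by (simp add: ip_self)
  also have "\<dots> = 64 * a\<^sup>2 * ip h h'' + (- (60 * a\<^sup>2)) * ip Y h''"
    using ip_lin[OF nh(1) n(1) nh'', of "64 * a\<^sup>2" "- (60 * a\<^sup>2)"] unfolding h''_def[abs_def] by simp
  also have "ip h h'' = - sqint h'"
    using ip_parts[OF d1 d2 nh nh(2) nh''] by (simp add: ip_self)
  also have "ip Y h'' = - P"
    using ip_parts[OF Yd d2 n(1,3) nh(2) nh''] by (simp add: P_def)
  finally have "64 * a\<^sup>2 * sqint h' \<le> 60 * a\<^sup>2 * P" using sqint_nonneg[of h''] by simp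
  hence 1: "64 * sqint h' \<le> 60 * P" using a by (simp add: mult.commute mult.left_commute)
  have two: "2 * ip f g \<le> sqint f + sqint g" if f: "nice f" and g: "nice g" for f g
  proof -
    have "0 \<le> sqint (\<lambda>x. complex_of_real 1 * f x + complex_of_real (-1) * g x)" by (rule sqint_nonneg)
    also have "\<dots> = ip (\<lambda>x. complex_of_real 1 * f x + complex_of_real (-1) * g x) (\<lambda>x. complex_of_real 1 * f x + complex_of_real (-1) * g x)"
      by (simp add: ip_self)
    also have "\<dots> = sqint f - 2 * ip f g + sqint g"
      using ip_lin[OF f g, of "\<lambda>x. complex_of_real 1 * f x + complex_of_real (-1) * g x" 1 "-1"]
        ip_lin[OF f g f, of 1 "-1"] ip_lin[OF f g g, of 1 "-1"] nice_diff[OF f g]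
      by (simp add: ip_commute[of f "\<lambda>x. f x - g x"] ip_commute[of g "\<lambda>x. f x - g x"] ip_commute[of g f] ip_self)
    finally show ?thesis by simp
  qed
  have 2: "2 * P \<le> sqint dY + sqint h'" unfolding P_def by (rule two[OF n(3) nh(2)])
  have "P = sqint dY - ip dY dZ"
    using ip_lin[OF n(3,4,3), of 1 "-1"] unfolding P_def h'_def[abs_def]
    by (simp add: ip_commute[of dY "\<lambda>x. dY x - dZ x"] ip_commute[of dZ dY] ip_self)
  with 1 2 show ?thesis unfolding dY_def[symmetric] dZ_def[symmetric] by linarith
qed

text \<open>The inner products of the summands are divided differences of the increasing sequence \<open>low k\<^sub>j q\<close>,
  so their sum telescopes instead of growing with \<open>J\<close>; the sum \<open>H\<close> carries the induction.\<close>

lemma sym_sum: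
  assumes k: "k > 0" and q: "nice q"
  shows "sqint (\<lambda>x. \<Sum>j<J. complex_of_real (k * 4^j) * dresolv_sym (k * 4^j) q x) \<le> sqint q"
proof -
  define K where "K j = k * 4^j" for j :: nat
  have K: "K j > 0" for j using k by (simp add: K_def)
  have KS: "K (Suc j) = 4 * K j" for j by (simp add: K_def)
  define D where "D j = dresolv_sym (K j) q" for j
  have D: "nice (D j)" for j unfolding D_def by (rule dresolv_sym_nice[OF K q])
  define L where "L j = low (K j) q" for j
  define S where "S J x = (\<Sum>j<J. complex_of_real (K j) * D j x)" for J x
  have S: "nice (S J)" for J
  proof (induction J)
    case 0 show ?case by (simp add: S_def nice_zero)
  next
    case (Suc J)
    have "nice (\<lambda>x. S J x + complex_of_real (K J) * D J x)" by (intro nice_add Suc nice_mult_right bcont_const D)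
    thus ?case by (simp add: S_def)
  qed
  \<comment> \<open>\<open>4 ((4 K)^2 - K^2) = 60 K^2\<close>: neighbouring scales produce one
    increment of the sequence \<open>L\<close>.\<close>
  have nxt: "(K j)\<^sup>2 * ip (D j) (D (Suc j)) = (L (Suc j) - L j) / 60" for j
    using sym_cross[OF K K q, of "Suc j" j] unfolding D_def[symmetric] L_def[symmetric] unfolding KS
    by (simp add: power_mult_distrib algebra_simps)
  have diag: "(K j)\<^sup>2 * sqint (D j) \<le> 17 * ((L (Suc j) - L j) / 60)" for j
  proof -
    have "sqint (D j) \<le> 17 * ip (D j) (D (Suc j))" using sym_diag[OF K q, of j] by (simp add: D_def KS)
    from mult_left_mono[OF this, of "(K j)\<^sup>2"] show ?thesis unfolding nxt[symmetric] by simp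
  qed
  have mono1: "L j \<le> L (Suc j)" for j
    using order_trans[OF mult_nonneg_nonneg[OF zero_le_power2 sqint_nonneg] diag[of j]] by simp
  have mono: "L i \<le> L j" if "i \<le> j" for i j by (rule lift_Suc_mono_le[of L, OF mono1 that])
  \<comment> \<open>A geometrically weighted sum of \<open>L J - L i\<close> over all earlier
    scales. It dominates the cross terms of the next summand and shrinks by the factor 1/4 at each
    step up to the new increment, so it can be carried along with \<open>sqint (S J)\<close> below
    \<open>L J\<close>.\<close>
  define H where "H J = (\<Sum>i<J. (1/4::real)^(J - i) * (L J - L i))" for J
  have H0: "H J \<ge> 0" for J unfolding H_def using mono by (intro sum_nonneg mult_nonneg_nonneg) auto
  have HS: "H (Suc J) \<le> H J / 4 + (L (Suc J) - L J) / 3" for J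
  proof -
    have "H (Suc J) = (\<Sum>i<Suc J. (1/4::real)^(Suc J - i) * (L (Suc J) - L J)) + (\<Sum>i<Suc J. (1/4::real)^(Suc J - i) * (L J - L i))"
      unfolding H_def sum.distrib[symmetric] by (intro sum.cong refl) (simp add: algebra_simps)
    also have "(\<Sum>i<Suc J. (1/4::real)^(Suc J - i) * (L J - L i)) = H J / 4"
      unfolding H_def sum_divide_distrib by (simp add: Suc_diff_le)
    also have "(\<Sum>i<Suc J. (1/4::real)^(Suc J - i) * (L (Suc J) - L J)) = (\<Sum>i<Suc J. (1/4::real)^(Suc J - i)) * (L (Suc J) - L J)"
      by (rule sum_distrib_right[symmetric])
    also have "(\<Sum>i<Suc J. (1/4::real)^(Suc J - i)) \<le> 1/3"
    proof (induction J)
      case (Suc J)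
      have "(\<Sum>i<Suc (Suc J). (1/4::real)^(Suc (Suc J) - i)) = (\<Sum>i<Suc J. (1/4::real)^(Suc J - i)) / 4 + 1/4"
        by (subst sum.lessThan_Suc) (simp add: sum_divide_distrib Suc_diff_le del: sum.lessThan_Suc)
      thus ?case using Suc by simp
    qed simp
    finally show ?thesis using mono1[of J] by (simp add: mult_right_mono)
  qed
  have cross: "K J * ip (S J) (D J) \<le> 4 / 15 * H J" for J
  proof -
    have ipS: "ip (S n) (D J) = (\<Sum>i<n. K i * ip (D i) (D J))" for n
    proof (induction n)
      case 0 show ?case by (simp add: S_def ip_def)
    next
      case (Suc n)
      have "S (Suc n) = (\<lambda>x. complex_of_real 1 * S n x + complex_of_real (K n) * D n x)" by (auto simp: S_def)
      thus ?case using ip_lin[OF S D D, of 1 n "K n" n J] Suc by simp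
    qed
    have "K J * ip (S J) (D J) = (\<Sum>i<J. K J * (K i * ip (D i) (D J)))" unfolding ipS by (rule sum_distrib_left)
    also have "\<dots> \<le> (\<Sum>i<J. 4 / 15 * ((1/4::real)^(J - i) * (L J - L i)))"
    proof (intro sum_mono)
      fix i assume i: "i \<in> {..<J}"
      define t where "t = (1/4::real)^(J - i)"
      have t: "t > 0" "t \<le> 1/4"
      proof -
        show "t > 0" by (simp add: t_def)
        have "t \<le> (1/4)^1" unfolding t_def using i by (intro power_decreasing) auto
        thus "t \<le> 1/4" by simp
      qed
      have Ki: "K i = t * K J"
      proof -
        have "(4::real)^J = 4^(J - i) * 4^i" using i by (simp flip: power_add)
        thus ?thesis by (simp add: t_def K_def power_one_over field_simps)
      qed
      have t2: "t\<^sup>2 \<le> 1/16" using power_mono[OF t(2), of 2] t(1) by (simp add: power_divide)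
      define I where "I = ip (D i) (D J)"
      have "4 * ((K J)\<^sup>2 - (K i)\<^sup>2) * I = L J - L i"
        using sym_cross[OF K[of i] K[of J] q] by (simp add: D_def L_def I_def)
      hence eq: "4 * (1 - t\<^sup>2) * ((K J)\<^sup>2 * I) = L J - L i"
        unfolding Ki by (simp add: power_mult_distrib algebra_simps)
      have L0: "L J - L i \<ge> 0" using mono[of i J] i by simp
      have pos: "(K J)\<^sup>2 * I \<ge> 0"
      proof (rule ccontr)
        assume "\<not> ?thesis"
        hence "4 * (1 - t\<^sup>2) * ((K J)\<^sup>2 * I) < 0" using t2 by - (rule mult_pos_neg, simp_all)
        thus False using eq L0 by linarith
      qed
      \<comment> \<open>\<open>t \<le> 1/4\<close> gives \<open>4 (1 - t^2) \<ge> 15/4\<close>; this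
        is the origin of 4/15.\<close>
      have "15 / 4 * ((K J)\<^sup>2 * I) \<le> 4 * (1 - t\<^sup>2) * ((K J)\<^sup>2 * I)"
        using t2 pos by (intro mult_right_mono) auto
      hence "(K J)\<^sup>2 * I \<le> 4 / 15 * (L J - L i)" unfolding eq by simp
      from mult_left_mono[OF this less_imp_le[OF t(1)]]
      show "K J * (K i * ip (D i) (D J)) \<le> 4 / 15 * ((1/4::real)^(J - i) * (L J - L i))"
        unfolding I_def[symmetric] t_def[symmetric] Ki by (simp add: power2_eq_square mult_ac)
    qed
    also have "\<dots> = 4 / 15 * H J" unfolding H_def by (rule sum_distrib_left[symmetric])
    finally show ?thesis .
  qed
  have main: "sqint (S J) + H J \<le> L J" for J
  proof (induction J)
    case 0
    show ?case using low_nonneg[OF K q, of 0] by (simp add: S_def H_def L_def sqint_def)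
  next
    case (Suc J)
    have SS: "S (Suc J) = (\<lambda>x. complex_of_real 1 * S J x + complex_of_real (K J) * D J x)" by (auto simp: S_def)
    have "sqint (S (Suc J)) = ip (S (Suc J)) (S (Suc J))" by (simp add: ip_self)
    also have "\<dots> = ip (S J) (S (Suc J)) + K J * ip (D J) (S (Suc J))"
      by (subst (1) SS, subst ip_lin[OF S D S]) simp
    also have "ip (S J) (S (Suc J)) = sqint (S J) + K J * ip (S J) (D J)"
      by (subst ip_commute, subst SS, subst ip_lin[OF S D S]) (simp add: ip_self ip_commute[of "D J"])
    also have "ip (D J) (S (Suc J)) = ip (S J) (D J) + K J * sqint (D J)"
      by (subst ip_commute, subst SS, subst ip_lin[OF S D D]) (simp add: ip_self)
    finally have "sqint (S (Suc J)) = sqint (S J) + 2 * (K J * ip (S J) (D J)) + (K J)\<^sup>2 * sqint (D J)"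
      by (simp add: power2_eq_square algebra_simps)
    \<comment> \<open>The budget closes: \<open>2 * 4/15 + 1/4 \<le> 1\<close> for \<open>H\<close>,
      and \<open>17/60 + 1/3 \<le> 1\<close> for the increment of \<open>L\<close>.\<close>
    moreover have "s' + h' \<le> l'" if "s' = s + 2 * c + d" "c \<le> 4 / 15 * h" "d \<le> 17 * ((l' - l) / 60)"
        "h' \<le> h / 4 + (l' - l) / 3" "0 \<le> h" "s + h \<le> l" "l \<le> l'" for s s' c d h h' l l' :: real
      using that by (simp add: field_simps)
    ultimately show ?case using cross[of J] diag[of J] HS[of J] H0[of J] Suc mono1[of J] by blast
  qed
  have "sqint (S J) \<le> L J" using main[of J] H0[of J] by linarith
  also have "L J \<le> sqint q" unfolding L_def by (rule low_le[OF K q])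
  finally show ?thesis by (simp add: S_def[abs_def] K_def D_def)
qed

text \<open>\<open>R_k q = 2 k Y - Y'\<close> for the symmetric resolvent \<open>Y\<close>. As
  \<open>Y'' = 4 k^2 Y - q\<close>, the function \<open>Im (q cnj Y)\<close> is minus the derivative
  of \<open>Im (Y' cnj Y)\<close>. So the leading part moves onto \<open>\<eta>\<close>, where it is
  smaller by a power of \<open>k\<close>, and only the part with \<open>Y'\<close> keeps
  \<open>\<phi>\<close>.\<close>

lemma density_identity:
  assumes k: "k > 0" and q: "nice q" and \<phi>: "bcont \<phi>" "\<And>x. (\<phi> has_real_derivative \<eta> x) (at x)" and \<eta>: "bcont \<eta>"
  shows "(LINT x|lborel. \<phi> x * Im (q x * cnj (resolv (2 * k) q x))) =
    2 * k * (LINT x|lborel. \<eta> x * Im (dresolv_sym k q x * cnj (resolv_sym k q x)))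
    - (LINT x|lborel. \<phi> x * Im (q x * cnj (dresolv_sym k q x)))"
proof -
  have c: "2 * k > 0" using k by simp
  define Y dY where "Y = resolv_sym k q" and "dY = dresolv_sym k q"
  have n: "nice Y" "nice dY" unfolding Y_def dY_def by (intro resolv_sym_nice dresolv_sym_nice k q)+
  have d: "(Y has_vector_derivative dY x) (at x)" "(dY has_vector_derivative (4 * k\<^sup>2 * Y x - q x)) (at x)" for x
    unfolding Y_def dY_def by (intro resolv_sym_deriv dresolv_sym_deriv k q)+
  have w: "resolv (2 * k) q x = 2 * k * Y x - dY x" for x by (simp add: Y_def dY_def dresolv_sym_def)
  have n1: "nice (\<lambda>x. \<phi> x * Im (q x * cnj (Y x)))" "nice (\<lambda>x. \<phi> x * Im (q x * cnj (dY x)))"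
    by (intro nice_mult_right \<phi> nice_Im nice_mult_left q bcont_cnj bcont_nice n)+
  have n2: "nice (\<lambda>x. \<eta> x * Im (dY x * cnj (Y x)))"
    by (intro nice_mult_right \<eta> nice_Im nice_mult_left bcont_cnj bcont_nice n)
  have "(LINT x|lborel. \<eta> x * Im (dY x * cnj (Y x)) - \<phi> x * Im (q x * cnj (Y x))) = 0"
  proof (rule integral_derivative_nice)
    fix x
    have "((\<lambda>x. Im (dY x * cnj (Y x))) has_real_derivative Im (dY x * cnj (dY x) + (4 * k\<^sup>2 * Y x - q x) * cnj (Y x))) (at x)"
      unfolding has_real_derivative_iff_has_vector_derivative
      by (intro bounded_linear.has_vector_derivative[OF bounded_linear_Im] has_vector_derivative_mult d
          bounded_linear.has_vector_derivative[OF bounded_linear_cnj])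
    from DERIV_mult[OF \<phi>(2) this]
    show "((\<lambda>x. \<phi> x * Im (dY x * cnj (Y x))) has_vector_derivative (\<eta> x * Im (dY x * cnj (Y x)) - \<phi> x * Im (q x * cnj (Y x)))) (at x)"
      unfolding has_real_derivative_iff_has_vector_derivative[symmetric]
      by (rule DERIV_cong) (simp add: algebra_simps)
  next
    show "nice (\<lambda>x. \<eta> x * Im (dY x * cnj (Y x)) - \<phi> x * Im (q x * cnj (Y x)))" by (intro nice_diff n1 n2)
    show "nice (\<lambda>x. \<phi> x * Im (dY x * cnj (Y x)))"
      by (intro nice_mult_right \<phi> nice_Im nice_mult_left bcont_cnj bcont_nice n)
  qed
  hence 1: "(LINT x|lborel. \<eta> x * Im (dY x * cnj (Y x))) = (LINT x|lborel. \<phi> x * Im (q x * cnj (Y x)))"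
    using nice_integrable[OF n1(1)] nice_integrable[OF n2] by simp
  have eq: "\<phi> x * Im (q x * cnj (resolv (2 * k) q x)) = 2 * k * (\<phi> x * Im (q x * cnj (Y x))) - \<phi> x * Im (q x * cnj (dY x))" for x
    unfolding w by (simp add: algebra_simps)
  show ?thesis unfolding eq Y_def[symmetric] dY_def[symmetric] 1
    using nice_integrable[OF n1(1)] nice_integrable[OF n1(2)] by simp
qed

lemma sqint_resolv_sym:
  assumes k: "k > 0" and q: "nice q"
  shows "sqint (resolv_sym k q) \<le> sqint q / (4 * k\<^sup>2)\<^sup>2" "sqint (dresolv_sym k q) \<le> sqint q / (2 * k)\<^sup>2"
proof -
  have c: "2 * k > 0" using k by simp
  define f where "f y = resolv (2 * k) q (- y)" for y
  have f: "nice f" unfolding f_def[abs_def] by (intro nice_reflect resolv_nice c q)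
  have refl: "sqint (\<lambda>x. h (- x)) = sqint h" for h :: "real \<Rightarrow> complex"
    using sqint_shift[of h 0] by simp
  have fle: "sqint f \<le> sqint q / (2 * k)\<^sup>2"
    using sqint_resolv_le[OF c q] by (simp add: f_def[abs_def] refl)
  have Y: "sqint (resolv_sym k q) = sqint (resolv (2 * k) f)"
    unfolding resolv_sym_def[abs_def] f_def[abs_def] by (rule refl)
  have "sqint (resolv (2 * k) f) \<le> sqint f / (2 * k)\<^sup>2" by (rule sqint_resolv_le[OF c f])
  also have "\<dots> \<le> sqint q / (2 * k)\<^sup>2 / (2 * k)\<^sup>2" using fle by (intro divide_right_mono) auto
  finally show "sqint (resolv_sym k q) \<le> sqint q / (4 * k\<^sup>2)\<^sup>2"
    unfolding Y by (simp add: power2_eq_square)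
  have "dresolv_sym k q = (\<lambda>x. - (f (- x) - complex_of_real (2 * k) * resolv (2 * k) f (- x)))"
    by (auto simp: dresolv_sym_def resolv_sym_def f_def[abs_def])
  hence "sqint (dresolv_sym k q) = sqint (\<lambda>x. - (f x - complex_of_real (2 * k) * resolv (2 * k) f x))"
    using refl[of "\<lambda>x. - (f x - complex_of_real (2 * k) * resolv (2 * k) f x)"] by simp
  also have "\<dots> = sqint (\<lambda>x. f x - complex_of_real (2 * k) * resolv (2 * k) f x)" unfolding sqint_def norm_minus_cancel ..
  also have "\<dots> \<le> sqint f"
    using resolv_energy[OF c f] mult_nonneg_nonneg[OF zero_le_power2 sqint_nonneg, of "2 * k" "resolv (2 * k) f"] by linarith
  finally show "sqint (dresolv_sym k q) \<le> sqint q / (2 * k)\<^sup>2" using fle by linarith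
qed

lemma geometric_inverse_sum: "k > 0 \<Longrightarrow> (\<Sum>j<J. 1 / (k * 4^j)) \<le> 2 / (k::real)"
proof -
  assume k: "k > 0"
  have "(\<Sum>j<J. (1/4::real)^j) \<le> 2 - 4 / 3 * (1/4)^J"
  proof (induction J)
    case (Suc J)
    have "(0::real) \<le> (1/4)^J" by simp
    with Suc show ?case by simp
  qed simp
  hence "(\<Sum>j<J. (1/4::real)^j) \<le> 2" using zero_le_power[of "1/4::real" J] by linarith
  hence "(\<Sum>j<J. (1/4::real)^j) / k \<le> 2 / k" using k by (intro divide_right_mono) auto
  thus ?thesis by (simp add: sum_divide_distrib power_one_over mult.commute)
qed

text \<open>The parts with \<open>\<eta>\<close> are at most \<open>sqint q / (4 k_j)\<close> each
  and form a geometric series. The parts with \<open>\<phi>\<close> are added before they are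
  estimated: together they pair \<open>q\<close> with the single function bounded in
  \<open>sym_sum\<close>.\<close>

lemma density_bound:
  assumes k: "k \<ge> 1" and q: "nice q" and \<phi>: "bcont \<phi>" "\<And>x. (\<phi> has_real_derivative \<eta> x) (at x)"
    and \<eta>: "bcont \<eta>" "\<And>x. \<bar>\<eta> x\<bar> \<le> 1" and P: "\<And>x. \<bar>\<phi> x\<bar> \<le> P"
  shows "\<bar>\<Sum>j<J. k * 4^j * (LINT x|lborel. \<phi> x * Im (q x * cnj (resolv (2 * (k * 4^j)) q x)))\<bar> \<le> (P + 1) * sqint q"
proof -
  define K where "K j = k * 4^j" for j :: nat
  have K: "K j > 0" for j using k by (simp add: K_def)
  have P0: "P \<ge> 0" using P[of 0] by linarith
  define D Y where "D j = dresolv_sym (K j) q" and "Y j = resolv_sym (K j) q" for j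
  have n: "nice (D j)" "nice (Y j)" for j unfolding D_def Y_def by (intro dresolv_sym_nice resolv_sym_nice K q)+
  define S where "S x = (\<Sum>j<J. complex_of_real (K j) * D j x)" for x
  have nS: "nice S"
  proof -
    have "nice (\<lambda>x. \<Sum>j<n. complex_of_real (K j) * D j x)" for n
      by (induction n) (auto intro!: nice_zero nice_add nice_mult_right bcont_const n)
    thus ?thesis unfolding S_def[abs_def] .
  qed
  have CS: "\<bar>LINT x|lborel. h x * Im (f x * cnj (g x))\<bar> \<le> C * (sqrt (sqint f) * sqrt (sqint g))"
    if f: "nice f" and g: "nice g" and h: "bcont h" "\<And>x. \<bar>h x\<bar> \<le> C" for f g :: "real \<Rightarrow> complex" and h C
  proof -
    have C0: "C \<ge> 0" using h(2)[of 0] by linarith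
    have "\<bar>LINT x|lborel. h x * Im (f x * cnj (g x))\<bar> \<le> (LINT x|lborel. \<bar>h x * Im (f x * cnj (g x))\<bar>)"
      using integral_norm_bound[of lborel "\<lambda>x. h x * Im (f x * cnj (g x))"] by simp
    also have "\<dots> \<le> (LINT x|lborel. C * \<bar>cmod (f x) * cmod (g x)\<bar>)"
    proof (rule integral_mono)
      show "integrable lborel (\<lambda>x. \<bar>h x * Im (f x * cnj (g x))\<bar>)"
        by (intro integrable_abs nice_integrable nice_mult_right h nice_Im nice_mult_left f bcont_cnj bcont_nice g)
      show "integrable lborel (\<lambda>x. C * \<bar>cmod (f x) * cmod (g x)\<bar>)"
        by (intro integrable_mult_right integrable_abs nice_integrable nice_mult_left nice_norm f bcont_norm bcont_nice g)
      show "\<bar>h x * Im (f x * cnj (g x))\<bar> \<le> C * \<bar>cmod (f x) * cmod (g x)\<bar>" for x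
        unfolding abs_mult[of "h x"] using abs_Im_le_cmod[of "f x * cnj (g x)"] C0
        by (intro mult_mono h) (auto simp: norm_mult)
    qed
    also have "\<dots> = C * (LINT x|lborel. \<bar>cmod (f x) * cmod (g x)\<bar>)" by simp
    also have "\<dots> \<le> C * (sqrt (sqint (\<lambda>x. cmod (f x))) * sqrt (sqint (\<lambda>x. cmod (g x))))"
      by (intro mult_left_mono nice_Cauchy_Schwarz nice_norm f g C0)
    finally show ?thesis by (simp add: sqint_def)
  qed
  have "(\<Sum>j<J. K j * (LINT x|lborel. \<phi> x * Im (q x * cnj (resolv (2 * K j) q x)))) =
    (\<Sum>j<J. K j * (2 * K j * (LINT x|lborel. \<eta> x * Im (D j x * cnj (Y j x))))) - (\<Sum>j<J. K j * (LINT x|lborel. \<phi> x * Im (q x * cnj (D j x))))"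
    unfolding density_identity[OF K q \<phi> \<eta>(1)] D_def Y_def by (simp add: right_diff_distrib sum_subtractf)
  also have "(\<Sum>j<J. K j * (LINT x|lborel. \<phi> x * Im (q x * cnj (D j x)))) = (LINT x|lborel. \<phi> x * Im (q x * cnj (S x)))"
  proof -
    have i: "integrable lborel (\<lambda>x. \<phi> x * Im (q x * cnj (D j x)))" for j
      by (intro nice_integrable nice_mult_right \<phi> nice_Im nice_mult_left q bcont_cnj bcont_nice n)
    have "\<phi> x * Im (q x * cnj (S x)) = (\<Sum>j<J. K j * (\<phi> x * Im (q x * cnj (D j x))))" for x
    proof -
      have "q x * cnj (S x) = (\<Sum>j<J. complex_of_real (K j) * (q x * cnj (D j x)))"
        by (simp add: S_def sum_distrib_left mult.left_commute)
      hence "Im (q x * cnj (S x)) = (\<Sum>j<J. K j * Im (q x * cnj (D j x)))"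
        by (simp add: Im_sum del: times_complex.sel) (simp only: Im_complex_of_real Re_complex_of_real times_complex.sel mult_zero_left add_0_right)
      thus ?thesis by (simp only: sum_distrib_left mult.left_commute)
    qed
    thus ?thesis using i by (simp add: Bochner_Integration.integral_sum del: times_complex.sel)
  qed
  finally have eq: "(\<Sum>j<J. K j * (LINT x|lborel. \<phi> x * Im (q x * cnj (resolv (2 * K j) q x)))) =
    (\<Sum>j<J. K j * (2 * K j * (LINT x|lborel. \<eta> x * Im (D j x * cnj (Y j x))))) - (LINT x|lborel. \<phi> x * Im (q x * cnj (S x)))" .
  have 1: "\<bar>LINT x|lborel. \<phi> x * Im (q x * cnj (S x))\<bar> \<le> P * sqint q"
  proof -
    have "\<bar>LINT x|lborel. \<phi> x * Im (q x * cnj (S x))\<bar> \<le> P * (sqrt (sqint q) * sqrt (sqint S))"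
      by (rule CS[OF q nS \<phi>(1) P])
    also have "\<dots> \<le> P * (sqrt (sqint q) * sqrt (sqint q))"
      using sym_sum[OF _ q, of k J] k unfolding S_def[abs_def] D_def K_def
      by (intro mult_left_mono real_sqrt_le_mono P0) (auto simp: sqint_nonneg)
    finally show ?thesis using sqint_nonneg[of q] by simp
  qed
  have 2: "\<bar>K j * (2 * K j * (LINT x|lborel. \<eta> x * Im (D j x * cnj (Y j x))))\<bar> \<le> sqint q / 4 * (1 / K j)" for j
  proof -
    have "\<bar>LINT x|lborel. \<eta> x * Im (D j x * cnj (Y j x))\<bar> \<le> 1 * (sqrt (sqint (D j)) * sqrt (sqint (Y j)))"
      by (rule CS[OF n \<eta>])
    also have "\<dots> \<le> 1 * (sqrt (sqint q / (2 * K j)\<^sup>2) * sqrt (sqint q / (4 * (K j)\<^sup>2)\<^sup>2))"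
      using sqint_resolv_sym[OF K q, of j] unfolding D_def Y_def
      by (intro mult_left_mono mult_mono real_sqrt_le_mono) (auto simp: sqint_nonneg)
    also have "\<dots> = sqint q / (8 * (K j)^3)"
    proof -
      have "sqrt (sqint q / (2 * K j)\<^sup>2) = sqrt (sqint q) / (2 * K j)"
        using K[of j] by (simp only: real_sqrt_divide real_sqrt_abs) 
      moreover have "sqrt (sqint q / (4 * (K j)\<^sup>2)\<^sup>2) = sqrt (sqint q) / (4 * (K j)\<^sup>2)"
        using K[of j] by (simp only: real_sqrt_divide real_sqrt_abs) simp
      moreover have "sqrt (sqint q) * sqrt (sqint q) = sqint q" using sqint_nonneg[of q] by simp
      ultimately show ?thesis by (simp add: power2_eq_square power3_eq_cube)
    qed
    finally have "2 * (K j)\<^sup>2 * \<bar>LINT x|lborel. \<eta> x * Im (D j x * cnj (Y j x))\<bar> \<le> 2 * (K j)\<^sup>2 * (sqint q / (8 * (K j)^3))"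
      by (intro mult_left_mono) auto
    also have "\<dots> = sqint q / 4 * (1 / K j)" using K[of j] by (simp add: power2_eq_square power3_eq_cube field_simps)
    finally show ?thesis using K[of j] by (simp add: abs_mult power2_eq_square mult_ac)
  qed
  have "\<bar>\<Sum>j<J. K j * (2 * K j * (LINT x|lborel. \<eta> x * Im (D j x * cnj (Y j x))))\<bar> \<le> (\<Sum>j<J. sqint q / 4 * (1 / K j))"
    by (rule order_trans[OF sum_abs]) (intro sum_mono 2)
  also have "\<dots> = sqint q / 4 * (\<Sum>j<J. 1 / (k * 4^j))" by (simp only: sum_distrib_left K_def)
  also have "\<dots> \<le> sqint q / 4 * (2 / k)" using k by (intro mult_left_mono geometric_inverse_sum) (auto simp: sqint_nonneg)
  also have "\<dots> \<le> sqint q / 4 * 2" using k sqint_nonneg[of q] by (intro mult_left_mono) (auto simp: divide_le_eq)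
  also have "\<dots> \<le> sqint q" using sqint_nonneg[of q] by simp
  finally show ?thesis using eq 1 unfolding K_def by (simp add: algebra_simps abs_le_iff)
qed

section \<open>Local smoothing\<close>

text \<open>\<open>riccati_small\<close> takes a positive bound and gives a strict inequality, while
  \<open>wsup\<close> may be 0. It is applied with \<open>d\<close> slightly above \<open>s\<close>;
  uniqueness identifies the solutions, so \<open>d\<close> can tend to \<open>s\<close>.\<close>

lemma riccati_wsup:
  assumes k: "k > 0" and q: "nice q" and e: "e > 0" "4 * e \<le> 1" "4 * e * sqrt (sqint q) < 1"
    and w: "\<And>x. sqrt k * cmod (resolv (2 * k) q x) \<le> e"
  obtains r where "riccati (lam k) q r" "\<And>x. cmod (r x) \<le> 2 * sqrt k * wsup k q"
proof -
  define s where "s = sqrt k * wsup k q"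
  have sk: "sqrt k > 0" using k by simp
  have s0: "s \<ge> 0" using wsup_nonneg[OF k q] k by (simp add: s_def)
  have se: "s \<le> e"
  proof -
    have "wsup k q \<le> e / sqrt k" by (rule wsup_le) (use w sk in \<open>simp add: pos_le_divide_eq mult.commute\<close>)
    thus ?thesis using sk by (simp add: s_def pos_le_divide_eq mult.commute)
  qed
  have ws: "sqrt k * cmod (resolv (2 * k) q x) \<le> s" for x
    unfolding s_def using sk by (intro mult_left_mono wsup_upper k q) auto
  have ex: "\<exists>r. riccati (lam k) q r \<and> (\<forall>x. cmod (r x) < 2 * d)" if d: "s < d" "d \<le> 2 * e" for d
  proof -
    have "2 * d * sqrt (sqint q) \<le> 4 * e * sqrt (sqint q)"
      using d sqint_nonneg[of q] by (intro mult_right_mono) auto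
    hence "2 * d * sqrt (sqint q) < 1" using e(3) by linarith
    with d s0 e(2) have "d > 0" "2 * d \<le> 1" "2 * d * sqrt (sqint q) < 1" by linarith+
    from riccati_small[OF k q this order_trans[OF ws less_imp_le[OF d(1)]]] show ?thesis by metis
  qed
  obtain r where r: "riccati (lam k) q r" using ex[of "2 * e"] se e by auto
  have "cmod (r x) \<le> 2 * s" for x
  proof (rule field_le_epsilon)
    fix \<delta> :: real assume \<delta>: "\<delta> > 0"
    define d where "d = min (s + \<delta> / 2) (2 * e)"
    have "s < d" "d \<le> 2 * e" using se e \<delta> by (auto simp: d_def)
    from ex[OF this] obtain r' where r': "riccati (lam k) q r'" "\<And>x. cmod (r' x) < 2 * d" by blast
    have "r' = r" by (rule riccati_unique[OF lam_simps(1,2)[OF k] q r'(1) r])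
    moreover have "d \<le> s + \<delta> / 2" by (simp add: d_def)
    ultimately show "cmod (r x) \<le> 2 * s + \<delta>" using r'(2)[of x] by simp
  qed
  thus ?thesis using that[OF r] by (simp add: s_def mult.assoc)
qed

context scale
begin

text \<open>Beyond its quadratic part the density is \<open>k \<phi> Im (q v)\<close>, and
  \<open>v\<close> carries the factor \<open>k s^2\<close>; so the error can be summed over the
  scales.\<close>

lemma density_expansion:
  assumes \<phi>: "bcont \<phi>" "\<And>x. \<bar>\<phi> x\<bar> \<le> P"
  shows "\<bar>(LINT x|lborel. \<phi> x * Re (lam k * (q x * r x))) - k * (LINT x|lborel. \<phi> x * Im (q x * cnj (resolv (2 * k) q x)))\<bar>
    \<le> 2 * P * (k * s\<^sup>2) * sqint q"
proof -
  have P0: "P \<ge> 0" using \<phi>(2)[of 0] by linarith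
  have lr: "lam k * (q x * r x) = - (\<i> * k) * (q x * u x)" for x
    unfolding r_eq[of x] lam_simps(3)[OF k0, symmetric] by (simp add: power2_eq_square)
  have eq: "\<phi> x * Re (lam k * (q x * r x)) = k * (\<phi> x * Im (q x * cnj (w x))) + k * (\<phi> x * Im (q x * v x))" for x
    unfolding lr u_eq by (simp add: algebra_simps)
  have n: "nice (\<lambda>x. \<phi> x * Im (q x * cnj (w x)))" "nice (\<lambda>x. \<phi> x * Im (q x * v x))"
    by (intro nice_mult_right \<phi> nice_Im nice_mult_left q bcont_cnj bconts)+
  have "(LINT x|lborel. \<phi> x * Re (lam k * (q x * r x))) - k * (LINT x|lborel. \<phi> x * Im (q x * cnj (w x)))
     = k * (LINT x|lborel. \<phi> x * Im (q x * v x))"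
    unfolding eq using nice_integrable[OF n(1)] nice_integrable[OF n(2)] by simp
  note main = this
  have "\<bar>LINT x|lborel. \<phi> x * Im (q x * v x)\<bar> \<le> P * (4 * (k * s\<^sup>2)) * (sqint q / (2 * k))"
  proof -
    have "\<bar>LINT x|lborel. \<phi> x * Im (q x * v x)\<bar> \<le> (LINT x|lborel. \<bar>\<phi> x * Im (q x * v x)\<bar>)"
      using integral_norm_bound[of lborel "\<lambda>x. \<phi> x * Im (q x * v x)"] by simp
    also have "\<dots> \<le> (LINT x|lborel. P * (4 * (k * s\<^sup>2)) * \<bar>cmod (q x) * Rq x\<bar>)"
    proof (rule integral_mono)
      show "integrable lborel (\<lambda>x. \<bar>\<phi> x * Im (q x * v x)\<bar>)" by (intro integrable_abs nice_integrable n)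
      show "integrable lborel (\<lambda>x. P * (4 * (k * s\<^sup>2)) * \<bar>cmod (q x) * Rq x\<bar>)"
        by (intro integrable_mult_right integrable_abs nice_integrable nice_mult_left nice_norm q bconts)
      fix x
      have "\<bar>Im (q x * v x)\<bar> \<le> cmod (q x) * (4 * (k * s\<^sup>2) * Rq x)"
        by (rule order_trans[OF abs_Im_le_cmod]) (unfold norm_mult, intro mult_left_mono v_le norm_ge_zero)
      hence "\<bar>\<phi> x\<bar> * \<bar>Im (q x * v x)\<bar> \<le> P * (cmod (q x) * (4 * (k * s\<^sup>2) * Rq x))"
        using P0 by (intro mult_mono \<phi>) auto
      thus "\<bar>\<phi> x * Im (q x * v x)\<bar> \<le> P * (4 * (k * s\<^sup>2)) * \<bar>cmod (q x) * Rq x\<bar>"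
        using Rq0[of x] by (simp only: abs_mult abs_norm_cancel abs_of_nonneg mult_ac)
    qed
    also have "\<dots> = P * (4 * (k * s\<^sup>2)) * (LINT x|lborel. \<bar>cmod (q x) * Rq x\<bar>)" by simp
    also have "(LINT x|lborel. \<bar>cmod (q x) * Rq x\<bar>) \<le> sqrt (sqint (\<lambda>x. cmod (q x))) * sqrt (sqint Rq)"
      by (intro nice_Cauchy_Schwarz nice_norm q nices)
    also have "\<dots> \<le> sqrt (sqint q) * sqrt (sqint q / (2 * k)\<^sup>2)"
      using sqint_resolv_le[OF c0 nice_norm[OF q]] unfolding Rq_def[symmetric]
      by (intro mult_mono real_sqrt_le_mono) (auto simp: sqint_def)
    also have "\<dots> = sqint q / (2 * k)"
    proof -
      have "sqrt (sqint q / (2 * k)\<^sup>2) = sqrt (sqint q) / (2 * k)"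
        using k0 by (simp only: real_sqrt_divide real_sqrt_abs)
      thus ?thesis using sqint_nonneg[of q] by simp
    qed
    finally show ?thesis using P0 k0 by (simp add: mult_left_mono)
  qed
  hence "k * \<bar>LINT x|lborel. \<phi> x * Im (q x * v x)\<bar> \<le> k * (P * (4 * (k * s\<^sup>2)) * (sqint q / (2 * k)))"
    using k0 by (intro mult_left_mono) auto
  also have "\<dots> = 2 * P * (k * s\<^sup>2) * sqint q" using k0 by simp
  finally show ?thesis using k0 unfolding main[unfolded w_def] by (simp add: abs_mult del: times_complex.sel)
qed

end

text \<open>If \<open>j\<close> is the last scale with \<open>4 sqrt k\<^sub>j e < |q|\<close>, then the low-frequency part
  \<open>2 k\<^sub>j w\<^sub>j\<close> is at most half of \<open>q\<close>.\<close>

lemma quartic_le_scales: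
  fixes q :: complex and w :: "nat \<Rightarrow> complex"
  assumes k: "k > 0" and e: "e > 0" and w: "\<And>j. sqrt (k * 4^j) * cmod (w j) \<le> e"
    and J: "cmod q \<le> 4 * sqrt (k * 4^J) * e"
  shows "(cmod q)^4 \<le> 256 * e\<^sup>2 * (\<Sum>j<J. k * 4^j * (cmod (q - complex_of_real (2 * (k * 4^j)) * w j))\<^sup>2) + 16 * k * e\<^sup>2 * (cmod q)\<^sup>2"
    (is "_ \<le> 256 * e\<^sup>2 * ?X + _")
proof -
  define K where "K j = k * 4^j" for j :: nat
  have K: "K j > 0" for j using k by (simp add: K_def)
  have X0: "?X \<ge> 0" using k by (intro sum_nonneg mult_nonneg_nonneg) auto
  have sK: "sqrt (K (Suc j)) = 2 * sqrt (K j)" for j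
    using real_sqrt_mult[of 4 "K j"] by (simp add: K_def mult_ac)
  define n where "n = (LEAST j. cmod q \<le> 4 * sqrt (K j) * e)"
  have n: "cmod q \<le> 4 * sqrt (K n) * e" unfolding n_def by (rule LeastI[of _ J]) (use J in \<open>simp add: K_def\<close>)
  have nJ: "n \<le> J" unfolding n_def by (rule Least_le) (use J in \<open>simp add: K_def\<close>)
  show ?thesis
  proof (cases n)
    case 0
    have "(cmod q)\<^sup>2 \<le> (4 * sqrt (K n) * e)\<^sup>2" by (intro power_mono n) auto
    also have "\<dots> = 16 * k * e\<^sup>2" using k by (simp add: 0 K_def power_mult_distrib)
    finally have "(cmod q)\<^sup>2 * (cmod q)\<^sup>2 \<le> 16 * k * e\<^sup>2 * (cmod q)\<^sup>2" by (intro mult_right_mono) auto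
    moreover have "(cmod q)\<^sup>2 * (cmod q)\<^sup>2 = (cmod q)^4" by (simp flip: power_add)
    moreover have "0 \<le> 256 * e\<^sup>2 * ?X" by (intro mult_nonneg_nonneg X0) auto
    ultimately show ?thesis by linarith
  next
    case (Suc j)
    have jJ: "j < J" using Suc nJ by simp
    have lt: "4 * sqrt (K j) * e < cmod q" using not_less_Least[of j "\<lambda>j. cmod q \<le> 4 * sqrt (K j) * e"] Suc
      by (simp add: n_def[symmetric] not_le)
    have up: "cmod q \<le> 8 * sqrt (K j) * e" using n by (simp add: Suc sK)
    let ?d = "cmod (q - complex_of_real (2 * K j) * w j)"
    have "cmod (complex_of_real (2 * K j) * w j) = 2 * sqrt (K j) * (sqrt (K j) * cmod (w j))"
      using K[of j] by (simp add: norm_mult)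
    also have "\<dots> \<le> 2 * sqrt (K j) * e" using w[of j] K[of j] unfolding K_def by (intro mult_left_mono) auto
    finally have "cmod q - cmod q / 2 \<le> ?d" using lt norm_triangle_ineq2[of q "complex_of_real (2 * K j) * w j"] by linarith
    hence "cmod q \<le> 2 * ?d" by simp
    from power_mono[OF this norm_ge_zero, of 2] have 1: "(cmod q)\<^sup>2 \<le> 4 * ?d\<^sup>2" by (simp add: power_mult_distrib)
    have "(cmod q)\<^sup>2 \<le> (8 * sqrt (K j) * e)\<^sup>2" by (intro power_mono up) auto
    also have "\<dots> = 64 * e\<^sup>2 * K j" using K[of j] by (simp add: power_mult_distrib)
    finally have "(cmod q)\<^sup>2 * (cmod q)\<^sup>2 \<le> (64 * e\<^sup>2 * K j) * (4 * ?d\<^sup>2)"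
      using 1 K[of j] by (intro mult_mono) auto
    also have "\<dots> = 256 * e\<^sup>2 * (K j * ?d\<^sup>2)" by simp
    also have "\<dots> \<le> 256 * e\<^sup>2 * ?X" unfolding K_def
    proof (rule mult_left_mono)
      show "k * 4^j * (cmod (q - complex_of_real (2 * (k * 4^j)) * w j))\<^sup>2 \<le> ?X"
        by (rule member_le_sum[of j "{..<J}"]) (use jJ k in auto)
    qed auto
    finally have "(cmod q)^4 \<le> 256 * e\<^sup>2 * ?X" by (simp flip: power_add)
    thus ?thesis using k by (simp add: add_increasing2)
  qed
qed

context dnls_flow
begin

text \<open>\<open>G\<close> is the sum over the scales of the tested densities plus a multiple of
  \<open>t\<close>, added so that its derivative dominates the smoothing quantity. The hypothesis on
  \<open>J\<close> makes the scales reach the size of \<open>q\<close>, as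
  \<open>quartic_le_scales\<close> demands. The bound on \<open>G\<close> contains neither
  \<open>J\<close> nor \<open>B\<close>.\<close>

lemma local_smoothing:
  assumes wt: "weight \<eta> \<eta>'" and M: "M \<ge> 1" "\<And>t. \<bar>t\<bar> < T \<Longrightarrow> sqint (q t) \<le> M"
    and k: "k \<ge> 1" and e: "e > 0" "20000000 * (M * e\<^sup>2) \<le> 1"
    and good: "\<And>t k' x. \<bar>t\<bar> < T \<Longrightarrow> k' \<ge> k \<Longrightarrow> sqrt k' * cmod (resolv (2 * k') (q t) x) \<le> e"
    and J: "B \<le> 4 * sqrt (k * 4^J) * e" and T: "T > 0"
  obtains G g where
    "\<And>t. \<bar>t\<bar> < T \<Longrightarrow> (G has_real_derivative g t) (at t)"
    "\<And>t. \<bar>t\<bar> < T \<Longrightarrow> (\<Sum>j<J. k * 4^j * (LINT x|lborel. \<eta> x *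
      (cmod (q t x - complex_of_real (2 * (k * 4^j)) * resolv (2 * (k * 4^j)) (q t) x))\<^sup>2)) \<le> g t"
    "\<And>t. \<bar>t\<bar> < T \<Longrightarrow> \<bar>G t\<bar> \<le> ((1 + 12 * M) * ((LINT x|lborel. \<eta> x) + 1) + (3 + 12 * M + k) * T) * sqint (q 0)"
proof -
  interpret weight \<eta> \<eta>' by (rule wt)
  define K where "K j = k * 4^j" for j :: nat
  have Kk: "K j \<ge> k" for j using mult_left_mono[of 1 "4^j" k] k by (simp add: K_def)
  have K1: "K j \<ge> 1" and K0: "K j > 0" for j using Kk[of j] k by auto
  define S where "S = sqint (q 0)"
  have S: "sqint (q t) = S" if "\<bar>t\<bar> < T" for t unfolding S_def using mass_conserved[OF that, of 0] T by simp
  have SM: "S \<le> M" and S0: "S \<ge> 0" using M(2)[of 0] T sqint_nonneg[of "q 0"] by (auto simp: S_def)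
  have e2: "e\<^sup>2 \<le> 1 / 20000000"
    using e(2) mult_right_mono[OF M(1) zero_le_power2[of e]] by simp
  have e4: "4 * e \<le> 1"
  proof (rule power2_le_imp_le)
    show "(4 * e)\<^sup>2 \<le> 1\<^sup>2" using e2 by (simp add: power_mult_distrib)
  qed simp
  have eS: "4 * e * sqrt S < 1"
  proof (rule power2_less_imp_less)
    have "S * e\<^sup>2 \<le> M * e\<^sup>2" by (intro mult_right_mono SM) auto
    thus "(4 * e * sqrt S)\<^sup>2 < 1\<^sup>2" using e(2) S0 by (simp add: power_mult_distrib mult.commute)
  qed simp
  define s where "s t j = wsup (K j) (q t)" for t j
  have s0: "s t j \<ge> 0" if "\<bar>t\<bar> < T" for t j unfolding s_def by (rule wsup_nonneg[OF K0 q_nice[OF that]])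
  have Ks: "K j * (s t j)\<^sup>2 \<le> e\<^sup>2" if t: "\<bar>t\<bar> < T" for t j
  proof -
    have "s t j \<le> e / sqrt (K j)" unfolding s_def
      by (rule wsup_le) (use good[OF t Kk] K0[of j] in \<open>simp add: pos_le_divide_eq mult.commute\<close>)
    from power_mono[OF this s0[OF t], of 2] show ?thesis
      using K0[of j] by (simp add: power_divide pos_le_divide_eq mult.commute)
  qed
  have sumKs: "(\<Sum>j<J. K j * (s t j)\<^sup>2) \<le> 6 * S" if t: "\<bar>t\<bar> < T" for t
    using square_function[OF _ q_nice[OF t], of k J] k unfolding K_def s_def S[OF t] by simp
  have "\<exists>r. \<forall>j t. \<bar>t\<bar> < T \<longrightarrow> riccati (lam (K j)) (q t) (r j t) \<and> (\<forall>x. cmod (r j t x) \<le> 2 * sqrt (K j) * s t j)"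
  proof -
    have "\<exists>r. \<bar>t\<bar> < T \<longrightarrow> riccati (lam (K j)) (q t) r \<and> (\<forall>x. cmod (r x) \<le> 2 * sqrt (K j) * s t j)" for j t
    proof (cases "\<bar>t\<bar> < T")
      case True
      obtain r where "riccati (lam (K j)) (q t) r" "\<And>x. cmod (r x) \<le> 2 * sqrt (K j) * s t j"
        using riccati_wsup[OF K0 q_nice[OF True] e(1) e4 _ good[OF True Kk]] eS unfolding S[OF True] s_def by metis
      thus ?thesis by blast
    qed simp
    hence "\<forall>j. \<exists>f. \<forall>t. \<bar>t\<bar> < T \<longrightarrow> riccati (lam (K j)) (q t) (f t) \<and> (\<forall>x. cmod (f t x) \<le> 2 * sqrt (K j) * s t j)"
      by (intro allI choice) blast
    from choice[OF this] show ?thesis .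
  qed
  then obtain r where ric: "\<And>j t. \<bar>t\<bar> < T \<Longrightarrow> riccati (lam (K j)) (q t) (r j t)"
    and r_le: "\<And>j t x. \<bar>t\<bar> < T \<Longrightarrow> cmod (r j t x) \<le> 2 * sqrt (K j) * s t j" by blast
  have sc: "scale \<eta> \<eta>' (q t) (p t) (r j t) (K j) (s t j)" if t: "\<bar>t\<bar> < T" for j t
  proof (intro scale.intro wt scale_axioms.intro q_nice p_nice q_deriv K1 ric s0 r_le t)
    show "K j * (s t j)\<^sup>2 \<le> 1 / 4" using Ks[OF t, of j] e2 by linarith
    show "cmod (resolv (2 * K j) (q t) x) \<le> s t j" for x
      unfolding s_def by (rule wsup_upper[OF K0 q_nice[OF t]])
  qed
  define P where "P = (LINT x|lborel. \<eta> x)"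
  define \<phi> where "\<phi> = cumul \<eta>"
  have \<phi>: "bcont \<phi>" "\<And>x. (\<phi> has_real_derivative \<eta> x) (at x)" "\<And>x. \<bar>\<phi> x\<bar> \<le> P"
  proof -
    show "bcont \<phi>" unfolding \<phi>_def by (rule cumul_bcont[OF \<eta>_nice])
    show "(\<phi> has_real_derivative \<eta> x) (at x)" for x
      unfolding \<phi>_def has_real_derivative_iff_has_vector_derivative by (rule cumul_deriv[OF \<eta>_nice])
    show "\<bar>\<phi> x\<bar> \<le> P" for x using cumul_norm_le[OF \<eta>_nice, of x] \<eta>_nonneg by (simp add: \<phi>_def P_def)
  qed
  have P0: "P \<ge> 0" using \<phi>(3)[of 0] by linarith
  define D where "D t j = (LINT x|lborel. \<eta> x * (cmod (q t x - complex_of_real (2 * K j) * resolv (2 * K j) (q t) x))\<^sup>2)" for t j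
  define X where "X t = (\<Sum>j<J. K j * D t j)" for t
  define m where "m t = (LINT x|lborel. \<eta> x * (cmod (q t x))\<^sup>2)" for t
  define A where "A t = (LINT x|lborel. \<eta> x * (cmod (q t x))^4)" for t
  define b where "b t = (\<Sum>j<J. Re (LINT x|lborel. \<phi> x *\<^sub>R (lam (K j) * (q t x * r j t x))))" for t
  define b' where "b' t = (\<Sum>j<J. Re (- (LINT x|lborel. \<eta> x *\<^sub>R flux (lam (K j)) (r j) t x)))" for t
  have bd: "(b has_real_derivative b' t) (at t)" if t: "\<bar>t\<bar> < T" for t
    unfolding b_def[abs_def] b'_def has_real_derivative_iff_has_vector_derivative
    by (intro has_vector_derivative_sum bounded_linear.has_vector_derivative[OF bounded_linear_Re]
        flux_law lam_simps(1,2)[OF K0] ric \<phi> bcont_nice[OF \<eta>_nice] t)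
  have m0: "m t \<ge> 0" "A t \<ge> 0" for t unfolding m_def A_def using \<eta>_nonneg by (auto intro!: integral_nonneg_AE)
  have D0: "D t j \<ge> 0" for t j unfolding D_def using \<eta>_nonneg by (auto intro!: integral_nonneg_AE)
  have X0: "X t \<ge> 0" for t unfolding X_def using D0 K0 by (intro sum_nonneg mult_nonneg_nonneg) (auto simp: less_imp_le)
  have mS: "m t \<le> S" if t: "\<bar>t\<bar> < T" for t
    using wint_le_integral[OF nice_sq[OF q_nice[OF t]]] unfolding wint_def m_def S[OF t, symmetric] sqint_def by simp
  have nw: "nice (\<lambda>x. q t x - complex_of_real (2 * K j) * resolv (2 * K j) (q t) x)" if t: "\<bar>t\<bar> < T" for t j
    using K0[of j] by (intro nice_diff nice_mult_right bcont_const resolv_nice q_nice t) simp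
  \<comment> \<open>15/8 is the main coefficient 2 minus the 1/8 absorbed at a single scale.\<close>
  have step: "15 / 8 * (K j * D t j) - (1 / K j + 2 * (K j * (s t j)\<^sup>2)) * m t - 10000 * (K j * (s t j)\<^sup>2) * A t
      \<le> Re (- (LINT x|lborel. \<eta> x *\<^sub>R flux (lam (K j)) (r j) t x))" if t: "\<bar>t\<bar> < T" for t j
  proof -
    interpret c: scale \<eta> \<eta>' "q t" "p t" "r j t" "K j" "s t j" by (rule sc[OF t])
    have "Re (- (LINT x|lborel. \<eta> x *\<^sub>R flux (lam (K j)) (r j) t x)) = - (LINT x|lborel. \<eta> x * Re (c.current x))"
    proof -
      have i: "integrable lborel (\<lambda>x. \<eta> x *\<^sub>R flux (lam (K j)) (r j) t x)"
        by (intro nice_integrable nice_scaleR_left bcont_nice[OF \<eta>_nice] flux_nice lam_simps(1,2)[OF K0] ric t)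
      have fl: "c.current x = flux (lam (K j)) (r j) t x" for x
        unfolding c.current_def by (rule sym, rule flux_def) (intro lam_simps(1,2)[OF K0] ric | assumption)+
      have "(LINT x|lborel. \<eta> x * Re (c.current x)) = (LINT x|lborel. Re (\<eta> x *\<^sub>R flux (lam (K j)) (r j) t x))"
        unfolding fl by (simp del: times_complex.sel plus_complex.sel)
      also have "\<dots> = Re (LINT x|lborel. \<eta> x *\<^sub>R flux (lam (K j)) (r j) t x)" by (rule integral_Re[OF i])
      finally show ?thesis by simp
    qed
    moreover have "wint (\<lambda>x. (cmod (c.dw x))\<^sup>2) = D t j" by (simp add: wint_def c.dw_def c.w_def D_def)
    moreover have "c.m = m t" "c.A = A t" by (simp_all add: c.m_def c.A_def wint_def m_def A_def)
    ultimately show ?thesis using c.current_estimate by (simp only: abs_le_iff) linarith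
  qed
  have A_le: "A t \<le> 256 * e\<^sup>2 * X t + 16 * k * e\<^sup>2 * m t" if t: "\<bar>t\<bar> < T" for t
  proof -
    let ?d = "\<lambda>j x. (cmod (q t x - complex_of_real (2 * K j) * resolv (2 * K j) (q t) x))\<^sup>2"
    have i: "integrable lborel (\<lambda>x. \<eta> x * ?d j x)" for j
      by (intro nice_integrable nice_mult_left \<eta>_nice bcont_nice[OF nice_sq[OF nw[OF t]]])
    have i2: "integrable lborel (\<lambda>x. \<eta> x * (cmod (q t x))\<^sup>2)"
      by (intro nice_integrable nice_mult_left \<eta>_nice bcont_nice[OF nice_sq[OF q_nice[OF t]]])
    have isum: "integrable lborel (\<lambda>x. \<Sum>j<J. K j * (\<eta> x * ?d j x))"
      by (intro Bochner_Integration.integrable_sum integrable_mult_right i)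
    have "A t \<le> (LINT x|lborel. 256 * e\<^sup>2 * (\<Sum>j<J. K j * (\<eta> x * ?d j x)) + 16 * k * e\<^sup>2 * (\<eta> x * (cmod (q t x))\<^sup>2))"
      unfolding A_def
    proof (rule integral_mono)
      show "integrable lborel (\<lambda>x. \<eta> x * (cmod (q t x))^4)"
        by (intro nice_integrable nice_mult_left \<eta>_nice bcont_power bcont_norm bcont_nice[OF q_nice[OF t]])
      show "integrable lborel (\<lambda>x. 256 * e\<^sup>2 * (\<Sum>j<J. K j * (\<eta> x * ?d j x)) + 16 * k * e\<^sup>2 * (\<eta> x * (cmod (q t x))\<^sup>2))"
        by (intro Bochner_Integration.integrable_add integrable_mult_right isum i2)
      fix x
      have "(cmod (q t x))^4 \<le> 256 * e\<^sup>2 * (\<Sum>j<J. K j * ?d j x) + 16 * k * e\<^sup>2 * (cmod (q t x))\<^sup>2"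
        unfolding K_def
        by (rule quartic_le_scales) (use k e good[OF t Kk] sup_bounds(1)[OF t, of x] J in \<open>auto simp: K_def intro: order_trans\<close>)
      from mult_left_mono[OF this \<eta>_nonneg[of x]]
      show "\<eta> x * (cmod (q t x))^4 \<le> 256 * e\<^sup>2 * (\<Sum>j<J. K j * (\<eta> x * ?d j x)) + 16 * k * e\<^sup>2 * (\<eta> x * (cmod (q t x))\<^sup>2)"
        by (simp add: distrib_left sum_distrib_left mult_ac)
    qed
    also have "\<dots> = 256 * e\<^sup>2 * (LINT x|lborel. (\<Sum>j<J. K j * (\<eta> x * ?d j x))) + 16 * k * e\<^sup>2 * m t"
      unfolding m_def using isum i2 by simp
    also have "(LINT x|lborel. (\<Sum>j<J. K j * (\<eta> x * ?d j x))) = X t"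
      unfolding X_def D_def
      by (subst Bochner_Integration.integral_sum[OF integrable_mult_right[OF i]]) (simp only: integral_mult_right_zero)
    finally show ?thesis .
  qed
  define C0 where "C0 = 3 + 12 * M + k"
  have C00: "C0 \<ge> 0" using M k by (simp add: C0_def)
  have lower: "X t \<le> b' t + C0 * S" if t: "\<bar>t\<bar> < T" for t
  proof -
    let ?s = "\<Sum>j<J. K j * (s t j)\<^sup>2"
    have "(\<Sum>j<J. 15 / 8 * (K j * D t j) - (1 / K j + 2 * (K j * (s t j)\<^sup>2)) * m t - 10000 * (K j * (s t j)\<^sup>2) * A t) \<le> b' t"
      unfolding b'_def by (intro sum_mono step t)
    also have "(\<Sum>j<J. 15 / 8 * (K j * D t j) - (1 / K j + 2 * (K j * (s t j)\<^sup>2)) * m t - 10000 * (K j * (s t j)\<^sup>2) * A t)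
      = 15 / 8 * X t - ((\<Sum>j<J. 1 / K j) + 2 * ?s) * m t - 10000 * ?s * A t"
      by (simp only: sum_subtractf sum.distrib sum_distrib_left[symmetric] sum_distrib_right[symmetric] X_def)
    finally have 1: "15 / 8 * X t - ((\<Sum>j<J. 1 / K j) + 2 * ?s) * m t - 10000 * ?s * A t \<le> b' t" .
    have sM: "?s \<le> 6 * M" using sumKs[OF t] SM by linarith
    have "(\<Sum>j<J. 1 / K j) \<le> 2 / k" unfolding K_def by (rule geometric_inverse_sum) (use k in simp)
    also have "\<dots> \<le> 2" using k by (simp add: divide_le_eq)
    finally have 2: "((\<Sum>j<J. 1 / K j) + 2 * ?s) * m t \<le> (2 + 12 * M) * m t"
      using sM m0 by (intro mult_right_mono) auto
    \<comment> \<open>The sum of \<open>K j * (s t j)\<^sup>2\<close> is at most \<open>6 M\<close>,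
      and \<open>A\<close> returns \<open>256 e^2 X\<close>. Their product
      \<open>15360000 M e^2\<close> has to stay below 7/8, which the constant 20000000
      ensures.\<close>
    have "10000 * ?s * A t \<le> 60000 * M * A t" using sM m0 by (intro mult_right_mono) auto
    also have "\<dots> \<le> 60000 * M * (256 * e\<^sup>2 * X t + 16 * k * e\<^sup>2 * m t)" using M by (intro mult_left_mono A_le t) auto
    also have "\<dots> = 15360000 * (M * e\<^sup>2) * X t + 960000 * (M * e\<^sup>2) * k * m t" by (simp add: algebra_simps)
    also have "\<dots> \<le> 7 / 8 * X t + 1 * k * m t"
      using e(2) X0 m0 k by (intro add_mono mult_right_mono) auto
    finally have 3: "10000 * ?s * A t \<le> 7 / 8 * X t + k * m t" by simp
    have "(2 + 12 * M) * m t + k * m t \<le> C0 * m t" using m0(1)[of t] by (simp add: C0_def algebra_simps)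
    also have "\<dots> \<le> C0 * S" by (intro mult_left_mono mS t C00)
    finally show ?thesis using 1 2 3 by linarith
  qed
  have b_le: "\<bar>b t\<bar> \<le> (1 + 12 * M) * (P + 1) * S" if t: "\<bar>t\<bar> < T" for t
  proof -
    let ?I = "\<lambda>j. K j * (LINT x|lborel. \<phi> x * Im (q t x * cnj (resolv (2 * K j) (q t) x)))"
    let ?F = "\<lambda>j. Re (LINT x|lborel. \<phi> x *\<^sub>R (lam (K j) * (q t x * r j t x)))"
    have d: "\<bar>?F j - ?I j\<bar> \<le> 2 * P * (K j * (s t j)\<^sup>2) * S" for j
    proof -
      interpret c: scale \<eta> \<eta>' "q t" "p t" "r j t" "K j" "s t j" by (rule sc[OF t])
      have i: "integrable lborel (\<lambda>x. \<phi> x *\<^sub>R (lam (K j) * (q t x * r j t x)))"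
        by (intro nice_integrable nice_scaleR_left \<phi> nice_mult_right bcont_const nice_mult_left q_nice t c.bconts)
      have "?F j = (LINT x|lborel. \<phi> x * Re (lam (K j) * (q t x * r j t x)))"
        unfolding integral_Re[OF i, symmetric] by (simp del: times_complex.sel)
      thus ?thesis using c.density_expansion[OF \<phi>(1,3)] unfolding S[OF t] by simp
    qed
    \<comment> \<open>Only the remainders are estimated scale by scale; the quadratic parts go into
      \<open>density_bound\<close> as one sum.\<close>
    have "b t = (\<Sum>j<J. ?F j - ?I j) + (\<Sum>j<J. ?I j)" unfolding b_def sum.distrib[symmetric] by simp
    hence "\<bar>b t\<bar> \<le> \<bar>\<Sum>j<J. ?F j - ?I j\<bar> + \<bar>\<Sum>j<J. ?I j\<bar>" by linarith
    also have "\<bar>\<Sum>j<J. ?F j - ?I j\<bar> \<le> (\<Sum>j<J. 2 * P * (K j * (s t j)\<^sup>2) * S)"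
      by (rule order_trans[OF sum_abs]) (intro sum_mono d)
    also have "\<dots> = 2 * P * (\<Sum>j<J. K j * (s t j)\<^sup>2) * S"
      by (simp only: sum_distrib_left[symmetric] sum_distrib_right[symmetric])
    also have "\<dots> \<le> 2 * P * (6 * M) * S"
      using P0 S0 sumKs[OF t] SM by (intro mult_right_mono mult_left_mono) auto
    also have "\<bar>\<Sum>j<J. ?I j\<bar> \<le> (P + 1) * S" unfolding S[OF t, symmetric] K_def
      by (rule density_bound[OF k q_nice[OF t] \<phi>(1,2) bcont_nice[OF \<eta>_nice] _ \<phi>(3)]) (simp add: \<eta>_nonneg \<eta>_le_1)
    finally have "\<bar>b t\<bar> \<le> (P + 1 + 12 * M * P) * S" by (simp add: algebra_simps)
    also have "\<dots> \<le> (1 + 12 * M) * (P + 1) * S"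
      using S0 M by (intro mult_right_mono) (auto simp: algebra_simps)
    finally show ?thesis .
  qed
  show ?thesis
  proof (rule that[of "\<lambda>t. b t + C0 * S * t" "\<lambda>t. b' t + C0 * S"])
    fix t assume t: "\<bar>t\<bar> < T"
    show "((\<lambda>t. b t + C0 * S * t) has_real_derivative b' t + C0 * S) (at t)"
      by (rule DERIV_cong[OF DERIV_add[OF bd[OF t] DERIV_cmult[OF DERIV_ident]]]) simp
    show "(\<Sum>j<J. k * 4^j * (LINT x|lborel. \<eta> x *
      (cmod (q t x - complex_of_real (2 * (k * 4^j)) * resolv (2 * (k * 4^j)) (q t) x))\<^sup>2)) \<le> b' t + C0 * S"
      using lower[OF t] unfolding X_def D_def K_def .
    have "\<bar>C0 * S * t\<bar> \<le> C0 * S * T" unfolding abs_mult using C00 S0 t by (intro mult_mono) auto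
    thus "\<bar>b t + C0 * S * t\<bar> \<le> ((1 + 12 * M) * ((LINT x|lborel. \<eta> x) + 1) + (3 + 12 * M + k) * T) * sqint (q 0)"
      using b_le[OF t] unfolding P_def[symmetric] C0_def[symmetric] S_def[symmetric] by (simp add: algebra_simps)
  qed
qed

end

section \<open>Fourier analysis\<close>

lemma fourier_measurable [measurable]:
  assumes [measurable]: "f \<in> borel_measurable borel" shows "fourier f \<in> borel_measurable borel"
  unfolding fourier_def[abs_def] by measurable

lemma cmod_character: "cmod (exp (- \<i> * complex_of_real x)) = 1"
  using norm_exp_i_times[of "- x"] by simp

lemma fourier_norm_le:
  assumes f: "integrable lborel f" shows "cmod (fourier f \<xi>) \<le> (LINT x|lborel. cmod (f x))"
proof -
  have "cmod (fourier f \<xi>) \<le> (LINT x|lborel. cmod (exp (- \<i> * complex_of_real (x * \<xi>)) * f x))"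
    unfolding fourier_def by (rule integral_norm_bound)
  thus ?thesis unfolding norm_mult[of "exp _"] cmod_character by simp
qed

lemma integrable_mult_bounded:
  fixes a b :: "real \<Rightarrow> complex"
  assumes a: "integrable lborel a" and [measurable]: "b \<in> borel_measurable borel" and b: "\<And>x. cmod (b x) \<le> C"
  shows "integrable lborel (\<lambda>x. a x * b x)"
proof (rule Bochner_Integration.integrable_bound[of _ "\<lambda>x. C * cmod (a x)"])
  have [measurable]: "a \<in> borel_measurable borel" using borel_measurable_integrable[OF a] by simp
  show "(\<lambda>x. a x * b x) \<in> borel_measurable lborel" by measurable
  show "integrable lborel (\<lambda>x. C * cmod (a x))" by (intro integrable_mult_right integrable_norm a)
  have C0: "C \<ge> 0" using order_trans[OF norm_ge_zero b] .
  have "cmod (a x) * cmod (b x) \<le> cmod (a x) * C" for x by (intro mult_left_mono b) auto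
  thus "AE x in lborel. norm (a x * b x) \<le> norm (C * cmod (a x))"
    using C0 by (intro AE_I2) (simp add: norm_mult mult.commute)
qed

lemma fourier_multiplication:
  fixes a b :: "real \<Rightarrow> complex"
  assumes a: "integrable lborel a" and b: "integrable lborel b"
  shows "(LINT \<xi>|lborel. a \<xi> * fourier b \<xi>) = (LINT x|lborel. fourier a x * b x)"
proof -
  have [measurable]: "a \<in> borel_measurable borel" "b \<in> borel_measurable borel"
    using borel_measurable_integrable[OF a] borel_measurable_integrable[OF b] by auto
  let ?F = "\<lambda>x \<xi>. exp (- \<i> * complex_of_real (x * \<xi>)) * a \<xi> * b x"
  have "integrable (lborel \<Otimes>\<^sub>M lborel) (case_prod ?F)"
  proof (rule lborel_pair.Fubini_integrable)
    show "case_prod ?F \<in> borel_measurable (lborel \<Otimes>\<^sub>M lborel)" by measurable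
    have "(LINT \<xi>|lborel. norm (case_prod ?F (x, \<xi>))) = (LINT \<xi>|lborel. cmod (a \<xi>)) * cmod (b x)" for x
      unfolding prod.case norm_mult cmod_character by simp
    thus "integrable lborel (\<lambda>x. LINT \<xi>|lborel. norm (case_prod ?F (x, \<xi>)))"
      using b by (simp only:) (intro integrable_mult_right integrable_norm)
    have "integrable lborel (\<lambda>\<xi>. a \<xi> * (exp (- \<i> * complex_of_real (x * \<xi>)) * b x))" for x
      by (rule integrable_mult_bounded[OF a, of _ "cmod (b x)"]) (measurable, simp only: norm_mult cmod_character)
    thus "AE x in lborel. integrable lborel (\<lambda>\<xi>. case_prod ?F (x, \<xi>))"
      by (intro AE_I2) (simp add: mult_ac)
  qed
  from lborel_pair.Fubini_integral[OF this]
  have "(LINT \<xi>|lborel. LINT x|lborel. ?F x \<xi>) = (LINT x|lborel. LINT \<xi>|lborel. ?F x \<xi>)" .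
  moreover have "(LINT x|lborel. ?F x \<xi>) = a \<xi> * fourier b \<xi>" for \<xi>
    unfolding fourier_def integral_mult_right_zero[symmetric] by (simp add: mult_ac)
  moreover have "(LINT \<xi>|lborel. ?F x \<xi>) = fourier a x * b x" for x
    unfolding fourier_def integral_mult_left_zero[symmetric] by (simp add: mult_ac)
  ultimately show ?thesis by (simp only:)
qed

text \<open>The substitution \<open>\<xi> = x / s\<close> reduces this to the characteristic
  function of the standard normal distribution.\<close>

lemma fourier_gaussian:
  assumes s: "s > 0"
  shows "fourier (\<lambda>\<xi>. complex_of_real (exp (- (s\<^sup>2 * \<xi>\<^sup>2 / 2)))) u = complex_of_real (2 * pi * normal_density 0 s u)"
proof -
  let ?N = "std_normal_density"
  have "complex_of_real (exp (- ((- u / s)\<^sup>2) / 2)) = (CLINT x|std_normal_distribution. iexp (- u / s * x))"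
    using fun_cong[OF char_std_normal_distribution, of "- u / s"] unfolding char_def by simp
  also have "\<dots> = (LINT x|lborel. ?N x *\<^sub>R iexp (- u / s * x))"
    by (rule integral_density) (auto intro!: borel_measurable_continuous_onI continuous_intros)
  finally have 1: "(LINT x|lborel. ?N x *\<^sub>R iexp (- u / s * x)) = complex_of_real (exp (- ((u / s)\<^sup>2) / 2))" by (simp only: power2_minus minus_divide_left[symmetric])
  have "fourier (\<lambda>\<xi>. complex_of_real (exp (- (s\<^sup>2 * \<xi>\<^sup>2 / 2)))) u
    = \<bar>1 / s\<bar> *\<^sub>R (LINT x|lborel. exp (- \<i> * complex_of_real ((0 + 1 / s * x) * u)) * complex_of_real (exp (- (s\<^sup>2 * (0 + 1 / s * x)\<^sup>2 / 2))))"
    unfolding fourier_def using s by (intro lborel_integral_real_affine) simp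
  also have "(LINT x|lborel. exp (- \<i> * complex_of_real ((0 + 1 / s * x) * u)) * complex_of_real (exp (- (s\<^sup>2 * (0 + 1 / s * x)\<^sup>2 / 2))))
    = (LINT x|lborel. sqrt (2 * pi) *\<^sub>R (?N x *\<^sub>R iexp (- u / s * x)))"
  proof (intro Bochner_Integration.integral_cong refl)
    fix x
    have 2: "s\<^sup>2 * (0 + 1 / s * x)\<^sup>2 / 2 = x\<^sup>2 / 2" using s by (simp add: power_divide)
    have 3: "- \<i> * complex_of_real ((0 + 1 / s * x) * u) = \<i> * complex_of_real (- u / s * x)" by simp
    have 4: "sqrt (2 * pi) * ?N x = exp (- (x\<^sup>2 / 2))" by (simp add: std_normal_density_def)
    show "exp (- \<i> * complex_of_real ((0 + 1 / s * x) * u)) * complex_of_real (exp (- (s\<^sup>2 * (0 + 1 / s * x)\<^sup>2 / 2)))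
       = sqrt (2 * pi) *\<^sub>R (?N x *\<^sub>R iexp (- u / s * x))"
      unfolding 2 3 scaleR_scaleR 4 by (simp add: scaleR_conv_of_real mult.commute)
  qed
  also have "\<dots> = sqrt (2 * pi) *\<^sub>R complex_of_real (exp (- ((u / s)\<^sup>2) / 2))" unfolding integral_scaleR_right 1 ..
  also have "\<bar>1 / s\<bar> *\<^sub>R \<dots> = complex_of_real (2 * pi * normal_density 0 s u)"
  proof -
    have a: "sqrt (2 * pi * s\<^sup>2) = sqrt (2 * pi) * s" using s by (simp add: real_sqrt_mult)
    have b: "2 * pi = sqrt (2 * pi) * sqrt (2 * pi)" by simp
    have c: "2 * pi * (1 / (sqrt (2 * pi) * s)) = sqrt (2 * pi) / s" by (subst b) (use s in \<open>simp add: field_simps\<close>)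
    have d: "2 * pi * normal_density 0 s u = sqrt (2 * pi) / s * exp (- ((u / s)\<^sup>2) / 2)"
      unfolding normal_density_def a mult.assoc[symmetric] using c by (simp add: power_divide)
    show ?thesis unfolding d using s by (simp add: scaleR_conv_of_real)
  qed
  finally show ?thesis .
qed

lemma norm_integral_le_nn: "ennreal (norm (integral\<^sup>L M f)) \<le> (\<integral>\<^sup>+x. ennreal (norm (f x)) \<partial>M)"
  for f :: "'a \<Rightarrow> 'b::{banach, second_countable_topology}"
  by (cases "integrable M f") (auto simp: integral_norm_bound_ennreal not_integrable_integral_eq)

text \<open>The multiplication formula turns the left side into a double integral of
  \<open>f x\<close>, \<open>cnj (f y)\<close> and a normal density in \<open>x - y\<close>. Then
  \<open>2 |f x| |f y| \<le> |f x|^2 + |f y|^2\<close>, and the density has total mass 1 in either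
  variable. The Gaussian factor makes every integral involved finite.\<close>

lemma gaussian_weighted_Plancherel:
  assumes f: "nice f" and s: "s > 0"
  shows "(\<integral>\<^sup>+\<xi>. ennreal (exp (- (s\<^sup>2 * \<xi>\<^sup>2 / 2)) * (cmod (fourier f \<xi>))\<^sup>2) \<partial>lborel) \<le> ennreal (2 * pi * sqint f)"
proof -
  define G where "G \<xi> = complex_of_real (exp (- (s\<^sup>2 * \<xi>\<^sup>2 / 2)))" for \<xi> :: real
  let ?N = "\<lambda>x y. normal_density x s y"
  have fi: "integrable lborel f" by (rule nice_integrable[OF f])
  have [measurable]: "f \<in> borel_measurable borel" using nice_measurable[OF f] .
  define C where "C = (LINT x|lborel. cmod (f x))"
  have fC: "cmod (fourier f \<xi>) \<le> C" for \<xi> unfolding C_def by (rule fourier_norm_le[OF fi])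
  have Gi: "integrable lborel G"
  proof -
    have "exp (- (s\<^sup>2 * \<xi>\<^sup>2 / 2)) = sqrt (2 * pi * (1 / s)\<^sup>2) * normal_density 0 (1 / s) \<xi>" for \<xi>
      using s by (simp add: normal_density_def power_divide)
    hence "integrable lborel (\<lambda>\<xi>. exp (- (s\<^sup>2 * \<xi>\<^sup>2 / 2)))" by (simp only:) (intro integrable_mult_right integrable_normal_density, use s in simp)
    thus ?thesis unfolding G_def by simp
  qed
  have [measurable]: "G \<in> borel_measurable borel" using borel_measurable_integrable[OF Gi] by simp
  define a where "a \<xi> = G \<xi> * cnj (fourier f \<xi>)" for \<xi>
  have "cnj \<in> borel_measurable borel" by (intro borel_measurable_continuous_onI continuous_intros)
  from measurable_compose[OF fourier_measurable this]
  have [measurable]: "(\<lambda>x. cnj (fourier f x)) \<in> borel_measurable borel" by measurable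
  have ai: "integrable lborel a" unfolding a_def
    by (rule integrable_mult_bounded[OF Gi, of _ C]) (measurable, simp add: fC)
  have fa: "fourier a x = (LINT y|lborel. complex_of_real (2 * pi * ?N x y) * cnj (f y))" for x
  proof -
    define e where "e \<xi> = exp (- \<i> * complex_of_real (\<xi> * x)) * G \<xi>" for \<xi>
    have "integrable lborel (\<lambda>\<xi>. G \<xi> * exp (- \<i> * complex_of_real (\<xi> * x)))"
    proof (rule integrable_mult_bounded[OF Gi])
      show "(\<lambda>\<xi>. exp (- \<i> * complex_of_real (\<xi> * x))) \<in> borel_measurable borel"
        by (intro borel_measurable_continuous_onI continuous_intros)
    qed (rule eq_refl[OF cmod_character])
    hence ei: "integrable lborel e" by (simp add: e_def[abs_def] mult.commute)
    \<comment> \<open>The conjugate of a transform is the transform of the reflected conjugate,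
      which permits a second use of the multiplication formula.\<close>
    define h where "h y = cnj (f (- y))" for y
    have hi: "integrable lborel h" unfolding h_def[abs_def]
      by (intro nice_integrable nice_cnj) (rule nice_reflect[OF f])
    have "cnj (fourier f \<xi>) = fourier h \<xi>" for \<xi>
    proof -
      have "cnj (fourier f \<xi>) = (LINT y|lborel. cnj (exp (- \<i> * complex_of_real (y * \<xi>)) * f y))"
        unfolding fourier_def by (rule Bochner_Integration.integral_cnj[symmetric])
      also have "\<dots> = (LINT y|lborel. exp (\<i> * complex_of_real (y * \<xi>)) * cnj (f y))" by (simp add: exp_cnj)
      also have "\<dots> = (LINT y|lborel. exp (- \<i> * complex_of_real (y * \<xi>)) * h y)"
        using lborel_integral_real_affine[of "-1" "\<lambda>y. exp (\<i> * complex_of_real (y * \<xi>)) * cnj (f y)" 0]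
        by (simp add: h_def)
      finally show ?thesis by (simp add: fourier_def)
    qed
    hence "fourier a x = (LINT \<xi>|lborel. e \<xi> * fourier h \<xi>)"
      unfolding fourier_def[of a] a_def e_def by (simp add: mult.assoc)
    also have "\<dots> = (LINT y|lborel. fourier e y * h y)" by (rule fourier_multiplication[OF ei hi])
    also have "\<dots> = (LINT y|lborel. complex_of_real (2 * pi * ?N 0 (x + y)) * h y)"
    proof (intro Bochner_Integration.integral_cong refl)
      fix y
      have "fourier e y = fourier G (x + y)" unfolding fourier_def e_def
      proof (intro Bochner_Integration.integral_cong refl)
        fix \<xi>
        have eq: "- \<i> * complex_of_real (\<xi> * (x + y)) = - \<i> * complex_of_real (\<xi> * y) + - \<i> * complex_of_real (\<xi> * x)"
          by (simp add: algebra_simps)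
        show "exp (- \<i> * complex_of_real (\<xi> * y)) * (exp (- \<i> * complex_of_real (\<xi> * x)) * G \<xi>)
          = exp (- \<i> * complex_of_real (\<xi> * (x + y))) * G \<xi>"
          unfolding eq exp_add mult.assoc ..
      qed
      thus "fourier e y * h y = complex_of_real (2 * pi * ?N 0 (x + y)) * h y"
        using fourier_gaussian[OF s, of "x + y"] unfolding G_def[abs_def] by simp
    qed
    also have "\<dots> = (LINT y|lborel. complex_of_real (2 * pi * ?N 0 (x - y)) * cnj (f y))"
      using lborel_integral_real_affine[of "-1" "\<lambda>y. complex_of_real (2 * pi * ?N 0 (x - y)) * cnj (f y)" 0] by (simp add: h_def)
    also have "\<dots> = (LINT y|lborel. complex_of_real (2 * pi * ?N x y) * cnj (f y))"
      by (simp add: normal_density_def power2_commute[of x])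
    finally show ?thesis .
  qed
  have sq: "(\<integral>\<^sup>+x. ennreal ((cmod (f x))\<^sup>2) \<partial>lborel) = ennreal (sqint f)" by (rule nn_integral_sqint[OF f])
  have N1: "(\<integral>\<^sup>+y. ennreal (?N x y) \<partial>lborel) = 1" for x
    using nn_integral_eq_integral[OF integrable_normal_density[OF s, of x]] s by simp
  have joint: "case_prod (\<lambda>x y. ennreal (pi * (cmod (f y))\<^sup>2 * ?N x y)) \<in> borel_measurable (lborel \<Otimes>\<^sub>M lborel)"
    unfolding normal_density_def by measurable
  note inner = lborel.borel_measurable_nn_integral[OF joint]
  have Nsym: "?N x y = ?N y x" for x y by (simp add: normal_density_def power2_commute)
  have "(\<integral>\<^sup>+\<xi>. ennreal (exp (- (s\<^sup>2 * \<xi>\<^sup>2 / 2)) * (cmod (fourier f \<xi>))\<^sup>2) \<partial>lborel) = (\<integral>\<^sup>+\<xi>. ennreal (cmod (a \<xi> * fourier f \<xi>)) \<partial>lborel)"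
    by (simp add: a_def G_def norm_mult power2_eq_square mult.assoc)
  also have "\<dots> = ennreal (LINT \<xi>|lborel. cmod (a \<xi> * fourier f \<xi>))"
    by (rule nn_integral_eq_integral[OF integrable_norm[OF integrable_mult_bounded[OF ai _ fC]]]) simp_all
  also have "(LINT \<xi>|lborel. cmod (a \<xi> * fourier f \<xi>)) = cmod (LINT \<xi>|lborel. a \<xi> * fourier f \<xi>)"
  proof -
    have pos: "a \<xi> * fourier f \<xi> = complex_of_real (cmod (a \<xi> * fourier f \<xi>))" for \<xi>
    proof -
      have "a \<xi> * fourier f \<xi> = G \<xi> * (fourier f \<xi> * cnj (fourier f \<xi>))" by (simp add: a_def mult_ac)
      also have "\<dots> = complex_of_real (exp (- (s\<^sup>2 * \<xi>\<^sup>2 / 2)) * (cmod (fourier f \<xi>))\<^sup>2)"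
        unfolding G_def complex_norm_square[symmetric] by simp
      finally have *: "a \<xi> * fourier f \<xi> = complex_of_real (exp (- (s\<^sup>2 * \<xi>\<^sup>2 / 2)) * (cmod (fourier f \<xi>))\<^sup>2)" .
      show ?thesis unfolding * norm_of_real by simp
    qed
    have "(LINT \<xi>|lborel. a \<xi> * fourier f \<xi>) = complex_of_real (LINT \<xi>|lborel. cmod (a \<xi> * fourier f \<xi>))"
      by (subst integral_complex_of_real[symmetric], subst pos) (rule refl)
    moreover have "(LINT \<xi>|lborel. cmod (a \<xi> * fourier f \<xi>)) \<ge> 0" by (intro integral_nonneg_AE AE_I2) auto
    ultimately show ?thesis by simp
  qed
  also have "(LINT \<xi>|lborel. a \<xi> * fourier f \<xi>) = (LINT x|lborel. fourier a x * f x)"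
    by (rule fourier_multiplication[OF ai fi])
  also have "ennreal (cmod (LINT x|lborel. fourier a x * f x)) \<le> (\<integral>\<^sup>+x. ennreal (cmod (fourier a x * f x)) \<partial>lborel)"
    by (rule norm_integral_le_nn)
  also have "\<dots> \<le> (\<integral>\<^sup>+x. (\<integral>\<^sup>+y. ennreal (2 * pi * ?N x y * cmod (f y)) \<partial>lborel) * ennreal (cmod (f x)) \<partial>lborel)"
  proof (intro nn_integral_mono)
    fix x
    have "ennreal (cmod (fourier a x)) \<le> (\<integral>\<^sup>+y. ennreal (2 * pi * ?N x y * cmod (f y)) \<partial>lborel)"
      unfolding fa by (rule order_trans[OF norm_integral_le_nn])
        (intro nn_integral_mono, simp add: norm_mult)
    thus "ennreal (cmod (fourier a x * f x)) \<le> (\<integral>\<^sup>+y. ennreal (2 * pi * ?N x y * cmod (f y)) \<partial>lborel) * ennreal (cmod (f x))"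
      unfolding norm_mult ennreal_mult'[OF norm_ge_zero] by (intro mult_right_mono) auto
  qed
  also have "\<dots> = (\<integral>\<^sup>+x. \<integral>\<^sup>+y. ennreal (2 * pi * ?N x y * cmod (f y)) * ennreal (cmod (f x)) \<partial>lborel \<partial>lborel)"
    by (subst nn_integral_multc) auto
  also have "\<dots> \<le> (\<integral>\<^sup>+x. \<integral>\<^sup>+y. ennreal (pi * (cmod (f x))\<^sup>2) * ennreal (?N x y) + ennreal (pi * (cmod (f y))\<^sup>2 * ?N x y) \<partial>lborel \<partial>lborel)"
  proof (intro nn_integral_mono)
    fix x y
    have "2 * cmod (f y) * cmod (f x) \<le> (cmod (f x))\<^sup>2 + (cmod (f y))\<^sup>2"
      using sum_squares_bound[of "cmod (f y)" "cmod (f x)"] by simp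
    from mult_left_mono[OF this, of "pi * ?N x y"]
    have "2 * pi * ?N x y * cmod (f y) * cmod (f x) \<le> pi * (cmod (f x))\<^sup>2 * ?N x y + pi * (cmod (f y))\<^sup>2 * ?N x y"
      by (simp add: algebra_simps)
    thus "ennreal (2 * pi * ?N x y * cmod (f y)) * ennreal (cmod (f x))
      \<le> ennreal (pi * (cmod (f x))\<^sup>2) * ennreal (?N x y) + ennreal (pi * (cmod (f y))\<^sup>2 * ?N x y)"
      by (simp add: ennreal_mult'[symmetric] ennreal_plus[symmetric] del: ennreal_plus)
  qed
  also have "\<dots> = (\<integral>\<^sup>+x. ennreal (pi * (cmod (f x))\<^sup>2) + (\<integral>\<^sup>+y. ennreal (pi * (cmod (f y))\<^sup>2 * ?N x y) \<partial>lborel) \<partial>lborel)"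
    by (subst nn_integral_add, measurable) (subst nn_integral_cmult, measurable, simp add: N1)
  also have "\<dots> = (\<integral>\<^sup>+x. ennreal (pi * (cmod (f x))\<^sup>2) \<partial>lborel) + (\<integral>\<^sup>+x. \<integral>\<^sup>+y. ennreal (pi * (cmod (f y))\<^sup>2 * ?N x y) \<partial>lborel \<partial>lborel)"
    by (rule nn_integral_add[OF _ inner]) measurable
  also have "(\<integral>\<^sup>+x. \<integral>\<^sup>+y. ennreal (pi * (cmod (f y))\<^sup>2 * ?N x y) \<partial>lborel \<partial>lborel)
    = (\<integral>\<^sup>+y. \<integral>\<^sup>+x. ennreal (pi * (cmod (f y))\<^sup>2 * ?N x y) \<partial>lborel \<partial>lborel)"
    by (rule lborel_pair.Fubini'[OF joint, symmetric])
  also have "\<dots> = (\<integral>\<^sup>+y. ennreal (pi * (cmod (f y))\<^sup>2) * (\<integral>\<^sup>+x. ennreal (?N y x) \<partial>lborel) \<partial>lborel)"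
    by (subst nn_integral_cmult[symmetric]) (auto simp: ennreal_mult' Nsym)
  also have "\<dots> = (\<integral>\<^sup>+x. ennreal (pi * (cmod (f x))\<^sup>2) \<partial>lborel)" by (simp add: N1)
  also have "(\<integral>\<^sup>+x. ennreal (pi * (cmod (f x))\<^sup>2) \<partial>lborel) = ennreal (pi * sqint f)"
    by (subst ennreal_mult', simp, subst nn_integral_cmult, simp) (simp add: sq ennreal_mult' sqint_nonneg)
  also have "ennreal (pi * sqint f) + ennreal (pi * sqint f) = ennreal (2 * pi * sqint f)"
    by (simp add: ennreal_plus[symmetric] sqint_nonneg del: ennreal_plus)
  finally show ?thesis .
qed

text \<open>Fatou's lemma as the Gaussian weights increase to 1. The factor \<open>2 pi\<close>
  comes from the transform being unnormalised.\<close>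

lemma Plancherel_le:
  assumes f: "nice f"
  shows "(\<integral>\<^sup>+\<xi>. ennreal ((cmod (fourier f \<xi>))\<^sup>2) \<partial>lborel) \<le> ennreal (2 * pi * sqint f)"
proof -
  have [measurable]: "f \<in> borel_measurable borel" using nice_measurable[OF f] .
  let ?u = "\<lambda>n \<xi>. ennreal (exp (- ((1 / real (Suc n))\<^sup>2 * \<xi>\<^sup>2 / 2)) * (cmod (fourier f \<xi>))\<^sup>2)"
  have "liminf (\<lambda>n. ?u n \<xi>) = ennreal ((cmod (fourier f \<xi>))\<^sup>2)" for \<xi>
  proof (rule lim_imp_Liminf)
    have "(\<lambda>n. exp (- ((1 / real (Suc n))\<^sup>2 * \<xi>\<^sup>2 / 2)) * (cmod (fourier f \<xi>))\<^sup>2) \<longlonglongrightarrow> exp (- (0\<^sup>2 * \<xi>\<^sup>2 / 2)) * (cmod (fourier f \<xi>))\<^sup>2"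
      by (intro tendsto_intros LIMSEQ_Suc[OF lim_1_over_n]) auto
    thus "(\<lambda>n. ?u n \<xi>) \<longlonglongrightarrow> ennreal ((cmod (fourier f \<xi>))\<^sup>2)" by (simp add: tendsto_ennrealI)
  qed simp
  hence "(\<integral>\<^sup>+\<xi>. ennreal ((cmod (fourier f \<xi>))\<^sup>2) \<partial>lborel) = (\<integral>\<^sup>+\<xi>. liminf (\<lambda>n. ?u n \<xi>) \<partial>lborel)" by simp
  also have "\<dots> \<le> liminf (\<lambda>n. \<integral>\<^sup>+\<xi>. ?u n \<xi> \<partial>lborel)" by (rule nn_integral_liminf) measurable
  also have "\<dots> \<le> ennreal (2 * pi * sqint f)"
    by (rule order_trans[OF Liminf_le_Limsup Limsup_bounded])
      (auto intro!: always_eventually gaussian_weighted_Plancherel f)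
  finally show ?thesis .
qed

lemma fourier_deriv:
  assumes f: "nice f" "nice f'" and d: "\<And>x. (f has_vector_derivative f' x) (at x)"
  shows "fourier f' \<xi> = \<i> * \<xi> * fourier f \<xi>"
proof -
  let ?e = "\<lambda>x. exp (- \<i> * complex_of_real (x * \<xi>))"
  have eb: "bcont ?e" by (rule bcontI[of _ 1]) (auto intro!: continuous_intros simp: cmod_character[simplified])
  have n: "nice (\<lambda>x. ?e x * f' x)" "nice (\<lambda>x. ?e x * f x)" by (intro nice_mult_right eb f)+
  have "(LINT x|lborel. ?e x * f' x + (- \<i> * \<xi>) * (?e x * f x)) = 0"
  proof (rule integral_derivative_nice[where F="\<lambda>x. ?e x * f x"])
    fix x
    have "(?e has_vector_derivative (- \<i> * \<xi>) * ?e x) (at x)"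
      by (auto intro!: derivative_eq_intros simp: has_vector_derivative_complex_iff Re_exp Im_exp)
    from has_vector_derivative_mult[OF this d]
    show "((\<lambda>x. ?e x * f x) has_vector_derivative ?e x * f' x + (- \<i> * \<xi>) * (?e x * f x)) (at x)"
      by (simp add: mult.assoc)
  qed (intro nice_add nice_mult_right[OF bcont_const] n)+
  moreover have "(LINT x|lborel. ?e x * f' x + (- \<i> * \<xi>) * (?e x * f x)) = fourier f' \<xi> + (- \<i> * \<xi>) * fourier f \<xi>"
    unfolding fourier_def using nice_integrable[OF n(1)] nice_integrable[OF n(2)]
    by (subst Bochner_Integration.integral_add) auto
  ultimately show ?thesis by (simp add: eq_neg_iff_add_eq_0)
qed

text \<open>Let \<open>W\<close> be the resolvent of \<open>f\<close> and \<open>h = W'\<close>. The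
  transform of \<open>h\<close> is \<open>\<i> \<xi>\<close> times that of \<open>W\<close>, and the
  transform of \<open>f = h + 2 k W\<close> is \<open>2 k + \<i> \<xi>\<close> times it.\<close>

lemma fourier_resolv:
  assumes k: "k > 0" and f: "nice f"
  shows "\<xi>\<^sup>2 / (4 * k\<^sup>2 + \<xi>\<^sup>2) * (cmod (fourier f \<xi>))\<^sup>2
    = (cmod (fourier (\<lambda>x. f x - complex_of_real (2 * k) * resolv (2 * k) f x) \<xi>))\<^sup>2"
proof -
  have c: "2 * k > 0" using k by simp
  define W where "W = resolv (2 * k) f"
  define h where "h x = f x - complex_of_real (2 * k) * W x" for x
  have W: "nice W" unfolding W_def by (intro resolv_nice c f)
  have h: "nice h" unfolding h_def[abs_def] by (intro nice_diff nice_mult_right bcont_const W f)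
  have "(W has_vector_derivative h x) (at x)" for x
    using resolv_deriv[OF c bcont_nice[OF f], of x] by (simp add: W_def h_def scaleR_conv_of_real)
  from fourier_deriv[OF W h this] have 1: "fourier h \<xi> = \<i> * \<xi> * fourier W \<xi>" .
  let ?e = "\<lambda>x. exp (- \<i> * complex_of_real (x * \<xi>))"
  have eb: "bcont ?e" by (rule bcontI[of _ 1]) (auto intro!: continuous_intros simp: cmod_character[simplified])
  have n: "nice (\<lambda>x. ?e x * f x)" "nice (\<lambda>x. ?e x * W x)" by (intro nice_mult_right eb f W)+
  have "?e x * h x = ?e x * f x - complex_of_real (2 * k) * (?e x * W x)" for x by (simp add: h_def algebra_simps)
  hence "fourier h \<xi> = fourier f \<xi> - complex_of_real (2 * k) * fourier W \<xi>"
    unfolding fourier_def using nice_integrable[OF n(1)] nice_integrable[OF n(2)] by simp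
  hence "fourier f \<xi> = (complex_of_real (2 * k) + \<i> * \<xi>) * fourier W \<xi>" using 1 by (simp add: algebra_simps)
  moreover have "(cmod (complex_of_real (2 * k) + \<i> * \<xi>))\<^sup>2 = 4 * k\<^sup>2 + \<xi>\<^sup>2" by (simp add: cmod_power2 power_mult_distrib)
  ultimately have "(cmod (fourier f \<xi>))\<^sup>2 = (4 * k\<^sup>2 + \<xi>\<^sup>2) * (cmod (fourier W \<xi>))\<^sup>2"
    by (simp only: norm_mult power_mult_distrib)
  moreover have "4 * k\<^sup>2 + \<xi>\<^sup>2 > 0" using k by (intro add_pos_nonneg) auto
  ultimately show ?thesis unfolding W_def[symmetric] h_def[symmetric] 1
    by (simp add: norm_mult power_mult_distrib)
qed

section \<open>The localized Sobolev norm\<close>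

text \<open>For \<open>|\<xi>|\<close> between \<open>2 k\<close> and \<open>2 k_J\<close>, take the
  last scale with \<open>2 k_j < |\<xi>|\<close>: its summand is at least \<open>k_j / 2\<close>,
  while \<open>|\<xi>| \<le> 8 k_j\<close>. Lower frequencies are covered by \<open>2 k\<close>,
  higher ones by the last term.\<close>

lemma dyadic_frequency_bound:
  fixes \<xi> :: real
  assumes k: "k > 0"
  shows "\<bar>\<xi>\<bar> \<le> 2 * k + 16 * (\<Sum>j<J. k * 4^j * (\<xi>\<^sup>2 / (4 * (k * 4^j)\<^sup>2 + \<xi>\<^sup>2))) + \<xi>\<^sup>2 / (2 * (k * 4^J))"
    (is "_ \<le> _ + 16 * ?X + ?R")
proof -
  define K where "K j = k * 4^j" for j :: nat
  have K: "K j > 0" for j using k by (simp add: K_def)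
  have X0: "?X \<ge> 0" using k by (intro sum_nonneg mult_nonneg_nonneg divide_nonneg_nonneg) auto
  have R0: "?R \<ge> 0" using k by simp
  show ?thesis
  proof (cases "\<bar>\<xi>\<bar> \<le> 2 * K J")
    case False
    hence "2 * K J * \<bar>\<xi>\<bar> \<le> \<bar>\<xi>\<bar> * \<bar>\<xi>\<bar>" by (intro mult_right_mono) auto
    hence "\<bar>\<xi>\<bar> \<le> ?R" using K[of J] unfolding K_def[symmetric] by (simp add: pos_le_divide_eq power2_eq_square mult_ac)
    thus ?thesis using X0 k by linarith
  next
    case True
    define n where "n = (LEAST j. \<bar>\<xi>\<bar> \<le> 2 * K j)"
    have n: "\<bar>\<xi>\<bar> \<le> 2 * K n" unfolding n_def by (rule LeastI[of _ J]) (rule True)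
    have nJ: "n \<le> J" unfolding n_def by (rule Least_le) (rule True)
    show ?thesis
    proof (cases n)
      case 0
      hence "\<bar>\<xi>\<bar> \<le> 2 * k" using n by (simp add: K_def)
      thus ?thesis using X0 R0 by linarith
    next
      case (Suc j)
      have jJ: "j < J" using Suc nJ by simp
      have lt: "2 * K j < \<bar>\<xi>\<bar>" using not_less_Least[of j "\<lambda>j. \<bar>\<xi>\<bar> \<le> 2 * K j"] Suc
        by (simp add: n_def[symmetric] not_le)
      have up: "\<bar>\<xi>\<bar> \<le> 8 * K j" using n by (simp add: Suc K_def)
      have "(2 * K j)\<^sup>2 \<le> \<bar>\<xi>\<bar>\<^sup>2" using lt K[of j] by (intro power_mono) auto
      hence "4 * (K j)\<^sup>2 \<le> \<xi>\<^sup>2" by (simp add: power_mult_distrib)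
      moreover have "0 < 4 * (K j)\<^sup>2 + \<xi>\<^sup>2" using K[of j] by (intro add_pos_nonneg) auto
      ultimately have "1 / 2 \<le> \<xi>\<^sup>2 / (4 * (K j)\<^sup>2 + \<xi>\<^sup>2)" by (simp add: pos_le_divide_eq)
      from mult_left_mono[OF this less_imp_le[OF K[of j]]]
      have "K j / 2 \<le> K j * (\<xi>\<^sup>2 / (4 * (K j)\<^sup>2 + \<xi>\<^sup>2))" by simp
      also have "\<dots> \<le> ?X" unfolding K_def
        by (rule member_le_sum[of j "{..<J}"]) (use jJ k in \<open>auto intro!: mult_nonneg_nonneg divide_nonneg_nonneg\<close>)
      finally show ?thesis using up R0 k by linarith
    qed
  qed
qed

text \<open>The weight is at most \<open>2 + |\<xi>|\<close>, and each term of the dyadic bound for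
  \<open>|\<xi>|\<close> becomes an \<open>L^2\<close> norm by Plancherel. Truncation at
  \<open>J\<close> scales costs the term with \<open>f'\<close>, which tends to 0 as
  \<open>J\<close> grows.\<close>

lemma Hs_half_le:
  assumes f: "nice f" "nice f'" "\<And>x. (f has_vector_derivative f' x) (at x)" and k: "k > 0"
  shows "Hs_norm_sq (1 / 2) f \<le> ennreal (2 * pi * ((2 + 2 * k) * sqint f
    + 16 * (\<Sum>j<J. k * 4^j * sqint (\<lambda>x. f x - complex_of_real (2 * (k * 4^j)) * resolv (2 * (k * 4^j)) f x))
    + sqint f' / (2 * (k * 4^J))))"
proof -
  define K where "K j = k * 4^j" for j :: nat
  have K: "K j > 0" for j using k by (simp add: K_def)
  define h where "h j x = f x - complex_of_real (2 * K j) * resolv (2 * K j) f x" for j x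
  have h: "nice (h j)" for j unfolding h_def[abs_def]
    using K[of j] by (intro nice_diff nice_mult_right bcont_const resolv_nice f) simp
  have [measurable]: "f \<in> borel_measurable borel" "f' \<in> borel_measurable borel" "h j \<in> borel_measurable borel" for j
    using nice_measurable[OF f(1)] nice_measurable[OF f(2)] nice_measurable[OF h] .
  define c d where "c = 1 / (2 * K J)" and "d = 2 + 2 * k"
  have cd: "c \<ge> 0" "d \<ge> 0" using K[of J] k by (simp_all add: c_def d_def)
  let ?N = "\<lambda>g \<xi>. ennreal ((cmod (fourier g \<xi>))\<^sup>2)"
  have "Hs_norm_sq (1 / 2) f \<le> (\<integral>\<^sup>+\<xi>. ennreal d * ?N f \<xi> + (\<Sum>j<J. ennreal (16 * K j) * ?N (h j) \<xi>)
    + ennreal (c) * ?N f' \<xi> \<partial>lborel)"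
    unfolding Hs_norm_sq_def
  proof (intro nn_integral_mono)
    fix \<xi>
    let ?F = "(cmod (fourier f \<xi>))\<^sup>2"
    have "(4 + \<xi>\<^sup>2) powr (1 / 2) = sqrt (4 + \<xi>\<^sup>2)" by (rule powr_half_sqrt) simp
    also have "\<dots> \<le> 2 + \<bar>\<xi>\<bar>" by (rule real_le_lsqrt) (auto simp: power2_eq_square algebra_simps)
    also have "\<dots> \<le> 2 + 2 * k + 16 * (\<Sum>j<J. K j * (\<xi>\<^sup>2 / (4 * (K j)\<^sup>2 + \<xi>\<^sup>2))) + \<xi>\<^sup>2 / (2 * K J)"
      using dyadic_frequency_bound[OF k, of \<xi> J] unfolding K_def by linarith
    finally have "(4 + \<xi>\<^sup>2) powr (1 / 2) * ?F \<le> (2 + 2 * k + 16 * (\<Sum>j<J. K j * (\<xi>\<^sup>2 / (4 * (K j)\<^sup>2 + \<xi>\<^sup>2))) + \<xi>\<^sup>2 / (2 * K J)) * ?F"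
      by (rule mult_right_mono) simp
    also have "\<dots> = d * ?F + (\<Sum>j<J. 16 * K j * (\<xi>\<^sup>2 / (4 * (K j)\<^sup>2 + \<xi>\<^sup>2) * ?F)) + c * (\<xi>\<^sup>2 * ?F)"
      by (simp add: c_def d_def distrib_right sum_distrib_left sum_distrib_right mult.assoc)
    also have "\<dots> = d * ?F + (\<Sum>j<J. 16 * K j * (cmod (fourier (h j) \<xi>))\<^sup>2) + c * (cmod (fourier f' \<xi>))\<^sup>2"
      unfolding fourier_resolv[OF K f(1)] h_def[abs_def] fourier_deriv[OF f] by (simp add: norm_mult power_mult_distrib)
    finally have "ennreal ((4 + \<xi>\<^sup>2) powr (1 / 2) * ?F) \<le> ennreal \<dots>" by (rule ennreal_leI)
    also have "\<dots> = ennreal d * ?N f \<xi> + (\<Sum>j<J. ennreal (16 * K j) * ?N (h j) \<xi>) + ennreal (c) * ?N f' \<xi>"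
      using cd K by (simp add: ennreal_plus ennreal_mult' sum_ennreal[symmetric] sum_nonneg less_imp_le)
    finally show "ennreal ((4 + \<xi>\<^sup>2) powr (1 / 2) * ?F) \<le> \<dots>" .
  qed
  also have "\<dots> = ennreal d * integral\<^sup>N lborel (?N f) + (\<Sum>j<J. ennreal (16 * K j) * integral\<^sup>N lborel (?N (h j)))
    + ennreal (c) * integral\<^sup>N lborel (?N f')"
    by (simp add: nn_integral_add nn_integral_sum nn_integral_cmult)
  also have "\<dots> \<le> ennreal d * ennreal (2 * pi * sqint f) + (\<Sum>j<J. ennreal (16 * K j) * ennreal (2 * pi * sqint (h j)))
    + ennreal (c) * ennreal (2 * pi * sqint f')"
    by (intro add_mono sum_mono mult_left_mono Plancherel_le f h) auto
  also have "\<dots> = ennreal (d * (2 * pi * sqint f) + (\<Sum>j<J. 16 * K j * (2 * pi * sqint (h j))) + c * (2 * pi * sqint f'))"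
    using cd K by (simp add: ennreal_mult'[symmetric] ennreal_plus[symmetric] sum_nonneg less_imp_le sqint_nonneg
      del: ennreal_plus)
  also have "d * (2 * pi * sqint f) + (\<Sum>j<J. 16 * K j * (2 * pi * sqint (h j))) + c * (2 * pi * sqint f')
    = 2 * pi * ((2 + 2 * k) * sqint f + 16 * (\<Sum>j<J. K j * sqint (h j)) + sqint f' / (2 * K J))"
    by (simp add: c_def d_def distrib_left sum_distrib_left mult_ac)
  finally show ?thesis unfolding K_def h_def[abs_def] .
qed

lemma sqint_add_le:
  fixes f g :: "real \<Rightarrow> complex"
  assumes f: "nice f" and g: "nice g"
  shows "sqint (\<lambda>x. f x + g x) \<le> 2 * sqint f + 2 * sqint g"
proof -
  have "sqint (\<lambda>x. f x + g x) \<le> (LINT x|lborel. 2 * (cmod (f x))\<^sup>2 + 2 * (cmod (g x))\<^sup>2)"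
    unfolding sqint_def
  proof (rule integral_mono)
    show "integrable lborel (\<lambda>x. (cmod (f x + g x))\<^sup>2)" by (rule sqint_integrable[OF nice_add[OF f g]])
    show "integrable lborel (\<lambda>x. 2 * (cmod (f x))\<^sup>2 + 2 * (cmod (g x))\<^sup>2)"
      by (intro Bochner_Integration.integrable_add integrable_mult_right sqint_integrable f g)
    fix x
    have "(cmod (f x + g x))\<^sup>2 \<le> (cmod (f x) + cmod (g x))\<^sup>2" by (intro power_mono norm_triangle_ineq) auto
    also have "\<dots> \<le> 2 * (cmod (f x))\<^sup>2 + 2 * (cmod (g x))\<^sup>2"
      using sum_squares_bound[of "cmod (f x)" "cmod (g x)"] by (simp add: power2_sum)
    finally show "(cmod (f x + g x))\<^sup>2 \<le> 2 * (cmod (f x))\<^sup>2 + 2 * (cmod (g x))\<^sup>2" .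
  qed
  thus ?thesis using sqint_integrable[OF f] sqint_integrable[OF g] by (simp add: sqint_def)
qed

lemma sqint_mult_le:
  fixes g :: "real \<Rightarrow> complex"
  assumes a: "bcont a" "\<And>x. \<bar>a x\<bar> \<le> C" and g: "nice g"
  shows "sqint (\<lambda>x. complex_of_real (a x) * g x) \<le> C\<^sup>2 * sqint g"
proof -
  have "sqint (\<lambda>x. complex_of_real (a x) * g x) \<le> (LINT x|lborel. C\<^sup>2 * (cmod (g x))\<^sup>2)"
    unfolding sqint_def
  proof (rule integral_mono)
    show "integrable lborel (\<lambda>x. (cmod (complex_of_real (a x) * g x))\<^sup>2)"
      by (rule sqint_integrable[OF nice_mult_right[OF bcont_of_real[OF a(1)] g]])
    show "integrable lborel (\<lambda>x. C\<^sup>2 * (cmod (g x))\<^sup>2)" by (intro integrable_mult_right sqint_integrable g)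
    fix x
    have "(a x)\<^sup>2 \<le> C\<^sup>2" using power_mono[OF a(2), of x 2] by simp
    thus "(cmod (complex_of_real (a x) * g x))\<^sup>2 \<le> C\<^sup>2 * (cmod (g x))\<^sup>2"
      by (simp add: norm_mult power_mult_distrib mult_right_mono)
  qed
  thus ?thesis by (simp add: sqint_def)
qed

text \<open>The commutator of the cutoff with the resolvent gains one derivative:
  with \<open>w = R q\<close> one has \<open>a w - R (a q) = R (a' w)\<close>.\<close>

lemma localized_resolv:
  fixes q :: "real \<Rightarrow> complex"
  assumes k: "k > 0" and q: "nice q" and a: "bcont a" "bcont a'" "\<And>x. (a has_real_derivative a' x) (at x)" "\<And>x. \<bar>a' x\<bar> \<le> 1 / 16"
  shows "sqint (\<lambda>x. complex_of_real (a x) * q x - complex_of_real (2 * k) * resolv (2 * k) (\<lambda>x. complex_of_real (a x) * q x) x)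
    \<le> 2 * (LINT x|lborel. (a x)\<^sup>2 * (cmod (q x - complex_of_real (2 * k) * resolv (2 * k) q x))\<^sup>2) + sqint q / (512 * k\<^sup>2)"
proof -
  have c: "2 * k > 0" using k by simp
  define w where "w = resolv (2 * k) q"
  define dw where "dw x = q x - complex_of_real (2 * k) * w x" for x
  define g where "g x = complex_of_real (a' x) * w x" for x
  let ?f = "\<lambda>x. complex_of_real (a x) * q x"
  have w: "nice w" unfolding w_def by (intro resolv_nice c q)
  have dw: "nice dw" unfolding dw_def[abs_def] by (intro nice_diff nice_mult_right bcont_const q w)
  have f: "nice ?f" by (intro nice_mult_right bcont_of_real a q)
  have g: "nice g" unfolding g_def[abs_def] by (intro nice_mult_right bcont_of_real a w)
  have wd: "(w has_vector_derivative dw x) (at x)" for x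
    using resolv_deriv[OF c bcont_nice[OF q], of x] by (simp add: w_def dw_def scaleR_conv_of_real)
  have ad: "((\<lambda>x. complex_of_real (a x)) has_vector_derivative complex_of_real (a' x)) (at x)" for x
    using a(3)[of x] unfolding has_real_derivative_iff_has_vector_derivative
    by (rule bounded_linear.has_vector_derivative[OF bounded_linear_of_real])
  define V where "V x = complex_of_real (a x) * w x - resolv (2 * k) ?f x" for x
  have V: "V x = resolv (2 * k) g x" for x
  proof (rule resolv_unique[OF c bcont_nice[OF g]])
    show "bcont V" unfolding V_def[abs_def]
      by (intro bcont_diff bcont_mult bcont_of_real a bcont_nice[OF w] resolv_bcont c bcont_nice[OF f])
    fix x
    have "(V has_vector_derivative (complex_of_real (a x) * dw x + complex_of_real (a' x) * w x - (?f x - (2 * k) *\<^sub>R resolv (2 * k) ?f x))) (at x)"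
      unfolding V_def[abs_def]
      by (intro has_vector_derivative_diff has_vector_derivative_mult ad wd resolv_deriv c bcont_nice[OF f])
    thus "(V has_vector_derivative (g x - (2 * k) *\<^sub>R V x)) (at x)"
      by (rule has_vector_derivative_eq_rhs) (simp add: V_def g_def dw_def scaleR_conv_of_real algebra_simps)
  qed
  have n1: "nice (\<lambda>x. complex_of_real (a x) * dw x)" by (intro nice_mult_right bcont_of_real a dw)
  have n2: "nice (\<lambda>x. complex_of_real (2 * k) * resolv (2 * k) g x)" by (intro nice_mult_right bcont_const resolv_nice c g)
  have "(\<lambda>x. ?f x - complex_of_real (2 * k) * resolv (2 * k) ?f x) = (\<lambda>x. complex_of_real (a x) * dw x + complex_of_real (2 * k) * resolv (2 * k) g x)"
    unfolding V[symmetric] by (auto simp: V_def dw_def algebra_simps)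
  hence "sqint (\<lambda>x. ?f x - complex_of_real (2 * k) * resolv (2 * k) ?f x)
    \<le> 2 * sqint (\<lambda>x. complex_of_real (a x) * dw x) + 2 * sqint (\<lambda>x. complex_of_real (2 * k) * resolv (2 * k) g x)"
    using sqint_add_le[OF n1 n2] by simp
  also have "sqint (\<lambda>x. complex_of_real (a x) * dw x) = (LINT x|lborel. (a x)\<^sup>2 * (cmod (dw x))\<^sup>2)"
    by (simp add: sqint_def norm_mult power_mult_distrib)
  also have "sqint (\<lambda>x. complex_of_real (2 * k) * resolv (2 * k) g x) \<le> (2 * k)\<^sup>2 * sqint (resolv (2 * k) g)"
    by (rule sqint_mult_le) (use k in \<open>auto intro!: bcont_const resolv_nice g\<close>)
  also have "\<dots> \<le> (2 * k)\<^sup>2 * (sqint g / (2 * k)\<^sup>2)" by (intro mult_left_mono sqint_resolv_le c g) auto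
  also have "\<dots> = sqint g" using k by simp
  also have "sqint g \<le> (1 / 16)\<^sup>2 * sqint w" unfolding g_def[abs_def] by (intro sqint_mult_le a w)
  also have "sqint w \<le> sqint q / (2 * k)\<^sup>2" unfolding w_def by (rule sqint_resolv_le[OF c q])
  also have "2 * ((1 / 16)\<^sup>2 * (sqint q / (2 * k)\<^sup>2)) = sqint q / (512 * k\<^sup>2)" using k by (simp add: power_mult_distrib field_simps)
  finally show ?thesis unfolding dw_def w_def by simp
qed

text \<open>The commutator error at one scale is \<open>sqint q / (512 k_j^2)\<close>; multiplied by
  \<open>k_j\<close> it forms a geometric series, and raising \<open>2 + 2 k\<close> to
  \<open>3 + 2 k\<close> pays for it.\<close>

lemma Hs_localized:
  assumes q: "nice q" "nice p" "\<And>x. (q has_vector_derivative p x) (at x)" and k: "k \<ge> 1"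
    and a: "bcont a" "bcont a'" "\<And>x. (a has_real_derivative a' x) (at x)" "\<And>x. \<bar>a' x\<bar> \<le> 1 / 16" "\<And>x. \<bar>a x\<bar> \<le> 1"
  shows "Hs_norm_sq (1 / 2) (\<lambda>x. complex_of_real (a x) * q x) \<le> ennreal (2 * pi * ((3 + 2 * k) * sqint q
    + 32 * (\<Sum>j<J. k * 4^j * (LINT x|lborel. (a x)\<^sup>2 * (cmod (q x - complex_of_real (2 * (k * 4^j)) * resolv (2 * (k * 4^j)) q x))\<^sup>2))
    + (sqint q + sqint p) / (k * 4^J)))"
proof -
  define K where "K j = k * 4^j" for j :: nat
  have K: "K j > 0" for j using k by (simp add: K_def)
  define D where "D j = (LINT x|lborel. (a x)\<^sup>2 * (cmod (q x - complex_of_real (2 * K j) * resolv (2 * K j) q x))\<^sup>2)" for j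
  let ?f = "\<lambda>x. complex_of_real (a x) * q x"
  define f' where "f' x = complex_of_real (a x) * p x + complex_of_real (a' x) * q x" for x
  have f: "nice ?f" by (intro nice_mult_right bcont_of_real a q)
  have f': "nice f'" unfolding f'_def[abs_def] by (intro nice_add nice_mult_right bcont_of_real a q)
  have ad: "((\<lambda>x. complex_of_real (a x)) has_vector_derivative complex_of_real (a' x)) (at x)" for x
    using a(3)[of x] unfolding has_real_derivative_iff_has_vector_derivative
    by (rule bounded_linear.has_vector_derivative[OF bounded_linear_of_real])
  have d: "(?f has_vector_derivative f' x) (at x)" for x unfolding f'_def by (intro has_vector_derivative_mult ad q)
  define Y where "Y j = sqint (\<lambda>x. ?f x - complex_of_real (2 * K j) * resolv (2 * K j) ?f x)" for j
  have "Hs_norm_sq (1 / 2) ?f \<le> ennreal (2 * pi * ((2 + 2 * k) * sqint ?f + 16 * (\<Sum>j<J. K j * Y j) + sqint f' / (2 * K J)))"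
    unfolding K_def Y_def by (rule Hs_half_le[OF f f' d]) (use k in simp)
  also have "\<dots> \<le> ennreal (2 * pi * ((3 + 2 * k) * sqint q + 32 * (\<Sum>j<J. K j * D j) + (sqint q + sqint p) / K J))"
  proof (intro ennreal_leI mult_left_mono)
    have fq: "sqint ?f \<le> sqint q" using sqint_mult_le[OF a(1,5) q(1)] by simp
    have 1: "(2 + 2 * k) * sqint ?f \<le> (2 + 2 * k) * sqint q" using k by (intro mult_left_mono fq) auto
    have "(\<Sum>j<J. K j * Y j) \<le> (\<Sum>j<J. 2 * (K j * D j) + sqint q / 512 * (1 / K j))"
    proof (intro sum_mono)
      fix j
      have "Y j \<le> 2 * D j + sqint q / (512 * (K j)\<^sup>2)" unfolding Y_def D_def by (rule localized_resolv[OF K q(1) a(1-4)])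
      from mult_left_mono[OF this less_imp_le[OF K[of j]]]
      show "K j * Y j \<le> 2 * (K j * D j) + sqint q / 512 * (1 / K j)"
        using K[of j] by (simp add: power2_eq_square distrib_left)
    qed
    also have "\<dots> = 2 * (\<Sum>j<J. K j * D j) + sqint q / 512 * (\<Sum>j<J. 1 / K j)" by (simp add: sum.distrib sum_distrib_left)
    also have "(\<Sum>j<J. 1 / K j) \<le> 2 / k" unfolding K_def by (rule geometric_inverse_sum) (use k in simp)
    also have "2 / k \<le> 2" using k by (simp add: divide_le_eq)
    finally have 2: "(\<Sum>j<J. K j * Y j) \<le> 2 * (\<Sum>j<J. K j * D j) + sqint q / 512 * 2"
      using sqint_nonneg[of q] by (simp add: mult_left_mono)
    have "sqint f' \<le> 2 * sqint (\<lambda>x. complex_of_real (a x) * p x) + 2 * sqint (\<lambda>x. complex_of_real (a' x) * q x)"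
      unfolding f'_def[abs_def] by (intro sqint_add_le nice_mult_right bcont_of_real a q)
    also have "\<dots> \<le> 2 * (1\<^sup>2 * sqint p) + 2 * ((1 / 16)\<^sup>2 * sqint q)"
      by (intro add_mono mult_left_mono sqint_mult_le a q) auto
    also have "\<dots> \<le> 2 * (sqint q + sqint p)" using sqint_nonneg[of q] by (simp add: power2_eq_square)
    finally have "sqint f' / (2 * K J) \<le> 2 * (sqint q + sqint p) / (2 * K J)" using K[of J] by (intro divide_right_mono) auto
    also have "\<dots> = (sqint q + sqint p) / K J" by (rule mult_divide_mult_cancel_left) simp
    finally have 3: "sqint f' / (2 * K J) \<le> (sqint q + sqint p) / K J" .
    have "(3 + 2 * k) * sqint q = (2 + 2 * k) * sqint q + sqint q" by (simp add: algebra_simps)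
    thus "(2 + 2 * k) * sqint ?f + 16 * (\<Sum>j<J. K j * Y j) + sqint f' / (2 * K J)
      \<le> (3 + 2 * k) * sqint q + 32 * (\<Sum>j<J. K j * D j) + (sqint q + sqint p) / K J"
      using 1 2 3 sqint_nonneg[of q] by linarith
  qed simp
  finally show ?thesis unfolding K_def D_def .
qed

section \<open>Schwartz solutions and the hyperbolic secant weight\<close>

context dnls_flow
begin

text \<open>The bound is proved up to an arbitrary \<open>\<epsilon>\<close>, because
  \<open>J\<close> is chosen after \<open>\<epsilon>\<close> and after the solution, so as to reach
  the sup norm and to make the truncation term at most \<open>\<epsilon>\<close>. The other
  constants do not see \<open>J\<close>. With \<open>T0 < T\<close> the end points are interior,
  where \<open>G\<close> is differentiable.\<close>

lemma integrated_smoothing: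
  assumes wt: "weight (\<lambda>x. (a x)\<^sup>2) \<eta>'"
    and a: "bcont a" "bcont a'" "\<And>x. (a has_real_derivative a' x) (at x)" "\<And>x. \<bar>a' x\<bar> \<le> 1 / 16" "\<And>x. \<bar>a x\<bar> \<le> 1"
    and M: "M \<ge> 1" "\<And>t. \<bar>t\<bar> < T \<Longrightarrow> sqint (q t) \<le> M"
    and k: "k \<ge> 1" and e: "e > 0" "20000000 * (M * e\<^sup>2) \<le> 1"
    and good: "\<And>t k' x. \<bar>t\<bar> < T \<Longrightarrow> k' \<ge> k \<Longrightarrow> sqrt k' * cmod (resolv (2 * k') (q t) x) \<le> e"
    and T: "0 < T0" "T0 < T"
  shows "(\<integral>\<^sup>+ t\<in>{-T0..T0}. Hs_norm_sq (1 / 2) (\<lambda>x. complex_of_real (a x) * q t x) \<partial>lborel)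
    \<le> ennreal (4 * pi * ((3 + 2 * k) * T0 + 32 * ((1 + 12 * M) * ((LINT x|lborel. (a x)\<^sup>2) + 1) + (3 + 12 * M + k) * T)) * sqint (q 0))"
    (is "_ \<le> ennreal (4 * pi * (_ + 32 * ?C) * _)")
proof (rule ennreal_le_epsilon)
  fix \<epsilon> :: real assume \<epsilon>: "0 < \<epsilon>"
  define S where "S = sqint (q 0)"
  have T': "T > 0" using T by simp
  have S: "sqint (q t) = S" if "\<bar>t\<bar> < T" for t unfolding S_def using mass_conserved[OF that, of 0] T' by simp
  define E where "E = S + B\<^sup>2 * (LINT x::real|lborel. 1 / (1 + x\<^sup>2))"
  have E: "sqint (q t) + sqint (p t) \<le> E" if t: "\<bar>t\<bar> < T" for t
  proof -
    have "sqint (p t) \<le> (LINT x::real|lborel. B\<^sup>2 * (1 / (1 + x\<^sup>2)))" unfolding sqint_def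
    proof (rule integral_mono)
      show "integrable lborel (\<lambda>x. (cmod (p t x))\<^sup>2)" by (rule sqint_integrable[OF p_nice[OF t]])
      show "integrable lborel (\<lambda>x::real. B\<^sup>2 * (1 / (1 + x\<^sup>2)))" by (intro integrable_mult_right integrable_inverse_square)
      fix x
      have "cmod (p t x) * cmod (p t x) \<le> B * (B / (1 + x\<^sup>2))"
        by (intro mult_mono sup_bounds p_bound t B_nonneg[OF t]) auto
      thus "(cmod (p t x))\<^sup>2 \<le> B\<^sup>2 * (1 / (1 + x\<^sup>2))" by (simp add: power2_eq_square)
    qed
    thus ?thesis unfolding S[OF t] E_def integral_mult_right_zero by simp
  qed
  have E0: "E \<ge> 0" using E[of 0] T' sqint_nonneg[of "q 0"] sqint_nonneg[of "p 0"] by auto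
  \<comment> \<open>One condition covers both demands on \<open>J\<close>, since \<open>2^J\<close>
    is at most \<open>sqrt K\<close> and at most \<open>K\<close>.\<close>
  obtain J :: nat where J2: "B / (4 * e) + 4 * pi * T0 * E / \<epsilon> < 2^J"
    using real_arch_pow[of 2] by auto
  define K where "K = k * 4^J"
  have K2: "2^J \<le> sqrt K" "2^J \<le> K"
  proof -
    have "(2^J)\<^sup>2 = (4::real)^J" by (simp add: power_mult[symmetric] mult.commute[of J]) (simp add: power_mult)
    moreover have "1 * 4^J \<le> K" unfolding K_def using k by (intro mult_right_mono) auto
    ultimately have le: "(2^J)\<^sup>2 \<le> K" by simp
    thus "2^J \<le> sqrt K" by (intro real_le_rsqrt)
    have "(2::real)^J \<le> (2^J)\<^sup>2" by (rule self_le_power) auto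
    thus "2^J \<le> K" using le by linarith
  qed
  have nonneg: "B / (4 * e) \<ge> 0" "4 * pi * T0 * E / \<epsilon> \<ge> 0"
    using B_nonneg[of 0] T T' e \<epsilon> E0 by auto
  have K0: "K > 0" unfolding K_def using k by simp
  have J: "B \<le> 4 * sqrt (k * 4^J) * e"
  proof -
    have "B / (4 * e) \<le> sqrt K" using J2 K2 nonneg by linarith
    thus ?thesis using e by (simp add: K_def field_simps)
  qed
  have rest: "4 * pi * T0 * E / K \<le> \<epsilon>"
  proof -
    have "4 * pi * T0 * E / \<epsilon> \<le> K" using J2 K2 nonneg by linarith
    thus ?thesis using \<epsilon> K0 by (simp add: field_simps)
  qed
  define X where "X t = (\<Sum>j<J. k * 4^j * (LINT x|lborel. (a x)\<^sup>2 *
      (cmod (q t x - complex_of_real (2 * (k * 4^j)) * resolv (2 * (k * 4^j)) (q t) x))\<^sup>2))" for t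
  obtain G g where G: "\<And>t. \<bar>t\<bar> < T \<Longrightarrow> (G has_real_derivative g t) (at t)"
    "\<And>t. \<bar>t\<bar> < T \<Longrightarrow> X t \<le> g t" "\<And>t. \<bar>t\<bar> < T \<Longrightarrow> \<bar>G t\<bar> \<le> ?C * S"
    using local_smoothing[OF wt M k e good J T'] unfolding X_def S_def by blast
  have X0: "X t \<ge> 0" for t unfolding X_def using k
    by (intro sum_nonneg mult_nonneg_nonneg) (auto intro!: integral_nonneg_AE)
  define c where "c = (3 + 2 * k) * S + E / K"
  define H where "H t = 2 * pi * (c * t + 32 * G t)" for t
  define h where "h t = 2 * pi * (c + 32 * g t)" for t
  have S0: "S \<ge> 0" unfolding S_def by (rule sqint_nonneg)
  have c0: "c \<ge> 0" unfolding c_def using S0 E0 K0 k by simp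
  have tT: "\<bar>t\<bar> < T" if "t \<in> {-T0..T0}" for t using that T by auto
  have Hh: "Hs_norm_sq (1 / 2) (\<lambda>x. complex_of_real (a x) * q t x) \<le> ennreal (h t)" if "t \<in> {-T0..T0}" for t
  proof -
    note t = tT[OF that]
    have "Hs_norm_sq (1 / 2) (\<lambda>x. complex_of_real (a x) * q t x)
      \<le> ennreal (2 * pi * ((3 + 2 * k) * sqint (q t) + 32 * X t + (sqint (q t) + sqint (p t)) / (k * 4^J)))"
      unfolding X_def by (rule Hs_localized[OF q_nice[OF t] p_nice[OF t] q_deriv[OF t] k a])
    also have "\<dots> \<le> ennreal (h t)"
    proof (rule ennreal_leI)
      have "(sqint (q t) + sqint (p t)) / K \<le> E / K" using E[OF t] K0 by (intro divide_right_mono) auto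
      hence "(3 + 2 * k) * sqint (q t) + 32 * X t + (sqint (q t) + sqint (p t)) / K \<le> c + 32 * g t"
        using G(2)[OF t] unfolding c_def S[OF t] by linarith
      thus "2 * pi * ((3 + 2 * k) * sqint (q t) + 32 * X t + (sqint (q t) + sqint (p t)) / (k * 4^J)) \<le> h t"
        unfolding h_def K_def by (intro mult_left_mono) auto
    qed
    finally show ?thesis .
  qed
  have h0: "h t \<ge> 0" if "t \<in> {-T0..T0}" for t
    using c0 order_trans[OF X0 G(2)[OF tT[OF that]]] by (simp add: h_def)
  \<comment> \<open>The majorant \<open>h\<close> is an exact derivative, so its integral is the
    increment of \<open>H\<close>; the Sobolev norm is compared with it pointwise in time.\<close>
  have "(h has_integral H T0 - H (- T0)) {-T0..T0}"
  proof (rule fundamental_theorem_of_calculus)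
    fix t assume "t \<in> {-T0..T0}"
    from G(1)[OF tT[OF this]] have "(H has_real_derivative h t) (at t)"
      unfolding H_def[abs_def] h_def by (auto intro!: derivative_eq_intros)
    thus "(H has_vector_derivative h t) (at t within {-T0..T0})"
      unfolding has_real_derivative_iff_has_vector_derivative by (rule has_vector_derivative_at_within)
  qed (use T in simp)
  from nn_integral_has_integral_lebesgue[OF h0 this]
  have int: "(\<integral>\<^sup>+ t. ennreal (indicator {-T0..T0} t * h t) \<partial>lborel) = ennreal (H T0 - H (- T0))" .
  have "(\<integral>\<^sup>+ t\<in>{-T0..T0}. Hs_norm_sq (1 / 2) (\<lambda>x. complex_of_real (a x) * q t x) \<partial>lborel)
    \<le> (\<integral>\<^sup>+ t. ennreal (indicator {-T0..T0} t * h t) \<partial>lborel)"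
    by (intro nn_integral_mono) (auto simp: indicator_def Hh)
  also have "\<dots> = ennreal (H T0 - H (- T0))" by (rule int)
  also have "\<dots> \<le> ennreal (4 * pi * ((3 + 2 * k) * T0 + 32 * ?C) * S + 4 * pi * T0 * E / K)"
  proof (rule ennreal_leI)
    have "\<bar>G T0\<bar> \<le> ?C * S" "\<bar>G (- T0)\<bar> \<le> ?C * S" using T by (auto intro!: G(3))
    hence "G T0 - G (- T0) \<le> 2 * (?C * S)" by linarith
    hence "2 * pi * (2 * (c * T0) + 32 * (G T0 - G (- T0))) \<le> 2 * pi * (2 * (c * T0) + 32 * (2 * (?C * S)))"
      by (intro mult_left_mono add_left_mono) auto
    moreover have "H T0 - H (- T0) = 2 * pi * (2 * (c * T0) + 32 * (G T0 - G (- T0)))"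
      by (simp add: H_def algebra_simps)
    moreover have "2 * pi * (2 * (c * T0) + 32 * (2 * (C * S))) = 4 * pi * ((3 + 2 * k) * T0 + 32 * C) * S + 4 * pi * T0 * E / K" for C
      unfolding c_def by (simp add: algebra_simps)
    ultimately show "H T0 - H (- T0) \<le> 4 * pi * ((3 + 2 * k) * T0 + 32 * ?C) * S + 4 * pi * T0 * E / K" by (simp only:)
  qed
  also have "\<dots> \<le> ennreal (4 * pi * ((3 + 2 * k) * T0 + 32 * ?C) * S + \<epsilon>)" by (intro ennreal_leI add_left_mono rest)
  also have "ennreal (y + \<epsilon>) \<le> ennreal y + ennreal \<epsilon>" for y
    using \<epsilon> by (cases "y \<ge> 0") (auto simp: ennreal_plus ennreal_neg intro!: ennreal_leI)
  finally show "(\<integral>\<^sup>+ t\<in>{-T0..T0}. Hs_norm_sq (1 / 2) (\<lambda>x. complex_of_real (a x) * q t x) \<partial>lborel)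
    \<le> ennreal (4 * pi * ((3 + 2 * k) * T0 + 32 * ?C) * sqint (q 0)) + ennreal \<epsilon>" unfolding S_def .
qed

end

section \<open>Powers of the hyperbolic secant\<close>

lemma cosh_ge_quadratic: "cosh (y::real) \<ge> (1 + y\<^sup>2) / 4"
proof -
  have "1 + \<bar>y\<bar> + \<bar>y\<bar>\<^sup>2 / 2 \<le> exp \<bar>y\<bar>" by (rule exp_lower_Taylor_quadratic) simp
  moreover have "cosh y = (exp \<bar>y\<bar> + exp (- \<bar>y\<bar>)) / 2" by (cases "y \<ge> 0") (simp_all add: cosh_field_def)
  moreover have "exp (- \<bar>y\<bar>) > 0" by simp
  ultimately show ?thesis unfolding power2_abs add_divide_distrib using abs_ge_zero[of y] by linarith
qed

text \<open>The cutoff is the twelfth power of \<open>psi\<close>, that is \<open>n = 6\<close>; its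
  square, \<open>n = 12\<close>, is the weight of the estimates.\<close>

definition sech_power :: "nat \<Rightarrow> real \<Rightarrow> real \<Rightarrow> real" where
  "sech_power n \<mu> x = (1 / cosh ((x - \<mu>) / 99)) ^ n"

definition dsech_power :: "nat \<Rightarrow> real \<Rightarrow> real \<Rightarrow> real" where
  "dsech_power n \<mu> x = - (real n / 99) * tanh ((x - \<mu>) / 99) * sech_power n \<mu> x"

lemma sech_power_bounds: "0 \<le> sech_power n \<mu> x" "sech_power n \<mu> x \<le> 1"
  using cosh_real_ge_1[of "(x - \<mu>) / 99"] by (auto simp: sech_power_def intro!: power_le_one)

lemma dsech_power_bound: "\<bar>dsech_power n \<mu> x\<bar> \<le> real n / 99 * sech_power n \<mu> x"
proof -
  have "\<bar>tanh ((x - \<mu>) / 99)\<bar> \<le> 1" using tanh_real_bounds[of "(x - \<mu>) / 99"] by auto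
  from mult_left_mono[OF this, of "real n / 99 * sech_power n \<mu> x"] show ?thesis
    using sech_power_bounds[of n \<mu> x] by (simp add: dsech_power_def abs_mult mult_ac)
qed

lemma sech_power_deriv: "(sech_power n \<mu> has_real_derivative dsech_power n \<mu> x) (at x)"
proof (cases n)
  case 0
  show ?thesis unfolding sech_power_def[abs_def] dsech_power_def by (simp add: 0)
next
  case (Suc m)
  let ?y = "(x - \<mu>) / 99"
  have c: "cosh ?y \<noteq> 0" using cosh_real_pos[of ?y] by simp
  have "((\<lambda>x. 1 / cosh ((x - \<mu>) / 99)) has_real_derivative - (1 / 99) * sinh ?y / (cosh ?y)\<^sup>2) (at x)"
    using c by (auto intro!: derivative_eq_intros simp: power2_eq_square)
  from DERIV_power[OF this, of n] show ?thesis
    unfolding sech_power_def[abs_def] dsech_power_def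
    by (rule DERIV_cong) (use c in \<open>simp add: Suc tanh_def sech_power_def power2_eq_square field_simps\<close>)
qed

lemma sech_power_nice: assumes "n > 0" shows "nice (sech_power n \<mu>)"
proof -
  have "nice (sech_power n 0)"
  proof (rule niceI)
    show "continuous_on UNIV (sech_power n 0)"
      by (intro continuous_at_imp_continuous_on ballI DERIV_isCont[OF sech_power_deriv])
    fix x :: real
    have 1: "1 + x\<^sup>2 \<le> 4 * 99\<^sup>2 * cosh (x / 99)" using cosh_ge_quadratic[of "x / 99"] by (simp add: power_divide)
    have "sech_power n 0 x \<le> (1 / cosh (x / 99)) ^ 1" unfolding sech_power_def diff_zero
      by (rule power_decreasing) (use assms cosh_real_ge_1[of "x / 99"] in auto)
    also have "\<dots> \<le> 4 * 99\<^sup>2 / (1 + x\<^sup>2)" using 1 cosh_real_pos[of "x / 99"] by (simp add: field_simps)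
    finally show "norm (sech_power n 0 x) \<le> 4 * 99\<^sup>2 / (1 + x\<^sup>2)" using sech_power_bounds[of n 0 x] by simp
  qed
  from nice_shift[OF this, of \<mu>] show ?thesis by (simp add: sech_power_def[abs_def])
qed

lemma dsech_power_cont: "continuous_on UNIV (dsech_power n \<mu>)"
proof -
  have "continuous_on UNIV (sech_power n \<mu>)"
    by (intro continuous_at_imp_continuous_on ballI DERIV_isCont[OF sech_power_deriv])
  moreover have "cosh ((x - \<mu>) / 99) \<noteq> 0" for x using cosh_real_pos[of "(x - \<mu>) / 99"] by simp
  ultimately show ?thesis unfolding dsech_power_def[abs_def]
    by (intro continuous_intros) auto
qed

text \<open>\<open>12 / 99 \<le> 1 / 8\<close>, just as the cutoff itself satisfies
  \<open>6 / 99 \<le> 1 / 16\<close>: the number 99 in \<open>psi\<close> leaves room for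
  both.\<close>

lemma sech_power_weight: "weight (sech_power 12 \<mu>) (dsech_power 12 \<mu>)"
proof
  fix x
  show "\<bar>dsech_power 12 \<mu> x\<bar> \<le> sech_power 12 \<mu> x / 8"
    using dsech_power_bound[of 12 \<mu> x] sech_power_bounds(1)[of 12 \<mu> x] by simp
qed (simp_all add: sech_power_bounds sech_power_deriv sech_power_nice dsech_power_cont)

lemma sech_power_integral: "(LINT x|lborel. sech_power n \<mu> x) = (LINT x|lborel. sech_power n 0 x)"
  using lborel_integral_real_affine[of 1 "sech_power n \<mu>" \<mu>] by (simp add: sech_power_def)

lemma psi_power: "psi (x - \<mu>) ^ 12 = sech_power 6 \<mu> x"
proof -
  have "psi (x - \<mu>) ^ 12 = ((psi (x - \<mu>))\<^sup>2) ^ 6" by (simp flip: power_mult)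
  also have "(psi (x - \<mu>))\<^sup>2 = 1 / cosh ((x - \<mu>) / 99)"
    using cosh_real_pos[of "(x - \<mu>) / 99"] by (simp add: psi_def)
  finally show ?thesis by (simp add: sech_power_def)
qed

section \<open>From Schwartz solutions and equicontinuous sets to the estimates\<close>

lemma schwartz_bound:
  assumes "\<And>k. \<exists>C. \<forall>t x. \<bar>t\<bar> \<le> T \<longrightarrow> \<bar>x\<bar> ^ k * cmod (f t x) \<le> C"
  obtains B where "\<And>t x. \<bar>t\<bar> \<le> T \<Longrightarrow> cmod (f t x) \<le> B / (1 + (x::real)\<^sup>2)"
proof -
  obtain C0 C2 where C: "\<And>t x. \<bar>t\<bar> \<le> T \<Longrightarrow> \<bar>x\<bar> ^ 0 * cmod (f t x) \<le> C0" "\<And>t x. \<bar>t\<bar> \<le> T \<Longrightarrow> \<bar>x\<bar>\<^sup>2 * cmod (f t x) \<le> C2"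
    using assms[of 0] assms[of 2] by blast
  have "cmod (f t x) \<le> (C0 + C2) / (1 + x\<^sup>2)" if "\<bar>t\<bar> \<le> T" for t x
    using add_mono[OF C[OF that, of x]] by (simp add: pos_le_divide_eq algebra_simps)
  thus ?thesis using that by blast
qed

lemma schwartz_nice: assumes "f \<in> schwartz" shows "nice f"
proof -
  have d: "(f has_vector_derivative vderiv_n 1 f x) (at x)" for x
  proof -
    have "(vderiv_n 0 f has_vector_derivative vderiv_n (Suc 0) f x) (at x)" using assms unfolding schwartz_def by blast
    thus ?thesis by simp
  qed
  have "\<exists>C. \<forall>t x. \<bar>t\<bar> \<le> (0::real) \<longrightarrow> \<bar>x\<bar> ^ k * cmod (f x) \<le> C" for k
  proof -
    have "\<exists>C. \<forall>x. \<bar>x\<bar> ^ k * cmod (vderiv_n 0 f x) \<le> C" using assms unfolding schwartz_def by blast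
    thus ?thesis by simp
  qed
  from schwartz_bound[of 0 "\<lambda>t. f", OF this] obtain B where "\<And>t x. \<bar>t::real\<bar> \<le> 0 \<Longrightarrow> cmod (f x) \<le> B / (1 + x\<^sup>2)" by blast
  from this[of 0] show ?thesis by (intro niceI has_vector_derivative_cont[OF d]) auto
qed

text \<open>The nonlinearity is differentiated as the product \<open>q * cnj q * q\<close>, and
  multiplication by \<open>- \<i>\<close> solves the equation for the time derivative. The Schwartz
  bounds, uniform on bounded time intervals, supply one \<open>B\<close> for \<open>q\<close> and
  two derivatives.\<close>

lemma dnls_solution_flow:
  assumes u: "dnls_solution u"
  obtains B where "dnls_flow u (\<lambda>t. vderiv_n 1 (u t)) (\<lambda>t. vderiv_n 2 (u t)) T B"
proof -
  have sch: "u t \<in> schwartz" for t using u by (simp add: dnls_solution_def)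
  have d: "(vderiv_n n (u t) has_vector_derivative vderiv_n (Suc n) (u t) x) (at x)" for n t x
    using sch[of t] unfolding schwartz_def by blast
  have d1: "(u t has_vector_derivative vderiv_n 1 (u t) x) (at x)" for t x
    using d[of 0 t x] by simp
  have d2: "(vderiv_n 1 (u t) has_vector_derivative vderiv_n 2 (u t) x) (at x)" for t x
    using d[of 1 t x] by (simp only: numeral_2_eq_2 One_nat_def)
  have "\<exists>C. \<forall>t x. \<bar>t\<bar> \<le> T \<longrightarrow> \<bar>x\<bar> ^ k * cmod (vderiv_n n (u t) x) \<le> C" for k n
    using u unfolding dnls_solution_def by blast
  from schwartz_bound[of T "\<lambda>t. vderiv_n n (u t)" for n, OF this]
  have "\<exists>B. \<forall>t x. \<bar>t\<bar> \<le> T \<longrightarrow> cmod (vderiv_n n (u t) x) \<le> B / (1 + x\<^sup>2)" for n by metis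
  then obtain B where B: "\<And>n t x. \<bar>t\<bar> \<le> T \<Longrightarrow> cmod (vderiv_n n (u t) x) \<le> B n / (1 + x\<^sup>2)" by metis
  define B' where "B' = max (B 0) (max (B 1) (B 2))"
  have B': "cmod (vderiv_n n (u t) x) \<le> B' / (1 + x\<^sup>2)" if "\<bar>t\<bar> < T" "n \<in> {0, 1, 2}" for n t x
  proof -
    have "B n / (1 + x\<^sup>2) \<le> B' / (1 + x\<^sup>2)" using that(2) by (intro divide_right_mono) (auto simp: B'_def)
    thus ?thesis using B[of t n x] that(1) by simp
  qed
  have "dnls_flow u (\<lambda>t. vderiv_n 1 (u t)) (\<lambda>t. vderiv_n 2 (u t)) T B'"
  proof
    fix t x assume t: "\<bar>t\<bar> < T"
    show "continuous_on UNIV (vderiv_n 2 (u t))" by (rule has_vector_derivative_cont[OF d])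
    show "cmod (u t x) \<le> B' / (1 + x\<^sup>2)" using B'[OF t, of 0 x] by simp
    show "cmod (vderiv_n 1 (u t) x) \<le> B' / (1 + x\<^sup>2)" "cmod (vderiv_n 2 (u t) x) \<le> B' / (1 + x\<^sup>2)"
      by (intro B' t; simp)+
    obtain \<delta> where \<delta>: "((\<lambda>s. u s x) has_vector_derivative \<delta>) (at t)" "\<i> * \<delta> + vderiv_n 2 (u t) x
        + \<i> * vector_derivative (\<lambda>y. complex_of_real ((cmod (u t y))\<^sup>2) * u t y) (at x) = 0"
      using u unfolding dnls_solution_def by blast
    define a b z where "a = u t x" and "b = vderiv_n 1 (u t) x" and "z = vderiv_n 2 (u t) x"
    have "((\<lambda>y. u t y * cnj (u t y) * u t y) has_vector_derivative
        (a * cnj a * b + (a * cnj b + b * cnj a) * a)) (at x)"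
      unfolding a_def b_def
      by (intro has_vector_derivative_mult d1 bounded_linear.has_vector_derivative[OF bounded_linear_cnj])
    from vector_derivative_at[OF this]
    have "vector_derivative (\<lambda>y. complex_of_real ((cmod (u t y))\<^sup>2) * u t y) (at x) = 2 * (a * cnj a) * b + a\<^sup>2 * cnj b"
      unfolding complex_norm_square by (simp add: power2_eq_square algebra_simps)
    with \<delta>(2) have eq: "\<i> * \<delta> + z + \<i> * (2 * (a * cnj a) * b + a\<^sup>2 * cnj b) = 0" by (simp only: z_def)
    have "\<delta> = - \<i> * (\<i> * \<delta> + z + \<i> * (2 * (a * cnj a) * b + a\<^sup>2 * cnj b)) + qdot a b z"
      unfolding qdot_def by (simp add: algebra_simps)
    hence "\<delta> = qdot a b z" unfolding eq by simp
    thus "((\<lambda>s. u s x) has_vector_derivative qdot (u t x) (vderiv_n 1 (u t) x) (vderiv_n 2 (u t) x)) (at t)"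
      using \<delta>(1) unfolding a_def b_def z_def by simp
  qed (rule d1 d2)+
  thus ?thesis using that by blast
qed

lemma sqint_L2norm: "(L2norm f)\<^sup>2 = sqint f"
  unfolding L2norm_def sqint_def by (intro real_sqrt_pow2 integral_nonneg_AE) simp

text \<open>Translations shorter than \<open>\<delta>\<close> contribute
  \<open>\<epsilon> / 2\<close>. The tail is at most \<open>4 M / (2 k \<delta>)\<close> by
  \<open>exp (- x) \<le> 1 / x\<close>, and the threshold for \<open>k\<close> makes this at most
  \<open>\<epsilon> / 2\<close>.\<close>

lemma equicontinuous_high:
  assumes nice: "\<And>f. f \<in> Q \<Longrightarrow> nice f" and M: "\<And>f. f \<in> Q \<Longrightarrow> sqint f \<le> M" "M > 0"
    and eq: "L2_equicontinuous Q" and \<epsilon>: "\<epsilon> > 0"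
  shows "\<exists>K>0. \<forall>k\<ge>K. \<forall>f\<in>Q. high k f \<le> \<epsilon>"
proof -
  have "sqrt (\<epsilon> / 2) > 0" using \<epsilon> by simp
  then obtain \<delta> where \<delta>: "\<delta> > 0" "\<And>f y. f \<in> Q \<Longrightarrow> \<bar>y\<bar> < \<delta> \<Longrightarrow> L2norm (\<lambda>x. f (x + y) - f x) < sqrt (\<epsilon> / 2)"
    using eq unfolding L2_equicontinuous_def by meson
  have "high k f \<le> \<epsilon>" if k: "k \<ge> 4 * M / (\<delta> * \<epsilon>)" and f: "f \<in> Q" for k f
  proof -
    have k0: "k > 0" using k M(2) \<delta>(1) \<epsilon> by (intro less_le_trans[OF _ k]) auto
    have "high k f \<le> \<epsilon> / 2 + 4 * sqint f * exp (- (2 * k * \<delta>))"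
    proof (rule high_le_translates[OF k0 nice[OF f] \<delta>(1)])
      fix s :: real assume s: "\<bar>s\<bar> < \<delta>"
      have "sqint (\<lambda>x. f x - f (x - s)) = sqint (\<lambda>x. f (x + - s) - f x)"
        unfolding sqint_def by (simp add: norm_minus_commute)
      also have "\<dots> = (L2norm (\<lambda>x. f (x + - s) - f x))\<^sup>2" by (rule sqint_L2norm[symmetric])
      also have "\<dots> \<le> (sqrt (\<epsilon> / 2))\<^sup>2"
        using \<delta>(2)[OF f, of "- s"] s by (intro power_mono) (auto simp: L2norm_def)
      also have "\<dots> = \<epsilon> / 2" using \<epsilon> by simp
      finally show "sqint (\<lambda>x. f x - f (x - s)) \<le> \<epsilon> / 2" .
    qed
    also have "4 * sqint f * exp (- (2 * k * \<delta>)) \<le> 4 * M * (1 / (2 * k * \<delta>))"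
    proof (intro mult_mono)
      have "2 * k * \<delta> \<le> exp (2 * k * \<delta>)" using exp_ge_add_one_self[of "2 * k * \<delta>"] by linarith
      thus "exp (- (2 * k * \<delta>)) \<le> 1 / (2 * k * \<delta>)" using k0 \<delta>(1) by (simp add: exp_minus field_simps)
    qed (use M f in \<open>auto simp: sqint_nonneg\<close>)
    also have "\<dots> \<le> \<epsilon> / 2" using k k0 \<delta>(1) \<epsilon> by (simp add: field_simps)
    finally show ?thesis by simp
  qed
  moreover have "4 * M / (\<delta> * \<epsilon>) > 0" using M(2) \<delta>(1) \<epsilon> by simp
  ultimately show ?thesis by blast
qed

theorem theorem1p5:
  fixes Q :: "(real \<Rightarrow> complex) set"
  assumes "Q \<subseteq> schwartz" and "L2_bounded Q" and "L2_equicontinuous Q"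
  shows "\<forall>T>0. \<exists>C::real. \<forall>q. dnls_solution q \<and> q 0 \<in> Q \<longrightarrow>
     (SUP \<mu>. \<integral>\<^sup>+ t\<in>{-T..T}. Hs_norm_sq (1/2) (\<lambda>x. complex_of_real (psi (x - \<mu>) ^ 12) * q t x) \<partial>lborel)
       \<le> ennreal (C * (L2norm (q 0))\<^sup>2)"
proof (intro allI impI)
  fix T :: real assume T: "T > 0"
  have nice: "nice f" if "f \<in> Q" for f using assms(1) that by (intro schwartz_nice) auto
  obtain M0 where M0: "\<And>f. f \<in> Q \<Longrightarrow> L2norm f \<le> M0" using assms(2) unfolding L2_bounded_def by blast
  define M where "M = max 1 (M0\<^sup>2)"
  have M1: "M \<ge> 1" by (simp add: M_def)
  have M: "sqint f \<le> M" if "f \<in> Q" for f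
  proof -
    have "(L2norm f)\<^sup>2 \<le> M0\<^sup>2" by (intro power_mono M0 that) (simp add: L2norm_def)
    thus ?thesis by (simp add: sqint_L2norm M_def)
  qed
  \<comment> \<open>The largest value that the absorption condition of the smoothing estimate
    allows.\<close>
  define e where "e = sqrt (1 / (20000000 * M))"
  have e: "0 < e" "e \<le> 1" "20000000 * (M * e\<^sup>2) \<le> 1"
    using M1 by (auto simp: e_def field_simps real_sqrt_le_1_iff)
  have "\<And>\<epsilon>. \<epsilon> > 0 \<Longrightarrow> \<exists>K>0. \<forall>k\<ge>K. \<forall>f\<in>Q. high k f \<le> \<epsilon>"
    using M1 by (intro equicontinuous_high[of Q M] nice M assms(3)) auto
  from equicontinuity_propagates[OF M1 M this e(1,2)] obtain K where
    K: "\<And>q p z T B t k x. dnls_flow q p z T B \<Longrightarrow> T > 0 \<Longrightarrow> q 0 \<in> Q \<Longrightarrow> \<bar>t\<bar> < T \<Longrightarrow> k \<ge> K \<Longrightarrow>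
      sqrt k * cmod (resolv (2 * k) (q t) x) \<le> e" by blast
  define k where "k = max 1 K"
  have k: "k \<ge> 1" "k \<ge> K" by (auto simp: k_def)
  \<comment> \<open>\<open>M\<close> and \<open>k\<close> come from \<open>Q\<close> alone, and the
    weight enters through the integral of its centred version, so \<open>C\<close> is uniform in
    \<open>\<mu>\<close> and in the solution.\<close>
  define C where "C = 4 * pi * ((3 + 2 * k) * T + 32 * ((1 + 12 * M) * ((LINT x|lborel. sech_power 12 0 x) + 1) + (3 + 12 * M + k) * (T + 1)))"
  show "\<exists>C::real. \<forall>q. dnls_solution q \<and> q 0 \<in> Q \<longrightarrow>
     (SUP \<mu>. \<integral>\<^sup>+ t\<in>{-T..T}. Hs_norm_sq (1/2) (\<lambda>x. complex_of_real (psi (x - \<mu>) ^ 12) * q t x) \<partial>lborel)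
       \<le> ennreal (C * (L2norm (q 0))\<^sup>2)"
  proof (intro exI[of _ C] allI impI SUP_least)
    fix u \<mu> assume u: "dnls_solution u \<and> u 0 \<in> Q"
    \<comment> \<open>The flow is taken on \<open>|t| < T + 1\<close>, so that the end points of the
      time interval are interior; hence the \<open>T + 1\<close> in \<open>C\<close>.\<close>
    obtain B where flow: "dnls_flow u (\<lambda>t. vderiv_n 1 (u t)) (\<lambda>t. vderiv_n 2 (u t)) (T + 1) B"
      using dnls_solution_flow[of u] u by blast
    interpret dnls_flow u "\<lambda>t. vderiv_n 1 (u t)" "\<lambda>t. vderiv_n 2 (u t)" "T + 1" B by (rule flow)
    have sq: "(\<lambda>x. (sech_power 6 \<mu> x)\<^sup>2) = sech_power 12 \<mu>" by (auto simp: sech_power_def simp flip: power_mult)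
    have "(\<integral>\<^sup>+ t\<in>{-T..T}. Hs_norm_sq (1/2) (\<lambda>x. complex_of_real (sech_power 6 \<mu> x) * u t x) \<partial>lborel)
      \<le> ennreal (4 * pi * ((3 + 2 * k) * T + 32 * ((1 + 12 * M) * ((LINT x|lborel. (sech_power 6 \<mu> x)\<^sup>2) + 1) + (3 + 12 * M + k) * (T + 1))) * sqint (u 0))"
    proof (rule integrated_smoothing)
      show "weight (\<lambda>x. (sech_power 6 \<mu> x)\<^sup>2) (dsech_power 12 \<mu>)" unfolding sq by (rule sech_power_weight)
      show "bcont (sech_power 6 \<mu>)" by (intro bcont_nice sech_power_nice) simp
      show le: "\<bar>dsech_power 6 \<mu> x\<bar> \<le> 1 / 16" for x
        using dsech_power_bound[of 6 \<mu> x] sech_power_bounds(2)[of 6 \<mu> x] by simp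
      show "bcont (dsech_power 6 \<mu>)" by (rule bcontI[OF dsech_power_cont, where B="1 / 16"]) (use le in simp)
      show "\<bar>sech_power 6 \<mu> x\<bar> \<le> 1" for x using sech_power_bounds[of 6 \<mu> x] by simp
      show "sqint (u t) \<le> M" if "\<bar>t\<bar> < T + 1" for t
        using mass_conserved[OF that, of 0] M[of "u 0"] u T by simp
      show "sqrt k' * cmod (resolv (2 * k') (u t) x) \<le> e" if "\<bar>t\<bar> < T + 1" "k' \<ge> k" for t k' x
        by (rule K[OF flow]) (use that u T k in auto)
    qed (use M1 k e T sech_power_deriv in auto)
    thus "(\<integral>\<^sup>+ t\<in>{-T..T}. Hs_norm_sq (1/2) (\<lambda>x. complex_of_real (psi (x - \<mu>) ^ 12) * u t x) \<partial>lborel) \<le> ennreal (C * (L2norm (u 0))\<^sup>2)"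
      unfolding psi_power sq sech_power_integral[of 12 \<mu>] C_def sqint_L2norm .
  qed
qed

end
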